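(* Up to equivalence, all regular normal extensions from $(O(p+2,q),O(p,q))$ (the case $c=1$) to CR structures form a one-parameter class with parameter $t\ge1$. Up to equivalence, all regular normal extensions from $(O(p+1,q+1),O(p,q))$ (the case $c=-1$) to CR structures form a one-parameter class with parameter $t>-1$.
   Context: $n=p+q$; $E$ is the identity matrix; $I$ is the diagonal $n\times n$ matrix with $p$ entries $1$ and $q$ entries $-1$. The Lie algebra $\mathfrak g$ of $G=O(p+2,q)$ ($c=1$) resp. $G=O(p+1,q+1)$ ($c=-1$) consists of the matrices $\left(\begin{array}{ccc}0&a&-X_1^TI \\ -ca&0&-cX_2^TI \\ X_1&X_2&A\end{array}\right)$ with $a\in\mathbb R$, $X_1,X_2\in\mathbb R^n$, $A\in\mathfrak{so}(p,q)$. The underlying symmetric space is $G/H$ with $H=O(p,q)\times O(2)$ resp. $O(p,q)\times O(1,1)$, symmetry $h=\mathrm{diag}(E,-E)$ (block sizes $(2,n)$), and $K=\{\mathrm{diag}(E,A):A\in O(p,q)\}\cong O(p,q)$. CR structures here are parabolic contact geometries of type $(L,P)$, here $L=PSU(p+1,q+1)$, $\mathfrak l=\mathfrak{su}(p+1,q+1)$ realized with respect to the hermitian form $x_0\bar y_{n+1}+x_{n+1}\bar y_0+\sum_{j=1}^px_j\bar y_j-\sum_{j=p+1}^nx_j\bar y_j$, graded by block sizes $(1,n,1)$ with block $(j,k)$ of degree $k-j$; $\mathfrak p=\mathfrak l_0+\mathfrak l_1+\mathfrak l_2$. A Cartan geometry of type $(L,P)$ is a $P$-principal bundle with a $P$-equivariant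 $\mathfrak l$-valued 1-form $\omega$ reproducing generators of fundamental vector fields and isomorphic on each tangent space. Extension: a homomorphism $\iota:K\to P$, here fixed as $\iota(\mathrm{diag}(E,A))=\mathrm{diag}(1,A,1)$, and a linear map $\alpha:\mathfrak g\to\mathfrak l$ with $\alpha\circ\mathrm{Ad}(k)=\mathrm{Ad}(\iota(k))\circ\alpha$ ($k\in K$), $\alpha|_{\mathfrak k}=\iota'$, $\alpha:\mathfrak g/\mathfrak k\to\mathfrak l/\mathfrak p$ an isomorphism. It yields the Cartan geometry $(G\times_\iota P\to G/K,\omega_\alpha)$ of type $(L,P)$, $\omega_\alpha$ extending $\alpha\circ\omega_G$ ($\omega_G$ the Maurer–Cartan form), with curvature $\kappa(X,Y)=[\alpha(X),\alpha(Y)]-\alpha([X,Y])$ on $\mathfrak g$. Regular: $\kappa$, viewed on $\mathfrak l/\mathfrak p$, satisfies $\kappa(\mathfrak l_j,\mathfrak l_k)\subset\bigoplus_{l\ge j+k+1}\mathfrak l_l$ for $j,k<0$. Normal: $\sum_k\kappa([Z_k,X],X_k)=2\sum_k[Z_k,\kappa(X,X_k)]$ for all $X\in\mathfrak l/\mathfrak p$ ($X_k$ a basis of $\mathfrak l/\mathfrak p$, $Z_k$ the dual basis of $\mathfrak l_1+\mathfrak l_2$), the standard Kostant-codifferential condition. Two extensions are equivalent if there is a principal bundle morphism $\Phi$ of $G\times_\iota P$ with $\Phi^*\omega_{\alpha'}=\omega_\alpha$. The parameter $t$: writing $X=X_1+iX_2$ ($i=\sqrt{-1}$), all regular extensions have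 the form $$\left(\begin{array}{ccc}0&a&-X_1^TI \\ -ca&0&-cX_2^TI \\ X_1&X_2&A\end{array}\right)\mapsto\left(\begin{array}{ccc}c_1a&-(\bar d_1\bar X^T+\bar d_2iX^T)I&e_1ai \\ b_1X-b_2i\bar X&A-\frac{2\,\mathrm{Im}(c_1)}{n}Eai&d_1X-d_2i\bar X \\ 2(|b_1|^2-|b_2|^2)ai&-(\bar b_1\bar X^T+\bar b_2iX^T)I&-\bar c_1a\end{array}\right)$$ with $b_1,b_2,c_1,d_1,d_2\in\mathbb C$, $e_1\in\mathbb R$, $|b_1|\ne|b_2|$. The parameter is $t=\frac{|b_1|^2+|b_2|^2}{|b_1|^2-|b_2|^2}$ for $c=1$ and $t=2\,\frac{\mathrm{Re}(b_1)\mathrm{Im}(b_2)-\mathrm{Re}(b_2)\mathrm{Im}(b_1)}{|b_1|^2-|b_2|^2}$ for $c=-1$.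
   Formalization: For c=-1, that t classifies extensions up to equivalence is stated only for pairs on the same side of |b1|=|b2|: (b1,b2) is equivalent to (-i b2, i b1), which changes t to -t, so t>-1 alone does not classify (t=1/2 on one side is equivalent to t=-1/2 on the other). *)

theory Defs
  imports "HOL-Analysis.Analysis"
begin

section \<open>Smooth maps\<close>

text \<open>On an open set of a Euclidean space this is the usual notion: a map is \<open>C\<^sup>k\<^sup>+\<^sup>1\<close> iff it is
  differentiable and all its directional derivatives are \<open>C\<^sup>k\<close>.\<close>

primrec Ck_on :: "nat \<Rightarrow> 'a::euclidean_space set \<Rightarrow> ('a \<Rightarrow> 'b::euclidean_space) \<Rightarrow> bool" where
  "Ck_on 0 S f \<longleftrightarrow> continuous_on S f"
| "Ck_on (Suc k) S f \<longleftrightarrow> (\<forall>x\<in>S. f differentiable (at x)) \<and>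
     (\<forall>v. Ck_on k S (\<lambda>x. frechet_derivative f (at x) v))"

definition smooth_on :: "'a::euclidean_space set \<Rightarrow> ('a \<Rightarrow> 'b::euclidean_space) \<Rightarrow> bool" where
  "smooth_on S f \<longleftrightarrow> (\<forall>k. Ck_on k S f)"


section \<open>The pair \<open>(G, K)\<close>\<close>

text \<open>The type \<open>'n\<close> indexes \<open>\<real>\<^sup>n\<close>, \<open>n = p + q\<close>, and the diagonal matrix \<open>I\<close> is given by its diagonal
  \<open>s :: 'n \<Rightarrow> real\<close> (in any order of the entries).  Matrices of \<open>G\<close> have blocks of sizes
  \<open>(1,1,n)\<close>, those of \<open>L\<close> blocks of sizes \<open>(1,n,1)\<close>.\<close>

type_synonym 'n gidx = "unit + unit + 'n"
type_synonym 'n lidx = "unit + 'n + unit"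
type_synonym 'n gmatrix = "real^('n gidx)^('n gidx)"
type_synonym 'n lmatrix = "complex^('n lidx)^('n lidx)"

definition signature :: "('n::finite \<Rightarrow> real) \<Rightarrow> nat \<Rightarrow> nat \<Rightarrow> bool" where
  "signature s p q \<longleftrightarrow> (\<forall>j. s j = 1 \<or> s j = -1) \<and> card {j. s j = 1} = p \<and> card {j. s j = -1} = q"

definition diag :: "('m \<Rightarrow> real) \<Rightarrow> real^'m^'m" where
  "diag d = (\<chi> i j. if i = j then d i else 0)"

definition gblocks :: "real \<Rightarrow> real \<Rightarrow> real^'n \<Rightarrow> real \<Rightarrow> real \<Rightarrow> real^'n \<Rightarrow>
    real^'n \<Rightarrow> real^'n \<Rightarrow> real^'n^'n \<Rightarrow> 'n::finite gmatrix" where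
  "gblocks m00 m01 r0 m10 m11 r1 x0 x1 A = (\<chi> i j.
     case i of
       Inl _ \<Rightarrow> (case j of Inl _ \<Rightarrow> m00 | Inr (Inl _) \<Rightarrow> m01 | Inr (Inr k) \<Rightarrow> r0 $ k)
     | Inr (Inl _) \<Rightarrow> (case j of Inl _ \<Rightarrow> m10 | Inr (Inl _) \<Rightarrow> m11 | Inr (Inr k) \<Rightarrow> r1 $ k)
     | Inr (Inr l) \<Rightarrow> (case j of Inl _ \<Rightarrow> x0 $ l | Inr (Inl _) \<Rightarrow> x1 $ l | Inr (Inr k) \<Rightarrow> A $ l $ k))"

definition O_pq :: "('n::finite \<Rightarrow> real) \<Rightarrow> (real^'n^'n) set" where
  "O_pq s = {A. transpose A ** diag s ** A = diag s}"

definition so_pq :: "('n::finite \<Rightarrow> real) \<Rightarrow> (real^'n^'n) set" where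
  "so_pq s = {A. transpose A ** diag s + diag s ** A = 0}"

text \<open>\<open>G\<close> is the orthogonal group of the form \<open>diag(1, c, I)\<close>, i.e. \<open>O(p+2,q)\<close> for \<open>c = 1\<close> and
  \<open>O(p+1,q+1)\<close> for \<open>c = -1\<close>.\<close>

definition G_grp :: "real \<Rightarrow> ('n::finite \<Rightarrow> real) \<Rightarrow> 'n gmatrix set" where
  "G_grp c s = O_pq (\<lambda>i. case i of Inl _ \<Rightarrow> 1 | Inr (Inl _) \<Rightarrow> c | Inr (Inr j) \<Rightarrow> s j)"

definition gmat :: "real \<Rightarrow> ('n::finite \<Rightarrow> real) \<Rightarrow>
    real \<Rightarrow> real^'n \<Rightarrow> real^'n \<Rightarrow> real^'n^'n \<Rightarrow> 'n gmatrix" where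
  "gmat c s a X1 X2 A = gblocks
     0        a   (- (X1 v* diag s))
     (-c*a)   0   (- (c *\<^sub>R (X2 v* diag s)))
     X1       X2  A"

definition g_alg :: "real \<Rightarrow> ('n::finite \<Rightarrow> real) \<Rightarrow> 'n gmatrix set" where
  "g_alg c s = {gmat c s a X1 X2 A | a X1 X2 A. A \<in> so_pq s}"

definition kmat :: "real^'n^'n \<Rightarrow> 'n::finite gmatrix" where
  "kmat A = gblocks 1 0 0 0 1 0 0 0 A"

definition k_alg :: "real \<Rightarrow> ('n::finite \<Rightarrow> real) \<Rightarrow> 'n gmatrix set" where
  "k_alg c s = {gmat c s 0 0 0 A | A. A \<in> so_pq s}"


section \<open>The pair \<open>(L, P)\<close>\<close>

definition lblocks :: "complex \<Rightarrow> complex^'n \<Rightarrow> complex \<Rightarrow> complex^'n \<Rightarrow> complex^'n^'n \<Rightarrow> complex^'n \<Rightarrow>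
    complex \<Rightarrow> complex^'n \<Rightarrow> complex \<Rightarrow> 'n::finite lmatrix" where
  "lblocks m00 r0 m02 x0 A x2 m20 r2 m22 = (\<chi> i j.
     case i of
       Inl _ \<Rightarrow> (case j of Inl _ \<Rightarrow> m00 | Inr (Inl k) \<Rightarrow> r0 $ k | Inr (Inr _) \<Rightarrow> m02)
     | Inr (Inl l) \<Rightarrow> (case j of Inl _ \<Rightarrow> x0 $ l | Inr (Inl k) \<Rightarrow> A $ l $ k | Inr (Inr _) \<Rightarrow> x2 $ l)
     | Inr (Inr _) \<Rightarrow> (case j of Inl _ \<Rightarrow> m20 | Inr (Inl k) \<Rightarrow> r2 $ k | Inr (Inr _) \<Rightarrow> m22))"

definition cplx :: "real^'n^'n \<Rightarrow> complex^'n^'n" where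
  "cplx A = (\<chi> i j. of_real (A $ i $ j))"

definition adjoint_mat :: "complex^'m^'m \<Rightarrow> complex^'m^'m" where
  "adjoint_mat M = (\<chi> i j. cnj (M $ j $ i))"

definition herm :: "('n::finite \<Rightarrow> real) \<Rightarrow> 'n lmatrix" where
  "herm s = lblocks
     0 0               1
     0 (cplx (diag s)) 0
     1 0               0"

definition u_alg :: "('n::finite \<Rightarrow> real) \<Rightarrow> 'n lmatrix set" where
  "u_alg s = {M. adjoint_mat M ** herm s + herm s ** M = 0}"

definition l_alg :: "('n::finite \<Rightarrow> real) \<Rightarrow> 'n lmatrix set" where
  "l_alg s = {M \<in> u_alg s. trace M = 0}"

definition blk :: "'n lidx \<Rightarrow> int" where
  "blk i = (case i of Inl _ \<Rightarrow> 0 | Inr (Inl _) \<Rightarrow> 1 | Inr (Inr _) \<Rightarrow> 2)"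

definition l_deg :: "('n::finite \<Rightarrow> real) \<Rightarrow> int \<Rightarrow> 'n lmatrix set" where
  "l_deg s d = {M \<in> l_alg s. \<forall>i j. M $ i $ j \<noteq> 0 \<longrightarrow> blk j - blk i = d}"

definition l_filt :: "('n::finite \<Rightarrow> real) \<Rightarrow> int \<Rightarrow> 'n lmatrix set" where
  "l_filt s d = {M \<in> l_alg s. \<forall>i j. M $ i $ j \<noteq> 0 \<longrightarrow> blk j - blk i \<ge> d}"

abbreviation p_alg :: "('n::finite \<Rightarrow> real) \<Rightarrow> 'n lmatrix set" where
  "p_alg s \<equiv> l_filt s 0"

text \<open>\<open>L = PSU(p+1,q+1)\<close> is used in the form \<open>PU(p+1,q+1) = U(p+1,q+1)/U(1)\<close>; this is where
  \<open>diag(1,A,1)\<close> lives when \<open>det A = -1\<close>.  The group \<open>P\<close> is \<open>P_cover s\<close> modulo the scalars of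
  modulus 1, and \<open>p_cover s\<close> is the Lie algebra of \<open>P_cover s\<close>.\<close>

definition P_cover :: "('n::finite \<Rightarrow> real) \<Rightarrow> 'n lmatrix set" where
  "P_cover s = {U. adjoint_mat U ** herm s ** U = herm s \<and> (\<forall>i j. blk j < blk i \<longrightarrow> U $ i $ j = 0)}"

definition p_cover :: "('n::finite \<Rightarrow> real) \<Rightarrow> 'n lmatrix set" where
  "p_cover s = {Y \<in> u_alg s. \<forall>i j. blk j < blk i \<longrightarrow> Y $ i $ j = 0}"

definition iota :: "real^'n^'n \<Rightarrow> 'n::finite lmatrix" where
  "iota A = lblocks 1 0 0 0 (cplx A) 0 0 0 1"

definition iota' :: "real^'n^'n \<Rightarrow> 'n::finite lmatrix" where
  "iota' A = lblocks 0 0 0 0 (cplx A) 0 0 0 0"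


section \<open>Extensions, regularity and normality\<close>

definition bracket :: "'a::comm_ring_1^'m^'m \<Rightarrow> 'a^'m^'m \<Rightarrow> 'a^'m^'m" where
  "bracket X Y = X ** Y - Y ** X"

text \<open>Only the values of \<open>\<alpha>\<close> on \<open>g_alg c s\<close> are relevant.\<close>

definition CR_extension :: "real \<Rightarrow> ('n::finite \<Rightarrow> real) \<Rightarrow> ('n gmatrix \<Rightarrow> 'n lmatrix) \<Rightarrow> bool" where
  "CR_extension c s \<alpha> \<longleftrightarrow>
     (\<forall>X\<in>g_alg c s. \<alpha> X \<in> l_alg s) \<and>
     (\<forall>X\<in>g_alg c s. \<forall>Y\<in>g_alg c s. \<alpha> (X + Y) = \<alpha> X + \<alpha> Y) \<and>
     (\<forall>r::real. \<forall>X\<in>g_alg c s. \<alpha> (r *\<^sub>R X) = r *\<^sub>R \<alpha> X) \<and>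
     (\<forall>A\<in>O_pq s. \<forall>X\<in>g_alg c s.
        \<alpha> (kmat A ** X ** matrix_inv (kmat A)) = iota A ** \<alpha> X ** matrix_inv (iota A)) \<and>
     (\<forall>A\<in>so_pq s. \<alpha> (gmat c s 0 0 0 A) = iota' A) \<and>
     (\<forall>X\<in>g_alg c s. \<alpha> X \<in> p_alg s \<longrightarrow> X \<in> k_alg c s) \<and>
     (\<forall>Y\<in>l_alg s. \<exists>X\<in>g_alg c s. \<alpha> X - Y \<in> p_alg s)"

definition curvature :: "('n::finite gmatrix \<Rightarrow> 'n lmatrix) \<Rightarrow> 'n gmatrix \<Rightarrow> 'n gmatrix \<Rightarrow> 'n lmatrix" where
  "curvature \<alpha> X Y = bracket (\<alpha> X) (\<alpha> Y) - \<alpha> (bracket X Y)"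

text \<open>The curvature viewed on \<open>\<ll>/\<pp>\<close>, through the isomorphism \<open>\<gg>/\<kk> \<rightarrow> \<ll>/\<pp>\<close> induced by \<open>\<alpha>\<close>.  The
  preimage under \<open>\<alpha>\<close> is unique up to \<open>\<kk>\<close>, and \<open>curvature \<alpha>\<close> vanishes on \<open>\<kk>\<close> for an extension
  \<open>\<alpha>\<close>, so the choice is immaterial.\<close>

definition curv :: "real \<Rightarrow> ('n::finite \<Rightarrow> real) \<Rightarrow> ('n gmatrix \<Rightarrow> 'n lmatrix) \<Rightarrow>
    'n lmatrix \<Rightarrow> 'n lmatrix \<Rightarrow> 'n lmatrix" where
  "curv c s \<alpha> U V =
     (let pre = (\<lambda>W. SOME X. X \<in> g_alg c s \<and> \<alpha> X - W \<in> p_alg s) in curvature \<alpha> (pre U) (pre V))"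

definition regular :: "real \<Rightarrow> ('n::finite \<Rightarrow> real) \<Rightarrow> ('n gmatrix \<Rightarrow> 'n lmatrix) \<Rightarrow> bool" where
  "regular c s \<alpha> \<longleftrightarrow>
     (\<forall>j<0. \<forall>k<0. \<forall>U\<in>l_deg s j. \<forall>V\<in>l_deg s k. curv c s \<alpha> U V \<in> l_filt s (j + k + 1))"

text \<open>The Killing form of \<open>\<s>\<u>(p+1,q+1)\<close>.\<close>

definition killing :: "'n::finite lmatrix \<Rightarrow> 'n lmatrix \<Rightarrow> real" where
  "killing X Y = 2 * of_nat (CARD('n) + 2) * Re (trace (X ** Y))"

text \<open>The \<open>X\<^sub>k\<close> represent a basis of \<open>\<ll>/\<pp>\<close> (independence follows from duality) and the \<open>Z\<^sub>k\<close> form the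
  dual basis of \<open>\<ll>\<^sub>1 + \<ll>\<^sub>2\<close>.\<close>

definition dual_bases :: "('n::finite \<Rightarrow> real) \<Rightarrow> nat \<Rightarrow> (nat \<Rightarrow> 'n lmatrix) \<Rightarrow> (nat \<Rightarrow> 'n lmatrix) \<Rightarrow> bool" where
  "dual_bases s m X Z \<longleftrightarrow>
     (\<forall>k<m. X k \<in> l_alg s \<and> Z k \<in> l_filt s 1) \<and>
     (\<forall>V\<in>l_alg s. \<exists>r::nat \<Rightarrow> real. V - (\<Sum>k<m. r k *\<^sub>R X k) \<in> p_alg s) \<and>
     (\<forall>j<m. \<forall>k<m. killing (Z j) (X k) = (if j = k then 1 else 0))"

definition normal :: "real \<Rightarrow> ('n::finite \<Rightarrow> real) \<Rightarrow> ('n gmatrix \<Rightarrow> 'n lmatrix) \<Rightarrow> bool" where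
  "normal c s \<alpha> \<longleftrightarrow> (\<forall>m X Z. dual_bases s m X Z \<longrightarrow> (\<forall>V\<in>l_alg s.
     (\<Sum>k<m. curv c s \<alpha> (bracket (Z k) V) (X k)) = 2 *\<^sub>R (\<Sum>k<m. bracket (Z k) (curv c s \<alpha> V (X k)))))"

definition regular_normal_extension ::
    "real \<Rightarrow> ('n::finite \<Rightarrow> real) \<Rightarrow> ('n gmatrix \<Rightarrow> 'n lmatrix) \<Rightarrow> bool" where
  "regular_normal_extension c s \<alpha> \<longleftrightarrow> CR_extension c s \<alpha> \<and> regular c s \<alpha> \<and> normal c s \<alpha>"


section \<open>Equivalence of extensions\<close>

text \<open>\<open>G \<times>\<^sub>\<iota> P\<close> is the quotient of \<open>G \<times> P_cover\<close> by \<open>(g k, U) \<sim> (g, \<iota>(k) U)\<close> for \<open>k \<in> K\<close> and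
  \<open>(g, z U) \<sim> (g, U)\<close> for \<open>\<bar>z\<bar> = 1\<close>.\<close>

definition GP :: "real \<Rightarrow> ('n::finite \<Rightarrow> real) \<Rightarrow> ('n gmatrix \<times> 'n lmatrix) set" where
  "GP c s = G_grp c s \<times> P_cover s"

definition GP_rel :: "real \<Rightarrow> ('n::finite \<Rightarrow> real) \<Rightarrow> ('n gmatrix \<times> 'n lmatrix) rel" where
  "GP_rel c s = {((g, U), (g', U')). (g, U) \<in> GP c s \<and>
     (\<exists>A\<in>O_pq s. \<exists>z. norm z = 1 \<and> g' = g ** kmat A \<and> U' = mat z ** matrix_inv (iota A) ** U)}"

definition total_space :: "real \<Rightarrow> ('n::finite \<Rightarrow> real) \<Rightarrow> ('n gmatrix \<times> 'n lmatrix) set set" where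
  "total_space c s = GP c s // GP_rel c s"

definition right_act :: "'n::finite lmatrix \<Rightarrow> ('n gmatrix \<times> 'n lmatrix) set \<Rightarrow> ('n gmatrix \<times> 'n lmatrix) set" where
  "right_act V x = (\<lambda>(g, U). (g, U ** V)) ` x"

text \<open>As \<open>GP \<rightarrow> total_space\<close> is a principal bundle, a map of \<open>total_space\<close> is smooth iff it lifts locally to
  smooth maps of the embedded submanifold \<open>GP\<close> of the matrix space, i.e. to restrictions of smooth
  maps defined on open sets of the matrix space.\<close>

definition smooth_lift :: "real \<Rightarrow> ('n::finite \<Rightarrow> real) \<Rightarrow>
    (('n gmatrix \<times> 'n lmatrix) set \<Rightarrow> ('n gmatrix \<times> 'n lmatrix) set) \<Rightarrow>
    ('n gmatrix \<times> 'n lmatrix) set \<Rightarrow> ('n gmatrix \<times> 'n lmatrix \<Rightarrow> 'n gmatrix \<times> 'n lmatrix) \<Rightarrow> bool" where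
  "smooth_lift c s \<Phi> W F \<longleftrightarrow> open W \<and> smooth_on W F \<and>
     (\<forall>y \<in> W \<inter> GP c s. F y \<in> GP c s \<and> \<Phi> (GP_rel c s `` {y}) = GP_rel c s `` {F y})"

definition bundle_morphism :: "real \<Rightarrow> ('n::finite \<Rightarrow> real) \<Rightarrow>
    (('n gmatrix \<times> 'n lmatrix) set \<Rightarrow> ('n gmatrix \<times> 'n lmatrix) set) \<Rightarrow> bool" where
  "bundle_morphism c s \<Phi> \<longleftrightarrow>
     (\<forall>x\<in>total_space c s. \<Phi> x \<in> total_space c s) \<and>
     (\<forall>x\<in>total_space c s. \<forall>V\<in>P_cover s. \<Phi> (right_act V x) = right_act V (\<Phi> x)) \<and>
     (\<forall>y\<in>GP c s. \<exists>W F. y \<in> W \<and> smooth_lift c s \<Phi> W F)"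

definition tangent :: "real \<Rightarrow> ('n::finite \<Rightarrow> real) \<Rightarrow> 'n gmatrix \<times> 'n lmatrix \<Rightarrow> ('n gmatrix \<times> 'n lmatrix) set" where
  "tangent c s y = {(fst y ** X, snd y ** Y) | X Y. X \<in> g_alg c s \<and> Y \<in> p_cover s}"

text \<open>\<open>\<omega>\<^sub>\<alpha>\<close>, pulled back to \<open>GP\<close>.  The projection \<open>\<u> \<rightarrow> \<u>/\<u>(1) \<cong> \<s>\<u>\<close> to the trace-free part accounts
  for the quotient by the scalars.\<close>

definition trace_free :: "'n::finite lmatrix \<Rightarrow> 'n lmatrix" where
  "trace_free M = M - mat (trace M / of_nat (CARD('n) + 2))"

definition cartan_form :: "('n::finite gmatrix \<Rightarrow> 'n lmatrix) \<Rightarrow>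
    'n gmatrix \<times> 'n lmatrix \<Rightarrow> 'n gmatrix \<times> 'n lmatrix \<Rightarrow> 'n lmatrix" where
  "cartan_form \<alpha> = (\<lambda>(g, U) (\<xi>, \<eta>).
     trace_free (matrix_inv U ** \<alpha> (matrix_inv g ** \<xi>) ** U + matrix_inv U ** \<eta>))"

definition pulls_back :: "real \<Rightarrow> ('n::finite \<Rightarrow> real) \<Rightarrow>
    (('n gmatrix \<times> 'n lmatrix) set \<Rightarrow> ('n gmatrix \<times> 'n lmatrix) set) \<Rightarrow>
    ('n gmatrix \<Rightarrow> 'n lmatrix) \<Rightarrow> ('n gmatrix \<Rightarrow> 'n lmatrix) \<Rightarrow> bool" where
  "pulls_back c s \<Phi> \<alpha>' \<alpha> \<longleftrightarrow>
     (\<forall>W F. smooth_lift c s \<Phi> W F \<longrightarrow> (\<forall>y \<in> W \<inter> GP c s. \<forall>v \<in> tangent c s y.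
        cartan_form \<alpha>' (F y) (frechet_derivative F (at y) v) = cartan_form \<alpha> y v))"

definition equivalent_extensions :: "real \<Rightarrow> ('n::finite \<Rightarrow> real) \<Rightarrow>
    ('n gmatrix \<Rightarrow> 'n lmatrix) \<Rightarrow> ('n gmatrix \<Rightarrow> 'n lmatrix) \<Rightarrow> bool" where
  "equivalent_extensions c s \<alpha> \<alpha>' \<longleftrightarrow> (\<exists>\<Phi>. bundle_morphism c s \<Phi> \<and> pulls_back c s \<Phi> \<alpha>' \<alpha>)"


section \<open>The parameter \<open>t\<close>\<close>

definition cvec :: "real^'n \<Rightarrow> real^'n \<Rightarrow> complex^'n" where
  "cvec X1 X2 = (\<chi> k. Complex (X1 $ k) (X2 $ k))"

definition cnj_vec :: "complex^'n \<Rightarrow> complex^'n" where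
  "cnj_vec X = (\<chi> k. cnj (X $ k))"

definition ext_form :: "('n::finite \<Rightarrow> real) \<Rightarrow>
    complex \<Rightarrow> complex \<Rightarrow> complex \<Rightarrow> complex \<Rightarrow> complex \<Rightarrow> real \<Rightarrow>
    real \<Rightarrow> complex^'n \<Rightarrow> real^'n^'n \<Rightarrow> 'n lmatrix" where
  "ext_form s b1 b2 c1 d1 d2 e1 a X A = lblocks
     (c1 * of_real a)
       (- ((cnj d1 *s cnj_vec X + (cnj d2 * \<i>) *s X) v* cplx (diag s)))
       (of_real (e1 * a) * \<i>)
     (b1 *s X - (b2 * \<i>) *s cnj_vec X)
       (cplx A - mat (of_real (2 * Im c1 / of_nat CARD('n) * a) * \<i>))
       (d1 *s X - (d2 * \<i>) *s cnj_vec X)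
     (of_real (2 * ((cmod b1)\<^sup>2 - (cmod b2)\<^sup>2) * a) * \<i>)
       (- ((cnj b1 *s cnj_vec X + (cnj b2 * \<i>) *s X) v* cplx (diag s)))
       (- (cnj c1 * of_real a))"

definition has_coefficients :: "real \<Rightarrow> ('n::finite \<Rightarrow> real) \<Rightarrow> ('n gmatrix \<Rightarrow> 'n lmatrix) \<Rightarrow>
    complex \<Rightarrow> complex \<Rightarrow> bool" where
  "has_coefficients c s \<alpha> b1 b2 \<longleftrightarrow> cmod b1 \<noteq> cmod b2 \<and>
     (\<exists>c1 d1 d2 e1. \<forall>a X1 X2. \<forall>A\<in>so_pq s.
        \<alpha> (gmat c s a X1 X2 A) = ext_form s b1 b2 c1 d1 d2 e1 a (cvec X1 X2) A)"

definition t_param :: "real \<Rightarrow> complex \<Rightarrow> complex \<Rightarrow> real" where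
  "t_param c b1 b2 =
     (if c = 1 then ((cmod b1)\<^sup>2 + (cmod b2)\<^sup>2) / ((cmod b1)\<^sup>2 - (cmod b2)\<^sup>2)
      else 2 * ((Re b1 * Im b2 - Re b2 * Im b1) / ((cmod b1)\<^sup>2 - (cmod b2)\<^sup>2)))"

end

theory Submission imports Defs begin

lemma sum_lidx: "(\<Sum>i\<in>(UNIV::'n::finite lidx set). f i) = f (Inl ()) + (\<Sum>k\<in>UNIV. f (Inr (Inl k))) + f (Inr (Inr ()))"
proof -
  have eq: "(UNIV::'n lidx set) = insert (Inl ()) (insert (Inr (Inr ())) (range (\<lambda>k. Inr (Inl k))))"
  proof -
    have "x \<in> insert (Inl ()) (insert (Inr (Inr ())) (range (\<lambda>k. Inr (Inl k))))" for x :: "'n lidx"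
      by (cases x; (cases "projr x")?) auto
    then show ?thesis by auto
  qed
  have inj: "inj (\<lambda>k::'n. (Inr (Inl k) :: 'n lidx))" by (auto simp: inj_def)
  show ?thesis
    unfolding sum.cong[OF eq refl, of f] using inj by (simp add: sum.reindex image_iff algebra_simps)
qed

lemma sum_gidx: "(\<Sum>i\<in>(UNIV::'n::finite gidx set). f i) = f (Inl ()) + f (Inr (Inl ())) + (\<Sum>k\<in>UNIV. f (Inr (Inr k)))"
proof -
  have eq: "(UNIV::'n gidx set) = insert (Inl ()) (insert (Inr (Inl ())) (range (\<lambda>k. Inr (Inr k))))"
  proof -
    have "x \<in> insert (Inl ()) (insert (Inr (Inl ())) (range (\<lambda>k. Inr (Inr k))))" for x :: "'n gidx"
      by (cases x; (cases "projr x")?) auto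
    then show ?thesis by auto
  qed
  have inj: "inj (\<lambda>k::'n. (Inr (Inr k) :: 'n gidx))" by (auto simp: inj_def)
  show ?thesis
    unfolding sum.cong[OF eq refl, of f] using inj by (simp add: sum.reindex image_iff algebra_simps)
qed

lemma all_lidx: "(\<forall>i::'n lidx. P i) \<longleftrightarrow> P (Inl ()) \<and> (\<forall>k. P (Inr (Inl k))) \<and> P (Inr (Inr ()))"
  by (auto simp: split_sum_all)

lemma all_gidx: "(\<forall>i::'n gidx. P i) \<longleftrightarrow> P (Inl ()) \<and> P (Inr (Inl ())) \<and> (\<forall>k. P (Inr (Inr k)))"
  by (auto simp: split_sum_all)

lemma lblocks_nth [simp]:
  "lblocks m00 r0 m02 x0 A x2 m20 r2 m22 $ Inl u $ Inl u' = m00"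
  "lblocks m00 r0 m02 x0 A x2 m20 r2 m22 $ Inl u $ Inr (Inl k) = r0 $ k"
  "lblocks m00 r0 m02 x0 A x2 m20 r2 m22 $ Inl u $ Inr (Inr u') = m02"
  "lblocks m00 r0 m02 x0 A x2 m20 r2 m22 $ Inr (Inl l) $ Inl u' = x0 $ l"
  "lblocks m00 r0 m02 x0 A x2 m20 r2 m22 $ Inr (Inl l) $ Inr (Inl k) = A $ l $ k"
  "lblocks m00 r0 m02 x0 A x2 m20 r2 m22 $ Inr (Inl l) $ Inr (Inr u') = x2 $ l"
  "lblocks m00 r0 m02 x0 A x2 m20 r2 m22 $ Inr (Inr u) $ Inl u' = m20"
  "lblocks m00 r0 m02 x0 A x2 m20 r2 m22 $ Inr (Inr u) $ Inr (Inl k) = r2 $ k"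
  "lblocks m00 r0 m02 x0 A x2 m20 r2 m22 $ Inr (Inr u) $ Inr (Inr u') = m22"
  by (simp_all add: lblocks_def)

lemma gblocks_nth [simp]:
  "gblocks m00 m01 r0 m10 m11 r1 x0 x1 A $ Inl u $ Inl u' = m00"
  "gblocks m00 m01 r0 m10 m11 r1 x0 x1 A $ Inl u $ Inr (Inl u') = m01"
  "gblocks m00 m01 r0 m10 m11 r1 x0 x1 A $ Inl u $ Inr (Inr k) = r0 $ k"
  "gblocks m00 m01 r0 m10 m11 r1 x0 x1 A $ Inr (Inl u) $ Inl u' = m10"
  "gblocks m00 m01 r0 m10 m11 r1 x0 x1 A $ Inr (Inl u) $ Inr (Inl u') = m11"
  "gblocks m00 m01 r0 m10 m11 r1 x0 x1 A $ Inr (Inl u) $ Inr (Inr k) = r1 $ k"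
  "gblocks m00 m01 r0 m10 m11 r1 x0 x1 A $ Inr (Inr l) $ Inl u' = x0 $ l"
  "gblocks m00 m01 r0 m10 m11 r1 x0 x1 A $ Inr (Inr l) $ Inr (Inl u') = x1 $ l"
  "gblocks m00 m01 r0 m10 m11 r1 x0 x1 A $ Inr (Inr l) $ Inr (Inr k) = A $ l $ k"
  by (simp_all add: gblocks_def)

lemma matrix_mult_nth: "(A ** B) $ i $ j = (\<Sum>k\<in>UNIV. A $ i $ k * B $ k $ j)"
  by (simp add: matrix_matrix_mult_def)

lemma diag_nth: "diag d $ i $ j = (if i = j then d i else 0)"
  by (simp add: diag_def)

lemma cplx_nth [simp]: "cplx A $ i $ j = of_real (A $ i $ j)"
  by (simp add: cplx_def)

lemma mat_nth: "mat a $ i $ j = (if i = j then a else 0)"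
  by (simp add: mat_def)

lemma vec_times_diag: "(v v* diag d) $ j = v $ j * d j"
  by (simp add: vector_matrix_mult_def diag_nth if_distrib cong: if_cong)

lemma vec_times_cplx_diag: "(v v* cplx (diag d)) $ j = v $ j * of_real (d j)"
  by (simp add: vector_matrix_mult_def diag_nth if_distrib cong: if_cong)

text \<open>Coordinates\<close>

definition zc :: "'n::finite lmatrix \<Rightarrow> complex" where "zc M = M $ Inl () $ Inl ()"
definition xc :: "'n::finite lmatrix \<Rightarrow> complex^'n" where "xc M = (\<chi> k. M $ Inr (Inl k) $ Inl ())"
definition Ac :: "'n::finite lmatrix \<Rightarrow> complex^'n^'n" where "Ac M = (\<chi> i j. M $ Inr (Inl i) $ Inr (Inl j))"
definition yc :: "'n::finite lmatrix \<Rightarrow> complex^'n" where "yc M = (\<chi> k. M $ Inr (Inl k) $ Inr (Inr ()))"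
definition xic :: "'n::finite lmatrix \<Rightarrow> real" where "xic M = Im (M $ Inr (Inr ()) $ Inl ())"
definition etac :: "'n::finite lmatrix \<Rightarrow> real" where "etac M = Im (M $ Inl () $ Inr (Inr ()))"

lemmas lcoords = zc_def xc_def Ac_def yc_def xic_def etac_def

lemma lcoords_linear [simp]:
  "zc (M + N) = zc M + zc N" "xc (M + N) = xc M + xc N" "Ac (M + N) = Ac M + Ac N"
  "yc (M + N) = yc M + yc N" "xic (M + N) = xic M + xic N" "etac (M + N) = etac M + etac N"
  "zc (M - N) = zc M - zc N" "xc (M - N) = xc M - xc N" "Ac (M - N) = Ac M - Ac N"
  "yc (M - N) = yc M - yc N" "xic (M - N) = xic M - xic N" "etac (M - N) = etac M - etac N"
  "zc (r *\<^sub>R M) = r *\<^sub>R zc M" "xc (r *\<^sub>R M) = r *\<^sub>R xc M" "Ac (r *\<^sub>R M) = r *\<^sub>R Ac M"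
  "yc (r *\<^sub>R M) = r *\<^sub>R yc M" "xic (r *\<^sub>R M) = r * xic M" "etac (r *\<^sub>R M) = r * etac M"
  "zc 0 = 0" "xc 0 = 0" "Ac 0 = 0" "yc 0 = 0" "xic 0 = 0" "etac 0 = 0"
  by (simp_all add: lcoords vec_eq_iff)

lemma lcoords_sum [simp]:
  "zc (sum f S) = (\<Sum>i\<in>S. zc (f i))" "xc (sum f S) = (\<Sum>i\<in>S. xc (f i))"
  "Ac (sum f S) = (\<Sum>i\<in>S. Ac (f i))" "yc (sum f S) = (\<Sum>i\<in>S. yc (f i))"
  "xic (sum f S) = (\<Sum>i\<in>S. xic (f i))" "etac (sum f S) = (\<Sum>i\<in>S. etac (f i))"
  by (induction S rule: infinite_finite_induct; simp)+

definition ip :: "('n::finite \<Rightarrow> real) \<Rightarrow> complex^'n \<Rightarrow> complex^'n \<Rightarrow> complex" where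
  "ip s u v = (\<Sum>j\<in>UNIV. of_real (s j) * cnj (u $ j) * v $ j)"

definition op :: "('n::finite \<Rightarrow> real) \<Rightarrow> complex^'n \<Rightarrow> complex^'n \<Rightarrow> complex^'n^'n" where
  "op s u v = (\<chi> i j. u $ i * cnj (v $ j) * of_real (s j))"

lemma op_nth [simp]: "op s u v $ i $ j = u $ i * cnj (v $ j) * of_real (s j)"
  by (simp add: op_def)

lemma herm_nth [simp]:
  "herm s $ Inl u $ Inl u' = 0" "herm s $ Inl u $ Inr (Inl k) = 0" "herm s $ Inl u $ Inr (Inr u') = 1"
  "herm s $ Inr (Inl l) $ Inl u' = 0" "herm s $ Inr (Inl l) $ Inr (Inl k) = (if l = k then of_real (s l) else 0)"
  "herm s $ Inr (Inl l) $ Inr (Inr u') = 0"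
  "herm s $ Inr (Inr u) $ Inl u' = 1" "herm s $ Inr (Inr u) $ Inr (Inl k) = 0" "herm s $ Inr (Inr u) $ Inr (Inr u') = 0"
  by (simp_all add: herm_def diag_nth)

lemma u_alg_iff:
  "M \<in> u_alg s \<longleftrightarrow>
     M $ Inr (Inr ()) $ Inl () = \<i> * of_real (xic M) \<and>
     M $ Inl () $ Inr (Inr ()) = \<i> * of_real (etac M) \<and>
     M $ Inr (Inr ()) $ Inr (Inr ()) = - cnj (zc M) \<and>
     (\<forall>j. M $ Inr (Inr ()) $ Inr (Inl j) = - cnj (xc M $ j) * of_real (s j)) \<and>
     (\<forall>j. M $ Inl () $ Inr (Inl j) = - cnj (yc M $ j) * of_real (s j)) \<and>
     (\<forall>i j. cnj (Ac M $ j $ i) * of_real (s j) + of_real (s i) * Ac M $ i $ j = 0)"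
  unfolding u_alg_def
  apply (simp add: vec_eq_iff all_lidx matrix_mult_nth sum_lidx adjoint_mat_def if_distrib if_distribR
     lcoords cong: if_cong)
  apply (simp add: complex_eq_iff)
  apply (rule iffI; intro conjI allI; elim conjE)
  apply (simp_all add: algebra_simps)
  apply (smt (verit))+
  done

lemma u_alg_eqI:
  assumes "M \<in> u_alg s" "N \<in> u_alg s" "zc M = zc N" "xc M = xc N" "Ac M = Ac N" "yc M = yc N"
    "xic M = xic N" "etac M = etac N"
  shows "M = N"
proof -
  have "M $ i $ j = N $ i $ j" for i j
    using assms unfolding u_alg_iff
    by (cases i; (cases "projr i")?; cases j; (cases "projr j")?)
       (auto simp: zc_def xc_def Ac_def yc_def vec_eq_iff)
  then show ?thesis by (simp add: vec_eq_iff)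
qed

lemma matrix_vector_nth: "(A *v v) $ i = (\<Sum>k\<in>UNIV. A $ i $ k * v $ k)"
  by (simp add: matrix_vector_mult_def)

lemma bracket_nth: "bracket A B $ i $ j = (\<Sum>k\<in>UNIV. A $ i $ k * B $ k $ j) - (\<Sum>k\<in>UNIV. B $ i $ k * A $ k $ j)"
  by (simp add: bracket_def matrix_mult_nth)

lemma Im_coords: "M \<in> u_alg s \<Longrightarrow> of_real (etac M) = - \<i> * M $ Inl () $ Inr (Inr ())"
  "M \<in> u_alg s \<Longrightarrow> of_real (xic M) = - \<i> * M $ Inr (Inr ()) $ Inl ()"
  by (auto simp: u_alg_iff)

lemma cnj_ip: "cnj (ip s u v) = ip s v u"
  by (simp add: ip_def algebra_simps)

lemma bracket_coords:
  assumes "M \<in> u_alg s" "N \<in> u_alg s"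
  shows
    "zc (bracket M N) = ip s (yc N) (xc M) - ip s (yc M) (xc N)
       + of_real (etac N * xic M - etac M * xic N)"
    "xc (bracket M N) = zc N *s xc M + Ac M *v xc N + (\<i> * of_real (xic N)) *s yc M
       - (zc M *s xc N + Ac N *v xc M + (\<i> * of_real (xic M)) *s yc N)"
    "Ac (bracket M N) = op s (xc N) (yc M) + op s (yc N) (xc M) - op s (xc M) (yc N) - op s (yc M) (xc N)
       + (Ac M ** Ac N - Ac N ** Ac M)"
    "yc (bracket M N) = (\<i> * of_real (etac N)) *s xc M + Ac M *v yc N - cnj (zc N) *s yc M
       - ((\<i> * of_real (etac M)) *s xc N + Ac N *v yc M - cnj (zc M) *s yc N)"
    "xic (bracket M N) = 2 * Re (zc N) * xic M - 2 * Re (zc M) * xic N - 2 * Im (ip s (xc M) (xc N))"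
    "etac (bracket M N) = 2 * Re (zc M) * etac N - 2 * Re (zc N) * etac M - 2 * Im (ip s (yc M) (yc N))"
proof -
  note M = assms(1)[unfolded u_alg_iff] and N = assms(2)[unfolded u_alg_iff]
  have MN: "\<And>i. M $ Inr (Inl i) $ Inl () = xc M $ i" "\<And>i. N $ Inr (Inl i) $ Inl () = xc N $ i"
     "\<And>i. M $ Inr (Inl i) $ Inr (Inr ()) = yc M $ i" "\<And>i. N $ Inr (Inl i) $ Inr (Inr ()) = yc N $ i"
     "M $ Inl () $ Inl () = zc M" "N $ Inl () $ Inl () = zc N"
     "\<And>i j. M $ Inr (Inl i) $ Inr (Inl j) = Ac M $ i $ j" "\<And>i j. N $ Inr (Inl i) $ Inr (Inl j) = Ac N $ i $ j"
    by (simp_all add: lcoords)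
  note R = M[THEN conjunct1] N[THEN conjunct1] M[THEN conjunct2, THEN conjunct1] N[THEN conjunct2, THEN conjunct1]
    M[THEN conjunct2, THEN conjunct2, THEN conjunct1] N[THEN conjunct2, THEN conjunct2, THEN conjunct1]
  have r2: "\<And>j. M $ Inr (Inr ()) $ Inr (Inl j) = - cnj (xc M $ j) * of_real (s j)"
     "\<And>j. N $ Inr (Inr ()) $ Inr (Inl j) = - cnj (xc N $ j) * of_real (s j)"
     "\<And>j. M $ Inl () $ Inr (Inl j) = - cnj (yc M $ j) * of_real (s j)"
     "\<And>j. N $ Inl () $ Inr (Inl j) = - cnj (yc N $ j) * of_real (s j)"
    using M N by auto
  show "zc (bracket M N) = ip s (yc N) (xc M) - ip s (yc M) (xc N)
       + of_real (etac N * xic M - etac M * xic N)"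
    by (simp add: zc_def[of "bracket M N"] bracket_nth sum_lidx MN R r2 sum_negf ip_def algebra_simps)
  show "xc (bracket M N) = zc N *s xc M + Ac M *v xc N + (\<i> * of_real (xic N)) *s yc M
       - (zc M *s xc N + Ac N *v xc M + (\<i> * of_real (xic M)) *s yc N)"
    by (simp add: vec_eq_iff xc_def[of "bracket M N"] bracket_nth sum_lidx MN R r2 matrix_vector_nth algebra_simps)
  show "Ac (bracket M N) = op s (xc N) (yc M) + op s (yc N) (xc M) - op s (xc M) (yc N) - op s (yc M) (xc N)
       + (Ac M ** Ac N - Ac N ** Ac M)"
    by (simp add: vec_eq_iff Ac_def[of "bracket M N"] bracket_nth sum_lidx MN R r2 matrix_mult_nth algebra_simps)
  show "yc (bracket M N) = (\<i> * of_real (etac N)) *s xc M + Ac M *v yc N - cnj (zc N) *s yc M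
       - ((\<i> * of_real (etac M)) *s xc N + Ac N *v yc M - cnj (zc M) *s yc N)"
    by (simp add: vec_eq_iff yc_def[of "bracket M N"] bracket_nth sum_lidx MN R r2 matrix_vector_nth algebra_simps)
  have Imip: "Im (ip s v u) = - Im (ip s u v)" for u v
    using cnj_ip[of s u v] by (metis cnj.simps(2))
  show "xic (bracket M N) = 2 * Re (zc N) * xic M - 2 * Re (zc M) * xic N - 2 * Im (ip s (xc M) (xc N))"
    by (simp add: xic_def[of "bracket M N"] bracket_nth sum_lidx MN R r2 sum_negf Imip[of "xc N"] algebra_simps)
      (simp add: ip_def algebra_simps sum_subtractf)
  show "etac (bracket M N) = 2 * Re (zc M) * etac N - 2 * Re (zc N) * etac M - 2 * Im (ip s (yc M) (yc N))"
    by (simp add: etac_def[of "bracket M N"] bracket_nth sum_lidx MN R r2 sum_negf Imip[of "yc N"] algebra_simps)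
      (simp add: ip_def algebra_simps sum_subtractf)
qed

lemma adjoint_mat_mult: "adjoint_mat (A ** B) = adjoint_mat B ** adjoint_mat A"
  by (simp add: vec_eq_iff adjoint_mat_def matrix_mult_nth mult.commute)

lemma adjoint_mat_linear: "adjoint_mat (A + B) = adjoint_mat A + adjoint_mat B"
  "adjoint_mat (A - B) = adjoint_mat A - adjoint_mat B" "adjoint_mat (r *\<^sub>R A) = r *\<^sub>R adjoint_mat A"
  "adjoint_mat 0 = 0" "adjoint_mat (mat 1) = mat 1" "adjoint_mat (- A) = - adjoint_mat A"
  by (simp_all add: vec_eq_iff adjoint_mat_def mat_nth)

lemma matrix_distribs:
  fixes A B C :: "'a::comm_ring_1^'m^'m"
  shows "(A + B) ** C = A ** C + B ** C" "A ** (B + C) = A ** B + A ** C"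
    "(A - B) ** C = A ** C - B ** C" "A ** (B - C) = A ** B - A ** C" "(- A) ** B = - (A ** B)" "A ** (- B) = - (A ** B)"
  by (simp_all add: vec_eq_iff matrix_mult_nth algebra_simps sum_subtractf sum_negf sum.distrib)

lemma u_alg_bracket: assumes "M \<in> u_alg s" "N \<in> u_alg s" shows "bracket M N \<in> u_alg s"
proof -
  have M: "adjoint_mat M ** herm s = - (herm s ** M)" and N: "adjoint_mat N ** herm s = - (herm s ** N)"
    using assms by (auto simp: u_alg_def eq_neg_iff_add_eq_0)
  have "adjoint_mat M ** adjoint_mat N ** herm s = herm s ** M ** N"
    by (simp add: matrix_mul_assoc[symmetric] N matrix_distribs) (simp add: matrix_mul_assoc M matrix_distribs)
  moreover have "adjoint_mat N ** adjoint_mat M ** herm s = herm s ** N ** M"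
    by (simp add: matrix_mul_assoc[symmetric] M matrix_distribs) (simp add: matrix_mul_assoc N matrix_distribs)
  ultimately show ?thesis
    by (simp add: u_alg_def bracket_def adjoint_mat_linear adjoint_mat_mult matrix_distribs matrix_mul_assoc)
qed

lemma trace_mult_commute: "trace (A ** B) = trace (B ** (A::'a::comm_ring_1^'m^'m))"
  unfolding trace_def matrix_mult_nth by (subst sum.swap) (simp add: mult.commute)

lemma trace_linear [simp]: "trace (A + B) = trace A + trace B" "trace (A - B) = trace A - trace (B::'a::comm_ring_1^'m^'m)"
  by (simp_all add: trace_def sum.distrib sum_subtractf)

lemma trace_scaleR [simp]: "trace (r *\<^sub>R (A::complex^'m^'m)) = r *\<^sub>R trace A"
  by (simp add: trace_def scaleR_right.sum)

lemma trace_0' [simp]: "trace (0::complex^'m^'m) = 0"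
  by (simp add: trace_def)

lemma matrix_mult_scaleR: fixes A B :: "'a::real_algebra_1^'m^'m"
  shows "(r *\<^sub>R A) ** B = r *\<^sub>R (A ** B)" "A ** (r *\<^sub>R B) = r *\<^sub>R (A ** B)"
  by (simp_all add: vec_eq_iff matrix_mult_nth scaleR_right.sum)

lemma u_alg_linear: "M \<in> u_alg s \<Longrightarrow> N \<in> u_alg s \<Longrightarrow> M + N \<in> u_alg s"
  "M \<in> u_alg s \<Longrightarrow> N \<in> u_alg s \<Longrightarrow> M - N \<in> u_alg s" "M \<in> u_alg s \<Longrightarrow> r *\<^sub>R M \<in> u_alg s" "0 \<in> u_alg s"
proof -
  define L where "L M = adjoint_mat M ** herm s + herm s ** M" for M
  have mem: "M \<in> u_alg s \<longleftrightarrow> L M = 0" for M by (simp add: u_alg_def L_def)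
  have L: "L (M + N) = L M + L N" "L (M - N) = L M - L N" "L (r *\<^sub>R M) = r *\<^sub>R L M" "L 0 = 0" for M N r
    by (simp_all add: L_def adjoint_mat_linear matrix_distribs matrix_mult_scaleR scaleR_add_right vec_eq_iff matrix_mult_nth)
  show "M \<in> u_alg s \<Longrightarrow> N \<in> u_alg s \<Longrightarrow> M + N \<in> u_alg s" "M \<in> u_alg s \<Longrightarrow> N \<in> u_alg s \<Longrightarrow> M - N \<in> u_alg s"
    "M \<in> u_alg s \<Longrightarrow> r *\<^sub>R M \<in> u_alg s" "0 \<in> u_alg s"
    by (simp_all add: mem L)
qed

lemma l_alg_linear: "M \<in> l_alg s \<Longrightarrow> N \<in> l_alg s \<Longrightarrow> M + N \<in> l_alg s"
  "M \<in> l_alg s \<Longrightarrow> N \<in> l_alg s \<Longrightarrow> M - N \<in> l_alg s" "M \<in> l_alg s \<Longrightarrow> r *\<^sub>R M \<in> l_alg s" "0 \<in> l_alg s"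
  by (auto simp: l_alg_def u_alg_linear)

lemma l_alg_sum: "(\<And>i. i \<in> S \<Longrightarrow> f i \<in> l_alg s) \<Longrightarrow> sum f S \<in> l_alg s"
  by (induction S rule: infinite_finite_induct) (auto simp: l_alg_linear)

lemma l_alg_bracket: "M \<in> l_alg s \<Longrightarrow> N \<in> l_alg s \<Longrightarrow> bracket M N \<in> l_alg s"
  by (simp add: l_alg_def u_alg_bracket) (simp add: bracket_def trace_mult_commute)

lemma trace_u_alg: "M \<in> u_alg s \<Longrightarrow> trace M = zc M - cnj (zc M) + trace (Ac M)"
  unfolding u_alg_iff by (simp add: trace_def sum_lidx) (simp add: lcoords)

lemma all_sum_type: "(\<forall>i::'a+'b. P i) \<longleftrightarrow> (\<forall>i. P (Inl i)) \<and> (\<forall>i. P (Inr i))"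
  by (rule split_sum_all)

lemma blk_simps [simp]: "blk (Inl u) = 0" "blk (Inr (Inl k)) = 1" "blk (Inr (Inr u)) = 2"
  by (simp_all add: blk_def)

lemma p_alg_iff: "signature s p q \<Longrightarrow> M \<in> l_filt s 0 \<longleftrightarrow> M \<in> l_alg s \<and> xc M = 0 \<and> xic M = 0"
  unfolding l_filt_def l_alg_def mem_Collect_eq all_lidx
  by (auto simp: u_alg_iff vec_eq_iff) (auto simp: lcoords)

lemma s_nonzero: "signature s p q \<Longrightarrow> s j \<noteq> 0"
  unfolding signature_def by (metis zero_neq_neg_one zero_neq_one)

lemma s_square: "signature s p q \<Longrightarrow> s j * s j = 1"
  unfolding signature_def by (metis mult_minus1_right mult.right_neutral minus_minus)

lemma s_abs: "signature s p q \<Longrightarrow> \<bar>s j\<bar> = 1"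
  unfolding signature_def by (metis abs_minus_cancel abs_one)

lemma l_filt_1_iff: "signature s p q \<Longrightarrow>
   M \<in> l_filt s 1 \<longleftrightarrow> M \<in> l_alg s \<and> xc M = 0 \<and> xic M = 0 \<and> zc M = 0 \<and> Ac M = 0"
  unfolding l_filt_def l_alg_def mem_Collect_eq all_lidx
  by (auto simp: u_alg_iff vec_eq_iff) (auto simp: lcoords)

lemma l_filt_neg1_iff: "M \<in> l_filt s (-1) \<longleftrightarrow> M \<in> l_alg s \<and> xic M = 0"
  unfolding l_filt_def l_alg_def mem_Collect_eq all_lidx
  by (auto simp: u_alg_iff vec_eq_iff)

lemma l_filt_le: "d \<le> -2 \<Longrightarrow> M \<in> l_alg s \<Longrightarrow> M \<in> l_filt s d"
  unfolding l_filt_def by (auto simp: blk_def split: sum.splits)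

lemma l_deg_neg1_iff: "signature s p q \<Longrightarrow>
   M \<in> l_deg s (-1) \<longleftrightarrow> M \<in> l_alg s \<and> zc M = 0 \<and> Ac M = 0 \<and> yc M = 0 \<and> xic M = 0 \<and> etac M = 0"
  unfolding l_deg_def l_alg_def mem_Collect_eq all_lidx
  by (auto simp: u_alg_iff vec_eq_iff) (auto simp: lcoords)

definition lel :: "('n::finite \<Rightarrow> real) \<Rightarrow> complex \<Rightarrow> complex^'n \<Rightarrow> complex^'n^'n \<Rightarrow> complex^'n \<Rightarrow> real \<Rightarrow> real \<Rightarrow> 'n lmatrix" where
  "lel s z x A y \<xi> \<eta> = lblocks
     z                (\<chi> j. - cnj (y $ j) * of_real (s j))  (\<i> * of_real \<eta>)
     x                A                                      y
     (\<i> * of_real \<xi>)  (\<chi> j. - cnj (x $ j) * of_real (s j))  (- cnj z)"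

definition u_pq :: "('n::finite \<Rightarrow> real) \<Rightarrow> (complex^'n^'n) set" where
  "u_pq s = {A. \<forall>i j. cnj (A $ j $ i) * of_real (s j) + of_real (s i) * A $ i $ j = 0}"

lemma lel_coords [simp]: "zc (lel s z x A y \<xi> \<eta>) = z" "xc (lel s z x A y \<xi> \<eta>) = x" "Ac (lel s z x A y \<xi> \<eta>) = A"
  "yc (lel s z x A y \<xi> \<eta>) = y" "xic (lel s z x A y \<xi> \<eta>) = \<xi>" "etac (lel s z x A y \<xi> \<eta>) = \<eta>"
  by (simp_all add: lel_def lcoords)

lemma lel_in_u_alg: "A \<in> u_pq s \<Longrightarrow> lel s z x A y \<xi> \<eta> \<in> u_alg s"
  unfolding u_alg_iff lel_coords by (simp add: u_pq_def) (simp add: lel_def)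

lemma lel_in_l_alg: "A \<in> u_pq s \<Longrightarrow> z - cnj z + trace A = 0 \<Longrightarrow> lel s z x A y \<xi> \<eta> \<in> l_alg s"
  by (simp add: l_alg_def trace_u_alg[OF lel_in_u_alg] lel_in_u_alg)

lemma Ac_u_pq: "M \<in> u_alg s \<Longrightarrow> Ac M \<in> u_pq s"
  unfolding u_alg_iff u_pq_def by auto

lemma lel_collapse: "M \<in> u_alg s \<Longrightarrow> lel s (zc M) (xc M) (Ac M) (yc M) (xic M) (etac M) = M"
  by (rule u_alg_eqI[OF lel_in_u_alg]) (auto simp: Ac_u_pq)

text \<open>Real side\<close>

definition gform :: "real \<Rightarrow> ('n \<Rightarrow> real) \<Rightarrow> 'n gidx \<Rightarrow> real" where
  "gform c s = (\<lambda>i. case i of Inl _ \<Rightarrow> 1 | Inr (Inl _) \<Rightarrow> c | Inr (Inr j) \<Rightarrow> s j)"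

lemma gform_simps [simp]: "gform c s (Inl u) = 1" "gform c s (Inr (Inl u)) = c" "gform c s (Inr (Inr j)) = s j"
  by (simp_all add: gform_def)

lemma G_grp_eq: "G_grp c s = O_pq (gform c s)"
  by (simp add: G_grp_def gform_def)

definition ga :: "'n::finite gmatrix \<Rightarrow> real" where "ga M = M $ Inl () $ Inr (Inl ())"
definition gX :: "'n::finite gmatrix \<Rightarrow> complex^'n" where
  "gX M = cvec (\<chi> k. M $ Inr (Inr k) $ Inl ()) (\<chi> k. M $ Inr (Inr k) $ Inr (Inl ()))"
definition gA :: "'n::finite gmatrix \<Rightarrow> real^'n^'n" where "gA M = (\<chi> i j. M $ Inr (Inr i) $ Inr (Inr j))"

lemma cvec_nth [simp]: "cvec X Y $ k = Complex (X $ k) (Y $ k)"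
  by (simp add: cvec_def)

lemma cnj_vec_nth [simp]: "cnj_vec X $ k = cnj (X $ k)"
  by (simp add: cnj_vec_def)

lemmas gcoords = ga_def gX_def gA_def

lemma gmat_coords [simp]: "ga (gmat c s a X Y A) = a" "gX (gmat c s a X Y A) = cvec X Y" "gA (gmat c s a X Y A) = A"
  by (simp_all add: gcoords gmat_def vec_eq_iff)

lemma gcoords_linear [simp]:
  "ga (M + N) = ga M + ga N" "gX (M + N) = gX M + gX N" "gA (M + N) = gA M + gA N"
  "ga (M - N) = ga M - ga N" "gX (M - N) = gX M - gX N" "gA (M - N) = gA M - gA N"
  "ga (r *\<^sub>R M) = r * ga M" "gX (r *\<^sub>R M) = r *\<^sub>R gX M" "gA (r *\<^sub>R M) = r *\<^sub>R gA M"
  by (simp_all add: gcoords vec_eq_iff complex_eq_iff)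

lemma so_pq_iff: "A \<in> so_pq s \<longleftrightarrow> (\<forall>i j. A $ j $ i * s j + s i * A $ i $ j = 0)"
  by (simp add: so_pq_def vec_eq_iff matrix_mult_nth transpose_def diag_nth if_distrib if_distribR cong: if_cong)

lemma g_alg_iff_coords: "M \<in> g_alg c s \<longleftrightarrow>
   gA M \<in> so_pq s \<and> M = gmat c s (ga M) (\<chi> k. Re (gX M $ k)) (\<chi> k. Im (gX M $ k)) (gA M)"
proof
  assume "M \<in> g_alg c s"
  then obtain a X1 X2 A where "M = gmat c s a X1 X2 A" "A \<in> so_pq s" unfolding g_alg_def by blast
  then show "gA M \<in> so_pq s \<and> M = gmat c s (ga M) (\<chi> k. Re (gX M $ k)) (\<chi> k. Im (gX M $ k)) (gA M)"
    by simp
qed (auto simp: g_alg_def)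

lemma g_alg_eqI: "M \<in> g_alg c s \<Longrightarrow> N \<in> g_alg c s \<Longrightarrow> ga M = ga N \<Longrightarrow> gX M = gX N \<Longrightarrow> gA M = gA N \<Longrightarrow> M = N"
  by (metis g_alg_iff_coords)

lemma gmat_nth [simp]:
  "gmat c s a X Y A $ Inl u $ Inl u' = 0"
  "gmat c s a X Y A $ Inl u $ Inr (Inl u') = a"
  "gmat c s a X Y A $ Inl u $ Inr (Inr k) = - (X $ k) * s k"
  "gmat c s a X Y A $ Inr (Inl u) $ Inl u' = - c * a"
  "gmat c s a X Y A $ Inr (Inl u) $ Inr (Inl u') = 0"
  "gmat c s a X Y A $ Inr (Inl u) $ Inr (Inr k) = - c * (Y $ k) * s k"
  "gmat c s a X Y A $ Inr (Inr l) $ Inl u' = X $ l"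
  "gmat c s a X Y A $ Inr (Inr l) $ Inr (Inl u') = Y $ l"
  "gmat c s a X Y A $ Inr (Inr l) $ Inr (Inr k) = A $ l $ k"
  by (simp_all add: gmat_def vec_times_diag)

lemma g_alg_iff: 
  assumes "signature s p q" "c = 1 \<or> c = -1"
  shows "M \<in> g_alg c s \<longleftrightarrow> M \<in> so_pq (gform c s)"
proof -
  have sj: "s j = 1 \<or> s j = -1" for j using assms(1) by (auto simp: signature_def)
  have *: "x * s j = y \<longleftrightarrow> x = y * s j" for x y j using sj[of j] by auto
  show ?thesis
    unfolding g_alg_iff_coords so_pq_iff all_gidx gform_simps
    apply (simp add: vec_eq_iff all_gidx)
    apply (simp add: gcoords)
    using assms(2) s_square[OF assms(1)] apply (auto simp: *)
    by (smt (verit) mult_minus_left mult.commute mult.right_neutral mult_1 *)+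
qed

lemma so_pq_linear: "A \<in> so_pq s \<Longrightarrow> B \<in> so_pq s \<Longrightarrow> A + B \<in> so_pq s"
  "A \<in> so_pq s \<Longrightarrow> B \<in> so_pq s \<Longrightarrow> A - B \<in> so_pq s" "A \<in> so_pq s \<Longrightarrow> r *\<^sub>R A \<in> so_pq s" "0 \<in> so_pq s"
  unfolding so_pq_iff by (simp_all add: algebra_simps)
   (smt (verit) add_diff_cancel_left' diff_add_cancel  distrib_left mult.assoc mult.left_commute mult_zero_right)+

lemma so_pq_bracket: assumes "A \<in> so_pq s" "B \<in> so_pq s" shows "bracket A B \<in> so_pq s"
proof -
  have A: "transpose A ** diag s = - (diag s ** A)" and B: "transpose B ** diag s = - (diag s ** B)"
    using assms by (auto simp: so_pq_def eq_neg_iff_add_eq_0)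
  have "transpose A ** transpose B ** diag s = diag s ** A ** B"
    by (simp add: matrix_mul_assoc[symmetric] B matrix_distribs) (simp add: matrix_mul_assoc A matrix_distribs)
  moreover have "transpose B ** transpose A ** diag s = diag s ** B ** A"
    by (simp add: matrix_mul_assoc[symmetric] A matrix_distribs) (simp add: matrix_mul_assoc B matrix_distribs)
  moreover have "transpose (A ** B - B ** A) = transpose B ** transpose A - transpose A ** transpose B"
    by (simp add: matrix_transpose_mul[symmetric]) (simp add: transpose_def vec_eq_iff)
  ultimately show ?thesis
    by (simp add: so_pq_def bracket_def matrix_distribs matrix_mul_assoc)
qed

lemma cplx_linear: "cplx (A + B) = cplx A + cplx B" "cplx (A - B) = cplx A - cplx B"
  "cplx (r *\<^sub>R A) = r *\<^sub>R cplx A" "cplx (A ** B) = cplx A ** cplx B" "cplx 0 = 0" "cplx (mat 1) = mat 1"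
  by (simp_all add: vec_eq_iff matrix_mult_nth mat_nth complex_eq_iff)

definition rl :: "complex \<Rightarrow> complex \<Rightarrow> complex^'n \<Rightarrow> complex^'n" where
  "rl p q X = p *s X + q *s cnj_vec X"

lemma rl_nth [simp]: "rl p q X $ k = p * X $ k + q * cnj (X $ k)"
  by (simp add: rl_def)

definition Rc :: "real \<Rightarrow> complex^'n \<Rightarrow> complex^'n" where
  "Rc c X = (\<chi> k. Complex (c * Im (X $ k)) (- Re (X $ k)))"

lemma Rc_nth [simp]: "Rc c X $ k = Complex (c * Im (X $ k)) (- Re (X $ k))"
  by (simp add: Rc_def)

lemma g_alg_linear: 
  "M \<in> g_alg c s \<Longrightarrow> N \<in> g_alg c s \<Longrightarrow> M + N \<in> g_alg c s"
  "M \<in> g_alg c s \<Longrightarrow> N \<in> g_alg c s \<Longrightarrow> M - N \<in> g_alg c s"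
  "M \<in> g_alg c s \<Longrightarrow> r *\<^sub>R M \<in> g_alg c s" "0 \<in> g_alg c s"
proof -
  have *: "gmat c s a X Y A + gmat c s a' X' Y' A' = gmat c s (a+a') (X+X') (Y+Y') (A+A')"
     "gmat c s a X Y A - gmat c s a' X' Y' A' = gmat c s (a-a') (X-X') (Y-Y') (A-A')"
     "r *\<^sub>R gmat c s a X Y A = gmat c s (r*a) (r *\<^sub>R X) (r *\<^sub>R Y) (r *\<^sub>R A)"
     "0 = gmat c s 0 0 0 0" for a X Y A a' X' Y' A' r
    by (simp_all add: vec_eq_iff all_gidx algebra_simps)
  show "M \<in> g_alg c s \<Longrightarrow> N \<in> g_alg c s \<Longrightarrow> M + N \<in> g_alg c s"
  "M \<in> g_alg c s \<Longrightarrow> N \<in> g_alg c s \<Longrightarrow> M - N \<in> g_alg c s"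
  "M \<in> g_alg c s \<Longrightarrow> r *\<^sub>R M \<in> g_alg c s" "0 \<in> g_alg c s"
    unfolding g_alg_def by (fastforce simp: * so_pq_linear)+
qed

lemma g_alg_nth: assumes "M \<in> g_alg c s"
  shows "M $ Inl () $ Inl () = 0" "M $ Inl () $ Inr (Inl ()) = ga M" "M $ Inl () $ Inr (Inr k) = - Re (gX M $ k) * s k"
    "M $ Inr (Inl ()) $ Inl () = - c * ga M" "M $ Inr (Inl ()) $ Inr (Inl ()) = 0"
    "M $ Inr (Inl ()) $ Inr (Inr k) = - c * Im (gX M $ k) * s k"
    "M $ Inr (Inr k) $ Inl () = Re (gX M $ k)" "M $ Inr (Inr k) $ Inr (Inl ()) = Im (gX M $ k)"
    "M $ Inr (Inr k) $ Inr (Inr l) = gA M $ k $ l"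
  by (subst conjunct2[OF iffD1[OF g_alg_iff_coords assms]], simp)+

lemma bracket_gcoords:
  assumes M: "M \<in> g_alg c s" and N: "N \<in> g_alg c s" and "c = 1 \<or> c = -1"
  shows "ga (bracket M N) = - Im (ip s (gX M) (gX N))"
   "gX (bracket M N) = cplx (gA M) *v gX N - cplx (gA N) *v gX M + ga M *\<^sub>R Rc c (gX N) - ga N *\<^sub>R Rc c (gX M)"
   "gA (bracket M N) $ i $ j = bracket (gA M) (gA N) $ i $ j +
       s j * (Re (gX N $ i) * Re (gX M $ j) - Re (gX M $ i) * Re (gX N $ j)
            + c * (Im (gX N $ i) * Im (gX M $ j) - Im (gX M $ i) * Im (gX N $ j)))"
  unfolding ga_def[of "bracket M N"] gX_def[of "bracket M N"] gA_def[of "bracket M N"]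
  by (auto simp: bracket_nth sum_gidx g_alg_nth[OF M] g_alg_nth[OF N] ip_def matrix_vector_nth vec_eq_iff
    complex_eq_iff sum_negf sum_subtractf algebra_simps)

lemma g_alg_bracket:
  assumes M: "M \<in> g_alg c s" and N: "N \<in> g_alg c s" and "signature s p q" "c = 1 \<or> c = -1"
  shows "bracket M N \<in> g_alg c s"
  using assms so_pq_bracket by (auto simp: g_alg_iff)

lemma ext_form_lel: "ext_form s b1 b2 c1 d1 d2 e1 a X A =
   lel s (c1 * of_real a) (b1 *s X - (b2 * \<i>) *s cnj_vec X)
     (cplx A - mat (of_real (2 * Im c1 / of_nat CARD('n) * a) * \<i>)) (d1 *s X - (d2 * \<i>) *s cnj_vec (X::complex^'n::finite))
     (2 * ((cmod b1)\<^sup>2 - (cmod b2)\<^sup>2) * a) (e1 * a)"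
  by (simp add: ext_form_def lel_def vec_eq_iff all_lidx vec_times_cplx_diag algebra_simps)

lemma so_u_pq: "A \<in> so_pq s \<Longrightarrow> cplx A - mat (of_real r * \<i>) \<in> u_pq s"
proof -
  assume A: "A \<in> so_pq s"
  have "of_real (A $ j $ i * s j + s i * A $ i $ j) = (0::complex)" for i j using A unfolding so_pq_iff by auto
  then show ?thesis unfolding u_pq_def mem_Collect_eq by (auto simp: mat_nth algebra_simps)
qed

lemma so_diag: "signature s p q \<Longrightarrow> A \<in> so_pq s \<Longrightarrow> A $ i $ i = 0"
  unfolding so_pq_iff using s_nonzero by (metis add_cancel_right_right double_zero mult.commute mult_eq_0_iff)

definition extf :: "('n::finite \<Rightarrow> real) \<Rightarrow>
    complex \<Rightarrow> complex \<Rightarrow> complex \<Rightarrow> complex \<Rightarrow> complex \<Rightarrow> real \<Rightarrow> 'n gmatrix \<Rightarrow> 'n lmatrix" where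
  "extf s b1 b2 c1 d1 d2 e1 M = ext_form s b1 b2 c1 d1 d2 e1 (ga M) (gX M) (gA M)"

lemma ext_form_l_alg: "signature s p q \<Longrightarrow> A \<in> so_pq s \<Longrightarrow> ext_form s b1 b2 c1 d1 d2 e1 a X A \<in> l_alg s"
  unfolding ext_form_lel
  by (rule lel_in_l_alg[OF so_u_pq]) (auto simp: trace_def sum_subtractf so_diag mat_nth complex_eq_iff)

definition bb :: "complex \<Rightarrow> complex \<Rightarrow> real" where "bb b1 b2 = (cmod b1)\<^sup>2 - (cmod b2)\<^sup>2"
definition sg :: "real \<Rightarrow> complex \<Rightarrow> complex \<Rightarrow> real" where "sg c b1 b2 = - c * t_param c b1 b2"
definition kk :: "real \<Rightarrow> complex \<Rightarrow> complex \<Rightarrow> complex" where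
  "kk c b1 b2 = (if c = 1 then 2 * b1 * b2 else \<i> * (b2\<^sup>2 - b1\<^sup>2)) / of_real (bb b1 b2)"

lemma bb_cnj: "of_real (bb b1 b2) = b1 * cnj b1 - b2 * cnj b2"
  unfolding bb_def of_real_diff complex_norm_square ..

lemma sg_cnj: assumes "bb b1 b2 \<noteq> 0" "c = 1 \<or> c = -1"
  shows "\<i> * of_real (sg c b1 b2) * of_real (bb b1 b2) =
     (if c = 1 then - \<i> * (b1 * cnj b1 + b2 * cnj b2) else cnj b1 * b2 - b1 * cnj b2)"
proof -
  have "sg c b1 b2 * bb b1 b2 = (if c = 1 then - ((cmod b1)\<^sup>2 + (cmod b2)\<^sup>2) else 2 * (Re b1 * Im b2 - Re b2 * Im b1))"
    using assms unfolding sg_def t_param_def by (auto simp flip: bb_def)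
  then have "of_real (sg c b1 b2) * of_real (bb b1 b2) = complex_of_real
     (if c = 1 then - ((cmod b1)\<^sup>2 + (cmod b2)\<^sup>2) else 2 * (Re b1 * Im b2 - Re b2 * Im b1))"
    by (simp only: of_real_mult[symmetric])
  then show ?thesis using assms(2)
    by (auto simp: complex_eq_iff cmod_power2) (auto simp: algebra_simps power2_eq_square)
qed

lemma kk_bb: "bb b1 b2 \<noteq> 0 \<Longrightarrow> kk c b1 b2 * of_real (bb b1 b2) = (if c = 1 then 2 * b1 * b2 else \<i> * (b2\<^sup>2 - b1\<^sup>2))"
  by (simp add: kk_def)

lemma kk_norm: assumes "bb b1 b2 \<noteq> 0" "c = 1 \<or> c = -1" shows "(cmod (kk c b1 b2))\<^sup>2 = (sg c b1 b2)\<^sup>2 - c"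
proof -
  define b where "b = complex_of_real (bb b1 b2)"
  have b0: "b \<noteq> 0" using assms by (simp add: b_def)
  have b: "cnj b1 * b1 - cnj b2 * b2 = b" by (simp add: b_def bb_cnj mult.commute)
  have K: "kk c b1 b2 * b = (if c = 1 then 2 * b1 * b2 else \<i> * (b2\<^sup>2 - b1\<^sup>2))" using kk_bb assms b_def by blast
  then have K': "cnj (kk c b1 b2) * b = (if c = 1 then 2 * cnj b1 * cnj b2 else - \<i> * (cnj b2^2 - cnj b1^2))"
    by (metis b_def complex_cnj_complex_of_real complex_cnj_mult complex_cnj_numeral complex_cnj_i complex_cnj_diff complex_cnj_power mult_minus_left)
  have S: "(\<i> * of_real (sg c b1 b2)) * b = (if c = 1 then - \<i> * (b1 * cnj b1 + b2 * cnj b2) else cnj b1 * b2 - b1 * cnj b2)"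
    using sg_cnj[OF assms] b_def by simp
  have "(kk c b1 b2 * cnj (kk c b1 b2) + (\<i> * of_real (sg c b1 b2))^2 + of_real c) * b^2 = 0"
    using assms(2)
  proof
    assume c: "c = 1"
    have "(kk c b1 b2 * b) * (cnj (kk c b1 b2) * b) + ((\<i> * of_real (sg c b1 b2)) * b)^2 + b^2 = 0"
      unfolding K K' S unfolding b[symmetric] using c by (simp add: power2_eq_square algebra_simps)
    then show ?thesis using c by (simp add: power2_eq_square algebra_simps)
  next
    assume c: "c = -1"
    have "(kk c b1 b2 * b) * (cnj (kk c b1 b2) * b) + ((\<i> * of_real (sg c b1 b2)) * b)^2 - b^2 = 0"
      unfolding K K' S unfolding b[symmetric] using c by (simp add: power2_eq_square algebra_simps)
    then show ?thesis using c by (simp add: power2_eq_square algebra_simps)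
  qed
  then have "kk c b1 b2 * cnj (kk c b1 b2) + (\<i> * of_real (sg c b1 b2))^2 + of_real c = 0" using b0 by simp
  then have "complex_of_real ((cmod (kk c b1 b2))\<^sup>2 - (sg c b1 b2)\<^sup>2 + c) = 0"
    by (simp add: complex_norm_square[symmetric] power_mult_distrib)
  then have "(cmod (kk c b1 b2))\<^sup>2 - (sg c b1 b2)\<^sup>2 + c = 0" by (simp only: of_real_eq_0_iff)
  then show ?thesis by simp
qed

definition xof :: "complex \<Rightarrow> complex \<Rightarrow> complex^'n \<Rightarrow> complex^'n" where
  "xof b1 b2 X = b1 *s X - (b2 * \<i>) *s cnj_vec X"

lemma xof_nth [simp]: "xof b1 b2 X $ k = b1 * X $ k - b2 * \<i> * cnj (X $ k)"
  by (simp add: xof_def)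

lemma xof_Rc: assumes "bb b1 b2 \<noteq> 0" "c = 1 \<or> c = -1"
  shows "xof b1 b2 (Rc c X) = rl (\<i> * of_real (sg c b1 b2)) (kk c b1 b2) (xof b1 b2 X)"
proof -
  define b where "b = complex_of_real (bb b1 b2)"
  have b0: "b \<noteq> 0" using assms by (simp add: b_def)
  have b: "cnj b1 * b1 - cnj b2 * b2 = b" by (simp add: b_def bb_cnj mult.commute)
  have K: "kk c b1 b2 * b = (if c = 1 then 2 * b1 * b2 else \<i> * (b2\<^sup>2 - b1\<^sup>2))" using kk_bb assms b_def by blast
  have S: "(\<i> * of_real (sg c b1 b2)) * b = (if c = 1 then - \<i> * (b1 * cnj b1 + b2 * cnj b2) else cnj b1 * b2 - b1 * cnj b2)"
    using sg_cnj[OF assms] b_def by simp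
  have R1: "Complex (Im z) (- Re z) = - \<i> * z" and R2: "Complex (- Im z) (- Re z) = - \<i> * cnj z" for z
    by (simp_all add: complex_eq_iff)
  have "xof b1 b2 (Rc c X) $ k = rl (\<i> * of_real (sg c b1 b2)) (kk c b1 b2) (xof b1 b2 X) $ k" for k
  proof -
    define z z' where "z = X $ k" and "z' = cnj (X $ k)"
    have cz: "cnj z = z'" "cnj z' = z" by (simp_all add: z_def z'_def)
    have "(\<i> * of_real (sg c b1 b2) * b) * (b1 * z - b2 * \<i> * z') + (kk c b1 b2 * b) * (cnj b1 * z' + cnj b2 * \<i> * z)
        = xof b1 b2 (Rc c X) $ k * b"
      unfolding S K unfolding b[symmetric] using assms(2)
      by (auto simp: R1 R2 simp flip: z_def simp: cz power2_eq_square algebra_simps)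
    then have "((\<i> * of_real (sg c b1 b2)) * (b1 * z - b2 * \<i> * z') + kk c b1 b2 * (cnj b1 * z' + cnj b2 * \<i> * z)) * b
        = xof b1 b2 (Rc c X) $ k * b" by (simp add: algebra_simps)
    then show ?thesis using b0 by (simp flip: z_def add: cz)
  qed
  then show ?thesis by (simp add: vec_eq_iff)
qed

lemma yof_xof: assumes "bb b1 b2 \<noteq> 0"
  shows "d1 *s X - (d2 * \<i>) *s cnj_vec X =
     rl ((d1 * cnj b1 - d2 * cnj b2) / of_real (bb b1 b2)) (\<i> * (d1 * b2 - d2 * b1) / of_real (bb b1 b2)) (xof b1 b2 X)"
proof -
  have "d1 * z - d2 * \<i> * w = (d1 * cnj b1 - d2 * cnj b2) / of_real (bb b1 b2) * (b1 * z - b2 * \<i> * w)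
     + (\<i> * (d1 * b2 - d2 * b1) / of_real (bb b1 b2)) * (cnj b1 * w + cnj b2 * \<i> * z)" for z w
  proof -
    have "(d1 * z - d2 * \<i> * w) * of_real (bb b1 b2) = (d1 * cnj b1 - d2 * cnj b2) * (b1 * z - b2 * \<i> * w)
       + (\<i> * (d1 * b2 - d2 * b1)) * (cnj b1 * w + cnj b2 * \<i> * z)"
      unfolding bb_cnj by (simp add: algebra_simps)
    then have "d1 * z - d2 * \<i> * w = ((d1 * cnj b1 - d2 * cnj b2) * (b1 * z - b2 * \<i> * w)
       + (\<i> * (d1 * b2 - d2 * b1)) * (cnj b1 * w + cnj b2 * \<i> * z)) / of_real (bb b1 b2)"
      using assms by (simp add: nonzero_eq_divide_eq)
    then show ?thesis by (simp add: add_divide_distrib)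
  qed
  then show ?thesis by (simp add: vec_eq_iff)
qed

lemma Im_ip_xof: "Im (ip s (xof b1 b2 X) (xof b1 b2 Y)) = bb b1 b2 * Im (ip s X Y)"
  unfolding ip_def Im_sum sum_distrib_left
  unfolding bb_def cmod_power2
  by (rule sum.cong) (simp_all add: power2_eq_square algebra_simps)


lemma extf_coords:
  "zc (extf s b1 b2 c1 d1 d2 e1 M) = c1 * of_real (ga M)"
  "xc (extf s b1 b2 c1 d1 d2 e1 M) = xof b1 b2 (gX M)"
  "Ac (extf s b1 b2 c1 d1 d2 e1 M) = cplx (gA M) - mat (of_real (2 * Im c1 / of_nat CARD('n) * ga M) * \<i>)"
  "yc (extf s b1 b2 c1 d1 d2 e1 M) = d1 *s gX M - (d2 * \<i>) *s cnj_vec (gX (M::'n::finite gmatrix))"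
  "xic (extf s b1 b2 c1 d1 d2 e1 M) = 2 * bb b1 b2 * ga M"
  "etac (extf s b1 b2 c1 d1 d2 e1 M) = e1 * ga M"
  by (simp_all add: extf_def ext_form_lel xof_def bb_def)

lemma extf_u_alg: "M \<in> g_alg c s \<Longrightarrow> extf s b1 b2 c1 d1 d2 e1 M \<in> u_alg s"
  unfolding extf_def ext_form_lel g_alg_iff_coords by (intro lel_in_u_alg so_u_pq) simp

lemma extf_l_alg: "signature s p q \<Longrightarrow> M \<in> g_alg c s \<Longrightarrow> extf s b1 b2 c1 d1 d2 e1 M \<in> l_alg s"
  unfolding extf_def g_alg_iff_coords by (intro ext_form_l_alg) simp_all

lemma extf_add: "extf s b1 b2 c1 d1 d2 e1 (M + N) = extf s b1 b2 c1 d1 d2 e1 M + extf s b1 b2 c1 d1 d2 e1 N"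
  by (simp add: extf_def ext_form_lel lel_def vec_eq_iff all_lidx mat_nth algebra_simps add_divide_distrib)

lemma extf_diff: "extf s b1 b2 c1 d1 d2 e1 (M - N) = extf s b1 b2 c1 d1 d2 e1 M - extf s b1 b2 c1 d1 d2 e1 N"
  by (simp add: extf_def ext_form_lel lel_def vec_eq_iff all_lidx mat_nth algebra_simps diff_divide_distrib)

lemma extf_scaleR: "extf s b1 b2 c1 d1 d2 e1 (r *\<^sub>R M) = r *\<^sub>R extf s b1 b2 c1 d1 d2 e1 M"
  by (simp add: extf_def ext_form_lel lel_def vec_eq_iff all_lidx mat_nth scaleR_conv_of_real[where 'a=complex] algebra_simps)

lemma rl_rl: "rl p q (rl p' q' X) = rl (p * p' + q * cnj q') (p * q' + q * cnj p') X"
  by (simp add: vec_eq_iff algebra_simps)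

lemma xof_add: "xof b1 b2 (X + Y) = xof b1 b2 X + xof b1 b2 Y" "xof b1 b2 (X - Y) = xof b1 b2 X - xof b1 b2 Y"
  "xof b1 b2 (r *\<^sub>R X) = r *\<^sub>R xof b1 b2 X"
  by (simp_all add: vec_eq_iff algebra_simps) 

lemma xof_cplx: "xof b1 b2 (cplx A *v X) = cplx A *v xof b1 b2 X"
  by (simp add: vec_eq_iff matrix_vector_nth sum_distrib_left sum_subtractf algebra_simps)

lemma rl_cplx: "rl b1 b2 (cplx A *v X) = cplx A *v rl b1 b2 X"
  by (simp add: vec_eq_iff matrix_vector_nth sum_distrib_left sum.distrib algebra_simps)

lemma rl_add: "rl b1 b2 (X + Y) = rl b1 b2 X + rl b1 b2 Y" "rl b1 b2 (X - Y) = rl b1 b2 X - rl b1 b2 Y"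
  "rl b1 b2 (r *\<^sub>R X) = r *\<^sub>R rl b1 b2 X"
  by (simp_all add: vec_eq_iff algebra_simps) 

text \<open>The wedge \<open>x' \<otimes> y - x \<otimes> y'\<close> ...\<close>

definition kA :: "('n::finite \<Rightarrow> real) \<Rightarrow> complex \<Rightarrow> complex \<Rightarrow> complex \<Rightarrow> complex \<Rightarrow> complex \<Rightarrow>
   complex^'n \<Rightarrow> complex^'n \<Rightarrow> complex^'n^'n" where
  "kA s p1 p2 p3 p4 p5 x x' = (\<chi> i j.
      (p1 * (x' $ i * cnj (x $ j) - x $ i * cnj (x' $ j))
     + p2 * (cnj (x' $ i) * x $ j - cnj (x $ i) * x' $ j)
     + p3 * (x' $ i * x $ j - x $ i * x' $ j)
     + p4 * (cnj (x' $ i) * cnj (x $ j) - cnj (x $ i) * cnj (x' $ j))) * of_real (s j)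
     + (if i = j then p5 * \<i> * of_real (Im (ip s x x')) else 0))"

lemma gA_curv:
  assumes b: "bb b1 b2 \<noteq> 0" and c: "c = 1 \<or> c = -1"
  shows "complex_of_real (Re (Y $ i) * Re (X $ j) - Re (X $ i) * Re (Y $ j)
            + c * (Im (Y $ i) * Im (X $ j) - Im (X $ i) * Im (Y $ j))) * of_real (2 * bb b1 b2) =
     - of_real (sg c b1 b2) * (xof b1 b2 Y $ i * cnj (xof b1 b2 X $ j) - xof b1 b2 X $ i * cnj (xof b1 b2 Y $ j)
         + cnj (xof b1 b2 Y $ i) * xof b1 b2 X $ j - cnj (xof b1 b2 X $ i) * xof b1 b2 Y $ j)
     - \<i> * cnj (kk c b1 b2) * (xof b1 b2 Y $ i * xof b1 b2 X $ j - xof b1 b2 X $ i * xof b1 b2 Y $ j)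
     + \<i> * kk c b1 b2 * (cnj (xof b1 b2 Y $ i) * cnj (xof b1 b2 X $ j) - cnj (xof b1 b2 X $ i) * cnj (xof b1 b2 Y $ j))"
    (is "?L = ?R")
proof -
  define B where "B = complex_of_real (bb b1 b2)"
  have b0: "B \<noteq> 0" using assms by (simp add: B_def)
  have bB: "B = b1 * cnj b1 - b2 * cnj b2" by (simp add: B_def bb_cnj)
  have K: "kk c b1 b2 * B = (if c = 1 then 2 * b1 * b2 else \<i> * (b2\<^sup>2 - b1\<^sup>2))" using kk_bb assms B_def by blast
  then have K': "cnj (kk c b1 b2) * B = (if c = 1 then 2 * cnj b1 * cnj b2 else - \<i> * (cnj b2^2 - cnj b1^2))"
    by (metis B_def complex_cnj_complex_of_real complex_cnj_mult complex_cnj_numeral complex_cnj_i complex_cnj_diff complex_cnj_power mult_minus_left)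
  have "\<i> * of_real (sg c b1 b2) * B = (if c = 1 then - \<i> * (b1 * cnj b1 + b2 * cnj b2) else cnj b1 * b2 - b1 * cnj b2)"
    using sg_cnj[OF assms] B_def by simp
  moreover have "of_real (sg c b1 b2) * B = - \<i> * (\<i> * of_real (sg c b1 b2) * B)" by (simp add: mult.assoc)
  ultimately have S: "of_real (sg c b1 b2) * B = - \<i> * (if c = 1 then - \<i> * (b1 * cnj b1 + b2 * cnj b2) else cnj b1 * b2 - b1 * cnj b2)"
    by (simp only:)
  define x xi xj x' where "x = X $ i" and "xi = cnj (X $ i)" and "xj = X $ j" and "x' = cnj (X $ j)"
  define yi where "yi = cnj (Y $ i)"
  define z where "z = Y $ i" define zj where "zj = Y $ j" define z' where "z' = cnj (Y $ j)"
  note d = x_def[symmetric] xi_def[symmetric] xj_def[symmetric] x'_def[symmetric] yi_def[symmetric] z_def[symmetric]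
    zj_def[symmetric] z'_def[symmetric]
  have cn: "cnj x = xi" "cnj xi = x" "cnj xj = x'" "cnj x' = xj" "cnj z = yi" "cnj yi = z" "cnj zj = z'" "cnj z' = zj"
    by (simp_all add: x_def xi_def xj_def x'_def yi_def z_def zj_def z'_def)
  have "complex_of_real (Re (Y $ i) * Re (X $ j) - Re (X $ i) * Re (Y $ j)
            + c * (Im (Y $ i) * Im (X $ j) - Im (X $ i) * Im (Y $ j))) * 4 =
     (z + yi) * (xj + x') - (x + xi) * (zj + z') - of_real c * ((z - yi) * (xj - x') - (x - xi) * (zj - z'))"
    unfolding x_def xi_def xj_def x'_def z_def yi_def zj_def z'_def
    by (simp add: complex_eq_iff algebra_simps)
  note G4 = this
  have "w * of_real (2 * bb b1 b2) * B * 2 = (w * 4) * B * B" for w by (simp add: B_def)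
  from this G4 have L: "?L * B * 2 = ((z + yi) * (xj + x') - (x + xi) * (zj + z') - of_real c * ((z - yi) * (xj - x') - (x - xi) * (zj - z'))) * B * B"
    by (simp only:)
  have R: "?R * B * 2 = 2 * ( - (of_real (sg c b1 b2) * B) * (xof b1 b2 Y $ i * cnj (xof b1 b2 X $ j) - xof b1 b2 X $ i * cnj (xof b1 b2 Y $ j)
         + cnj (xof b1 b2 Y $ i) * xof b1 b2 X $ j - cnj (xof b1 b2 X $ i) * xof b1 b2 Y $ j)
     - \<i> * (cnj (kk c b1 b2) * B) * (xof b1 b2 Y $ i * xof b1 b2 X $ j - xof b1 b2 X $ i * xof b1 b2 Y $ j)
     + \<i> * (kk c b1 b2 * B) * (cnj (xof b1 b2 Y $ i) * cnj (xof b1 b2 X $ j) - cnj (xof b1 b2 X $ i) * cnj (xof b1 b2 Y $ j)))"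
    by algebra
  have "?L * B * 2 = ?R * B * 2"
  proof (cases "c = 1")
    case True
    show ?thesis
      unfolding L R S K K' if_P[OF True] unfolding bB True xof_nth d
      by (simp add: cn algebra_simps)
  next
    case False
    then have False': "c = -1" using c by simp
    show ?thesis
      unfolding L R S K K' if_not_P[OF False] unfolding bB False' xof_nth d
      by (simp add: cn power2_eq_square algebra_simps)
  qed
  moreover have "u = v" if "u * B * 2 = v * B * 2" for u v using that b0 by simp
  ultimately show ?thesis by blast
qed

lemma kA_nth: "kA s p1 p2 p3 p4 p5 x x' $ i $ j = 
      (p1 * (x' $ i * cnj (x $ j) - x $ i * cnj (x' $ j))
     + p2 * (cnj (x' $ i) * x $ j - cnj (x $ i) * x' $ j)
     + p3 * (x' $ i * x $ j - x $ i * x' $ j)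
     + p4 * (cnj (x' $ i) * cnj (x $ j) - cnj (x $ i) * cnj (x' $ j))) * of_real (s j)
     + (if i = j then p5 * \<i> * of_real (Im (ip s x x')) else 0)"
  by (simp add: kA_def)

locale ext_data =
  fixes c :: real and s :: "'n::finite \<Rightarrow> real" and p q :: nat and b1 b2 c1 d1 d2 :: complex and e1 :: real
  assumes sig: "signature s p q" and c: "c = 1 \<or> c = -1" and b: "bb b1 b2 \<noteq> 0"
begin

definition "\<beta> = bb b1 b2"
definition "\<mu> = (d1 * cnj b1 - d2 * cnj b2) / of_real \<beta>"
definition "\<nu> = \<i> * (d1 * b2 - d2 * b1) / of_real \<beta>"
definition "\<sigma> = sg c b1 b2"
definition "k = kk c b1 b2"
definition "n = real CARD('n)"
definition "\<gamma> = c1 + of_real (2 * Im c1 / n) * \<i>"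
definition "la1 = \<gamma> + 2 * \<i> * of_real \<beta> * \<mu> + \<i> * of_real \<sigma>"
definition "la2 = 2 * \<i> * of_real \<beta> * \<nu> + k"
definition "m1 = \<i> * of_real e1 - cnj \<gamma> * \<mu> + \<i> * of_real \<sigma> * \<mu> + \<nu> * cnj k"
definition "m2 = - cnj \<gamma> * \<nu> + \<mu> * k - \<i> * of_real \<sigma> * \<nu>"
definition "\<zeta> = c1 / of_real \<beta> - 2 * \<i> * cnj \<mu>"
definition "\<epsilon> = e1 / \<beta> - 2 * ((cmod \<mu>)\<^sup>2 - (cmod \<nu>)\<^sup>2)"
definition "p1 = 2 * Re \<mu> + \<sigma> / (2 * \<beta>)"
definition "p2 = \<sigma> / (2 * \<beta>)"
definition "p4 = \<nu> - \<i> * k / (2 * of_real \<beta>)"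
definition "p5 = - 2 * Im c1 / (n * \<beta>)"
abbreviation "\<alpha>0 \<equiv> extf s b1 b2 c1 d1 d2 e1"
abbreviation "xx \<equiv> xof b1 b2"

lemma n0: "n \<noteq> 0" "n \<ge> 1" 
proof -
  have "CARD('n) \<ge> 1" by (simp add: Suc_leI)
  then show "n \<noteq> 0" "n \<ge> 1" unfolding n_def by linarith+
qed

lemma \<beta>0: "\<beta> \<noteq> 0" using b by (simp add: \<beta>_def)

lemma y_eq: "d1 *s X - (d2 * \<i>) *s cnj_vec X = rl \<mu> \<nu> (xx X)"
  unfolding \<mu>_def \<nu>_def \<beta>_def by (rule yof_xof[OF b])

lemma J_eq: "xx (Rc c X) = rl (\<i> * of_real \<sigma>) k (xx X)"
  unfolding \<sigma>_def k_def by (rule xof_Rc[OF b c])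

lemma ip_rl: "ip s (rl \<mu> \<nu> x') x - ip s (rl \<mu> \<nu> x) x' = - 2 * \<i> * cnj \<mu> * of_real (Im (ip s x x'))"
proof -
  have "- 2 * \<i> * cnj \<mu> * of_real (Im (ip s x x')) = cnj \<mu> * (cnj (ip s x x') - ip s x x')"
    by (simp add: complex_eq_iff)
  then show ?thesis
    by (simp add: cnj_ip) (simp add: ip_def sum_distrib_left sum_subtractf[symmetric] algebra_simps)
qed

lemma curvature_coords:
  assumes M: "M \<in> g_alg c s" and N: "N \<in> g_alg c s"
  defines "x \<equiv> xx (gX M)" and "x' \<equiv> xx (gX N)"
  shows "curvature \<alpha>0 M N \<in> l_alg s"
    "xic (curvature \<alpha>0 M N) = 0"
    "zc (curvature \<alpha>0 M N) = \<zeta> * of_real (Im (ip s x x'))"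
    "xc (curvature \<alpha>0 M N) = rl la1 la2 (ga N *\<^sub>R x - ga M *\<^sub>R x')"
    "Ac (curvature \<alpha>0 M N) = kA s (of_real p1) (of_real p2) (cnj p4) p4 (of_real p5) x x'"
    "yc (curvature \<alpha>0 M N) = rl m1 m2 (ga N *\<^sub>R x - ga M *\<^sub>R x')"
    "etac (curvature \<alpha>0 M N) = \<epsilon> * Im (ip s x x')"
proof -
  note br = bracket_coords[OF extf_u_alg[OF M] extf_u_alg[OF N], of b1 b2 c1 d1 d2 e1 b1 b2 c1 d1 d2 e1]
  note gbr = bracket_gcoords[OF M N c]
  have gin: "bracket M N \<in> g_alg c s" by (rule g_alg_bracket[OF M N sig c])
  show "curvature \<alpha>0 M N \<in> l_alg s"
    unfolding curvature_def by (intro l_alg_linear l_alg_bracket extf_l_alg[OF sig M] extf_l_alg[OF sig N] extf_l_alg[OF sig gin])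
  have Imx: "Im (ip s x x') = \<beta> * Im (ip s (gX M) (gX N))"
    unfolding x_def x'_def \<beta>_def by (rule Im_ip_xof)
  have xbr: "xx (gX (bracket M N)) = cplx (gA M) *v x' - cplx (gA N) *v x
      + ga M *\<^sub>R rl (\<i> * of_real \<sigma>) k x' - ga N *\<^sub>R rl (\<i> * of_real \<sigma>) k x"
    unfolding gbr x_def x'_def by (simp only: xof_add xof_cplx J_eq)
  note co = curvature_def lcoords_linear br extf_coords y_eq xbr gbr(1) x_def[symmetric] x'_def[symmetric]
    \<beta>_def[symmetric] n_def[symmetric]
  show "xic (curvature \<alpha>0 M N) = 0"
    unfolding co by (simp add: Imx)
  show "zc (curvature \<alpha>0 M N) = \<zeta> * of_real (Im (ip s x x'))"
    unfolding co ip_rl \<zeta>_def using \<beta>0 by (simp add: Imx algebra_simps)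
  have mv: "(A - mat r) *v v = A *v v - r *s v" for A :: "complex^'n^'n" and r v
  proof -
    have "mat r *v v = r *s v"
      by (simp add: vec_eq_iff matrix_vector_nth mat_nth if_distrib if_distribR cong: if_cong)
    moreover have "(A - mat r) *v v = A *v v - mat r *v v"
      by (simp add: vec_eq_iff matrix_vector_nth left_diff_distrib sum_subtractf)
    ultimately show ?thesis by simp
  qed
  show "xc (curvature \<alpha>0 M N) = rl la1 la2 (ga N *\<^sub>R x - ga M *\<^sub>R x')"
    unfolding co mv la1_def la2_def \<gamma>_def
    by (simp add: vec_eq_iff algebra_simps scaleR_conv_of_real[where 'a=complex])
  show "yc (curvature \<alpha>0 M N) = rl m1 m2 (ga N *\<^sub>R x - ga M *\<^sub>R x')"
    unfolding co mv m1_def m2_def \<gamma>_def 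
    unfolding rl_add rl_rl rl_cplx
    by (simp add: vec_eq_iff algebra_simps scaleR_conv_of_real[where 'a=complex])
  have ipyy: "Im (ip s (rl \<mu> \<nu> x) (rl \<mu> \<nu> x')) = ((cmod \<mu>)\<^sup>2 - (cmod \<nu>)\<^sup>2) * Im (ip s x x')"
    unfolding ip_def Im_sum sum_distrib_left cmod_power2
    by (rule sum.cong) (simp_all add: power2_eq_square algebra_simps)
  show "etac (curvature \<alpha>0 M N) = \<epsilon> * Im (ip s x x')"
    unfolding co ipyy \<epsilon>_def using \<beta>0 by (simp add: Imx field_simps)
  show "Ac (curvature \<alpha>0 M N) = kA s (of_real p1) (of_real p2) (cnj p4) p4 (of_real p5) x x'"
  proof -
    have comm: "(cplx A - mat r) ** (cplx B - mat t) - (cplx B - mat t) ** (cplx A - mat r) = cplx (bracket A B)" 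
      for A B :: "real^'n^'n" and r t
    proof -
      have m: "C ** mat r = (\<chi> i j. r * C $ i $ j)" "mat r ** C = (\<chi> i j. r * C $ i $ j)" for C :: "complex^'n^'n" and r
        by (simp_all add: vec_eq_iff matrix_mult_nth mat_nth if_distrib if_distribR cong: if_cong)
      show ?thesis by (simp add: matrix_distribs m bracket_def cplx_linear) (simp add: vec_eq_iff mat_nth algebra_simps)
    qed
    have "Ac (curvature \<alpha>0 M N) $ i $ j = kA s (of_real p1) (of_real p2) (cnj p4) p4 (of_real p5) x x' $ i $ j" for i j
    proof -
      define G where "G = complex_of_real (Re (gX N $ i) * Re (gX M $ j) - Re (gX M $ i) * Re (gX N $ j)
            + c * (Im (gX N $ i) * Im (gX M $ j) - Im (gX M $ i) * Im (gX N $ j)))"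
      have G: "G * of_real (2 * \<beta>) = - of_real \<sigma> * (x' $ i * cnj (x $ j) - x $ i * cnj (x' $ j)
         + cnj (x' $ i) * x $ j - cnj (x $ i) * x' $ j)
       - \<i> * cnj k * (x' $ i * x $ j - x $ i * x' $ j)
       + \<i> * k * (cnj (x' $ i) * cnj (x $ j) - cnj (x $ i) * cnj (x' $ j))"
        unfolding G_def x_def x'_def \<beta>_def \<sigma>_def k_def by (rule gA_curv[OF b c])
      have cA: "cplx (gA (bracket M N)) $ i $ j = cplx (bracket (gA M) (gA N)) $ i $ j + of_real (s j) * G"
        unfolding cplx_nth gbr G_def by simp
      define K where "K = x' $ i * cnj (rl \<mu> \<nu> x $ j) + rl \<mu> \<nu> x' $ i * cnj (x $ j) - x $ i * cnj (rl \<mu> \<nu> x' $ j)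
         - rl \<mu> \<nu> x $ i * cnj (x' $ j)"
      have K: "K = 2 * complex_of_real (Re \<mu>) * (x' $ i * cnj (x $ j) - x $ i * cnj (x' $ j))
         + cnj \<nu> * (x' $ i * x $ j - x $ i * x' $ j) + \<nu> * (cnj (x' $ i) * cnj (x $ j) - cnj (x $ i) * cnj (x' $ j))"
      proof -
        have "2 * complex_of_real (Re \<mu>) = \<mu> + cnj \<mu>" by (simp add: complex_eq_iff)
        then show ?thesis unfolding K_def by (simp add: algebra_simps)
      qed
      have A: "Ac (curvature \<alpha>0 M N) $ i $ j = (K - G) * of_real (s j)
          + mat (of_real (2 * Im c1 / n * (- Im (ip s (gX M) (gX N)))) * \<i>) $ i $ j"
        unfolding co comm vector_add_component vector_minus_component cA K_def by (simp add: algebra_simps mat_nth)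
      have KG: "K - G = of_real p1 * (x' $ i * cnj (x $ j) - x $ i * cnj (x' $ j))
         + of_real p2 * (cnj (x' $ i) * x $ j - cnj (x $ i) * x' $ j)
         + cnj p4 * (x' $ i * x $ j - x $ i * x' $ j) 
         + p4 * (cnj (x' $ i) * cnj (x $ j) - cnj (x $ i) * cnj (x' $ j))"
      proof -
        define h where "h = 1 / complex_of_real (2 * \<beta>)"
        have "G = (G * of_real (2 * \<beta>)) * h" using \<beta>0 by (simp add: h_def)
        note G' = this[unfolded G]
        have h: "of_real p1 = 2 * of_real (Re \<mu>) + of_real \<sigma> * h" "of_real p2 = of_real \<sigma> * h"
          "p4 = \<nu> - \<i> * k * h" 
          by (simp_all add: h_def p1_def p2_def p4_def)
        have hc: "cnj p4 = cnj \<nu> + \<i> * cnj k * h"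
          unfolding h(3) by (simp add: h_def)
        show ?thesis unfolding K unfolding hc unfolding h by (subst G') (simp add: algebra_simps)
      qed
      have mm: "mat (of_real (2 * Im c1 / n * (- Im (ip s (gX M) (gX N)))) * \<i>) $ i $ j
          = (if i = j then of_real p5 * \<i> * of_real (Im (ip s x x')) else 0)"
        unfolding p5_def Imx using \<beta>0 by (simp add: mat_nth)
      show ?thesis unfolding A KG mm kA_nth ..
    qed
    then show ?thesis by (simp add: vec_eq_iff)
  qed
qed

end

lemma lel_add: "lel s z x A y \<xi> \<eta> + lel s z' x' A' y' \<xi>' \<eta>' = lel s (z+z') (x+x') (A+A') (y+y') (\<xi>+\<xi>') (\<eta>+\<eta>')"
  by (simp add: lel_def vec_eq_iff all_lidx algebra_simps)

lemma lel_scaleR: "r *\<^sub>R lel s z x A y \<xi> \<eta> = lel s (r *\<^sub>R z) (r *\<^sub>R x) (r *\<^sub>R A) (r *\<^sub>R y) (r * \<xi>) (r * \<eta>)"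
  by (simp add: lel_def vec_eq_iff all_lidx scaleR_conv_of_real[where 'a=complex] algebra_simps)

lemma lel_cong: "z = z' \<Longrightarrow> x = x' \<Longrightarrow> A = A' \<Longrightarrow> y = y' \<Longrightarrow> \<xi> = \<xi>' \<Longrightarrow> \<eta> = \<eta>' \<Longrightarrow>
    lel s z x A y \<xi> \<eta> = lel s z' x' A' y' \<xi>' \<eta>'" by simp

lemma Im_ip_linear: "Im (ip s (x + x') y) = Im (ip s x y) + Im (ip s x' y)" "Im (ip s y (x + x')) = Im (ip s y x) + Im (ip s y x')"
  "Im (ip s (r *\<^sub>R x) y) = r * Im (ip s x y)" "Im (ip s y (r *\<^sub>R x)) = r * Im (ip s y x)"
  by (simp_all add: ip_def sum.distrib[symmetric] sum_distrib_left algebra_simps)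

lemma kA_linear: 
  "kA s p1 p2 p3 p4 p5 (x + x') y = kA s p1 p2 p3 p4 p5 x y + kA s p1 p2 p3 p4 p5 x' y"
  "kA s p1 p2 p3 p4 p5 y (x + x') = kA s p1 p2 p3 p4 p5 y x + kA s p1 p2 p3 p4 p5 y x'"
  "kA s p1 p2 p3 p4 p5 (r *\<^sub>R x) y = r *\<^sub>R kA s p1 p2 p3 p4 p5 x y"
  "kA s p1 p2 p3 p4 p5 y (r *\<^sub>R x) = r *\<^sub>R kA s p1 p2 p3 p4 p5 y x"
  by (simp_all add: vec_eq_iff kA_nth Im_ip_linear scaleR_conv_of_real[where 'a=complex] algebra_simps)

lemma bracket_linear: fixes A B C :: "complex^'m^'m"
  shows "bracket (A + B) C = bracket A C + bracket B C" "bracket C (A + B) = bracket C A + bracket C B"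
    "bracket (r *\<^sub>R A) C = r *\<^sub>R bracket A C" "bracket C (r *\<^sub>R A) = r *\<^sub>R bracket C A"
  by (simp_all add: bracket_def matrix_distribs matrix_mult_scaleR scaleR_diff_right)

context ext_data begin

definition KK :: "complex^'n \<Rightarrow> real \<Rightarrow> complex^'n \<Rightarrow> real \<Rightarrow> 'n lmatrix" where
  "KK x \<xi> x' \<xi>' = lel s (\<zeta> * of_real (Im (ip s x x')))
     (rl la1 la2 ((1 / (2 * \<beta>)) *\<^sub>R (\<xi>' *\<^sub>R x - \<xi> *\<^sub>R x')))
     (kA s (of_real p1) (of_real p2) (cnj p4) p4 (of_real p5) x x')
     (rl m1 m2 ((1 / (2 * \<beta>)) *\<^sub>R (\<xi>' *\<^sub>R x - \<xi> *\<^sub>R x'))) 0 (\<epsilon> * Im (ip s x x'))"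

lemma KK_linear: 
  "KK (x + y) (\<xi> + \<eta>) x' \<xi>' = KK x \<xi> x' \<xi>' + KK y \<eta> x' \<xi>'" 
  "KK x' \<xi>' (x + y) (\<xi> + \<eta>) = KK x' \<xi>' x \<xi> + KK x' \<xi>' y \<eta>"
  "KK (r *\<^sub>R x) (r * \<xi>) x' \<xi>' = r *\<^sub>R KK x \<xi> x' \<xi>'" 
  "KK x' \<xi>' (r *\<^sub>R x) (r * \<xi>) = r *\<^sub>R KK x' \<xi>' x \<xi>"
  unfolding KK_def lel_add lel_scaleR kA_linear Im_ip_linear
  by (rule lel_cong; simp add: vec_eq_iff scaleR_conv_of_real[where 'a=complex] algebra_simps
    add_divide_distrib diff_divide_distrib)+


definition pre :: "complex^'n \<Rightarrow> real \<Rightarrow> 'n gmatrix" where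
  "pre x \<xi> = (let X = rl (cnj b1 / of_real \<beta>) (\<i> * b2 / of_real \<beta>) x in
     gmat c s (\<xi> / (2 * \<beta>)) (\<chi> k. Re (X $ k)) (\<chi> k. Im (X $ k)) 0)"

lemma xof_inv: "xx (rl (cnj b1 / of_real \<beta>) (\<i> * b2 / of_real \<beta>) x) = x"
proof -
  have "b1 * (cnj b1 / of_real \<beta> * w + \<i> * b2 / of_real \<beta> * w') - b2 * \<i> * (b1 / of_real \<beta> * w' + (- \<i>) * cnj b2 / of_real \<beta> * w) = w" for w w'
  proof -
    have "b1 * (cnj b1 * w + \<i> * b2 * w') - b2 * \<i> * (b1 * w' + (- \<i>) * cnj b2 * w) = of_real \<beta> * w"
      unfolding \<beta>_def bb_cnj by (simp add: algebra_simps)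
    then have "(b1 * (cnj b1 * w + \<i> * b2 * w') - b2 * \<i> * (b1 * w' + (- \<i>) * cnj b2 * w)) / of_real \<beta> = w"
      using \<beta>0 by simp
    then show ?thesis by (simp add: add_divide_distrib diff_divide_distrib algebra_simps)
  qed
  then show ?thesis by (simp add: vec_eq_iff)
qed

lemma pre_g_alg: "pre x \<xi> \<in> g_alg c s"
  unfolding pre_def Let_def g_alg_def using so_pq_linear(4) by blast

lemma cvec_Re_Im: "cvec (\<chi> k. Re (X $ k)) (\<chi> k. Im (X $ k)) = X"
  by (simp add: vec_eq_iff)

lemma pre_coords: "ga (pre x \<xi>) = \<xi> / (2 * \<beta>)" "xx (gX (pre x \<xi>)) = x" "gA (pre x \<xi>) = 0"
  unfolding pre_def Let_def gmat_coords cvec_Re_Im by (simp_all add: xof_inv)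

text \<open>The curvature of any map that agrees with the explicit form on \<open>\<gg>\<close>.\<close>

lemma curvature_KK:
  assumes M: "M \<in> g_alg c s" and N: "N \<in> g_alg c s"
  shows "curvature \<alpha>0 M N = KK (xx (gX M)) (2 * \<beta> * ga M) (xx (gX N)) (2 * \<beta> * ga N)"
proof -
  note cc = curvature_coords[OF M N]
  have h: "ga N *\<^sub>R xx (gX M) - ga M *\<^sub>R xx (gX N) = (1 / (2 * \<beta>)) *\<^sub>R ((2 * \<beta> * ga N) *\<^sub>R xx (gX M) - (2 * \<beta> * ga M) *\<^sub>R xx (gX N))"
    using \<beta>0 by (simp add: vec_eq_iff algebra_simps)
  have "curvature \<alpha>0 M N \<in> u_alg s" using cc(1) by (simp add: l_alg_def)
  from lel_collapse[OF this] show ?thesis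
    unfolding cc(2-) KK_def h[symmetric] by simp
qed

lemma KK_l_alg: "KK x \<xi> x' \<xi>' \<in> l_alg s"
proof -
  have "KK x \<xi> x' \<xi>' = curvature \<alpha>0 (pre x \<xi>) (pre x' \<xi>')"
    unfolding curvature_KK[OF pre_g_alg pre_g_alg] pre_coords using \<beta>0 by simp
  then show ?thesis using curvature_coords(1)[OF pre_g_alg pre_g_alg] by simp
qed

lemma curvature_agree:
  assumes "\<forall>X\<in>g_alg c s. \<alpha> X = \<alpha>0 X" "M \<in> g_alg c s" "N \<in> g_alg c s"
  shows "curvature \<alpha> M N = curvature \<alpha>0 M N"
  unfolding curvature_def using assms g_alg_bracket[OF assms(2,3) sig c] by simp

lemma curv_KK:
  assumes ag: "\<forall>X\<in>g_alg c s. \<alpha> X = \<alpha>0 X" and U: "U \<in> l_alg s" and V: "V \<in> l_alg s"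
  shows "curv c s \<alpha> U V = KK (xc U) (xic U) (xc V) (xic V)"
proof -
  have sm: "(SOME X. X \<in> g_alg c s \<and> \<alpha> X - W \<in> p_alg s) \<in> g_alg c s \<and>
      xx (gX (SOME X. X \<in> g_alg c s \<and> \<alpha> X - W \<in> p_alg s)) = xc W \<and>
      2 * \<beta> * ga (SOME X. X \<in> g_alg c s \<and> \<alpha> X - W \<in> p_alg s) = xic W" if W: "W \<in> l_alg s" for W
  proof -
    define P where "P X \<longleftrightarrow> X \<in> g_alg c s \<and> \<alpha> X - W \<in> p_alg s" for X
    have iff: "P X \<longleftrightarrow> X \<in> g_alg c s \<and> xx (gX X) = xc W \<and> 2 * \<beta> * ga X = xic W" for X
    proof (cases "X \<in> g_alg c s")
      case True
      then have "\<alpha> X - W \<in> l_alg s" using ag W extf_l_alg[OF sig True] by (auto intro!: l_alg_linear)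
      then show ?thesis unfolding P_def p_alg_iff[OF sig] using True ag
        by (auto simp: extf_coords \<beta>_def)
    qed (simp add: P_def)
    have "P (pre (xc W) (xic W))" unfolding iff pre_coords using pre_g_alg \<beta>0 by simp
    then have PS: "P (SOME X. P X)" by (rule someI)
    define Y where "Y = (SOME X. P X)"
    have PY: "P Y" using PS by (simp only: Y_def)
    have "Y = (SOME X. X \<in> g_alg c s \<and> \<alpha> X - W \<in> p_alg s)" by (simp add: Y_def P_def)
    then show ?thesis using PY[unfolded iff] by (simp only:)
  qed
  show ?thesis
    unfolding curv_def Let_def
    using sm[OF U] sm[OF V] curvature_agree[OF ag] by (simp add: curvature_KK)
qed

lemma KK_coords: "zc (KK x \<xi> x' \<xi>') = \<zeta> * of_real (Im (ip s x x'))"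
  "xc (KK x \<xi> x' \<xi>') = rl la1 la2 ((1 / (2 * \<beta>)) *\<^sub>R (\<xi>' *\<^sub>R x - \<xi> *\<^sub>R x'))"
  "Ac (KK x \<xi> x' \<xi>') = kA s (of_real p1) (of_real p2) (cnj p4) p4 (of_real p5) x x'"
  "yc (KK x \<xi> x' \<xi>') = rl m1 m2 ((1 / (2 * \<beta>)) *\<^sub>R (\<xi>' *\<^sub>R x - \<xi> *\<^sub>R x'))"
  "xic (KK x \<xi> x' \<xi>') = 0" "etac (KK x \<xi> x' \<xi>') = \<epsilon> * Im (ip s x x')"
  by (simp_all add: KK_def)

lemma regular_agree: 
  assumes ag: "\<forall>X\<in>g_alg c s. \<alpha> X = \<alpha>0 X" shows "regular c s \<alpha>"
  unfolding regular_def
proof (intro allI impI ballI)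
  fix j k :: int and U V assume jk: "j < 0" "k < 0" and U: "U \<in> l_deg s j" and V: "V \<in> l_deg s k"
  have UV: "U \<in> l_alg s" "V \<in> l_alg s" using U V by (auto simp: l_deg_def)
  have K: "curv c s \<alpha> U V \<in> l_alg s" "xic (curv c s \<alpha> U V) = 0"
    unfolding curv_KK[OF ag UV] by (simp_all add: KK_l_alg KK_coords)
  show "curv c s \<alpha> U V \<in> l_filt s (j + k + 1)"
  proof (cases "j + k + 1 \<le> -2")
    case False
    then have "j + k + 1 = -1" using jk by auto
    then show ?thesis using K by (simp only: l_filt_neg1_iff)
  qed (use K in \<open>auto intro: l_filt_le\<close>)
qed

end

lemma killing_l1: 
  assumes sig: "signature s p q" and Z: "Z \<in> l_filt s 1" and X: "X \<in> l_alg s"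
  shows "killing (Z::'n::finite lmatrix) X = - 2 * (CARD('n) + 2) * (2 * Re (ip s (yc Z) (xc X)) + etac Z * xic X)"
proof -
  have Zu: "Z \<in> u_alg s" and Xu: "X \<in> u_alg s" and Z0: "xc Z = 0" "xic Z = 0" "zc Z = 0" "Ac Z = 0"
    using Z X by (auto simp: l_filt_1_iff[OF sig] l_alg_def)
  have e: "Z $ Inl () $ Inl () = zc Z" "\<And>i. Z $ Inr (Inl i) $ Inl () = xc Z $ i" "\<And>i j. Z $ Inr (Inl i) $ Inr (Inl j) = Ac Z $ i $ j"
    "\<And>i. Z $ Inr (Inl i) $ Inr (Inr ()) = yc Z $ i" "\<And>i. X $ Inr (Inl i) $ Inl () = xc X $ i"
    by (simp_all add: lcoords)
  have "trace (Z ** X) = - (ip s (yc Z) (xc X) + cnj (ip s (yc Z) (xc X))) - of_real (etac Z * xic X)"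
    unfolding trace_def matrix_mult_nth sum_lidx
    using Zu Xu unfolding u_alg_iff by (simp add: e Z0 ip_def sum_negf algebra_simps)
  then have "Re (trace (Z ** X)) = - 2 * Re (ip s (yc Z) (xc X)) - etac Z * xic X" by simp
  then show ?thesis unfolding killing_def by (simp only:) (simp add: algebra_simps)
qed

definition bx :: "('n::finite \<Rightarrow> real) \<Rightarrow> complex^'n \<Rightarrow> real \<Rightarrow> 'n lmatrix" where "bx s x \<xi> = lel s 0 x 0 0 \<xi> 0"
definition by' :: "('n::finite \<Rightarrow> real) \<Rightarrow> complex^'n \<Rightarrow> real \<Rightarrow> 'n lmatrix" where "by' s y \<eta> = lel s 0 0 0 y 0 \<eta>"

lemma u_pq_0: "0 \<in> u_pq s" by (simp add: u_pq_def)

lemma bx_coords [simp]: "zc (bx s x \<xi>) = 0" "xc (bx s x \<xi>) = x" "Ac (bx s x \<xi>) = 0" "yc (bx s x \<xi>) = 0" "xic (bx s x \<xi>) = \<xi>" "etac (bx s x \<xi>) = 0"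
  "bx s x \<xi> \<in> l_alg s"
  by (simp_all add: bx_def lel_in_l_alg u_pq_0)

lemma by_coords [simp]: "zc (by' s x \<xi>) = 0" "xc (by' s x \<xi>) = 0" "Ac (by' s x \<xi>) = 0" "yc (by' s x \<xi>) = x" "xic (by' s x \<xi>) = 0" "etac (by' s x \<xi>) = \<xi>"
  "by' s x \<xi> \<in> l_alg s"
  by (simp_all add: by'_def lel_in_l_alg u_pq_0)

lemma by_filt: "signature s p q \<Longrightarrow> by' s y \<eta> \<in> l_filt s 1"
  by (simp add: l_filt_1_iff)

lemma l_filt_linear: "M \<in> l_filt s d \<Longrightarrow> N \<in> l_filt s d \<Longrightarrow> M + N \<in> l_filt s d" "M \<in> l_filt s d \<Longrightarrow> N \<in> l_filt s d \<Longrightarrow> M - N \<in> l_filt s d"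
  "M \<in> l_filt s d \<Longrightarrow> r *\<^sub>R M \<in> l_filt s d" "0 \<in> l_filt s d"
  by (auto simp: l_filt_def l_alg_linear; force)+

lemma l_filt_sum: "(\<And>i. i \<in> S \<Longrightarrow> f i \<in> l_filt s d) \<Longrightarrow> sum f S \<in> l_filt s d"
  by (induction S rule: infinite_finite_induct) (auto simp: l_filt_linear)

lemma killing_linear: "killing (A + B) C = killing A C + killing B C" "killing (A - B) C = killing A C - killing B C" "killing C (A + B) = killing C A + killing C B"
  "killing C (A - B) = killing C A - killing C B"
  "killing (r *\<^sub>R A) C = r * killing A C" "killing C (r *\<^sub>R A) = r * killing C A" "killing 0 C = 0" "killing C 0 = 0"
  by (simp_all add: killing_def matrix_distribs matrix_mult_scaleR algebra_simps)

lemma killing_sum: "killing (sum f S) C = (\<Sum>i\<in>S. killing (f i) C)" "killing C (sum f S) = (\<Sum>i\<in>S. killing C (f i))"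
  by (induction S rule: infinite_finite_induct) (auto simp: killing_linear)

lemma ip_axis: "ip s (axis j a) v = of_real (s j) * cnj a * v $ j" "ip s v (axis j a) = of_real (s j) * cnj (v $ j) * a"
  by (simp_all add: ip_def axis_def if_distrib if_distribR cong: if_cong)

lemma dual_expand:
  fixes s :: "'n::finite \<Rightarrow> real"
  assumes sig: "signature s p q" and db: "dual_bases s m X Z" and W: "W \<in> l_filt s 1"
  shows "(\<Sum>k<m. killing W (X k) *\<^sub>R Z k) = W"
proof -
  define D where "D = W - (\<Sum>k<m. killing W (X k) *\<^sub>R Z k)"
  have XZ: "\<And>k. k < m \<Longrightarrow> X k \<in> l_alg s" "\<And>k. k < m \<Longrightarrow> Z k \<in> l_filt s 1" 
    and dual: "\<And>j k. j < m \<Longrightarrow> k < m \<Longrightarrow> killing (Z j) (X k) = (if j = k then 1 else 0)"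
    and span: "\<And>V. V \<in> l_alg s \<Longrightarrow> \<exists>r. V - (\<Sum>k<m. r k *\<^sub>R X k) \<in> p_alg s"
    using db unfolding dual_bases_def by auto
  have DF: "D \<in> l_filt s 1" unfolding D_def by (intro l_filt_linear l_filt_sum W XZ) auto
  have D0: "killing D (X k) = 0" if "k < m" for k
    using that by (simp add: D_def killing_linear killing_sum dual if_distrib cong: if_cong)
  have DV: "killing D V = 0" if V: "V \<in> l_alg s" for V
  proof -
    obtain r where r: "V - (\<Sum>k<m. r k *\<^sub>R X k) \<in> p_alg s" using span[OF V] by blast
    then have "killing D (V - (\<Sum>k<m. r k *\<^sub>R X k)) = 0"
      unfolding p_alg_iff[OF sig] by (simp add: killing_l1[OF sig DF] ip_def)
    then show ?thesis by (simp add: killing_linear killing_sum D0)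
  qed
  have e0: "etac D = 0" using DV[OF bx_coords(7), of 0 1] by (simp add: killing_l1[OF sig DF] ip_def)
  have y0: "yc D = 0"
  proof -
    have "yc D $ j = 0" for j
    proof -
      have "Re (ip s (yc D) (axis j a)) = 0" for a
        using DV[OF bx_coords(7), of "axis j a" 0] unfolding killing_l1[OF sig DF bx_coords(7)] by simp
      from this[of 1] this[of \<i>] have "s j * Re (yc D $ j) = 0" "s j * Im (yc D $ j) = 0"
        unfolding ip_axis by simp_all
      then show ?thesis using s_nonzero[OF sig, of j] by (simp add: complex_eq_iff)
    qed
    then show ?thesis by (simp add: vec_eq_iff)
  qed
  have D1: "D \<in> u_alg s" "xc D = 0" "xic D = 0" "zc D = 0" "Ac D = 0"
    using DF by (simp_all add: l_filt_1_iff[OF sig] l_alg_def)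
  have "D = 0"
    by (rule u_alg_eqI[OF D1(1) u_alg_linear(4)]) (simp_all only: D1 e0 y0 lcoords_linear)
  then show ?thesis by (simp add: D_def)
qed

definition canon :: "('n::finite \<Rightarrow> real) \<Rightarrow> ('n lmatrix \<Rightarrow> 'n lmatrix \<Rightarrow> 'n lmatrix) \<Rightarrow> 'n lmatrix" where
  "canon s f = (let N = real (4 * (CARD('n) + 2)) in
     (\<Sum>j\<in>UNIV. f (by' s (axis j (of_real (- s j / N))) 0) (bx s (axis j 1) 0)
              + f (by' s (axis j (of_real (- s j / N) * \<i>)) 0) (bx s (axis j \<i>) 0))
     + f (by' s 0 (- 2 / N)) (bx s 0 1))"

lemma ip_axis_dual: assumes "signature s p q"
  shows "ip s (axis j (of_real (- s j / N))) v = - v $ j / of_real N"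
    "ip s (axis j (of_real (- s j / N) * \<i>)) v = \<i> * v $ j / of_real N"
proof -
  have "s j * (- s j / N) = - ((s j * s j) / N)" by (rule trans[OF times_divide_eq_right]) (simp only: mult_minus_right minus_divide_left)
  then have "s j * (- s j / N) = - (1 / N)" by (simp only: s_square[OF assms])
  then have *: "of_real (s j) * complex_of_real (- s j / N) = - (1 / of_real N)"
    by (metis of_real_1 of_real_divide of_real_minus of_real_mult)
  have "ip s (axis j (of_real (- s j / N))) v = (of_real (s j) * complex_of_real (- s j / N)) * v $ j"
    by (simp only: ip_axis complex_cnj_complex_of_real)
  then show "ip s (axis j (of_real (- s j / N))) v = - v $ j / of_real N" unfolding * by simp
  have "ip s (axis j (of_real (- s j / N) * \<i>)) v = (of_real (s j) * complex_of_real (- s j / N)) * (- \<i>) * v $ j"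
    by (simp only: ip_axis complex_cnj_mult complex_cnj_complex_of_real complex_cnj_i mult.assoc)
  then show "ip s (axis j (of_real (- s j / N) * \<i>)) v = \<i> * v $ j / of_real N" unfolding * by simp
qed

lemma dual_sum:
  fixes s :: "'n::finite \<Rightarrow> real"
  assumes sig: "signature s p q" and db: "dual_bases s m X Z" and f: "bilinear f"
    and f0: "\<And>Z X. xc X = 0 \<Longrightarrow> xic X = 0 \<Longrightarrow> f Z X = 0"
  shows "(\<Sum>k<m. f (Z k) (X k)) = canon s f"
proof -
  have XZ: "\<And>k. k < m \<Longrightarrow> X k \<in> l_alg s"
    using db unfolding dual_bases_def by blast
  define N where "N = real (4 * (CARD('n) + 2))"
  have N0: "N > 0" by (simp add: N_def)
  have l12: "linear (\<lambda>x. f x V)" "linear (f V)" for V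
    using f by (simp_all add: bilinear_def)
  have fl: "f (sum g S) V = (\<Sum>i\<in>S. f (g i) V)" "f V (sum g S) = (\<Sum>i\<in>S. f V (g i))" for g :: "nat \<Rightarrow> _" and S V
    by (rule linear_sum[OF l12(1)]) (rule linear_sum[OF l12(2)])
  have fl': "f V (sum g S) = (\<Sum>i\<in>S. f V (g i))" for g :: "'n \<Rightarrow> _" and S V
    by (rule linear_sum[OF l12(2)])
  have fs: "f (r *\<^sub>R A) B = r *\<^sub>R f A B" "f A (r *\<^sub>R B) = r *\<^sub>R f A B"
    "f A (B + C) = f A B + f A C" "f A (B - C) = f A B - f A C" for r A B C
    using f by (simp_all add: bilinear_lmul bilinear_rmul bilinear_radd bilinear_rsub)
  have ex: "f Y V = (\<Sum>j\<in>UNIV. Re (xc V $ j) *\<^sub>R f Y (bx s (axis j 1) 0) + Im (xc V $ j) *\<^sub>R f Y (bx s (axis j \<i>) 0))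
       + xic V *\<^sub>R f Y (bx s 0 1)" for Y V
  proof -
    have "f Y (V - ((\<Sum>j\<in>UNIV. Re (xc V $ j) *\<^sub>R (bx s (axis j 1) 0) + Im (xc V $ j) *\<^sub>R (bx s (axis j \<i>) 0)) + xic V *\<^sub>R (bx s 0 1))) = 0"
      by (rule f0) (simp_all add: vec_eq_iff axis_def if_distrib complex_eq_iff cong: if_cong)
    then show ?thesis by (simp add: fs fl')
  qed
  have sw: "(\<Sum>x\<in>UNIV. h x * cnj (axis i a $ x) * t x) = h i * cnj a * t i" for h t and i :: 'n and a :: complex
    by (simp add: axis_def if_distrib if_distribR cong: if_cong)
  have key: "(\<Sum>k<m. r k *\<^sub>R f (Z k) B) = f W B" if "W \<in> l_filt s 1" "\<And>k. k < m \<Longrightarrow> killing W (X k) = r k" for r W B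
    using arg_cong[OF dual_expand[OF sig db that(1)], of "\<lambda>x. f x B"] that(2) by (simp add: fl fs)
  have kl: "killing (by' s y \<eta>) (X k) = - N * Re (ip s y (xc (X k))) - (N / 2) * \<eta> * xic (X k)" if "k < m" for y \<eta> k
    by (simp add: killing_l1[OF sig by_filt[OF sig] XZ[OF that]] N_def algebra_simps)
  have k1: "(\<Sum>k<m. Re (xc (X k) $ j) *\<^sub>R f (Z k) B) = f (by' s (axis j (of_real (- s j / N))) 0) B" for j B
    by (rule key[OF by_filt[OF sig]]) (use N0 in \<open>simp only: kl ip_axis_dual[OF sig], simp\<close>)
  have k2: "(\<Sum>k<m. Im (xc (X k) $ j) *\<^sub>R f (Z k) B) = f (by' s (axis j (of_real (- s j / N) * \<i>)) 0) B" for j B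
    by (rule key[OF by_filt[OF sig]]) (use N0 in \<open>simp only: kl ip_axis_dual[OF sig], simp\<close>)
  have ip0: "ip s 0 v = 0" for v by (simp add: ip_def)
  have k3: "(\<Sum>k<m. xic (X k) *\<^sub>R f (Z k) B) = f (by' s 0 (- 2 / N)) B" for B
    by (rule key[OF by_filt[OF sig]]) (use N0 in \<open>simp add: kl ip0\<close>)
  have "(\<Sum>k<m. f (Z k) (X k)) = (\<Sum>k<m. (\<Sum>j\<in>UNIV. Re (xc (X k) $ j) *\<^sub>R f (Z k) (bx s (axis j 1) 0) + Im (xc (X k) $ j) *\<^sub>R f (Z k) (bx s (axis j \<i>) 0))
       + xic (X k) *\<^sub>R f (Z k) (bx s 0 1))"
    by (rule sum.cong[OF refl]) (rule ex)
  also have "\<dots> = (\<Sum>j\<in>UNIV. (\<Sum>k<m. Re (xc (X k) $ j) *\<^sub>R f (Z k) (bx s (axis j 1) 0)) + (\<Sum>k<m. Im (xc (X k) $ j) *\<^sub>R f (Z k) (bx s (axis j \<i>) 0)))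
       + (\<Sum>k<m. xic (X k) *\<^sub>R f (Z k) (bx s 0 1))"
    unfolding sum.distrib by (simp add: sum.swap[of _ "{..<m}"])
  also have "\<dots> = canon s f"
    unfolding k1 k2 k3 canon_def Let_def N_def[symmetric] ..
  finally show ?thesis .
qed


lemma sum_UNIV_sum: "(\<Sum>i\<in>(UNIV::('a::finite+'b::finite) set). f i) = (\<Sum>i\<in>UNIV. f (Inl i)) + (\<Sum>i\<in>UNIV. f (Inr i))"
  by (simp only: UNIV_Plus_UNIV[symmetric] Plus_def) (subst sum.union_disjoint, auto simp: sum.reindex)

lemma dual_bases_exist:
  fixes s :: "'n::finite \<Rightarrow> real"
  assumes sig: "signature s p q"
  shows "\<exists>m X Z. dual_bases s m X Z"
proof -
  define N where "N = real (4 * (CARD('n) + 2))"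
  have N0: "N > 0" by (simp add: N_def)
  define X0 :: "unit + 'n + 'n \<Rightarrow> 'n lmatrix" where "X0 i = (case i of Inl _ \<Rightarrow> bx s 0 1 | Inr (Inl j) \<Rightarrow> bx s (axis j 1) 0
      | Inr (Inr j) \<Rightarrow> bx s (axis j \<i>) 0)" for i
  define Z0 :: "unit + 'n + 'n \<Rightarrow> 'n lmatrix" where "Z0 i = (case i of Inl _ \<Rightarrow> by' s 0 (- 2 / N) | Inr (Inl j) \<Rightarrow> by' s (axis j (of_real (- s j / N))) 0
      | Inr (Inr j) \<Rightarrow> by' s (axis j (of_real (- s j / N) * \<i>)) 0)" for i
  have X0s: "X0 (Inl ()) = bx s 0 1" "\<And>j. X0 (Inr (Inl j)) = bx s (axis j 1) 0" "\<And>j. X0 (Inr (Inr j)) = bx s (axis j \<i>) 0"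
     "Z0 (Inl ()) = by' s 0 (- 2 / N)" "\<And>j. Z0 (Inr (Inl j)) = by' s (axis j (of_real (- s j / N))) 0"
     "\<And>j. Z0 (Inr (Inr j)) = by' s (axis j (of_real (- s j / N) * \<i>)) 0"
    by (simp_all add: X0_def Z0_def)
  have kl: "killing (by' s y \<eta>) (bx s x \<xi>) = - N * Re (ip s y x) - (N / 2) * \<eta> * \<xi>" for x y \<eta> \<xi>
    by (simp add: killing_l1[OF sig by_filt[OF sig]] N_def algebra_simps)
  have ip0: "ip s 0 v = 0" "ip s v 0 = 0" for v by (simp_all add: ip_def)
  have K0: "killing (Z0 i) (X0 j) = (if i = j then 1 else 0)" for i j
  proof -
    have "\<forall>i j. killing (Z0 i) (X0 j) = (if i = j then 1 else 0)"
      unfolding all_sum_type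
    proof (intro conjI allI)
      fix u u' :: unit and i j :: 'n
      have u: "u = ()" "u' = ()" by simp_all
      show "killing (Z0 (Inl u)) (X0 (Inl u')) = (if Inl u = (Inl u' :: unit + 'n + 'n) then 1 else 0)"
        unfolding u X0s kl ip0 using N0 by simp
      show "killing (Z0 (Inl u)) (X0 (Inr (Inl j))) = (if Inl u = (Inr (Inl j) :: unit + 'n + 'n) then 1 else 0)"
        "killing (Z0 (Inl u)) (X0 (Inr (Inr j))) = (if Inl u = (Inr (Inr j) :: unit + 'n + 'n) then 1 else 0)"
        "killing (Z0 (Inr (Inl i))) (X0 (Inl u)) = (if Inr (Inl i) = (Inl u :: unit + 'n + 'n) then 1 else 0)"
        "killing (Z0 (Inr (Inr i))) (X0 (Inl u)) = (if Inr (Inr i) = (Inl u :: unit + 'n + 'n) then 1 else 0)"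
        unfolding u X0s kl ip0 by simp_all
      show "killing (Z0 (Inr (Inl i))) (X0 (Inr (Inl j))) = (if Inr (Inl i) = (Inr (Inl j) :: unit + 'n + 'n) then 1 else 0)"
        "killing (Z0 (Inr (Inl i))) (X0 (Inr (Inr j))) = (if Inr (Inl i) = (Inr (Inr j) :: unit + 'n + 'n) then 1 else 0)"
        "killing (Z0 (Inr (Inr i))) (X0 (Inr (Inl j))) = (if Inr (Inr i) = (Inr (Inl j) :: unit + 'n + 'n) then 1 else 0)"
        "killing (Z0 (Inr (Inr i))) (X0 (Inr (Inr j))) = (if Inr (Inr i) = (Inr (Inr j) :: unit + 'n + 'n) then 1 else 0)"
        unfolding X0s kl ip_axis_dual[OF sig] using N0 by (auto simp: axis_def)
    qed
    then show ?thesis by blast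
  qed
  obtain h where h: "bij_betw h {..<CARD(unit + 'n + 'n)} (UNIV::(unit + 'n + 'n) set)"
    using ex_bij_betw_nat_finite[of "UNIV::(unit + 'n + 'n) set"] by (auto simp: atLeast0LessThan)
  define m where "m = CARD(unit + 'n + 'n)"
  have hm: "bij_betw h {..<m} UNIV" using h by (simp add: m_def)
  have X0l: "X0 i \<in> l_alg s" "Z0 i \<in> l_filt s 1" for i
    by (auto simp: X0_def Z0_def by_filt[OF sig] split: sum.splits)
  have "dual_bases s m (X0 \<circ> h) (Z0 \<circ> h)"
    unfolding dual_bases_def
  proof (intro conjI allI impI ballI)
    fix V assume V: "V \<in> l_alg s"
    define r where "r i = (case i of Inl _ \<Rightarrow> xic V | Inr (Inl j) \<Rightarrow> Re (xc V $ j) | Inr (Inr j) \<Rightarrow> Im (xc V $ j))" for i :: "unit + 'n + 'n"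
    define W where "W = (\<Sum>i\<in>UNIV. r i *\<^sub>R X0 i)"
    have W: "W = xic V *\<^sub>R bx s 0 1 + ((\<Sum>j\<in>UNIV. Re (xc V $ j) *\<^sub>R bx s (axis j 1) 0) + (\<Sum>j\<in>UNIV. Im (xc V $ j) *\<^sub>R bx s (axis j \<i>) 0))"
      unfolding W_def sum_UNIV_sum by (simp add: X0s r_def UNIV_unit)
    have "W \<in> l_alg s" unfolding W_def by (intro l_alg_sum l_alg_linear X0l)
    then have "V - W \<in> l_alg s" by (intro l_alg_linear V)
    moreover have "xc (V - W) = 0" "xic (V - W) = 0"
      unfolding W by (simp_all add: vec_eq_iff axis_def if_distrib complex_eq_iff cong: if_cong)
    ultimately have "V - W \<in> p_alg s" by (simp add: p_alg_iff[OF sig])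
    moreover have "W = (\<Sum>k<m. (r \<circ> h) k *\<^sub>R (X0 \<circ> h) k)"
      unfolding W_def using sum.reindex_bij_betw[OF hm, of "\<lambda>i. r i *\<^sub>R X0 i"] by simp
    ultimately show "\<exists>r. V - (\<Sum>k<m. r k *\<^sub>R (X0 \<circ> h) k) \<in> p_alg s" by auto
  next
    fix j k assume "j < m" "k < m"
    then have "h j = h k \<longleftrightarrow> j = k" using hm by (auto simp: bij_betw_def inj_on_def)
    then show "killing ((Z0 \<circ> h) j) ((X0 \<circ> h) k) = (if j = k then 1 else 0)" by (simp add: K0)
  qed (simp_all add: X0l)
  then show ?thesis by blast
qed

lemma kA_contract:
  fixes s :: "'n::finite \<Rightarrow> real"
  assumes sig: "signature s p q"
  shows "(\<Sum>j\<in>UNIV. kA s p1 p2 p3 p4 p5 v (axis j 1) *v axis j (of_real (- s j / N))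
            + kA s p1 p2 p3 p4 p5 v (axis j \<i>) *v axis j (of_real (- s j / N) * \<i>)) $ i
     = - ((2 * p2 - 2 * of_nat CARD('n) * p1 - p5) * v $ i + (2 - 2 * of_nat CARD('n)) * p4 * cnj (v $ i)) / of_real N"
proof -
  have ax: "(A *v axis j a) $ i = A $ i $ j * a" for A :: "complex^'n^'n" and i j a
    by (simp add: matrix_vector_nth axis_def if_distrib cong: if_cong)
  have ss: "complex_of_real (s j) * of_real (s j) = 1" for j
    using s_square[OF sig, of j] by (metis of_real_1 of_real_mult)
  have ReIm: "complex_of_real (Im (of_real r * cnj w)) = - of_real r * of_real (Im w)"
     "complex_of_real (Im (of_real r * cnj w * \<i>)) = of_real r * of_real (Re w)" for r w
    by simp_all
  have t: "(kA s p1 p2 p3 p4 p5 v (axis j 1) *v axis j (of_real (- s j / N))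
            + kA s p1 p2 p3 p4 p5 v (axis j \<i>) *v axis j (of_real (- s j / N) * \<i>)) $ i =
      - (1 / of_real N) * ((if i = j then (2 * p2 - p5) * v $ i + 2 * p4 * cnj (v $ i) else 0) - 2 * p1 * v $ i - 2 * p4 * cnj (v $ i))" for j
  proof -
    have e: "kA s p1 p2 p3 p4 p5 v (axis j 1) $ i $ j * of_real (s j) + kA s p1 p2 p3 p4 p5 v (axis j \<i>) $ i $ j * of_real (s j) * \<i> =
       ((if i = j then (2 * p2 - p5) * v $ i + 2 * p4 * cnj (v $ i) else 0) - 2 * p1 * v $ i - 2 * p4 * cnj (v $ i))"
    proof (cases "i = j")
      case True
      have "v $ j = of_real (Re (v $ j)) + \<i> * of_real (Im (v $ j))" by (simp add: complex_eq_iff)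
      then have vI: "\<i> * of_real (Re (v $ j)) - of_real (Im (v $ j)) = \<i> * v $ j" by (simp add: complex_eq_iff)
      have "kA s p1 p2 p3 p4 p5 v (axis j 1) $ i $ j * of_real (s j) + kA s p1 p2 p3 p4 p5 v (axis j \<i>) $ i $ j * of_real (s j) * \<i> =
         (of_real (s j) * of_real (s j)) * (2 * p2 * v $ j - 2 * p1 * v $ j + p5 * \<i> * (\<i> * of_real (Re (v $ j)) - of_real (Im (v $ j))))"
        unfolding kA_nth ip_axis True ReIm mult_1_right by (simp add: algebra_simps)
      then show ?thesis unfolding ss vI using True by (simp add: algebra_simps)
    next
      case False
      have "kA s p1 p2 p3 p4 p5 v (axis j 1) $ i $ j * of_real (s j) + kA s p1 p2 p3 p4 p5 v (axis j \<i>) $ i $ j * of_real (s j) * \<i> =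
         (of_real (s j) * of_real (s j)) * (- 2 * p1 * v $ i - 2 * p4 * cnj (v $ i))"
        unfolding kA_nth using False by (simp add: axis_def algebra_simps)
      then show ?thesis unfolding ss using False by (simp add: algebra_simps)
    qed
    show ?thesis
      unfolding vector_add_component ax e[symmetric] by (simp add: field_simps add_divide_distrib)
  qed
  show ?thesis
    unfolding sum_component t sum_distrib_left[symmetric] sum_subtractf
    by (simp add: field_simps) (simp only: minus_divide_left minus_diff_eq)
qed

context ext_data begin

definition fV :: "'n lmatrix \<Rightarrow> 'n lmatrix \<Rightarrow> 'n lmatrix \<Rightarrow> 'n lmatrix" where
  "fV V Z X = KK (xc (bracket Z V)) (xic (bracket Z V)) (xc X) (xic X) - 2 *\<^sub>R bracket Z (KK (xc V) (xic V) (xc X) (xic X))"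

lemma KK_0: "KK x \<xi> 0 0 = 0"
  using KK_linear(4)[where r=0] by simp

lemma fV_0: "xc X = 0 \<Longrightarrow> xic X = 0 \<Longrightarrow> fV V Z X = 0"
  by (simp add: fV_def KK_0) (simp add: bracket_def)

lemma fV_bilinear: "bilinear (fV V)"
  unfolding bilinear_def
  by (intro conjI allI linearI)
     (simp_all add: fV_def bracket_linear KK_linear scaleR_diff_right scaleR_add_right algebra_simps)

lemma normal_iff_canon:
  assumes ag: "\<forall>X\<in>g_alg c s. \<alpha> X = \<alpha>0 X"
  shows "normal c s \<alpha> \<longleftrightarrow> (\<forall>V\<in>l_alg s. canon s (fV V) = 0)"
proof -
  have eq: "(\<Sum>k<m. curv c s \<alpha> (bracket (Z k) V) (X k)) - 2 *\<^sub>R (\<Sum>k<m. bracket (Z k) (curv c s \<alpha> V (X k))) = canon s (fV V)"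
    if db: "dual_bases s m X Z" and V: "V \<in> l_alg s" for m X Z V
  proof -
    have XZ: "X k \<in> l_alg s" "Z k \<in> l_alg s" if "k < m" for k
    proof -
      have "X k \<in> l_alg s \<and> Z k \<in> l_filt s 1" using db that by (simp only: dual_bases_def)
      then show "X k \<in> l_alg s" "Z k \<in> l_alg s" by (simp_all only: l_filt_1_iff[OF sig])
    qed
    have "(\<Sum>k<m. curv c s \<alpha> (bracket (Z k) V) (X k)) - 2 *\<^sub>R (\<Sum>k<m. bracket (Z k) (curv c s \<alpha> V (X k)))
       = (\<Sum>k<m. fV V (Z k) (X k))"
      unfolding scaleR_right.sum sum_subtractf[symmetric] fV_def
      by (rule sum.cong[OF refl]) (simp add: curv_KK[OF ag] XZ V l_alg_bracket)
    also have "\<dots> = canon s (fV V)" by (rule dual_sum[OF sig db fV_bilinear fV_0])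
    finally show ?thesis .
  qed
  obtain m X Z where db: "dual_bases s m X Z" using dual_bases_exist[OF sig] by blast
  show ?thesis
  proof
    assume n: "normal c s \<alpha>"
    show "\<forall>V\<in>l_alg s. canon s (fV V) = 0"
    proof
      fix V assume V: "V \<in> l_alg s"
      have "(\<Sum>k<m. curv c s \<alpha> (bracket (Z k) V) (X k)) = 2 *\<^sub>R (\<Sum>k<m. bracket (Z k) (curv c s \<alpha> V (X k)))"
        using n db V unfolding normal_def by blast
      then show "canon s (fV V) = 0" unfolding eq[OF db V, symmetric] by simp
    qed
  next
    assume n: "\<forall>V\<in>l_alg s. canon s (fV V) = 0"
    show "normal c s \<alpha>"
      unfolding normal_def
    proof (intro allI impI ballI)
      fix m X Z V assume db: "dual_bases s m X Z" and V: "V \<in> l_alg s"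
      have "canon s (fV V) = 0" using n V by blast
      then show "(\<Sum>k<m. curv c s \<alpha> (bracket (Z k) V) (X k)) = 2 *\<^sub>R (\<Sum>k<m. bracket (Z k) (curv c s \<alpha> V (X k)))"
        unfolding eq[OF db V, symmetric] by simp
    qed
  qed
qed

lemma fV_coords:
  assumes V: "V \<in> l_alg s"
  defines "K \<equiv> KK (xc V) (xic V)"
  shows 
   "zc (fV V (by' s y \<eta>) (bx s u \<xi>)) = \<zeta> * of_real (Im (ip s ((\<i> * of_real (xic V)) *s y) u)) + 2 * ip s y (xc (K u \<xi>))"
   "xc (fV V (by' s y \<eta>) (bx s u \<xi>)) = rl la1 la2 ((\<xi> / (2 * \<beta>)) *\<^sub>R ((\<i> * of_real (xic V)) *s y))"
   "xic (fV V (by' s y \<eta>) (bx s u \<xi>)) = 0"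
   "etac (fV V (by' s y \<eta>) (bx s u \<xi>)) = \<epsilon> * Im (ip s ((\<i> * of_real (xic V)) *s y) u)
       + 4 * Re (zc (K u \<xi>)) * \<eta> + 4 * Im (ip s y (yc (K u \<xi>)))"
   "yc (fV V (by' s y \<eta>) (bx s u \<xi>)) = rl m1 m2 ((\<xi> / (2 * \<beta>)) *\<^sub>R ((\<i> * of_real (xic V)) *s y))
       + 2 *\<^sub>R (cnj (zc (K u \<xi>)) *s y + (\<i> * of_real \<eta>) *s xc (K u \<xi>) + Ac (K u \<xi>) *v y)"
   "Ac (fV V (by' s y \<eta>) (bx s u \<xi>)) = kA s (of_real p1) (of_real p2) (cnj p4) p4 (of_real p5) ((\<i> * of_real (xic V)) *s y) u
       - 2 *\<^sub>R (op s (xc (K u \<xi>)) y - op s y (xc (K u \<xi>)))"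
proof -
  have B: "by' s y \<eta> \<in> u_alg s" and V': "V \<in> u_alg s" and K: "K u \<xi> \<in> u_alg s"
    using by_coords(7) V KK_l_alg unfolding l_alg_def K_def by blast+
  have ip0: "ip s 0 v = 0" "ip s v 0 = 0" for v by (simp_all add: ip_def)
  have c1: "xc (bracket (by' s y \<eta>) V) = (\<i> * of_real (xic V)) *s y" "xic (bracket (by' s y \<eta>) V) = 0"
    unfolding bracket_coords[OF B V'] by (simp_all add: ip0)
  have Kx: "xic (K u \<xi>) = 0" by (simp add: K_def KK_coords)
  note c2 = bracket_coords[OF B K]
  note f = fV_def lcoords_linear c1 c2 by_coords bx_coords K_def[symmetric] ip0 Kx
  show "zc (fV V (by' s y \<eta>) (bx s u \<xi>)) = \<zeta> * of_real (Im (ip s ((\<i> * of_real (xic V)) *s y) u)) + 2 * ip s y (xc (K u \<xi>))"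
    unfolding f unfolding KK_coords by (simp add: scaleR_conv_of_real)
  show "xc (fV V (by' s y \<eta>) (bx s u \<xi>)) = rl la1 la2 ((\<xi> / (2 * \<beta>)) *\<^sub>R ((\<i> * of_real (xic V)) *s y))"
    unfolding f unfolding KK_coords by (simp add: vec_eq_iff matrix_vector_nth)
  show "xic (fV V (by' s y \<eta>) (bx s u \<xi>)) = 0"
    unfolding f unfolding KK_coords by simp
  show "etac (fV V (by' s y \<eta>) (bx s u \<xi>)) = \<epsilon> * Im (ip s ((\<i> * of_real (xic V)) *s y) u)
       + 4 * Re (zc (K u \<xi>)) * \<eta> + 4 * Im (ip s y (yc (K u \<xi>)))"
    unfolding f unfolding KK_coords by simp
  show "yc (fV V (by' s y \<eta>) (bx s u \<xi>)) = rl m1 m2 ((\<xi> / (2 * \<beta>)) *\<^sub>R ((\<i> * of_real (xic V)) *s y))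
       + 2 *\<^sub>R (cnj (zc (K u \<xi>)) *s y + (\<i> * of_real \<eta>) *s xc (K u \<xi>) + Ac (K u \<xi>) *v y)"
    unfolding f unfolding KK_coords(4) by (simp add: vec_eq_iff matrix_vector_nth scaleR_conv_of_real[where 'a=complex] algebra_simps)
  show "Ac (fV V (by' s y \<eta>) (bx s u \<xi>)) = kA s (of_real p1) (of_real p2) (cnj p4) p4 (of_real p5) ((\<i> * of_real (xic V)) *s y) u
       - 2 *\<^sub>R (op s (xc (K u \<xi>)) y - op s y (xc (K u \<xi>)))"
    unfolding f unfolding KK_coords(3) by (simp add: vec_eq_iff matrix_mult_nth)
qed

end

lemma ip_smult: "ip s (a *s y) u = cnj a * ip s y u"
  by (simp add: ip_def sum_distrib_left algebra_simps)

lemma ip_zero [simp]: "ip s 0 v = 0" "ip s v 0 = 0" by (simp_all add: ip_def)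

lemma yc_alg: "2 * (cz * (- \<i> * v / N) + - ((2 * p2 - 2 * nn * p1 - p5) * v + (2 - 2 * nn) * p4 * cv) / N) + (- 2 / N) * ((\<i> / b) * (la1 * v + la2 * cv))
   = (- 2 / N) * ((\<i> * cz - 2 * nn * p1 + 2 * p2 - p5 + \<i> * la1 / b) * v + ((2 - 2 * nn) * p4 + \<i> * la2 / b) * (cv::complex))"
proof -
  define h g where "h = inverse N" and "g = inverse b"
  show ?thesis unfolding divide_inverse h_def[symmetric] g_def[symmetric] by (simp add: algebra_simps)
qed

lemma sum_component_alg:
  fixes w1 w2 M1 M2 :: "'m::finite \<Rightarrow> complex^'n"
  shows "((\<Sum>j\<in>UNIV. 2 *\<^sub>R (a *s w1 j + M1 j) + 2 *\<^sub>R (a *s w2 j + M2 j)) + c *s (b *s z)) $ i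
   = 2 * (a * ((\<Sum>j\<in>UNIV. w1 j + w2 j) $ i) + (\<Sum>j\<in>UNIV. M1 j + M2 j) $ i) + c * (b * z $ i)"
  by (simp add: sum_component sum.distrib scaleR_conv_of_real[where 'a=complex] ring_distribs sum_distrib_left mult.assoc mult.left_commute)

context ext_data begin

definition "NN = real (4 * (CARD('n) + 2))"

lemma NN0: "NN > 0" by (simp add: NN_def)

lemma canon_zc:
  assumes V: "V \<in> l_alg s"
  shows "zc (canon s (fV V)) = of_real (2 * n * xic V / NN) * (\<zeta> + la1 / of_real \<beta>)"
proof -
  have t: "zc (fV V (by' s (axis j (of_real (- s j / NN))) 0) (bx s (axis j 1) 0)) +
     zc (fV V (by' s (axis j (of_real (- s j / NN) * \<i>)) 0) (bx s (axis j \<i>) 0)) = of_real (2 * xic V / NN) * (\<zeta> + la1 / of_real \<beta>)" for j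
    unfolding fV_coords(1)[OF V] KK_coords ip_smult ip_axis_dual[OF sig]
    using NN0 \<beta>0 by (simp add: scaleR_conv_of_real[where 'a=complex] field_simps)
  have t3: "zc (fV V (by' s 0 (- 2 / NN)) (bx s 0 1)) = 0"
    unfolding fV_coords(1)[OF V] by simp
  show ?thesis
    unfolding canon_def Let_def NN_def[symmetric] lcoords_linear lcoords_sum t t3 by (simp add: n_def)
qed

lemma canon_etac:
  assumes V: "V \<in> l_alg s"
  shows "etac (canon s (fV V)) = (2 * n * xic V / NN) * (\<epsilon> + 2 * Im m1 / \<beta>)"
proof -
  have t: "etac (fV V (by' s (axis j (of_real (- s j / NN))) 0) (bx s (axis j 1) 0)) +
     etac (fV V (by' s (axis j (of_real (- s j / NN) * \<i>)) 0) (bx s (axis j \<i>) 0)) = (2 * xic V / NN) * (\<epsilon> + 2 * Im m1 / \<beta>)" for j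
    unfolding fV_coords(4)[OF V] KK_coords ip_smult ip_axis_dual[OF sig]
    using NN0 \<beta>0 by (simp add: scaleR_conv_of_real[where 'a=complex] field_simps)
  have t3: "etac (fV V (by' s 0 (- 2 / NN)) (bx s 0 1)) = 0"
    unfolding fV_coords(4)[OF V] KK_coords by simp
  show ?thesis
    unfolding canon_def Let_def NN_def[symmetric] lcoords_linear lcoords_sum t t3 by (simp add: n_def)
qed

lemma canon_yc:
  assumes V: "V \<in> l_alg s"
  shows "yc (canon s (fV V)) $ i = of_real (- 2 / NN) *
     ((\<i> * cnj \<zeta> - 2 * of_real n * of_real p1 + 2 * of_real p2 - of_real p5 + \<i> * la1 / of_real \<beta>) * (xc V $ i)
       + ((2 - 2 * of_real n) * p4 + \<i> * la2 / of_real \<beta>) * cnj (xc V $ i))"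
proof -
  define v where "v = xc V"
  define y1 where "y1 j = (axis j (of_real (- s j / NN)) :: complex^'n)" for j
  define y2 where "y2 j = (axis j (of_real (- s j / NN) * \<i>) :: complex^'n)" for j
  let ?kA = "kA s (of_real p1) (of_real p2) (cnj p4) p4 (of_real p5) v"
  have t: "yc (fV V (by' s y 0) (bx s u 0)) = 2 *\<^sub>R (cnj \<zeta> *s (of_real (Im (ip s v u)) *s y) + ?kA u *v y)" for y u
    unfolding fV_coords(5)[OF V] KK_coords v_def by (simp add: vec_eq_iff)
  have t3: "yc (fV V (by' s 0 (- 2 / NN)) (bx s 0 1)) = of_real (- 2 / NN) *s ((\<i> / of_real \<beta>) *s rl la1 la2 v)"
    unfolding fV_coords(5)[OF V] KK_coords v_def
    by (simp add: vec_eq_iff matrix_vector_nth scaleR_conv_of_real[where 'a=complex] algebra_simps)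
  have im: "(\<Sum>j\<in>UNIV. (of_real (Im (ip s v (axis j 1))) *s y1 j + of_real (Im (ip s v (axis j \<i>))) *s y2 j)) $ i = - \<i> * v $ i / of_real NN"
  proof -
    have ss: "s j * s j = 1" for j by (rule s_square[OF sig])
    have "(of_real (Im (ip s v (axis j 1))) *s y1 j + of_real (Im (ip s v (axis j \<i>))) *s y2 j) $ i = (if i = j then - \<i> * v $ i / of_real NN else 0)" for j
    proof -
      have "of_real (Im (ip s v (axis j 1))) * of_real (- s j / NN) + of_real (Im (ip s v (axis j \<i>))) * (of_real (- s j / NN) * \<i>)
          = of_real (s j * s j) * (complex_of_real (Im (v $ j)) - \<i> * of_real (Re (v $ j))) / of_real NN"
        unfolding ip_axis by (simp add: diff_divide_distrib algebra_simps)
      also have "complex_of_real (Im (v $ j)) - \<i> * of_real (Re (v $ j)) = - \<i> * v $ j" by (simp add: complex_eq_iff)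
      finally show ?thesis unfolding ss y1_def y2_def by (auto simp: axis_def)
    qed
    then show ?thesis by (simp add: sum_component)
  qed
  have "yc (canon s (fV V)) = (\<Sum>j\<in>UNIV. 2 *\<^sub>R (cnj \<zeta> *s (of_real (Im (ip s v (axis j 1))) *s y1 j) + ?kA (axis j 1) *v y1 j)
      + 2 *\<^sub>R (cnj \<zeta> *s (of_real (Im (ip s v (axis j \<i>))) *s y2 j) + ?kA (axis j \<i>) *v y2 j))
     + of_real (- 2 / NN) *s ((\<i> / of_real \<beta>) *s rl la1 la2 v)"
    unfolding canon_def Let_def NN_def[symmetric] lcoords_linear lcoords_sum t t3 y1_def y2_def ..
  then have "yc (canon s (fV V)) $ i = 2 * (cnj \<zeta> * ((\<Sum>j\<in>UNIV. (of_real (Im (ip s v (axis j 1))) *s y1 j + of_real (Im (ip s v (axis j \<i>))) *s y2 j)) $ i)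
        + (\<Sum>j\<in>UNIV. ?kA (axis j 1) *v y1 j + ?kA (axis j \<i>) *v y2 j) $ i) + of_real (- 2 / NN) * ((\<i> / of_real \<beta>) * rl la1 la2 v $ i)"
    by (simp only: sum_component_alg)
  then have "yc (canon s (fV V)) $ i = 2 * (cnj \<zeta> * (- \<i> * v $ i / of_real NN) + - ((2 * of_real p2 - 2 * of_real n * of_real p1 - of_real p5) * v $ i
     + (2 - 2 * of_real n) * p4 * cnj (v $ i)) / of_real NN) + (- 2 / of_real NN) * ((\<i> / of_real \<beta>) * (la1 * v $ i + la2 * cnj (v $ i)))"
  proof -
    have nn: "of_nat CARD('n) = complex_of_real n" by (simp add: n_def)
    have hN: "complex_of_real (- 2 / NN) = - 2 / of_real NN" by simp
    assume "yc (canon s (fV V)) $ i = 2 * (cnj \<zeta> * ((\<Sum>j\<in>UNIV. (of_real (Im (ip s v (axis j 1))) *s y1 j + of_real (Im (ip s v (axis j \<i>))) *s y2 j)) $ i)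
        + (\<Sum>j\<in>UNIV. ?kA (axis j 1) *v y1 j + ?kA (axis j \<i>) *v y2 j) $ i) + of_real (- 2 / NN) * ((\<i> / of_real \<beta>) * rl la1 la2 v $ i)"
    then show ?thesis
      unfolding im unfolding y1_def y2_def kA_contract[OF sig] nn hN rl_nth .
  qed
  then have "yc (canon s (fV V)) $ i = of_real (- 2 / NN) *
     ((\<i> * cnj \<zeta> - 2 * of_real n * of_real p1 + 2 * of_real p2 - of_real p5 + \<i> * la1 / of_real \<beta>) * (v $ i)
       + ((2 - 2 * of_real n) * p4 + \<i> * la2 / of_real \<beta>) * cnj (v $ i))"
    unfolding yc_alg of_real_divide of_real_minus of_real_numeral .
  then show ?thesis unfolding v_def .
qed

text \<open>normal form of coefficients\<close>

definition ncond :: bool where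
  "ncond \<longleftrightarrow> Im c1 = - n * \<sigma> / (2 * (n + 1)) \<and> Im \<mu> = Re c1 / (2 * \<beta>) \<and> Re \<mu> = - n * \<sigma> / (4 * \<beta> * (n + 1))
     \<and> \<nu> = \<i> * k / (2 * of_real \<beta>) \<and> \<epsilon> + 2 * Im m1 / \<beta> = 0"

lemma la2_p4: "la2 = 2 * \<i> * of_real \<beta> * p4"
  unfolding la2_def p4_def using \<beta>0 by (simp add: field_simps)

lemma vec_gen_l_alg: "bx s v \<xi> \<in> l_alg s" by simp

lemma normal_ncond:
  assumes "\<And>V. V \<in> l_alg s \<Longrightarrow> canon s (fV V) = 0"
  shows ncond
proof -
  have z: "\<zeta> + la1 / of_real \<beta> = 0"
    using canon_zc[OF vec_gen_l_alg[of 0 1]] assms[OF vec_gen_l_alg[of 0 1]] n0 NN0 by simp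
  have e: "\<epsilon> + 2 * Im m1 / \<beta> = 0"
    using canon_etac[OF vec_gen_l_alg[of 0 1]] assms[OF vec_gen_l_alg[of 0 1]] n0 NN0 by simp
  define P where "P = \<i> * cnj \<zeta> - 2 * of_real n * of_real p1 + 2 * of_real p2 - of_real p5 + \<i> * la1 / of_real \<beta>"
  define Q where "Q = (2 - 2 * of_real n) * p4 + \<i> * la2 / of_real \<beta>"
  obtain i0 :: 'n where True by blast
  have PQ: "P * w + Q * cnj w = 0" for w
  proof -
    have "0 = of_real (- 2 / NN) * (P * w + Q * cnj w)"
      using canon_yc[OF vec_gen_l_alg[of "\<chi> i. w" 0], of i0] unfolding assms[OF vec_gen_l_alg[of "\<chi> i. w" 0]] P_def Q_def
      by simp
    moreover have "complex_of_real (- 2 / NN) \<noteq> 0" using NN0 by simp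
    ultimately show ?thesis using mult_eq_0_iff[of "complex_of_real (- 2 / NN)"] by metis
  qed
  from PQ[of 1] PQ[of \<i>] have "P + Q = 0" "\<i> * (P - Q) = 0" by (simp_all add: algebra_simps)
  then have PQ0: "P = 0" "Q = 0" by auto
  have "Q = - (2 * of_real n) * p4" unfolding Q_def la2_p4 using \<beta>0 by (simp add: algebra_simps)
  then have p40: "p4 = 0" using PQ0 n0 by simp
  then have nu: "\<nu> = \<i> * k / (2 * of_real \<beta>)" unfolding p4_def by simp
  have Re: "Re \<zeta> + Re la1 / \<beta> = 0" and Im: "Im \<zeta> + Im la1 / \<beta> = 0"
    using z by (simp_all add: complex_eq_iff)
  have la: "Re la1 = Re c1 - 2 * \<beta> * Im \<mu>" "Im la1 = Im c1 + 2 * Im c1 / n + 2 * \<beta> * Re \<mu> + \<sigma>"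
    unfolding la1_def \<gamma>_def by simp_all
  have ze: "Re \<zeta> = Re c1 / \<beta> - 2 * Im \<mu>" "Im \<zeta> = Im c1 / \<beta> - 2 * Re \<mu>"
    unfolding \<zeta>_def by simp_all
  have imu: "Im \<mu> = Re c1 / (2 * \<beta>)"
    using Re unfolding la ze using \<beta>0 by (simp add: field_simps)
  have "Im c1 * (2 * n + 2) + n * \<sigma> = 0"
    using Im unfolding la ze using \<beta>0 n0(1) by (simp add: field_simps)
  then have A: "Im c1 * (2 * n + 2) = - n * \<sigma>" by linarith
  have rho: "Im c1 = - n * \<sigma> / (2 * (n + 1))"
    using A n0 by (simp add: field_simps)
  have "Re P = 0" using PQ0 by simp
  then have "Im \<zeta> - 2 * n * p1 + 2 * p2 - p5 - Im la1 / \<beta> = 0"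
    unfolding P_def by simp
  then have "2 * Im \<zeta> - 2 * n * p1 + 2 * p2 - p5 = 0" using Im by linarith
  then have "2 * Im c1 / \<beta> - 4 * Re \<mu> - 4 * n * Re \<mu> - n * \<sigma> / \<beta> + \<sigma> / \<beta> + 2 * Im c1 / (n * \<beta>) = 0"
    unfolding ze p1_def p2_def p5_def by (simp add: algebra_simps)
  then have "(2 * Im c1 - n * \<sigma> + \<sigma> + 2 * Im c1 / n) / \<beta> = 4 * (n + 1) * Re \<mu>"
    by (simp add: algebra_simps add_divide_distrib diff_divide_distrib)
  moreover have "2 * Im c1 + 2 * Im c1 / n = - \<sigma>"
  proof -
    have "2 * Im c1 + 2 * Im c1 / n = Im c1 * (2 * n + 2) / n" using n0(1) by (simp add: field_simps)
    then show ?thesis unfolding A using n0(1) by simp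
  qed
  ultimately have "- n * \<sigma> / \<beta> = 4 * (n + 1) * Re \<mu>" by (simp add: algebra_simps)
  then have "- n * \<sigma> = 4 * (n + 1) * Re \<mu> * \<beta>" by (rule iffD1[OF nonzero_divide_eq_eq[OF \<beta>0]])
  moreover have "n + 1 \<noteq> 0" using n0 by linarith
  ultimately have "Re \<mu> = - n * \<sigma> / (4 * \<beta> * (n + 1))" using \<beta>0 by (simp only: nonzero_eq_divide_eq[of "4 * \<beta> * (n + 1)"]) simp
  then show ?thesis unfolding ncond_def using imu rho nu e by blast
qed

lemma ncond_simps:
  assumes ncond
  shows "\<zeta> = 0" "la1 = 0" "la2 = 0" "p4 = 0" "p1 = \<sigma> / (2 * \<beta>) / (n + 1)" "p5 = \<sigma> / \<beta> / (n + 1)"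
    "m1 = 0" "\<epsilon> = 0" "m2 = of_real (\<sigma> * (n + 2) / (2 * \<beta> * (n + 1))) * k"
    "cmod \<nu> = cmod k / (2 * \<bar>\<beta>\<bar>)"
proof -
  have nc: "Im c1 = - n * \<sigma> / (2 * (n + 1))" "Im \<mu> = Re c1 / (2 * \<beta>)" "Re \<mu> = - n * \<sigma> / (4 * \<beta> * (n + 1))"
     and nu: "\<nu> = \<i> * k / (2 * of_real \<beta>)" and e: "\<epsilon> + 2 * Im m1 / \<beta> = 0"
    using assms unfolding ncond_def by blast+
  have n1: "n + 1 \<noteq> 0" using n0 by linarith
  define g where "g = \<sigma> / (n + 1)"
  have gh: "n * \<sigma> / (n + 1) = \<sigma> - g" unfolding g_def using n1 by (simp add: field_simps)
  have "Im c1 = - (n * \<sigma> / (n + 1)) / 2" "Re \<mu> = - (n * \<sigma> / (n + 1)) / (4 * \<beta>)" unfolding nc by (simp_all add: mult_ac)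
  then have nc': "Im c1 = - (\<sigma> - g) / 2" "Re \<mu> = - (\<sigma> - g) / (4 * \<beta>)" unfolding gh .
  have "2 * Im c1 / n = - (\<sigma> / (n + 1))" 
  proof -
    have "2 * (- n * \<sigma> / (2 * w)) / n = - (\<sigma> / w)" for w using n0 by simp
    then show ?thesis unfolding nc .
  qed
  then have nc2: "2 * Im c1 / n = - g" by (simp add: g_def)
  show z: "\<zeta> = 0"
    unfolding \<zeta>_def complex_eq_iff using \<beta>0 by (simp add: nc(2) nc' field_simps)
  show l1: "la1 = 0"
    unfolding la1_def \<gamma>_def complex_eq_iff nc2 using \<beta>0 by (simp add: nc(2) nc' field_simps)
  show p4: "p4 = 0" unfolding p4_def nu by simp
  show "la2 = 0" unfolding la2_p4 p4 by simp
  have "p1 = g / (2 * \<beta>)" unfolding p1_def nc' using \<beta>0 by (simp add: field_simps)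
  then show "p1 = \<sigma> / (2 * \<beta>) / (n + 1)" unfolding g_def by (simp add: mult_ac)
  have "p5 = - (2 * Im c1 / n) / \<beta>" unfolding p5_def by simp
  then show "p5 = \<sigma> / \<beta> / (n + 1)" unfolding nc2 g_def by (simp add: mult_ac)
  have ga: "\<gamma> = - 2 * \<i> * of_real \<beta> * \<mu> - \<i> * of_real \<sigma>" using l1 unfolding la1_def by algebra
  have gc: "cnj \<gamma> = 2 * \<i> * of_real \<beta> * cnj \<mu> + \<i> * of_real \<sigma>" unfolding ga by simp
  have m1: "m1 = \<i> * of_real (e1 - 2 * \<beta> * (cmod \<mu>)\<^sup>2 + 2 * \<beta> * (cmod \<nu>)\<^sup>2)"
  proof -
    have "\<nu> * cnj k = 2 * \<i> * of_real \<beta> * (k / (2 * of_real \<beta>)) * (cnj k / (2 * of_real \<beta>))"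
      unfolding nu using \<beta>0 by (simp add: field_simps)
    also have "\<dots> = 2 * \<i> * of_real \<beta> * (\<nu> * cnj \<nu>)" unfolding nu by simp
    finally have *: "\<nu> * cnj k = 2 * \<i> * of_real \<beta> * (\<nu> * cnj \<nu>)" .
    show ?thesis unfolding m1_def gc * of_real_add of_real_diff of_real_mult complex_norm_square
      by (simp add: algebra_simps)
  qed
  have ep: "\<epsilon> = Im m1 / \<beta>" unfolding m1 \<epsilon>_def using \<beta>0 by (simp add: field_simps)
  then have "3 * (Im m1 / \<beta>) = 0" using e by simp
  then have im: "Im m1 = 0" using \<beta>0 by simp
  show "\<epsilon> = 0" using ep im by simp
  show "m1 = 0" using im m1 by (simp add: complex_eq_iff)
  have "m2 = k * (of_real (2 * Re \<mu> + \<sigma> / \<beta>))"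
  proof -
    have r: "complex_of_real (2 * Re \<mu> + \<sigma> / \<beta>) = \<mu> + cnj \<mu> + of_real \<sigma> / of_real \<beta>" by (simp add: complex_eq_iff)
    have "m2 = k * (- cnj \<gamma> * \<i> / (2 * of_real \<beta>) + \<mu> - \<i> * of_real \<sigma> * \<i> / (2 * of_real \<beta>))"
      unfolding m2_def nu by (simp add: algebra_simps)
    note this[unfolded gc]
    also have "- (2 * \<i> * of_real \<beta> * cnj \<mu> + \<i> * of_real \<sigma>) * \<i> / (2 * of_real \<beta>) = cnj \<mu> + of_real \<sigma> / (2 * of_real \<beta>)"
      using \<beta>0 by (simp add: algebra_simps add_divide_distrib)
    also have "\<i> * of_real \<sigma> * \<i> / (2 * of_real \<beta>) = - (of_real \<sigma> / (2 * of_real \<beta>))"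
    proof -
      have "\<i> * of_real \<sigma> * \<i> = - complex_of_real \<sigma>" by (simp add: algebra_simps)
      then show ?thesis by (simp only: minus_divide_left)
    qed
    also have "k * (cnj \<mu> + of_real \<sigma> / (2 * of_real \<beta>) + \<mu> - - (of_real \<sigma> / (2 * of_real \<beta>)))
        = k * (\<mu> + cnj \<mu> + (of_real \<sigma> / (2 * of_real \<beta>) + of_real \<sigma> / (2 * of_real \<beta>)))"
      by (simp add: algebra_simps)
    also have "of_real \<sigma> / (2 * of_real \<beta>) + of_real \<sigma> / (2 * of_real \<beta>) = of_real \<sigma> / complex_of_real \<beta>" by simp
    finally show ?thesis unfolding r .
  qed
  also have "2 * Re \<mu> + \<sigma> / \<beta> = \<sigma> * (n + 2) / (2 * \<beta> * (n + 1))"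
  proof -
    have "2 * Re \<mu> + \<sigma> / \<beta> = (\<sigma> + g) / (2 * \<beta>)" unfolding nc' using \<beta>0 by (simp add: field_simps)
    also have "\<sigma> + g = \<sigma> * (n + 2) / (n + 1)" unfolding g_def using n1 by (simp add: field_simps)
    finally show ?thesis by (simp add: mult_ac)
  qed
  finally show "m2 = of_real (\<sigma> * (n + 2) / (2 * \<beta> * (n + 1))) * k" by simp
  show "cmod \<nu> = cmod k / (2 * \<bar>\<beta>\<bar>)" unfolding nu by (simp add: norm_divide norm_mult)
qed

lemma kA_trace_zero:
  assumes "2 * (P1 - P2) + of_nat CARD('n) * P5 = (0::complex)"
  shows "(\<Sum>j\<in>UNIV. kA s P1 P2 0 0 P5 ((\<i> * of_real \<tau>) *s axis j (of_real (- s j / NN))) (axis j 1)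
     + kA s P1 P2 0 0 P5 ((\<i> * of_real \<tau>) *s axis j (of_real (- s j / NN) * \<i>)) (axis j \<i>)) = 0"
proof -
  have ss: "s j * s j = 1" for j by (rule s_square[OF sig])
  have ax: "a *s axis j b = axis j (a * b)" for a b :: complex and j :: 'n
    by (simp add: vec_eq_iff axis_def)
  have "kA s P1 P2 0 0 P5 (axis j (\<i> * of_real \<tau> * of_real (- s j / NN))) (axis j 1) $ i $ l
     + kA s P1 P2 0 0 P5 (axis j (\<i> * of_real \<tau> * (of_real (- s j / NN) * \<i>))) (axis j \<i>) $ i $ l
     = of_real (\<tau> / NN) * (\<i> * ((if i = j \<and> l = j then 4 * (P1 - P2) else 0) + (if i = l then 2 * P5 else 0)))" for i j l
  proof -
    have "Im (ip s ((\<i> * of_real \<tau>) *s axis j (of_real (- s j / NN))) (axis j 1)) = \<tau> / NN"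
       "Im (ip s ((\<i> * of_real \<tau>) *s axis j (of_real (- s j / NN) * \<i>)) (axis j \<i>)) = \<tau> / NN"
      unfolding ip_smult ip_axis_dual[OF sig] by simp_all
    note i1 = this[unfolded ax]
    show ?thesis
    proof (cases "i = j \<and> l = j")
      case True
      then have il: "i = j" "l = j" by simp_all
      have "kA s P1 P2 0 0 P5 (axis j (\<i> * of_real \<tau> * of_real (- s j / NN))) (axis j 1) $ i $ l
         + kA s P1 P2 0 0 P5 (axis j (\<i> * of_real \<tau> * (of_real (- s j / NN) * \<i>))) (axis j \<i>) $ i $ l
        = of_real (s j * s j) * (4 * \<i> * (P1 - P2)) * of_real (\<tau> / NN) + 2 * P5 * \<i> * of_real (\<tau> / NN)"
        unfolding kA_nth i1 il by (simp add: algebra_simps diff_divide_distrib add_divide_distrib)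
      then show ?thesis unfolding ss il by (simp add: algebra_simps)
    next
      case False
      then show ?thesis unfolding kA_nth i1 by (auto simp: axis_def)
    qed
  qed
  then have "(\<Sum>j\<in>UNIV. kA s P1 P2 0 0 P5 ((\<i> * of_real \<tau>) *s axis j (of_real (- s j / NN))) (axis j 1)
     + kA s P1 P2 0 0 P5 ((\<i> * of_real \<tau>) *s axis j (of_real (- s j / NN) * \<i>)) (axis j \<i>)) $ i $ l
    = of_real (\<tau> / NN) * (\<i> * (\<Sum>j\<in>UNIV. (if i = j \<and> l = j then 4 * (P1 - P2) else 0) + (if i = l then 2 * P5 else 0)))" for i l
    by (simp add: ax sum_component sum_distrib_left)
  moreover have "(\<Sum>j\<in>UNIV. (if i = j \<and> l = j then 4 * (P1 - P2) else 0) + (if i = l then 2 * P5 else 0)) = 0" for i l :: 'n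
  proof -
    have "(\<Sum>j\<in>UNIV. (if i = j \<and> l = j then 4 * (P1 - P2) else 0) + (if i = l then 2 * P5 else 0))
       = (if i = l then 2 * (2 * (P1 - P2) + of_nat CARD('n) * P5) else 0)"
      by (cases "i = l") (auto simp: sum.distrib algebra_simps intro!: sum.neutral)
    then show ?thesis using assms by simp
  qed
  ultimately show ?thesis by (simp add: vec_eq_iff)
qed

lemma ncond_canon:
  assumes nc: ncond and V: "V \<in> l_alg s"
  shows "canon s (fV V) = 0"
proof -
  note N = ncond_simps[OF nc]
  have rl0: "rl 0 0 x = 0" for x :: "complex^'n" by (simp add: vec_eq_iff)
  have n1: "n + 1 \<noteq> 0" using n0 by linarith
  have "Ac (canon s (fV V)) = 0"
  proof -
    have "2 * (\<sigma> / (2 * \<beta>) / w - \<sigma> / (2 * \<beta>)) + n * (\<sigma> / \<beta> / w) = ((n + 1) * (\<sigma> / w) - \<sigma>) / \<beta>" for w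
      by (simp add: add_divide_distrib diff_divide_distrib ring_distribs mult_ac)
    then have "2 * (p1 - p2) + n * p5 = ((n + 1) * (\<sigma> / (n + 1)) - \<sigma>) / \<beta>"
      unfolding N p2_def .
    then have r: "2 * (p1 - p2) + n * p5 = 0" using n1 by simp
    have "2 * (of_real p1 - of_real p2) + of_nat CARD('n) * complex_of_real p5 = of_real (2 * (p1 - p2) + n * p5)"
      by (simp add: n_def)
    then have "2 * (of_real p1 - of_real p2) + of_nat CARD('n) * complex_of_real p5 = 0"
      unfolding r by simp
    note kz = kA_trace_zero[OF this]
    have op0: "op s 0 y = 0" "op s y 0 = 0" for y by (simp_all add: vec_eq_iff)
    have kA0: "kA s P1 P2 P3 P4 P5 0 0 = 0" for P1 P2 P3 P4 P5 by (simp add: vec_eq_iff kA_nth)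
    show ?thesis
      unfolding canon_def Let_def NN_def[symmetric] lcoords_linear lcoords_sum fV_coords(6)[OF V] KK_coords N(2-4) rl0 op0
      using kz by (simp add: kA0)
  qed
  moreover have "xc (canon s (fV V)) = 0" "xic (canon s (fV V)) = 0"
    unfolding canon_def Let_def NN_def[symmetric] lcoords_linear lcoords_sum fV_coords(2,3)[OF V] N rl0 by simp_all
  moreover have "zc (canon s (fV V)) = 0" unfolding canon_zc[OF V] N by simp
  moreover have "etac (canon s (fV V)) = 0" unfolding canon_etac[OF V] N by simp
  moreover have "yc (canon s (fV V)) = 0"
  proof -
    have "- 2 * n * (\<sigma> / (2 * \<beta>) / w) + 2 * (\<sigma> / (2 * \<beta>)) - \<sigma> / \<beta> / w = (\<sigma> - (n + 1) * (\<sigma> / w)) / \<beta>" for w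
      by (simp add: add_divide_distrib diff_divide_distrib ring_distribs mult_ac)
    then have "- 2 * n * p1 + 2 * p2 - p5 = (\<sigma> - (n + 1) * (\<sigma> / (n + 1))) / \<beta>"
      unfolding N p2_def .
    then have "- 2 * n * p1 + 2 * p2 - p5 = 0" using n1 by simp
    then have "complex_of_real (- 2 * n * p1 + 2 * p2 - p5) = 0" by simp
    then have "\<i> * cnj 0 - 2 * of_real n * of_real p1 + 2 * of_real p2 - complex_of_real p5 + \<i> * 0 / of_real \<beta> = 0"
      by simp
    then show ?thesis unfolding vec_eq_iff canon_yc[OF V] N(1-4) by simp
  qed
  moreover have "canon s (fV V) \<in> u_alg s"
  proof -
    have "fV V (by' s y \<eta>) (bx s u \<xi>) \<in> l_alg s" for y \<eta> u \<xi>
      unfolding fV_def by (intro l_alg_linear l_alg_bracket by_coords KK_l_alg)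
    then have "canon s (fV V) \<in> l_alg s"
      unfolding canon_def Let_def by (intro l_alg_linear l_alg_sum)
    then show ?thesis by (simp add: l_alg_def)
  qed
  ultimately show ?thesis
    by (intro u_alg_eqI[OF _ u_alg_linear(4)[of s]]) (simp_all only: lcoords_linear)
qed

lemma normal_iff_ncond:
  assumes ag: "\<forall>X\<in>g_alg c s. \<alpha> X = \<alpha>0 X"
  shows "normal c s \<alpha> \<longleftrightarrow> ncond"
  unfolding normal_iff_canon[OF ag] using normal_ncond ncond_canon by blast

end

definition sharp :: "('m \<Rightarrow> real) \<Rightarrow> real^'m^'m \<Rightarrow> real^'m^'m" where
  "sharp d A = diag d ** transpose A ** diag d"

definition pm_one :: "('m \<Rightarrow> real) \<Rightarrow> bool" where "pm_one d \<longleftrightarrow> (\<forall>i. d i * d i = 1)"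

lemma signature_pm: "signature s p q \<Longrightarrow> pm_one s"
  unfolding pm_one_def using s_square by blast

lemma gform_pm: "signature s p q \<Longrightarrow> c = 1 \<or> c = -1 \<Longrightarrow> pm_one (gform c s)"
  unfolding pm_one_def all_gidx gform_simps by (elim disjE) (simp_all only: s_square[of s p q] mult_1 mult_minus1 minus_minus simp_thms)

lemma pm_oneD: "pm_one d \<Longrightarrow> d i * d i = 1"
  unfolding pm_one_def by blast

lemma diag_mult_nth: "(diag d ** A) $ i $ j = d i * A $ i $ j" "(A ** diag d) $ i $ j = A $ i $ j * d j"
  by (simp_all add: matrix_mult_nth diag_nth if_distrib if_distribR cong: if_cong)

lemma diag_sq: assumes "pm_one d" shows "diag d ** diag d = mat 1"
  unfolding vec_eq_iff diag_mult_nth by (simp add: diag_nth mat_nth pm_oneD[OF assms])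

lemma matrix_inv_unique: fixes A B :: "'a::field^'m^'m" assumes "A ** B = mat 1" "B ** A = mat 1" shows "matrix_inv A = B"
proof -
  have "A ** matrix_inv A = mat 1 \<and> matrix_inv A ** A = mat 1"
    unfolding matrix_inv_def by (rule someI[of _ B]) (use assms in blast)
  then have "matrix_inv A ** A = mat 1" ..
  then have "matrix_inv A ** (A ** B) = B" by (simp add: matrix_mul_assoc)
  then show ?thesis using assms by simp
qed

lemma sharp_nth: "sharp d A $ i $ j = d i * A $ j $ i * d j"
  by (simp add: sharp_def diag_mult_nth transpose_def)

lemma sharp_linear: "sharp d (A + B) = sharp d A + sharp d B" "sharp d (A - B) = sharp d A - sharp d B"
   "sharp d (r *\<^sub>R A) = r *\<^sub>R sharp d A"
  by (simp_all add: vec_eq_iff sharp_nth algebra_simps)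

lemma sharp_mult: assumes "pm_one d" shows "sharp d (A ** B) = sharp d B ** sharp d A"
proof -
  have "sharp d B ** sharp d A = diag d ** transpose B ** (diag d ** diag d) ** transpose A ** diag d"
    by (simp add: sharp_def matrix_mul_assoc)
  then show ?thesis by (simp add: diag_sq[OF assms] sharp_def matrix_transpose_mul matrix_mul_assoc)
qed

lemma sharp_sharp: assumes "pm_one d" shows "sharp d (sharp d A) = A"
proof -
  have "d i * (d j * A $ i $ j * d i) * d j = A $ i $ j * (d i * d i) * (d j * d j)" for i j by (simp add: mult_ac)
  then show ?thesis unfolding vec_eq_iff sharp_nth pm_oneD[OF assms] by simp
qed

lemma O_pq_sharp: assumes "pm_one d" shows "A \<in> O_pq d \<longleftrightarrow> sharp d A ** A = mat 1"
proof
  assume "A \<in> O_pq d"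
  then have "diag d ** (transpose A ** diag d ** A) = diag d ** diag d" by (simp add: O_pq_def)
  then show "sharp d A ** A = mat 1" by (simp add: sharp_def matrix_mul_assoc diag_sq[OF assms])
next
  assume a: "sharp d A ** A = mat 1"
  have "transpose A ** diag d ** A = (diag d ** diag d) ** (transpose A ** diag d ** A)"
    by (simp add: diag_sq[OF assms])
  also have "\<dots> = diag d ** (sharp d A ** A)" by (simp add: sharp_def matrix_mul_assoc)
  finally show "A \<in> O_pq d" using a by (simp add: O_pq_def)
qed

lemma so_pq_sharp: assumes "pm_one d" shows "A \<in> so_pq d \<longleftrightarrow> sharp d A = - A"
proof -
  have "A $ j $ i * d j + d i * A $ i $ j = 0 \<longleftrightarrow> d i * A $ j $ i * d j = - A $ i $ j" for i j
  proof -
    have di: "d i * d i = 1" by (rule pm_oneD[OF assms])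
    have "d i * (A $ j $ i * d j + d i * A $ i $ j) = d i * A $ j $ i * d j + (d i * d i) * A $ i $ j"
      by (simp add: algebra_simps)
    then have "d i * (A $ j $ i * d j + d i * A $ i $ j) = d i * A $ j $ i * d j + A $ i $ j" by (simp only: di mult_1)
    moreover have "d i \<noteq> 0" using di by (metis mult_zero_left zero_neq_one)
    ultimately have "A $ j $ i * d j + d i * A $ i $ j = 0 \<longleftrightarrow> d i * A $ j $ i * d j + A $ i $ j = 0"
      by (metis mult_eq_0_iff)
    then show ?thesis by linarith
  qed
  then show ?thesis unfolding so_pq_iff vec_eq_iff sharp_nth by simp
qed

lemma O_pq_inverse: assumes "pm_one d" "A \<in> O_pq d"
  shows "sharp d A ** A = mat 1" "A ** sharp d A = mat 1" "matrix_inv A = sharp d A" "sharp d A \<in> O_pq d" "invertible A"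
proof -
  show 1: "sharp d A ** A = mat 1" using assms O_pq_sharp by blast
  then show 2: "A ** sharp d A = mat 1" using matrix_left_right_inverse by blast
  show "matrix_inv A = sharp d A" using 2 1 by (rule matrix_inv_unique)
  show "sharp d A \<in> O_pq d" unfolding O_pq_sharp[OF assms(1)] sharp_sharp[OF assms(1)] by (rule 2)
  show "invertible A" using 1 2 unfolding invertible_def by blast
qed

lemma O_pq_mult: assumes "pm_one d" "A \<in> O_pq d" "B \<in> O_pq d" shows "A ** B \<in> O_pq d"
proof -
  have "sharp d (A ** B) ** (A ** B) = sharp d B ** (sharp d A ** A) ** B"
    by (simp add: sharp_mult[OF assms(1)] matrix_mul_assoc)
  then show ?thesis using O_pq_inverse[OF assms(1,2)] O_pq_inverse[OF assms(1,3)] by (simp add: O_pq_sharp[OF assms(1)])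
qed

lemma O_pq_one: "mat 1 \<in> O_pq d"
  by (simp add: O_pq_def transpose_mat)

lemma so_pq_conj: assumes "pm_one d" "A \<in> O_pq d" "X \<in> so_pq d" shows "A ** X ** sharp d A \<in> so_pq d"
  using assms by (simp add: so_pq_sharp sharp_mult sharp_sharp matrix_mul_assoc matrix_distribs)

lemma kmat_nth [simp]: 
  "kmat A $ Inl u $ Inl u' = 1" "kmat A $ Inl u $ Inr (Inl u') = 0" "kmat A $ Inl u $ Inr (Inr k) = 0"
  "kmat A $ Inr (Inl u) $ Inl u' = 0" "kmat A $ Inr (Inl u) $ Inr (Inl u') = 1" "kmat A $ Inr (Inl u) $ Inr (Inr k) = 0"
  "kmat A $ Inr (Inr l) $ Inl u' = 0" "kmat A $ Inr (Inr l) $ Inr (Inl u') = 0" "kmat A $ Inr (Inr l) $ Inr (Inr k) = A $ l $ k"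
  by (simp_all add: kmat_def)

lemma iota_nth [simp]: 
  "iota A $ Inl u $ Inl u' = 1" "iota A $ Inl u $ Inr (Inl k) = 0" "iota A $ Inl u $ Inr (Inr u') = 0"
  "iota A $ Inr (Inl l) $ Inl u' = 0" "iota A $ Inr (Inl l) $ Inr (Inl k) = of_real (A $ l $ k)" "iota A $ Inr (Inl l) $ Inr (Inr u') = 0"
  "iota A $ Inr (Inr u) $ Inl u' = 0" "iota A $ Inr (Inr u) $ Inr (Inl k) = 0" "iota A $ Inr (Inr u) $ Inr (Inr u') = 1"
  by (simp_all add: iota_def)

lemma kmat_mult: "kmat A ** kmat B = kmat (A ** B)" and kmat_one: "kmat (mat 1) = mat 1"
  and kmat_transpose: "sharp (gform c s) (kmat A) = gblocks 1 0 0 0 (c*c) 0 0 0 (sharp s A)"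
  by (simp_all add: vec_eq_iff all_gidx matrix_mult_nth sum_gidx mat_nth sharp_nth)

lemma iota_mult: "iota A ** iota B = iota (A ** B)" and iota_one: "iota (mat 1) = mat 1"
  by (simp_all add: vec_eq_iff all_lidx matrix_mult_nth sum_lidx mat_nth)

lemma kmat_inj: "kmat A = kmat B \<Longrightarrow> A = B"
  by (simp add: vec_eq_iff all_gidx)

lemma kmat_inverse: assumes "pm_one s" "A \<in> O_pq s"
  shows "matrix_inv (kmat A) = kmat (sharp s A)" "matrix_inv (iota A) = iota (sharp s A)"
    "kmat (sharp s A) ** kmat A = mat 1" "kmat A ** kmat (sharp s A) = mat 1"
    "iota (sharp s A) ** iota A = mat 1" "iota A ** iota (sharp s A) = mat 1"
  using O_pq_inverse[OF assms] by (auto simp: kmat_mult kmat_one iota_mult iota_one intro!: matrix_inv_unique)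

lemma kmat_G: assumes "signature s p q" "c = 1 \<or> c = -1" "A \<in> O_pq s" shows "kmat A \<in> O_pq (gform c s)"
proof -
  have "sharp (gform c s) (kmat A) = kmat (sharp s A)" unfolding kmat_transpose using assms(2) by (auto simp: kmat_def)
  then show ?thesis unfolding O_pq_sharp[OF gform_pm[OF assms(1,2)]]
    using kmat_inverse[OF signature_pm[OF assms(1)] assms(3)] by simp
qed

text \<open>conjugation by K\<close>

lemma gconj_coords:
  assumes "M \<in> g_alg c s" "signature s p q" "c = 1 \<or> c = -1" "A \<in> O_pq s"
  defines "M' \<equiv> kmat A ** M ** matrix_inv (kmat A)"
  shows "M' \<in> g_alg c s" "ga M' = ga M" "gX M' = cplx A *v gX M" "gA M' = A ** gA M ** sharp s A"
proof -
  note inv = kmat_inverse[OF signature_pm[OF assms(2)] assms(4)]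
  have sh: "sharp (gform c s) (kmat A) = kmat (sharp s A)" unfolding kmat_transpose using assms(3) by (auto simp: kmat_def)
  show "M' \<in> g_alg c s" unfolding M'_def inv g_alg_iff[OF assms(2,3)] sh[symmetric]
    using assms(1)[unfolded g_alg_iff[OF assms(2,3)]] gform_pm[OF assms(2,3)] kmat_G[OF assms(2-4)]
    by (intro so_pq_conj)
  show "ga M' = ga M" "gX M' = cplx A *v gX M" "gA M' = A ** gA M ** sharp s A"
    unfolding M'_def inv gcoords
    by (simp_all add: vec_eq_iff matrix_mult_nth sum_gidx matrix_vector_nth complex_eq_iff)
qed

lemma lconj_coords:
  assumes "M \<in> u_alg s" "pm_one s" "A \<in> O_pq s"
  defines "M' \<equiv> iota A ** M ** matrix_inv (iota A)"
  shows "M' \<in> u_alg s" "zc M' = zc M" "xc M' = cplx A *v xc M" "Ac M' = cplx A ** Ac M ** cplx (sharp s A)" 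
    "yc M' = cplx A *v yc M" "xic M' = xic M" "etac M' = etac M"
proof -
  note inv = kmat_inverse[OF assms(2,3)]
  show "zc M' = zc M" "xc M' = cplx A *v xc M" "Ac M' = cplx A ** Ac M ** cplx (sharp s A)" 
    "yc M' = cplx A *v yc M" "xic M' = xic M" "etac M' = etac M"
    unfolding M'_def inv lcoords
    by (simp_all add: vec_eq_iff matrix_mult_nth sum_lidx matrix_vector_nth)
  have H: "adjoint_mat (iota (sharp s B)) ** herm s = herm s ** iota B" for B
  proof -
    have "complex_of_real (s j * B $ i $ j * s i) * of_real (s j) = of_real (B $ i $ j * s i * (s j * s j))" for i j
      by (simp add: mult_ac)
    then have e: "complex_of_real (s j * B $ i $ j * s i) * of_real (s j) = of_real (s i * B $ i $ j)" for i j
      unfolding pm_oneD[OF assms(2)] by (simp add: mult_ac)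
    show ?thesis
      unfolding vec_eq_iff all_lidx matrix_mult_nth sum_lidx adjoint_mat_def
      using e by (simp add: sharp_nth if_distrib if_distribR del: of_real_mult cong: if_cong) simp
  qed
  have H': "adjoint_mat (iota A) ** herm s = herm s ** iota (sharp s A)"
    using H[of "sharp s A"] unfolding sharp_sharp[OF assms(2)] .
  have "adjoint_mat M ** herm s = - (herm s ** M)" using assms(1) by (simp add: u_alg_def eq_neg_iff_add_eq_0)
  have "adjoint_mat M' ** herm s = adjoint_mat (iota (sharp s A)) ** adjoint_mat M ** (adjoint_mat (iota A) ** herm s)"
    unfolding M'_def inv by (simp add: adjoint_mat_mult matrix_mul_assoc)
  also have "\<dots> = adjoint_mat (iota (sharp s A)) ** (adjoint_mat M ** herm s) ** iota (sharp s A)"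
    unfolding H' by (simp add: matrix_mul_assoc)
  also have "\<dots> = - ((adjoint_mat (iota (sharp s A)) ** herm s) ** M ** iota (sharp s A))"
    unfolding \<open>adjoint_mat M ** herm s = - (herm s ** M)\<close> by (simp add: matrix_distribs matrix_mul_assoc)
  also have "\<dots> = - (herm s ** M')" unfolding H M'_def inv by (simp add: matrix_mul_assoc)
  finally show "M' \<in> u_alg s" by (simp add: u_alg_def)
qed

context ext_data begin

lemma extf_equivariant:
  assumes "A \<in> O_pq s" "M \<in> g_alg c s"
  shows "\<alpha>0 (kmat A ** M ** matrix_inv (kmat A)) = iota A ** \<alpha>0 M ** matrix_inv (iota A)"
proof -
  note pm = signature_pm[OF sig]
  note g = gconj_coords[OF assms(2) sig c assms(1)]
  note l = lconj_coords[OF extf_u_alg[OF assms(2)] pm assms(1)]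
  have "cplx A ** mat r ** cplx (sharp s A) = mat r" for r
  proof -
    have "cplx A ** mat r = mat r ** cplx A"
      by (simp add: vec_eq_iff matrix_mult_nth mat_nth if_distrib if_distribR cong: if_cong)
    then have "cplx A ** mat r ** cplx (sharp s A) = mat r ** cplx (A ** sharp s A)"
      by (simp add: matrix_mul_assoc[symmetric] cplx_linear)
    then show ?thesis using O_pq_inverse[OF pm assms(1)] by (simp add: cplx_linear)
  qed
  then show ?thesis
    by (intro u_alg_eqI[OF extf_u_alg[OF g(1)] l(1)])
      (simp_all only: extf_coords g l xof_cplx y_eq rl_cplx matrix_distribs cplx_linear)
qed

lemma xof_zero: "xx X = 0 \<Longrightarrow> X = 0"
proof -
  assume X: "xx X = 0"
  have "of_real \<beta> * z = cnj b1 * (b1 * z - b2 * \<i> * cnj z) + \<i> * b2 * cnj (b1 * z - b2 * \<i> * cnj z)" for z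
    unfolding \<beta>_def bb_cnj by (simp add: algebra_simps)
  moreover have "b1 * X $ k - b2 * \<i> * cnj (X $ k) = 0" for k using X by (simp add: vec_eq_iff)
  ultimately have "of_real \<beta> * X $ k = 0" for k by (metis add.right_neutral complex_cnj_zero mult_zero_right)
  then show "X = 0" using \<beta>0 by (simp add: vec_eq_iff)
qed

lemma extf_CR_extension:
  assumes ag: "\<forall>X\<in>g_alg c s. \<alpha> X = \<alpha>0 X"
  shows "CR_extension c s \<alpha>"
  unfolding CR_extension_def
proof (intro conjI ballI allI impI)
  fix X assume X: "X \<in> g_alg c s"
  show "\<alpha> X \<in> l_alg s" using ag extf_l_alg[OF sig X] X by simp
  show "\<alpha> (r *\<^sub>R X) = r *\<^sub>R \<alpha> X" for r using ag X g_alg_linear(3)[OF X] by (simp add: extf_scaleR)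
  show "\<alpha> (X + Y) = \<alpha> X + \<alpha> Y" if "Y \<in> g_alg c s" for Y
    using ag X that g_alg_linear(1)[OF X that] by (simp add: extf_add)
  show "\<alpha> (kmat A ** X ** matrix_inv (kmat A)) = iota A ** \<alpha> X ** matrix_inv (iota A)" if "A \<in> O_pq s" for A
    using ag X gconj_coords(1)[OF X sig c that] extf_equivariant[OF that X] by simp
  show "X \<in> k_alg c s" if "\<alpha> X \<in> p_alg s"
  proof -
    have "xx (gX X) = 0" "2 * bb b1 b2 * ga X = 0" using that ag X unfolding p_alg_iff[OF sig] by (auto simp: extf_coords)
    then have "gX X = 0" "ga X = 0" using xof_zero b by auto
    moreover have "gA X \<in> so_pq s" "X = gmat c s (ga X) (\<chi> k. Re (gX X $ k)) (\<chi> k. Im (gX X $ k)) (gA X)"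
      using X unfolding g_alg_iff_coords by blast+
    ultimately have "X = gmat c s 0 0 0 (gA X)" by (metis (no_types, lifting) vec_eq_iff vec_lambda_beta zero_complex.simps zero_index)
    then show ?thesis unfolding k_alg_def using \<open>gA X \<in> so_pq s\<close> by blast
  qed
next
  fix A assume A: "A \<in> so_pq s"
  have "gmat c s 0 0 0 A \<in> g_alg c s" using A unfolding g_alg_def by blast
  moreover have c0: "cvec 0 0 = (0::complex^'n)" by (simp add: vec_eq_iff complex_eq_iff)
  ultimately show "\<alpha> (gmat c s 0 0 0 A) = iota' A"
    using ag by (simp add: extf_def ext_form_lel) (simp add: iota'_def lel_def vec_eq_iff all_lidx mat_nth)
next
  fix Y assume Y: "Y \<in> l_alg s"
  have "\<alpha> (pre (xc Y) (xic Y)) - Y \<in> p_alg s"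
    unfolding p_alg_iff[OF sig] using ag pre_g_alg extf_l_alg[OF sig pre_g_alg] Y \<beta>0
    by (auto simp: extf_coords pre_coords l_alg_linear \<beta>_def[symmetric])
  then show "\<exists>X\<in>g_alg c s. \<alpha> X - Y \<in> p_alg s" using pre_g_alg by blast
qed

lemma rne_iff:
  assumes ag: "\<forall>X\<in>g_alg c s. \<alpha> X = \<alpha>0 X"
  shows "regular_normal_extension c s \<alpha> \<longleftrightarrow> ncond"
  unfolding regular_normal_extension_def
  using extf_CR_extension[OF ag] regular_agree[OF ag] normal_iff_ncond[OF ag] by blast

end

lemma has_coefficients_iff:
  "has_coefficients c s \<alpha> b1 b2 \<longleftrightarrow> bb b1 b2 \<noteq> 0 \<and> (\<exists>c1 d1 d2 e1. \<forall>X\<in>g_alg c s. \<alpha> X = extf s b1 b2 c1 d1 d2 e1 X)"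
proof -
  have "bb b1 b2 \<noteq> 0 \<longleftrightarrow> cmod b1 \<noteq> cmod b2" by (simp add: bb_def)
  moreover have "(\<forall>X\<in>g_alg c s. \<alpha> X = extf s b1 b2 c1 d1 d2 e1 X) \<longleftrightarrow>
    (\<forall>a X1 X2. \<forall>A\<in>so_pq s. \<alpha> (gmat c s a X1 X2 A) = ext_form s b1 b2 c1 d1 d2 e1 a (cvec X1 X2) A)" for c1 d1 d2 e1
    unfolding g_alg_def extf_def by (auto; metis gmat_coords)
  ultimately show ?thesis unfolding has_coefficients_def by blast
qed


definition reflection :: "('n::finite \<Rightarrow> real) \<Rightarrow> real^'n \<Rightarrow> real^'n^'n" where
  "reflection s w = (\<chi> i j. (if i = j then 1 else 0) - 2 / (\<Sum>k\<in>UNIV. s k * (w $ k)\<^sup>2) * w $ i * w $ j * s j)"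

lemma reflection_O_pq:
  fixes s :: "'n::finite \<Rightarrow> real"
  assumes "pm_one s" "(\<Sum>k\<in>UNIV. s k * (w $ k)\<^sup>2) \<noteq> 0"
  shows "reflection s w \<in> O_pq s"
proof -
  define Q where "Q = (\<Sum>k\<in>UNIV. s k * (w $ k)\<^sup>2)"
  define h where "h = 2 / Q"
  have hQ: "h * Q = 2" using assms by (simp add: h_def Q_def)
  have R: "reflection s w = mat 1 - h *\<^sub>R (\<chi> i j. w $ i * w $ j * s j)"
    by (simp add: vec_eq_iff reflection_def mat_nth h_def Q_def)
  define W where "W = (\<chi> i j. w $ i * w $ j * s j)"
  have sW: "sharp s W = W"
  proof -
    have "s i * (w $ j * w $ i * s i) * s j = w $ i * w $ j * s j * (s i * s i)" for i j by (simp add: mult_ac)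
    then show ?thesis by (simp add: vec_eq_iff sharp_nth W_def pm_oneD[OF assms(1)])
  qed
  have s1: "sharp s (mat 1) = mat 1"
    by (simp add: vec_eq_iff sharp_nth mat_nth pm_oneD[OF assms(1)])
  have WW: "W ** W = Q *\<^sub>R W"
    by (simp add: vec_eq_iff matrix_mult_nth W_def Q_def sum_distrib_right sum_distrib_left power2_eq_square mult_ac)
  have "sharp s (reflection s w) ** reflection s w = mat 1 - h *\<^sub>R W - h *\<^sub>R W + (h * (h * Q)) *\<^sub>R W"
    unfolding R W_def[symmetric] sharp_linear s1 sW
    by (simp add: vec_eq_iff matrix_distribs matrix_mult_scaleR WW algebra_simps)
  then have "sharp s (reflection s w) ** reflection s w = mat 1"
    unfolding hQ by (simp add: vec_eq_iff)
  then show ?thesis by (simp add: O_pq_sharp[OF assms(1)])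
qed

lemma cplx_reflection_mult: "(cplx (reflection s w) *v v) $ i
   = v $ i - of_real (2 / (\<Sum>k\<in>UNIV. s k * (w $ k)\<^sup>2)) * (\<Sum>k\<in>UNIV. of_real (s k) * of_real (w $ k) * v $ k) * of_real (w $ i)"
proof -
  define h where "h = 2 / (\<Sum>k\<in>UNIV. s k * (w $ k)\<^sup>2)"
  have "(cplx (reflection s w) *v v) $ i = (\<Sum>k\<in>UNIV. (if i = k then v $ k else 0) - of_real h * (of_real (s k) * of_real (w $ k) * v $ k) * of_real (w $ i))"
    unfolding matrix_vector_nth cplx_nth reflection_def h_def[symmetric] by (rule sum.cong) (auto simp: algebra_simps)
  then show ?thesis unfolding h_def[symmetric] by (simp add: sum_subtractf sum_distrib_left sum_distrib_right)
qed

lemma reflection_self: assumes "(\<Sum>k\<in>UNIV. s k * (w $ k)\<^sup>2) \<noteq> 0" shows "reflection s w *v w = - w"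
proof -
  define Q where "Q = (\<Sum>k\<in>UNIV. s k * (w $ k)\<^sup>2)"
  have "(reflection s w *v w) $ i = - w $ i" for i
  proof -
    have "(reflection s w *v w) $ i = (\<Sum>k\<in>UNIV. (if i = k then w $ k else 0) - (2 / Q * w $ i) * (s k * (w $ k)\<^sup>2))"
      unfolding matrix_vector_nth reflection_def Q_def[symmetric] by (rule sum.cong) (auto simp: algebra_simps power2_eq_square)
    also have "\<dots> = w $ i - (2 / Q * w $ i) * Q" by (simp add: sum_subtractf Q_def sum_distrib_left)
    also have "\<dots> = - w $ i" using assms by (simp add: Q_def[symmetric])
    finally show ?thesis .
  qed
  then show ?thesis by (simp add: vec_eq_iff)
qed

lemma O_pq_commutant:
  fixes f :: "real^'n::finite \<Rightarrow> complex^'n"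
  assumes pm: "pm_one s" and lin: "linear f" and comm: "\<And>A v. A \<in> O_pq s \<Longrightarrow> f (A *v v) = cplx A *v f v"
  shows "\<exists>\<beta>. \<forall>v. f v = (\<chi> k. \<beta> * of_real (v $ k))"
proof -
  have eig: "\<exists>m. \<forall>i. f w $ i = m * of_real (w $ i)" if Q: "(\<Sum>k\<in>UNIV. s k * (w $ k)\<^sup>2) \<noteq> 0" for w
  proof -
    define Q where "Q = (\<Sum>k\<in>UNIV. s k * (w $ k)\<^sup>2)"
    have "reflection s w *v w = - w" by (rule reflection_self[OF Q])
    then have "f (- w) = cplx (reflection s w) *v f w" using comm[OF reflection_O_pq[OF pm Q], of w] by simp
    then have f1: "- f w = cplx (reflection s w) *v f w" using linear_neg[OF lin] by simp
    define L where "L = (\<Sum>k\<in>UNIV. of_real (s k) * of_real (w $ k) * f w $ k)"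
    have "(cplx (reflection s w) *v f w) $ i = f w $ i - of_real (2 / Q) * L * of_real (w $ i)" for i
      unfolding cplx_reflection_mult Q_def[symmetric] L_def ..
    then have "- f w $ i = f w $ i - of_real (2 / Q) * L * of_real (w $ i)" for i
      using f1 by (metis vector_uminus_component)
    then have "f w $ i = (of_real (1 / Q) * L) * of_real (w $ i)" for i
    proof -
      assume a: "\<And>i. - f w $ i = f w $ i - of_real (2 / Q) * L * of_real (w $ i)"
      have "2 * f w $ i = f w $ i - (- f w $ i)" by simp
      also have "\<dots> = of_real (2 / Q) * L * of_real (w $ i)" unfolding a by simp
      also have "\<dots> = 2 * (of_real (1 / Q) * L * of_real (w $ i))" by simp
      finally show ?thesis by (simp only: mult_cancel_left) simp
    qed
    then show ?thesis by blast
  qed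
  have Q1: "(\<Sum>k\<in>UNIV. s k * (axis i 1 $ k)\<^sup>2) \<noteq> 0" for i
  proof -
    have "s k * (axis i 1 $ k)\<^sup>2 = (if k = i then s k else 0)" for k by (simp add: axis_def)
    then have "(\<Sum>k\<in>UNIV. s k * (axis i 1 $ k)\<^sup>2) = s i" by simp
    then show ?thesis using pm_oneD[OF pm, of i] by auto
  qed
  have Q2: "(\<Sum>k\<in>UNIV. s k * ((axis i 1 + 2 *\<^sub>R axis j 1) $ k)\<^sup>2) \<noteq> 0" if "i \<noteq> j" for i j
  proof -
    have "s k * ((axis i 1 + 2 *\<^sub>R axis j 1) $ k)\<^sup>2 = (if k = i then s k else 0) + (if k = j then 4 * s k else 0)" for k
      using that by (simp add: axis_def)
    then have e: "(\<Sum>k\<in>UNIV. s k * ((axis i 1 + 2 *\<^sub>R axis j 1) $ k)\<^sup>2) = s i + 4 * s j"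
      by (simp add: sum.distrib)
    have "\<bar>s i\<bar> = 1" "\<bar>s j\<bar> = 1"
      using pm_oneD[OF pm, of i] pm_oneD[OF pm, of j] by (metis abs_1 abs_mult_self_eq abs_square_eq_1 power2_eq_square)+
    then show ?thesis unfolding e by linarith
  qed
  obtain l where l: "\<And>i k. f (axis i 1) $ k = l i * of_real (axis i 1 $ k)" using eig[OF Q1] by metis
  have same: "l i = l j" for i j
  proof (cases "i = j")
    case False
    obtain m where m: "\<And>k. f (axis i 1 + 2 *\<^sub>R axis j 1) $ k = m * of_real ((axis i 1 + 2 *\<^sub>R axis j 1) $ k)"
      using eig[OF Q2[OF False]] by blast
    have "f (axis i 1 + 2 *\<^sub>R axis j 1) $ k = l i * of_real (axis i 1 $ k) + 2 * (l j * of_real (axis j 1 $ k))" for k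
      unfolding linear_add[OF lin] linear_scale[OF lin] vector_add_component vector_scaleR_component l
      by (simp add: scaleR_conv_of_real[where 'a=complex])
    from this[of i] this[of j] m[of i] m[of j] False show ?thesis by (simp add: axis_def)
  qed simp
  have "f v $ k = l k * of_real (v $ k)" for v k
  proof -
    have "v = (\<Sum>i\<in>UNIV. v $ i *\<^sub>R axis i 1)" by (simp add: vec_eq_iff axis_def if_distrib cong: if_cong)
    then have "f v = (\<Sum>i\<in>UNIV. v $ i *\<^sub>R f (axis i 1))" by (metis (no_types, lifting) linear_sum[OF lin] linear_scale[OF lin] sum.cong)
    then have "f v $ k = (\<Sum>i\<in>UNIV. v $ i *\<^sub>R (l i * of_real (axis i 1 $ k)))"
      by (simp only: sum_component vector_scaleR_component l)
    also have "\<dots> = (\<Sum>i\<in>UNIV. if i = k then l k * of_real (v $ k) else 0)"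
      by (rule sum.cong) (auto simp: axis_def scaleR_conv_of_real[where 'a=complex])
    finally show ?thesis by simp
  qed
  then have "f v $ k = l undefined * of_real (v $ k)" for v k by (simp only: same[of k undefined])
  then have "f v = (\<chi> k. l undefined * of_real (v $ k))" for v by (simp add: vec_eq_iff)
  then show ?thesis by blast
qed

lemma CR_extension_form:
  fixes s :: "'n::finite \<Rightarrow> real"
  assumes sig: "signature s p q" and c: "c = 1 \<or> c = -1" and ext: "CR_extension c s \<alpha>" and reg: "regular c s \<alpha>"
  shows "\<exists>b1 b2 c1 d1 d2 e1. bb b1 b2 \<noteq> 0 \<and> (\<forall>X\<in>g_alg c s. \<alpha> X = extf s b1 b2 c1 d1 d2 e1 X)"
proof -
  note pm = signature_pm[OF sig]
  have gl: "gmat c s a X Y A \<in> g_alg c s" if "A \<in> so_pq s" for a X Y A using that unfolding g_alg_def by blast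
  have z: "0 \<in> so_pq s" by (rule so_pq_linear(4))
  note e = ext[unfolded CR_extension_def]
  note al = e[THEN conjunct1, rule_format]
  note add = e[THEN conjunct2, THEN conjunct1, rule_format]
  note scale = e[THEN conjunct2, THEN conjunct2, THEN conjunct1, rule_format]
  note equi = e[THEN conjunct2, THEN conjunct2, THEN conjunct2, THEN conjunct1, rule_format]
  note onk = e[THEN conjunct2, THEN conjunct2, THEN conjunct2, THEN conjunct2, THEN conjunct1, rule_format]
  note inj = e[THEN conjunct2, THEN conjunct2, THEN conjunct2, THEN conjunct2, THEN conjunct2, THEN conjunct1, rule_format]
  note surj = e[THEN conjunct2, THEN conjunct2, THEN conjunct2, THEN conjunct2, THEN conjunct2, THEN conjunct2, rule_format]
  have au: "\<alpha> X \<in> u_alg s" if "X \<in> g_alg c s" for X using al[OF that] by (simp add: l_alg_def)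
  define F where "F a X1 X2 = \<alpha> (gmat c s a X1 X2 0)" for a X1 X2
  have Fu: "F a X1 X2 \<in> u_alg s" for a X1 X2 unfolding F_def by (intro au gl z)
  have gadd: "gmat c s a X Y A + gmat c s a' X' Y' A' = gmat c s (a+a') (X+X') (Y+Y') (A+A')"
     "r *\<^sub>R gmat c s a X Y A = gmat c s (r*a) (r *\<^sub>R X) (r *\<^sub>R Y) (r *\<^sub>R A)" for a X Y A a' X' Y' A' r
    by (simp_all add: vec_eq_iff all_gidx algebra_simps)
  have Fadd: "F (a + a') (X + X') (Y + Y') = F a X Y + F a' X' Y'" for a a' X X' Y Y'
    unfolding F_def using add[OF gl[OF z] gl[OF z], of a X Y a' X' Y'] by (simp add: gadd)
  have Fsc: "F (r * a) (r *\<^sub>R X) (r *\<^sub>R Y) = r *\<^sub>R F a X Y" for r a X Y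
    unfolding F_def using scale[OF gl[OF z], of r a X Y] by (simp add: gadd)
  have Fall: "\<alpha> (gmat c s a X Y A) = a *\<^sub>R F 1 0 0 + F 0 X 0 + F 0 0 Y + iota' A" if A: "A \<in> so_pq s" for a X Y A
  proof -
    have "\<alpha> (gmat c s a X Y A) = \<alpha> (gmat c s a X Y 0) + \<alpha> (gmat c s 0 0 0 A)"
      using add[OF gl[OF z] gl[OF A], of a X Y 0 0 0] by (simp add: gadd)
    also have "\<alpha> (gmat c s a X Y 0) = F a 0 0 + F 0 X 0 + F 0 0 Y"
      using Fadd[of a 0 0 X 0 0] Fadd[of a 0 X 0 0 Y] by (simp add: F_def)
    finally show ?thesis using Fsc[of a 1 0 0] onk[OF A] by simp
  qed
  have Feq: "F a (A *v X) (A *v Y) = iota A ** F a X Y ** matrix_inv (iota A)" if A: "A \<in> O_pq s" for a A X Y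
  proof -
    have "kmat A ** gmat c s a X Y 0 ** matrix_inv (kmat A) = gmat c s a (A *v X) (A *v Y) 0"
      using gconj_coords[OF gl[OF z, of a X Y] sig c A]
      by (intro g_alg_eqI[OF gconj_coords(1)[OF gl[OF z] sig c A] gl[OF z]])
        (simp_all add: vec_eq_iff matrix_vector_nth complex_eq_iff matrix_mult_nth)
    then show ?thesis unfolding F_def using equi[OF A gl[OF z]] by metis
  qed
  note lc = lconj_coords[OF Fu pm]
  have m1: "mat (-1) \<in> O_pq s" "mat (-1) *v v = - v" "cplx (mat (-1)) = mat (-1)" "sharp s (mat (-1)) = mat (-1)" for v :: "real^'n"
  proof -
    show s: "sharp s (mat (-1)) = mat (-1)" by (simp add: vec_eq_iff sharp_nth mat_nth pm_oneD[OF pm])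
    have "mat (-1) ** mat (-1) = (mat 1 :: real^'n^'n)"
      by (simp add: vec_eq_iff matrix_mult_nth mat_nth if_distrib[of "\<lambda>x. x * _"] if_distribR cong: if_cong)
    then show "mat (-1) \<in> O_pq s" by (simp add: O_pq_sharp[OF pm] s)
    show "mat (-1) *v v = - v" by (simp add: vec_eq_iff matrix_vector_nth mat_nth if_distrib[of "\<lambda>x. x * _"] cong: if_cong)
    show "cplx (mat (-1)) = mat (-1)" by (simp add: vec_eq_iff mat_nth)
  qed
  have mc: "mat (-1) *v v = - v" "mat (-1) ** B ** mat (-1) = B" for v :: "complex^'n" and B :: "complex^'n^'n"
    by (simp_all add: vec_eq_iff matrix_vector_nth matrix_mult_nth mat_nth if_distrib[of "\<lambda>x. x * _"] if_distrib[of "\<lambda>x. _ * x"] cong: if_cong)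
  have par: "F a (- X) (- Y) = iota (mat (-1)) ** F a X Y ** matrix_inv (iota (mat (-1)))" for a X Y
    using Feq[OF m1(1), of a X Y] by (simp only: m1(2))
  have Fneg: "F 0 (- X) (- Y) = - F 0 X Y" for X Y using Fsc[of "-1" 0 X Y] by simp
  have neg: "zc (- M) = - zc M" "Ac (- M) = - Ac M" "xic (- M) = - xic M" "etac (- M) = - etac M" for M :: "'n lmatrix"
    by (simp_all add: lcoords vec_eq_iff)
  have odd: "zc (F 0 X Y) = 0" "Ac (F 0 X Y) = 0" "xic (F 0 X Y) = 0" "etac (F 0 X Y) = 0" for X Y
  proof -
    have self: "x = 0" if "- x = x" for x :: "'b::real_vector" using that by (metis equation_minus_iff neg_equal_iff_equal real_vector.scale_eq_0_iff scaleR_2 add_eq_0_iff zero_neq_numeral)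
    have e: "- F 0 X Y = iota (mat (-1)) ** F 0 X Y ** matrix_inv (iota (mat (-1)))" using par[of 0 X Y] Fneg by metis
    note l = lc[OF m1(1), of 0 X Y, folded e, unfolded neg m1 mc]
    show "zc (F 0 X Y) = 0" by (rule self[OF l(2)])
    show "Ac (F 0 X Y) = 0" by (rule self[OF l(4)])
    show "xic (F 0 X Y) = 0" by (rule self[OF l(6)])
    show "etac (F 0 X Y) = 0" by (rule self[OF l(7)])
  qed
  have even: "xc (F 1 0 0) = 0" "yc (F 1 0 0) = 0"
  proof -
    have self: "x = 0" if "x = - x" for x :: "complex^'n" using that by (simp add: vec_eq_iff)
    have e: "F 1 0 0 = iota (mat (-1)) ** F 1 0 0 ** matrix_inv (iota (mat (-1)))" using par[of 1 0 0] by simp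
    note l = lc[OF m1(1), of 1 0 0, folded e, unfolded m1 mc]
    show "xc (F 1 0 0) = 0" by (rule self[OF l(3)])
    show "yc (F 1 0 0) = 0" by (rule self[OF l(5)])
  qed
  have lin1: "linear (\<lambda>X. xc (F 0 X 0))" "linear (\<lambda>X. yc (F 0 X 0))" "linear (\<lambda>X. xc (F 0 0 X))" "linear (\<lambda>X. yc (F 0 0 X))"
    by (rule linearI; insert Fadd[of 0 0 _ _ 0 0] Fadd[of 0 0 0 0] Fsc[of _ 0 _ 0] Fsc[of _ 0 0]; simp)+
  obtain r1 where r1: "\<And>X. xc (F 0 X 0) = (\<chi> k. r1 * of_real (X $ k))"
    using O_pq_commutant[OF pm lin1(1)] lc(3)[of _ 0] Feq[of _ 0 _ 0] by (metis matrix_vector_mult_0_right)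
  obtain r2 where r2: "\<And>X. yc (F 0 X 0) = (\<chi> k. r2 * of_real (X $ k))"
    using O_pq_commutant[OF pm lin1(2)] lc(5)[of _ 0] Feq[of _ 0 _ 0] by (metis matrix_vector_mult_0_right)
  obtain r3 where r3: "\<And>X. xc (F 0 0 X) = (\<chi> k. r3 * of_real (X $ k))"
    using O_pq_commutant[OF pm lin1(3)] lc(3)[of _ 0] Feq[of _ 0 0 _] by (metis matrix_vector_mult_0_right)
  obtain r4 where r4: "\<And>X. yc (F 0 0 X) = (\<chi> k. r4 * of_real (X $ k))"
    using O_pq_commutant[OF pm lin1(4)] lc(5)[of _ 0] Feq[of _ 0 0 _] by (metis matrix_vector_mult_0_right)
  define T where "T = F 1 0 0"
  have Tl: "T \<in> l_alg s" unfolding T_def F_def by (intro al gl z)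
  obtain r5 where r5: "\<And>v. Ac T *v cvec v 0 = (\<chi> k. r5 * of_real (v $ k))"
  proof -
    have "linear (\<lambda>v. Ac T *v cvec v 0)"
      by (rule linearI) (simp_all add: vec_eq_iff matrix_vector_nth complex_of_real_def[symmetric] complex_eq_iff sum.distrib sum_distrib_left algebra_simps)
    moreover have "Ac T *v cvec (A *v v) 0 = cplx A *v (Ac T *v cvec v 0)" if A: "A \<in> O_pq s" for A v
    proof -
      have e: "T = iota A ** T ** matrix_inv (iota A)" using Feq[OF A, of 1 0 0] by (simp add: T_def)
      have AT: "Ac T = cplx A ** Ac T ** cplx (sharp s A)"
        using lc(4)[OF A, of 1 0 0] e unfolding T_def by simp
      have "cvec (A *v v) 0 = cplx A *v cvec v 0" by (simp add: vec_eq_iff matrix_vector_nth complex_eq_iff)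
      then have "Ac T *v cvec (A *v v) 0 = (cplx A ** Ac T ** (cplx (sharp s A) ** cplx A)) *v cvec v 0"
        by (subst AT) (simp add: matrix_vector_mul_assoc matrix_mul_assoc)
      also have "cplx (sharp s A) ** cplx A = mat 1"
        using O_pq_inverse(1)[OF pm A] by (simp add: cplx_linear flip: cplx_linear(4))
      finally show ?thesis by (simp add: matrix_vector_mul_assoc)
    qed
    ultimately show ?thesis using O_pq_commutant[OF pm] that by blast
  qed
  have AT: "Ac T = mat r5"
  proof -
    have "Ac T $ i $ j = r5 * (if i = j then 1 else 0)" for i j
    proof -
      have "(Ac T *v cvec (axis j 1) 0) $ i = (\<Sum>k\<in>UNIV. if k = j then Ac T $ i $ k else 0)"
        unfolding matrix_vector_nth by (rule sum.cong) (auto simp: axis_def complex_eq_iff)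
      then have "(\<chi> k. r5 * of_real (axis j 1 $ k)) $ i = Ac T $ i $ j" unfolding r5 by simp
      then show ?thesis by (cases "i = j") (simp_all add: axis_def)
    qed
    then show ?thesis by (simp add: vec_eq_iff mat_nth)
  qed
  define c1 where "c1 = zc T"
  have "c1 - cnj c1 + of_nat CARD('n) * r5 = 0"
    using Tl trace_u_alg[of T s] unfolding l_alg_def c1_def by (simp add: AT trace_def mat_nth)
  moreover have "c1 - cnj c1 = 2 * \<i> * of_real (Im c1)" by (simp add: complex_eq_iff)
  ultimately have "of_nat CARD('n) * r5 = - (2 * \<i> * of_real (Im c1))" by (metis add.commute add_eq_0_iff)
  moreover have "r5 = (of_nat CARD('n) * r5) / of_nat CARD('n)" by simp
  ultimately have "r5 = - (2 * \<i> * of_real (Im c1)) / of_nat CARD('n)" by (simp only:)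
  then have r5': "r5 = - (of_real (2 * Im c1 / of_nat CARD('n)) * \<i>)" by simp
  define b1 b2 d1 d2 where "b1 = (r1 - \<i> * r3) / 2" and "b2 = \<i> * (r1 + \<i> * r3) / 2"
    and "d1 = (r2 - \<i> * r4) / 2" and "d2 = \<i> * (r2 + \<i> * r4) / 2"
  define e1 where "e1 = etac T"
  define \<tau> where "\<tau> = xic T"
  have comb: "r * of_real x + r' * of_real y = (r - \<i> * r') / 2 * Complex x y - \<i> * (r + \<i> * r') / 2 * \<i> * cnj (Complex x y)" for r r' x y
    unfolding complex_eq_iff by (simp add: field_simps)
  have iu: "iota' A \<in> u_alg s" if "A \<in> so_pq s" for A using onk[OF that] au[OF gl[OF that]] by metis
  have ic: "zc (iota' A) = 0" "xc (iota' A) = 0" "Ac (iota' A) = cplx A" "yc (iota' A) = 0" "xic (iota' A) = 0" "etac (iota' A) = 0" for A :: "real^'n^'n"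
    by (simp_all add: iota'_def lcoords vec_eq_iff)
  have form: "zc (\<alpha> X) = c1 * of_real (ga X)" "xc (\<alpha> X) = xof b1 b2 (gX X)"
     "Ac (\<alpha> X) = cplx (gA X) - mat (of_real (2 * Im c1 / of_nat CARD('n) * ga X) * \<i>)"
     "yc (\<alpha> X) = xof d1 d2 (gX X)" "xic (\<alpha> X) = \<tau> * ga X" "etac (\<alpha> X) = e1 * ga X" if X: "X \<in> g_alg c s" for X
  proof -
    obtain a X1 X2 A where Xe: "X = gmat c s a X1 X2 A" and A: "A \<in> so_pq s" using X unfolding g_alg_def by blast
    note f = Fall[OF A, of a X1 X2, folded Xe T_def]
    show "zc (\<alpha> X) = c1 * of_real (ga X)" unfolding f by (simp add: Xe odd ic c1_def scaleR_conv_of_real[where 'a=complex] mult.commute)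
    show "xic (\<alpha> X) = \<tau> * ga X" "etac (\<alpha> X) = e1 * ga X" unfolding f by (simp_all add: Xe odd ic \<tau>_def e1_def)
    show "xc (\<alpha> X) = xof b1 b2 (gX X)" unfolding f
      by (simp add: Xe even[folded T_def] ic r1 r3 vec_eq_iff comb b1_def b2_def)
    show "yc (\<alpha> X) = xof d1 d2 (gX X)" unfolding f
      by (simp add: Xe even[folded T_def] ic r2 r4 vec_eq_iff comb d1_def d2_def)
    show "Ac (\<alpha> X) = cplx (gA X) - mat (of_real (2 * Im c1 / of_nat CARD('n) * ga X) * \<i>)"
      unfolding f by (simp add: Xe odd ic AT vec_eq_iff mat_nth r5' scaleR_conv_of_real[where 'a=complex])
  qed
  have kz: "ga X = 0 \<and> gX X = 0" if Xk: "X \<in> k_alg c s" for X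
  proof -
    obtain A where "X = gmat c s 0 0 0 A" using Xk unfolding k_alg_def by blast
    moreover have "cvec 0 0 = (0 :: complex^'n)" by (simp add: vec_eq_iff complex_eq_iff)
    ultimately show ?thesis by simp
  qed
  have pin: "ga X = 0 \<and> gX X = 0" if "X \<in> g_alg c s" "xc (\<alpha> X) = 0" "xic (\<alpha> X) = 0" for X
    using kz[OF inj[OF that(1)]] al[OF that(1)] that(2,3) by (simp add: p_alg_iff[OF sig])
  have tau0: "\<tau> \<noteq> 0"
  proof
    assume t0: "\<tau> = 0"
    have "ga (gmat c s 1 0 0 0) = 0"
      by (rule pin[THEN conjunct1, OF gl[OF z]]) (use form(2,5)[OF gl[OF z], of 1 0 0] t0 in \<open>simp_all add: vec_eq_iff complex_eq_iff\<close>)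
    then show False by simp
  qed
  obtain j0 :: 'n where True by blast
  have binj: "w = 0" if "b1 * w - b2 * \<i> * cnj w = 0" for w
  proof -
    let ?M = "gmat c s 0 (axis j0 (Re w)) (axis j0 (Im w)) 0"
    have gx: "gX ?M = axis j0 w" by (simp add: vec_eq_iff axis_def complex_eq_iff)
    have "gX ?M = 0"
      by (rule pin[THEN conjunct2, OF gl[OF z]]) (use form(2,5)[OF gl[OF z], of 0 "axis j0 (Re w)" "axis j0 (Im w)"] that gx in \<open>simp_all add: vec_eq_iff axis_def\<close>)
    then have "axis j0 w $ j0 = 0" unfolding gx by simp
    then show ?thesis by (simp add: axis_def)
  qed
  have b0: "bb b1 b2 \<noteq> 0"
  proof
    assume "bb b1 b2 = 0"
    then have bz: "b1 * cnj b1 = b2 * cnj b2" using bb_cnj[of b1 b2] by simp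
    have "b1 * (cnj b1 * w + \<i> * b2 * cnj w) - b2 * \<i> * cnj (cnj b1 * w + \<i> * b2 * cnj w) = (b1 * cnj b1 - b2 * cnj b2) * w" for w
      by (simp add: algebra_simps)
    then have "cnj b1 * w + \<i> * b2 * cnj w = 0" for w using binj[of "cnj b1 * w + \<i> * b2 * cnj w"] bz by simp
    from this[of 1] this[of \<i>] have "cnj b1 + \<i> * b2 = 0" "\<i> * (cnj b1 - \<i> * b2) = 0" by (simp_all add: algebra_simps)
    then have "cnj b1 = 0" "b2 = 0" by auto
    then have "(1::complex) = 0" using binj[of 1] by simp
    then show False by simp
  qed
  have tau: "\<tau> = 2 * bb b1 b2"
  proof -
    let ?U = "bx s (xof b1 b2 (axis j0 1)) 0" and ?V = "bx s (xof b1 b2 (axis j0 \<i>)) 0"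
    have deg: "?U \<in> l_deg s (-1)" "?V \<in> l_deg s (-1)" by (simp_all add: l_deg_neg1_iff[OF sig])
    define pr where "pr W = (SOME X. X \<in> g_alg c s \<and> \<alpha> X - W \<in> p_alg s)" for W
    have pr: "pr W \<in> g_alg c s \<and> \<alpha> (pr W) - W \<in> p_alg s" if "W \<in> l_alg s" for W
      unfolding pr_def by (rule someI_ex) (use surj[OF that] in blast)
    define M N where "M = pr ?U" and "N = pr ?V"
    have MN: "M \<in> g_alg c s" "N \<in> g_alg c s" "\<alpha> M - ?U \<in> p_alg s" "\<alpha> N - ?V \<in> p_alg s"
      unfolding M_def N_def using pr by simp_all
    have x: "xc (\<alpha> M) = xof b1 b2 (axis j0 1)" "xic (\<alpha> M) = 0" "xc (\<alpha> N) = xof b1 b2 (axis j0 \<i>)" "xic (\<alpha> N) = 0"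
      using MN(3,4) unfolding p_alg_iff[OF sig] by simp_all
    have "curv c s \<alpha> ?U ?V \<in> l_filt s (- 1 + - 1 + 1)"
      using reg deg unfolding regular_def by (metis neg_less_0_iff_less zero_less_one)
    then have "xic (curvature \<alpha> M N) = 0"
      unfolding curv_def Let_def pr_def[symmetric] M_def[symmetric] N_def[symmetric] by (simp add: l_filt_neg1_iff)
    then have "- 2 * Im (ip s (xc (\<alpha> M)) (xc (\<alpha> N))) - \<tau> * ga (bracket M N) = 0"
      unfolding curvature_def lcoords_linear bracket_coords[OF au[OF MN(1)] au[OF MN(2)]] x(2,4)
        form(5)[OF g_alg_bracket[OF MN(1,2) sig c]] by simp
    moreover have "ga (bracket M N) = - Im (ip s (gX M) (gX N))" by (rule bracket_gcoords(1)[OF MN(1,2) c])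
    moreover have "Im (ip s (xc (\<alpha> M)) (xc (\<alpha> N))) = bb b1 b2 * Im (ip s (gX M) (gX N))"
      unfolding form(2)[OF MN(1)] form(2)[OF MN(2)] by (rule Im_ip_xof)
    moreover have "Im (ip s (xc (\<alpha> M)) (xc (\<alpha> N))) = bb b1 b2 * s j0"
      unfolding x Im_ip_xof ip_axis by (simp add: axis_def)
    ultimately have "Im (ip s (gX M) (gX N)) = s j0" "(\<tau> - 2 * bb b1 b2) * Im (ip s (gX M) (gX N)) = 0"
      using b0 by (simp_all add: algebra_simps)
    then show ?thesis using s_nonzero[OF sig, of j0] by simp
  qed
  have "\<alpha> X = extf s b1 b2 c1 d1 d2 e1 X" if X: "X \<in> g_alg c s" for X
    by (rule u_alg_eqI[OF au[OF X] extf_u_alg[OF X]]) (simp_all add: form[OF X] extf_coords tau xof_def)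
  then show ?thesis using b0 by blast
qed

lemma bounded_bilinear_matrix_mult: "bounded_bilinear ((**) :: ('a::{euclidean_space,real_normed_field})^'m^'m \<Rightarrow> 'a^'m^'m \<Rightarrow> 'a^'m^'m)"
proof -
  have "bilinear ((**) :: 'a^'m^'m \<Rightarrow> 'a^'m^'m \<Rightarrow> 'a^'m^'m)"
    unfolding bilinear_def by (auto intro!: linearI simp: matrix_distribs matrix_mult_scaleR)
  then show ?thesis by (simp add: bilinear_conv_bounded_bilinear)
qed

lemma resolvent_curve:
  fixes X :: "('a::{euclidean_space,real_normed_field})^'m^'m"
  shows "\<exists>B \<delta>. \<delta> > 0 \<and> (\<forall>t. \<bar>t\<bar> < \<delta> \<longrightarrow> (mat 1 - t *\<^sub>R X) ** B t = mat 1 \<and> B t ** (mat 1 - t *\<^sub>R X) = mat 1)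
     \<and> B 0 = mat 1 \<and> (B has_vector_derivative X) (at (0::real))"
proof -
  have "\<exists>K>0. \<forall>(A::'a^'m^'m) (B::'a^'m^'m). norm (A ** B) \<le> norm A * norm B * K"
    by (rule bounded_bilinear.pos_bounded[OF bounded_bilinear_matrix_mult])
  then obtain K where K: "K > 0" and K2: "\<forall>(A::'a^'m^'m) (B::'a^'m^'m). norm (A ** B) \<le> norm A * norm B * K" by (elim exE conjE)
  note K = K K2[rule_format]
  define \<delta> where "\<delta> = 1 / (2 * (K * (norm X + 1)))"
  have pos: "K * (norm X + 1) > 0" using K(1) by (simp add: add_nonneg_pos)
  then have d0: "\<delta> > 0" unfolding \<delta>_def zero_less_divide_1_iff by linarith
  have half: "1 / (2 * w) * w = 1 / 2" if "w > 0" for w :: real using that by simp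
  have small: "\<bar>t\<bar> * norm X * K \<le> 1 / 2" if "\<bar>t\<bar> < \<delta>" for t
  proof -
    have "\<bar>t\<bar> * (norm X * K) \<le> \<delta> * (K * (norm X + 1))"
      using that K(1) d0 by (intro mult_mono[of "\<bar>t\<bar>" \<delta>]) (auto simp: algebra_simps)
    also have "\<dots> = 1 / 2" unfolding \<delta>_def by (rule half[OF pos])
    finally show ?thesis by (simp add: mult.assoc)
  qed
  have ex: "\<exists>B. (mat 1 - t *\<^sub>R X) ** B = mat 1 \<and> B ** (mat 1 - t *\<^sub>R X) = mat 1" if t: "\<bar>t\<bar> < \<delta>" for t
  proof -
    have "inj ((*v) (mat 1 - t *\<^sub>R X))"
    proof (rule injI)
      fix v w assume "(mat 1 - t *\<^sub>R X) *v v = (mat 1 - t *\<^sub>R X) *v w"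
      then have z: "(mat 1 - t *\<^sub>R X) *v (v - w) = 0" by (simp add: matrix_vector_mult_diff_distrib)
      define A where "A = (\<chi> i (j::'m). (v - w) $ i)"
      have "(mat 1 - t *\<^sub>R X) ** A = 0"
        using z by (simp add: vec_eq_iff matrix_mult_nth matrix_vector_nth A_def)
      then have "A = t *\<^sub>R (X ** A)" by (simp add: matrix_distribs matrix_mult_scaleR)
      then have "norm A = \<bar>t\<bar> * norm (X ** A)" by (metis norm_scaleR)
      also have "\<dots> \<le> \<bar>t\<bar> * (norm X * norm A * K)" by (intro mult_left_mono K(2)) simp
      also have "\<dots> = (\<bar>t\<bar> * norm X * K) * norm A" by simp
      also have "\<dots> \<le> 1 / 2 * norm A" by (intro mult_right_mono small t) simp
      finally have "norm A \<le> 0" by simp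
      then show "v = w" by (simp add: A_def vec_eq_iff)
    qed
    then show ?thesis using matrix_left_invertible_injective matrix_left_right_inverse by metis
  qed
  define B where "B t = (if \<bar>t\<bar> < \<delta> then (SOME B. (mat 1 - t *\<^sub>R X) ** B = mat 1 \<and> B ** (mat 1 - t *\<^sub>R X) = mat 1) else mat 1)" for t
  have B: "(mat 1 - t *\<^sub>R X) ** B t = mat 1 \<and> B t ** (mat 1 - t *\<^sub>R X) = mat 1" if "\<bar>t\<bar> < \<delta>" for t
    using someI_ex[OF ex[OF that]] that by (simp add: B_def)
  have B0: "B 0 = mat 1" using B[of 0] d0 by simp
  have rec: "B t = mat 1 + t *\<^sub>R (X ** B t)" if "\<bar>t\<bar> < \<delta>" for t
    using B[OF that] by (simp add: matrix_distribs matrix_mult_scaleR algebra_simps)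
  define M where "M = 2 * norm (mat 1 :: 'a^'m^'m)"
  have bd: "norm (B t) \<le> M" if "\<bar>t\<bar> < \<delta>" for t
  proof -
    have "norm (B t) \<le> norm (mat 1 :: 'a^'m^'m) + \<bar>t\<bar> * norm (X ** B t)"
      using norm_triangle_ineq[of "mat 1" "t *\<^sub>R (X ** B t)"] rec[OF that] by simp
    also have "\<bar>t\<bar> * norm (X ** B t) \<le> \<bar>t\<bar> * (norm X * norm (B t) * K)" by (intro mult_left_mono K(2)) simp
    also have "\<bar>t\<bar> * (norm X * norm (B t) * K) = (\<bar>t\<bar> * norm X * K) * norm (B t)" by simp
    also have "\<dots> \<le> 1 / 2 * norm (B t)" by (intro mult_right_mono small that) simp
    finally have "norm (B t) \<le> norm (mat 1 :: 'a^'m^'m) + 1 / 2 * norm (B t)" by simp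
    then show ?thesis unfolding M_def by linarith
  qed
  define C where "C = norm (X ** X) * M * K"
  have err: "norm (B t - B 0 - t *\<^sub>R X) \<le> t\<^sup>2 * C" if "\<bar>t\<bar> < \<delta>" for t
  proof -
    have "B t = mat 1 + t *\<^sub>R (X ** (mat 1 + t *\<^sub>R (X ** B t)))" using rec[OF that] by metis
    also have "\<dots> = mat 1 + (t *\<^sub>R X + (t * t) *\<^sub>R (X ** X ** B t))"
      by (simp add: matrix_distribs matrix_mult_scaleR scaleR_add_right matrix_mul_assoc)
    finally have e: "B t = mat 1 + (t *\<^sub>R X + (t * t) *\<^sub>R (X ** X ** B t))" .
    have "y - a - b = z" if "y = a + (b + z)" for y a b z :: "'a^'m^'m" using that by simp
    from this[OF e] have "B t - B 0 - t *\<^sub>R X = (t * t) *\<^sub>R (X ** X ** B t)" by (simp only: B0)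
    then have "norm (B t - B 0 - t *\<^sub>R X) = t\<^sup>2 * norm (X ** X ** B t)" by (simp add: power2_eq_square)
    also have "\<dots> \<le> t\<^sup>2 * (norm (X ** X) * norm (B t) * K)" by (intro mult_left_mono K(2)) simp
    also have "\<dots> \<le> t\<^sup>2 * C" unfolding C_def using K(1) bd[OF that]
      by (intro mult_left_mono mult_right_mono) auto
    finally show ?thesis .
  qed
  have "(B has_vector_derivative X) (at 0)"
    unfolding has_vector_derivative_def has_derivative_iff_norm
  proof (intro conjI)
    show "bounded_linear (\<lambda>x. x *\<^sub>R X)" by (rule bounded_linear_scaleR_left)
    show "((\<lambda>y. norm (B y - B 0 - (y - 0) *\<^sub>R X) / norm (y - 0)) \<longlongrightarrow> 0) (at 0)"
    proof (rule Lim_null_comparison)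
      show "((\<lambda>y. \<bar>y\<bar> * C) \<longlongrightarrow> 0) (at 0)" by (auto intro!: tendsto_eq_intros)
      have "norm (norm (B y - B 0 - (y - 0) *\<^sub>R X) / norm (y - 0)) \<le> \<bar>y\<bar> * C" if "\<bar>y\<bar> < \<delta>" "y \<noteq> 0" for y
      proof -
        have "norm (B y - B 0 - y *\<^sub>R X) \<le> (\<bar>y\<bar> * C) * \<bar>y\<bar>" using err[OF that(1)] by (simp add: power2_eq_square mult_ac abs_mult[symmetric])
        then show ?thesis using that(2) by (simp add: divide_le_eq)
      qed
      then show "\<forall>\<^sub>F y in at 0. norm (norm (B y - B 0 - (y - 0) *\<^sub>R X) / norm (y - 0)) \<le> \<bar>y\<bar> * C"
        unfolding eventually_at using d0 by (intro exI[of _ \<delta>]) (auto simp: dist_real_def)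
    qed
  qed
  then show ?thesis using d0 B B0 by (intro exI[of _ B] exI[of _ \<delta>] conjI allI impI) simp_all
qed

lemma cayley_curve:
  fixes X :: "('a::{euclidean_space,real_normed_field})^'m^'m"
  shows "\<exists>C. C 0 = mat 1 \<and> (C has_vector_derivative X) (at (0::real)) \<and>
    (\<forall>\<^sub>F t in at 0. \<exists>B. (mat 1 - (t/2) *\<^sub>R X) ** B = mat 1 \<and> B ** (mat 1 - (t/2) *\<^sub>R X) = mat 1
        \<and> C t = (mat 1 + (t/2) *\<^sub>R X) ** B)"
proof -
  obtain B \<delta> where B: "\<delta> > 0" "\<And>t. \<bar>t\<bar> < \<delta> \<Longrightarrow> (mat 1 - t *\<^sub>R ((1/2) *\<^sub>R X)) ** B t = mat 1 \<and> B t ** (mat 1 - t *\<^sub>R ((1/2) *\<^sub>R X)) = mat 1"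
     "B 0 = mat 1" "(B has_vector_derivative (1/2) *\<^sub>R X) (at (0::real))"
    using resolvent_curve[of "(1/2) *\<^sub>R X"] by (elim exE conjE) metis
  define C where "C t = (mat 1 + (t/2) *\<^sub>R X) ** B t" for t
  have d1: "((\<lambda>t. mat 1 + (t/2) *\<^sub>R X) has_vector_derivative (1/2) *\<^sub>R X) (at 0)"
    by (auto intro!: derivative_eq_intros)
  have "(C has_vector_derivative ((mat 1 + (0/2) *\<^sub>R X) ** ((1/2) *\<^sub>R X) + ((1/2) *\<^sub>R X) ** B 0)) (at 0)"
    unfolding C_def by (rule bounded_bilinear.has_vector_derivative[OF bounded_bilinear_matrix_mult d1 B(4)])
  moreover have "(1/2) *\<^sub>R X + (1/2) *\<^sub>R X = X" by (simp flip: scaleR_add_left)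
  ultimately have "(C has_vector_derivative X) (at 0)" by (simp add: B(3))
  moreover have "\<forall>\<^sub>F t in at 0. \<exists>B. (mat 1 - (t/2) *\<^sub>R X) ** B = mat 1 \<and> B ** (mat 1 - (t/2) *\<^sub>R X) = mat 1
        \<and> C t = (mat 1 + (t/2) *\<^sub>R X) ** B"
    unfolding eventually_at using B(1,2) by (intro exI[of _ \<delta>]) (auto simp: C_def dist_real_def)
  moreover have "C 0 = mat 1" by (simp add: C_def B(3))
  ultimately show ?thesis by blast
qed

text \<open>anti-involutions\<close>

lemma cayley_unitary:
  fixes X :: "('a::{euclidean_space,real_normed_field})^'m^'m"
  assumes lin: "\<And>A B. sh (A + B) = sh A + sh B" "\<And>A B. sh (A - B) = sh A - sh B" "\<And>r A. sh (r *\<^sub>R A) = r *\<^sub>R sh A"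
    and mult: "\<And>A B. sh (A ** B) = sh B ** sh A" and one: "sh (mat 1) = mat 1" and X: "sh X = - X"
    and B: "(mat 1 - h *\<^sub>R X) ** B = mat 1" 
  shows "sh ((mat 1 + h *\<^sub>R X) ** B) ** ((mat 1 + h *\<^sub>R X) ** B) = mat 1"
proof -
  have c: "(mat 1 - h *\<^sub>R X) ** (mat 1 + h *\<^sub>R X) = (mat 1 + h *\<^sub>R X) ** (mat 1 - h *\<^sub>R X)"
    by (simp add: vec_eq_iff matrix_distribs matrix_mult_scaleR algebra_simps)
  have p: "sh (mat 1 + h *\<^sub>R X) = mat 1 - h *\<^sub>R X" "sh (mat 1 - h *\<^sub>R X) = mat 1 + h *\<^sub>R X"
    by (simp_all add: lin one X)
  have "sh ((mat 1 + h *\<^sub>R X) ** B) ** ((mat 1 + h *\<^sub>R X) ** B) = sh B ** ((mat 1 - h *\<^sub>R X) ** (mat 1 + h *\<^sub>R X)) ** B"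
    unfolding mult p by (simp add: matrix_mul_assoc)
  also have "\<dots> = sh B ** (mat 1 + h *\<^sub>R X) ** ((mat 1 - h *\<^sub>R X) ** B)"
    unfolding c by (simp add: matrix_mul_assoc)
  also have "\<dots> = sh B ** (mat 1 + h *\<^sub>R X)" unfolding B by simp
  also have "\<dots> = sh ((mat 1 - h *\<^sub>R X) ** B)" by (simp only: mult p)
  finally show ?thesis unfolding B one .
qed

lemma O_pq_curve:
  assumes "pm_one d" "X \<in> so_pq d"
  shows "\<exists>C. C 0 = mat 1 \<and> (C has_vector_derivative X) (at (0::real)) \<and> (\<forall>\<^sub>F t in at 0. C t \<in> O_pq d)"
proof -
  obtain C where C: "C 0 = mat 1" "(C has_vector_derivative X) (at (0::real))"
    "\<forall>\<^sub>F t in at 0. \<exists>B. (mat 1 - (t/2) *\<^sub>R X) ** B = mat 1 \<and> B ** (mat 1 - (t/2) *\<^sub>R X) = mat 1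
        \<and> C t = (mat 1 + (t/2) *\<^sub>R X) ** B" using cayley_curve[of X] by blast
  have X: "sharp d X = - X" using assms so_pq_sharp by blast
  have one: "sharp d (mat 1) = mat 1" by (simp add: vec_eq_iff sharp_nth mat_nth pm_oneD[OF assms(1)])
  have "\<forall>\<^sub>F t in at 0. C t \<in> O_pq d"
    using C(3) by (rule eventually_mono) (auto simp: O_pq_sharp[OF assms(1)]
      intro!: cayley_unitary[where sh = "sharp d"] sharp_linear sharp_mult[OF assms(1)] one X)
  then show ?thesis using C by blast
qed

definition usharp :: "('n::finite \<Rightarrow> real) \<Rightarrow> 'n lmatrix \<Rightarrow> 'n lmatrix" where
  "usharp s U = herm s ** adjoint_mat U ** herm s"

lemma herm_sq: assumes "pm_one s" shows "herm s ** herm s = mat 1"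
proof -
  have "complex_of_real (s i) * of_real (s i) = 1" for i by (metis of_real_1 of_real_mult pm_oneD[OF assms])
  then show ?thesis by (auto simp: vec_eq_iff all_lidx matrix_mult_nth sum_lidx mat_nth if_distrib[of "\<lambda>x. _ * x"] cong: if_cong)
qed

lemma usharp_linear: "usharp s (A + B) = usharp s A + usharp s B" "usharp s (A - B) = usharp s A - usharp s B"
   "usharp s (r *\<^sub>R A) = r *\<^sub>R usharp s A"
  by (simp_all add: usharp_def adjoint_mat_linear matrix_distribs matrix_mult_scaleR)

lemma usharp_mult: assumes "pm_one s" shows "usharp s (A ** B) = usharp s B ** usharp s A"
proof -
  have "usharp s B ** usharp s A = herm s ** adjoint_mat B ** (herm s ** herm s) ** adjoint_mat A ** herm s"
    by (simp add: usharp_def matrix_mul_assoc)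
  then show ?thesis by (simp add: herm_sq[OF assms] usharp_def adjoint_mat_mult matrix_mul_assoc)
qed

lemma usharp_one: assumes "pm_one s" shows "usharp s (mat 1) = mat 1"
  by (simp add: usharp_def adjoint_mat_linear herm_sq[OF assms])

lemma herm_adjoint: "adjoint_mat (herm s) = herm s"
  by (auto simp: vec_eq_iff all_lidx adjoint_mat_def)

lemma adjoint_adjoint: "adjoint_mat (adjoint_mat A) = A"
  by (simp add: vec_eq_iff adjoint_mat_def)

lemma usharp_usharp: assumes "pm_one s" shows "usharp s (usharp s A) = A"
proof -
  have "usharp s (usharp s A) = (herm s ** herm s) ** A ** (herm s ** herm s)"
    unfolding usharp_def by (simp add: adjoint_mat_mult herm_adjoint adjoint_adjoint matrix_mul_assoc)
  then show ?thesis by (simp add: herm_sq[OF assms])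
qed

lemma unitary_usharp: assumes "pm_one s" shows "adjoint_mat U ** herm s ** U = herm s \<longleftrightarrow> usharp s U ** U = mat 1"
proof
  assume "adjoint_mat U ** herm s ** U = herm s"
  then have "herm s ** (adjoint_mat U ** herm s ** U) = herm s ** herm s" by simp
  then show "usharp s U ** U = mat 1" by (simp add: usharp_def matrix_mul_assoc herm_sq[OF assms])
next
  assume a: "usharp s U ** U = mat 1"
  have "adjoint_mat U ** herm s ** U = (herm s ** herm s) ** (adjoint_mat U ** herm s ** U)" by (simp add: herm_sq[OF assms])
  also have "\<dots> = herm s ** (usharp s U ** U)" by (simp add: usharp_def matrix_mul_assoc)
  finally show "adjoint_mat U ** herm s ** U = herm s" using a by simp
qed

lemma u_alg_usharp: assumes "pm_one s" shows "Y \<in> u_alg s \<longleftrightarrow> usharp s Y = - Y"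
proof
  assume "Y \<in> u_alg s"
  then have "adjoint_mat Y ** herm s = - (herm s ** Y)" by (simp add: u_alg_def eq_neg_iff_add_eq_0)
  then have "usharp s Y = - ((herm s ** herm s) ** Y)" by (simp add: usharp_def matrix_distribs flip: matrix_mul_assoc)
  then show "usharp s Y = - Y" by (simp add: herm_sq[OF assms])
next
  assume a: "usharp s Y = - Y"
  have "adjoint_mat Y ** herm s = (herm s ** herm s) ** (adjoint_mat Y ** herm s)" by (simp add: herm_sq[OF assms])
  also have "\<dots> = herm s ** usharp s Y" by (simp add: usharp_def matrix_mul_assoc)
  finally have "adjoint_mat Y ** herm s = - (herm s ** Y)" unfolding a by (simp add: matrix_distribs)
  then show "Y \<in> u_alg s" by (simp add: u_alg_def)
qed

lemma P_cover_iff: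
  assumes "pm_one s"
  shows "U \<in> P_cover s \<longleftrightarrow> usharp s U ** U = mat 1 \<and> xc U = 0 \<and> U $ Inr (Inr ()) $ Inl () = 0"
proof
  assume "U \<in> P_cover s"
  then show "usharp s U ** U = mat 1 \<and> xc U = 0 \<and> U $ Inr (Inr ()) $ Inl () = 0"
    unfolding P_cover_def unitary_usharp[OF assms] by (auto simp: xc_def vec_eq_iff)
next
  assume a: "usharp s U ** U = mat 1 \<and> xc U = 0 \<and> U $ Inr (Inr ()) $ Inl () = 0"
  then have H: "adjoint_mat U ** herm s ** U = herm s" unfolding unitary_usharp[OF assms] by blast
  have x0: "U $ Inr (Inl k) $ Inl () = 0" for k using a by (simp add: xc_def vec_eq_iff)
  have U0: "U $ Inl () $ Inl () \<noteq> 0"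
  proof
    assume z: "U $ Inl () $ Inl () = 0"
    have "(usharp s U ** U) $ Inl () $ Inl () = 0" unfolding matrix_mult_nth sum_lidx using a by (simp add: z x0)
    then show False using a by (simp add: mat_nth)
  qed
  have "U $ Inr (Inr ()) $ Inr (Inl j) = 0" for j
  proof -
    have "(adjoint_mat U ** herm s ** U) $ Inl () $ Inr (Inl j) = cnj (U $ Inl () $ Inl ()) * U $ Inr (Inr ()) $ Inr (Inl j)"
      using a by (simp add: matrix_mult_nth sum_lidx adjoint_mat_def x0 if_distrib[of "\<lambda>x. _ * x"] cong: if_cong)
    then show ?thesis using U0 H by simp
  qed
  then show "U \<in> P_cover s" unfolding P_cover_def mem_Collect_eq all_lidx using H a x0 by simp
qed

lemma P_cover_inverse: assumes "pm_one s" "U \<in> P_cover s"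
  shows "usharp s U ** U = mat 1" "U ** usharp s U = mat 1" "matrix_inv U = usharp s U"
proof -
  show 1: "usharp s U ** U = mat 1" using assms P_cover_iff by blast
  then show 2: "U ** usharp s U = mat 1" using matrix_left_right_inverse by blast
  show "matrix_inv U = usharp s U" using 2 1 by (rule matrix_inv_unique)
qed

lemma P_cover_mult: assumes "pm_one s" "U \<in> P_cover s" "V \<in> P_cover s" shows "U ** V \<in> P_cover s"
proof -
  have "usharp s (U ** V) ** (U ** V) = usharp s V ** (usharp s U ** U) ** V"
    by (simp add: usharp_mult[OF assms(1)] matrix_mul_assoc)
  then have "usharp s (U ** V) ** (U ** V) = mat 1"
    using P_cover_inverse[OF assms(1,2)] P_cover_inverse[OF assms(1,3)] by simp
  then show ?thesis using assms(2,3) unfolding P_cover_iff[OF assms(1)]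
    by (auto simp: xc_def vec_eq_iff matrix_mult_nth sum_lidx)
qed

lemma P_cover_one: assumes "pm_one s" shows "mat 1 \<in> P_cover s"
  by (simp add: P_cover_iff[OF assms] usharp_one[OF assms] xc_def vec_eq_iff mat_nth)

lemma P_cover_curve:
  assumes "pm_one s" "Y \<in> p_cover s"
  shows "\<exists>C. C 0 = mat 1 \<and> (C has_vector_derivative Y) (at (0::real)) \<and> (\<forall>\<^sub>F t in at 0. C t \<in> P_cover s)"
proof -
  obtain C where C: "C 0 = mat 1" "(C has_vector_derivative Y) (at (0::real))"
    "\<forall>\<^sub>F t in at 0. \<exists>B. (mat 1 - (t/2) *\<^sub>R Y) ** B = mat 1 \<and> B ** (mat 1 - (t/2) *\<^sub>R Y) = mat 1
        \<and> C t = (mat 1 + (t/2) *\<^sub>R Y) ** B" using cayley_curve[of Y] by blast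
  have X: "usharp s Y = - Y" using assms u_alg_usharp unfolding p_cover_def by blast
  have Y0: "Y $ Inr (Inl k) $ Inl () = 0" "Y $ Inr (Inr ()) $ Inl () = 0" for k using assms(2) unfolding p_cover_def by auto
  have "C t \<in> P_cover s" if "(mat 1 - (t/2) *\<^sub>R Y) ** B = mat 1" "B ** (mat 1 - (t/2) *\<^sub>R Y) = mat 1" "C t = (mat 1 + (t/2) *\<^sub>R Y) ** B" for t B
  proof -
    have 1: "usharp s (C t) ** C t = mat 1"
      unfolding that(3)
      by (intro cayley_unitary[where sh = "usharp s"] usharp_linear usharp_mult usharp_one assms X that)
    define d where "d = 1 - of_real (t/2) * Y $ Inl () $ Inl ()"
    have Bd: "B $ i $ Inl () * d = mat 1 $ i $ Inl ()" for i
    proof -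
      have "(B ** (mat 1 - (t/2) *\<^sub>R Y)) $ i $ Inl () = mat 1 $ i $ Inl ()" unfolding that(2) ..
      moreover have "(B ** (mat 1 - (t/2) *\<^sub>R Y)) $ i $ Inl () = B $ i $ Inl () * d"
        unfolding matrix_mult_nth sum_lidx d_def by (simp add: mat_nth Y0 scaleR_conv_of_real[where 'a=complex])
      ultimately show ?thesis by simp
    qed
    have "d \<noteq> 0" using Bd[of "Inl ()"] by (auto simp: mat_nth)
    then have B0: "B $ Inr i $ Inl () = 0" for i using Bd[of "Inr i"] by (simp add: mat_nth)
    have "C t $ Inr i $ Inl () = 0" for i
      unfolding that(3) matrix_mult_nth sum_lidx using Y0 B0 by (cases i) (auto simp: mat_nth)
    then show ?thesis unfolding P_cover_iff[OF assms(1)] using 1 by (simp add: xc_def vec_eq_iff)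
  qed
  then have "\<forall>\<^sub>F t in at 0. C t \<in> P_cover s" using C(3) by (auto elim!: eventually_mono)
  then show ?thesis using C by blast
qed


lemma bounded_linear_Ck: 
  fixes f :: "'a::euclidean_space \<Rightarrow> 'b::euclidean_space"
  assumes "bounded_linear f" shows "smooth_on S f"
proof -
  have const: "Ck_on k S (\<lambda>x. v :: 'b)" for k v
    by (induction k arbitrary: v) (simp_all add: frechet_derivative_const)
  have fd: "frechet_derivative f (at x) = f" for x
    using bounded_linear_imp_has_derivative[OF assms] frechet_derivative_at by metis
  have "Ck_on k S f" for k
    using const by (cases k) (auto simp: fd linear_continuous_on[OF assms] bounded_linear_imp_differentiable[OF assms])
  then show ?thesis by (simp add: smooth_on_def)
qed

lemma curve_chain:
  fixes F :: "'a::real_normed_vector \<Rightarrow> 'b::real_normed_vector"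
  assumes "F differentiable (at (\<gamma> 0))" "(\<gamma> has_vector_derivative v) (at (0::real))"
  shows "((\<lambda>t. F (\<gamma> t)) has_vector_derivative frechet_derivative F (at (\<gamma> 0)) v) (at 0)"
proof -
  have D: "(F has_derivative frechet_derivative F (at (\<gamma> 0))) (at (\<gamma> 0))" using assms(1) frechet_derivative_works by blast
  then have "((\<lambda>t. F (\<gamma> t)) has_derivative (\<lambda>t. frechet_derivative F (at (\<gamma> 0)) (t *\<^sub>R v))) (at 0)"
    using has_derivative_compose[OF assms(2)[unfolded has_vector_derivative_def]] by blast
  moreover have "frechet_derivative F (at (\<gamma> 0)) (t *\<^sub>R v) = t *\<^sub>R frechet_derivative F (at (\<gamma> 0)) v" for t
    using linear_scale[OF has_derivative_linear[OF D]] by blast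
  ultimately show ?thesis by (simp add: has_vector_derivative_def)
qed

lemma vector_derivative_eventually_eq:
  assumes "(f has_vector_derivative a) (at (0::real))" "(g has_vector_derivative b) (at 0)"
    "\<forall>\<^sub>F t in at 0. f t = g t" "f 0 = g 0"
  shows "a = b"
proof -
  have "(g has_vector_derivative a) (at 0)"
    using has_derivative_transform_eventually[OF assms(1)[unfolded has_vector_derivative_def] assms(3)] assms(4)
    by (simp add: has_vector_derivative_def)
  then show ?thesis using vector_derivative_unique_at assms(2) by blast
qed

lemmas mult_vector_derivative = bounded_bilinear.has_vector_derivative[OF bounded_bilinear_matrix_mult]

lemma bounded_linear_ev: "linear f \<Longrightarrow> bounded_linear (f :: 'a::euclidean_space \<Rightarrow> 'b::real_normed_vector)"
  by (rule linear_conv_bounded_linear[THEN iffD1])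

definition kblk :: "real^'n^'n \<Rightarrow> 'n::finite gmatrix" where "kblk A = gblocks 0 0 0 0 0 0 0 0 A"

lemma kmat_affine: "kmat A = kmat 0 + kblk A" and kblk_gmat: "kblk A = gmat c s 0 0 0 A"
  by (simp_all add: vec_eq_iff all_gidx kblk_def)

lemma iota_affine: "iota A = iota 0 + iota' A"
  by (simp add: vec_eq_iff all_lidx iota'_def)

lemma blk_linear: "bounded_linear kblk" "bounded_linear iota'" "bounded_linear gA" "bounded_linear (sharp s)"
  "bounded_linear (usharp t)" "bounded_linear (mat :: complex \<Rightarrow> 'n::finite lmatrix)"
  "bounded_linear (\<lambda>M::'n::finite lmatrix. M $ i $ j)"
  by (rule bounded_linear_ev, rule linearI, simp_all add: vec_eq_iff all_gidx all_lidx kblk_def iota'_def sharp_linear usharp_linear mat_nth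
     scaleR_conv_of_real[where 'a=complex])+

lemma kmat_vector_derivative: assumes "(A has_vector_derivative A') F"
  shows "((\<lambda>t. kmat (A t)) has_vector_derivative kblk A') F" "((\<lambda>t. iota (A t)) has_vector_derivative iota' A') F"
  by (subst kmat_affine iota_affine, auto intro!: derivative_eq_intros bounded_linear.has_vector_derivative[OF blk_linear(1) assms]
    bounded_linear.has_vector_derivative[OF blk_linear(2) assms])+

lemma kblk_mult: "kmat A ** kblk B = kblk (A ** B)" "kblk B ** kmat A = kblk (B ** A)"
  "iota A ** iota' B = iota' (A ** B)" "iota' B ** iota A = iota' (B ** A)"
  by (simp_all add: vec_eq_iff all_gidx all_lidx kblk_def iota'_def matrix_mult_nth sum_gidx sum_lidx)

lemma trace_free_add_mat: "trace_free (M + mat z) = trace_free (M::'n::finite lmatrix)"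
proof -
  have "trace (mat z :: 'n lmatrix) = of_nat (CARD('n) + 2) * z" by (simp add: trace_def mat_nth)
  moreover have "of_nat (CARD('n) + 2) \<noteq> (0::complex)" by (metis add_is_0 of_nat_eq_0_iff zero_neq_numeral)
  ultimately show ?thesis
    by (simp add: trace_free_def vec_eq_iff mat_nth add_divide_distrib del: of_nat_add)
qed

lemma mat_commute: "mat z ** (M::'a::comm_ring_1^'m^'m) = M ** mat z"
  by (simp add: vec_eq_iff matrix_mult_nth mat_nth if_distrib[of "\<lambda>x. x * _"] if_distrib[of "\<lambda>x. _ * x"] mult.commute cong: if_cong)

lemma mat_mult_mat: "mat z ** mat w = (mat (z * w) :: 'a::comm_ring_1^'m^'m)"
  by (simp add: vec_eq_iff matrix_mult_nth mat_nth if_distrib[of "\<lambda>x. x * _"] cong: if_cong)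

lemma usharp_mat: "pm_one s \<Longrightarrow> usharp s (mat z) = mat (cnj z)"
proof -
  assume pm: "pm_one s"
  have a: "adjoint_mat (mat z) = mat (cnj z)" by (simp add: adjoint_mat_def vec_eq_iff mat_nth)
  have "usharp s (mat z) = (herm s ** herm s) ** mat (cnj z)"
    unfolding usharp_def a by (simp add: mat_commute[of "cnj z" "herm s"] matrix_mul_assoc[symmetric])
  then show ?thesis by (simp add: herm_sq[OF pm])
qed

lemma iota_P_cover: assumes pm: "pm_one s" and A: "A \<in> O_pq s"
  shows "usharp s (iota A) = iota (sharp s A)" "iota A \<in> P_cover s"
proof -
  have e: "complex_of_real (s i) * of_real (A $ j $ i) * of_real (s j) = of_real (s i * A $ j $ i * s j)" for i j by simp
  show 1: "usharp s (iota A) = iota (sharp s A)"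
    unfolding usharp_def vec_eq_iff all_lidx matrix_mult_nth sum_lidx adjoint_mat_def
    by (simp add: sharp_nth if_distrib[of "\<lambda>x. x * _"] if_distrib[of "\<lambda>x. _ * x"] if_distribR cong: if_cong)
  show "iota A \<in> P_cover s"
    unfolding P_cover_iff[OF pm] 1 using kmat_inverse[OF pm A] by (simp add: xc_def vec_eq_iff)
qed

lemma mat_P_cover: assumes "pm_one s" "norm z = 1" shows "mat z \<in> P_cover s"
proof -
  have "cnj z * z = 1" using assms(2) complex_norm_square[of z] by (simp add: mult.commute)
  then show ?thesis
    unfolding P_cover_iff[OF assms(1)] usharp_mat[OF assms(1)] mat_mult_mat by (simp add: xc_def vec_eq_iff mat_nth)
qed

lemma G_alg_sharp: "signature s p q \<Longrightarrow> c = 1 \<or> c = -1 \<Longrightarrow> X \<in> g_alg c s \<Longrightarrow> sharp (gform c s) X = - X"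
  using g_alg_iff so_pq_sharp gform_pm by blast

lemma GP_class:
  assumes "(g, U) \<in> GP c s" 
  shows "GP_rel c s `` {(g, U)} = {(g ** kmat A, mat z ** matrix_inv (iota A) ** U) | A z. A \<in> O_pq s \<and> norm z = 1}"
  using assms unfolding GP_rel_def by auto

lemma equivalence_by_conjugation:
  fixes s :: "'n::finite \<Rightarrow> real"
  assumes sig: "signature s p q" and c: "c = 1 \<or> c = -1" 
    and ext': "CR_extension c s \<alpha>'"
    and h: "h \<in> O_pq (gform c s)" and hk: "\<And>A. h ** kmat A = kmat A ** h"
    and V: "V \<in> P_cover s" and vk: "\<And>A. V ** iota A = iota A ** V"
    and rel: "\<And>X. X \<in> g_alg c s \<Longrightarrow> \<alpha>' (sharp (gform c s) h ** X ** h) ** V = V ** \<alpha> X"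
  shows "equivalent_extensions c s \<alpha> \<alpha>'"
proof -
  define d where "d = gform c s"
  note pms = signature_pm[OF sig]
  have pmd: "pm_one d" unfolding d_def by (rule gform_pm[OF sig c])
  have GPi: "(g, U) \<in> GP c s \<longleftrightarrow> g \<in> O_pq d \<and> U \<in> P_cover s" for g U
    by (simp add: GP_def G_grp_eq d_def)
  have hG: "h \<in> O_pq d" using h by (simp add: d_def)
  define L where "L = (\<lambda>(g, U). (g ** h, V ** U) :: 'n gmatrix \<times> 'n lmatrix)"
  have LGP: "L y \<in> GP c s" if "y \<in> GP c s" for y
    using that unfolding L_def by (cases y) (auto simp: GPi O_pq_mult[OF pmd _ hG] P_cover_mult[OF pms V])
  define \<Phi> where "\<Phi> x = L ` x" for x
  have cls: "\<Phi> (GP_rel c s `` {y}) = GP_rel c s `` {L y}" if y: "y \<in> GP c s" for y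
  proof -
    obtain g U where yg: "y = (g, U)" by (cases y)
    have e: "L (g ** kmat A, mat z ** matrix_inv (iota A) ** U) = (g ** h ** kmat A, mat z ** matrix_inv (iota A) ** (V ** U))"
      if A: "A \<in> O_pq s" for A z
    proof -
      have "V ** (mat z ** iota (sharp s A) ** U) = mat z ** (V ** iota (sharp s A)) ** U"
        using mat_commute[of z V] by (simp add: matrix_mul_assoc)
      then have 1: "V ** (mat z ** iota (sharp s A) ** U) = mat z ** iota (sharp s A) ** (V ** U)"
        unfolding vk by (simp add: matrix_mul_assoc)
      have "g ** kmat A ** h = g ** (h ** kmat A)" unfolding hk by (simp add: matrix_mul_assoc)
      then have 2: "g ** kmat A ** h = g ** h ** kmat A" by (simp add: matrix_mul_assoc)
      show ?thesis
        unfolding L_def kmat_inverse[OF pms A] prod.case 1 2 ..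
    qed
    have "\<Phi> (GP_rel c s `` {y}) = {L (g ** kmat A, mat z ** matrix_inv (iota A) ** U) | A z. A \<in> O_pq s \<and> norm z = 1}"
      unfolding yg GP_class[OF y[unfolded yg]] \<Phi>_def by blast
    also have "\<dots> = {(g ** h ** kmat A, mat z ** matrix_inv (iota A) ** (V ** U)) | A z. A \<in> O_pq s \<and> norm z = 1}"
    proof -
      have "(x = L (g ** kmat A, mat z ** matrix_inv (iota A) ** U) \<and> A \<in> O_pq s \<and> norm z = 1) \<longleftrightarrow>
         (x = (g ** h ** kmat A, mat z ** matrix_inv (iota A) ** (V ** U)) \<and> A \<in> O_pq s \<and> norm z = 1)" for x A z
        using e by auto
      then show ?thesis by (simp only:)
    qed
    also have "\<dots> = GP_rel c s `` {L y}"
      using GP_class[of "g ** h" "V ** U" c s] LGP[OF y] unfolding yg L_def by simp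
    finally show ?thesis .
  qed
  have bm: "bundle_morphism c s \<Phi>"
    unfolding bundle_morphism_def
  proof (intro conjI ballI)
    fix x assume "x \<in> total_space c s"
    then obtain y where y: "y \<in> GP c s" "x = GP_rel c s `` {y}" unfolding total_space_def quotient_def by blast
    show "\<Phi> x \<in> total_space c s"
      unfolding y(2) cls[OF y(1)] total_space_def quotient_def using LGP[OF y(1)] by blast
  next
    fix x W
    show "\<Phi> (right_act W x) = right_act W (\<Phi> x)"
      unfolding \<Phi>_def right_act_def image_image L_def by (rule image_cong) (auto simp: matrix_mul_assoc)
  next
    fix y assume "y \<in> GP c s"
    have "bounded_linear L"
      unfolding L_def
      by (intro bounded_linear_ev linearI) (auto simp: matrix_distribs matrix_mult_scaleR)
    then have "smooth_lift c s \<Phi> UNIV L"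
      unfolding smooth_lift_def using bounded_linear_Ck LGP cls by auto
    then show "\<exists>W F. y \<in> W \<and> smooth_lift c s \<Phi> W F" by blast
  qed
  have "pulls_back c s \<Phi> \<alpha>' \<alpha>"
    unfolding pulls_back_def
  proof (intro allI impI ballI)
    fix W F y v
    assume sl: "smooth_lift c s \<Phi> W F" and yW: "y \<in> W \<inter> GP c s" and v: "v \<in> tangent c s y"
    have oW: "open W" and sm: "smooth_on W F" and lift: "\<And>y. y \<in> W \<inter> GP c s \<Longrightarrow> F y \<in> GP c s \<and> \<Phi> (GP_rel c s `` {y}) = GP_rel c s `` {F y}"
      using sl unfolding smooth_lift_def by blast+
    obtain g U where yg: "y = (g, U)" by (cases y)
    obtain X Y where X: "X \<in> g_alg c s" and Y: "Y \<in> p_cover s" and vv: "v = (g ** X, U ** Y)"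
      using v unfolding tangent_def yg by auto
    have g: "g \<in> O_pq d" and U: "U \<in> P_cover s" using yW unfolding yg by (auto simp: GPi)
    have Xs: "X \<in> so_pq d" using X g_alg_iff[OF sig c] by (simp add: d_def)
    obtain C where C: "C 0 = mat 1" "(C has_vector_derivative X) (at (0::real))" "\<forall>\<^sub>F t in at 0. C t \<in> O_pq d"
      using O_pq_curve[OF pmd Xs] by blast
    obtain D where D: "D 0 = mat 1" "(D has_vector_derivative Y) (at (0::real))" "\<forall>\<^sub>F t in at 0. D t \<in> P_cover s"
      using P_cover_curve[OF pms Y] by blast
    define \<gamma> where "\<gamma> t = (g ** C t, U ** D t)" for t
    have d\<gamma>1: "((\<lambda>t. g ** C t) has_vector_derivative g ** X) (at 0)" "((\<lambda>t. U ** D t) has_vector_derivative U ** Y) (at 0)"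
      using mult_vector_derivative[OF has_vector_derivative_const[of g] C(2)] mult_vector_derivative[OF has_vector_derivative_const[of U] D(2)]
      by simp_all
    have d\<gamma>: "(\<gamma> has_vector_derivative v) (at 0)"
      unfolding \<gamma>_def vv by (rule has_vector_derivative_Pair[OF d\<gamma>1])
    have \<gamma>0: "\<gamma> 0 = y" by (simp add: \<gamma>_def C(1) D(1) yg)
    have "\<forall>\<^sub>F t in at 0. \<gamma> t \<in> W"
    proof -
      have "isCont \<gamma> 0" using d\<gamma> has_vector_derivative_continuous by blast
      then have "(\<gamma> \<longlongrightarrow> y) (at 0)" unfolding isCont_def \<gamma>0 .
      then show ?thesis using topological_tendstoD oW yW by blast
    qed
    then have ev: "\<forall>\<^sub>F t in at 0. \<gamma> t \<in> W \<inter> GP c s \<and> C t \<in> O_pq d \<and> D t \<in> P_cover s"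
      using C(3) D(3) by eventually_elim (simp add: \<gamma>_def GPi O_pq_mult[OF pmd g] P_cover_mult[OF pms U])
    have ev0: "\<gamma> 0 \<in> W \<inter> GP c s \<and> C 0 \<in> O_pq d \<and> D 0 \<in> P_cover s"
      using yW \<gamma>0 by (simp add: C(1) D(1) O_pq_one P_cover_one[OF pms])
    define f where "f t = fst (F (\<gamma> t))" for t
    define u where "u t = snd (F (\<gamma> t))" for t
    define P where "P t = g ** C t ** h" for t
    define Q where "Q t = V ** (U ** D t)" for t
    define A where "A t = gA (sharp d (P t) ** f t)" for t
    define Z where "Z t = (u t ** usharp s (Q t) ** iota (A t)) $ Inl () $ Inl ()" for t
    define R where "R t \<longleftrightarrow> A t \<in> O_pq s \<and> norm (Z t) = 1 \<and> f t = P t ** kmat (A t) \<and> u t = mat (Z t) ** iota (sharp s (A t)) ** Q t" for t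
    have R: "R t" if t: "\<gamma> t \<in> W \<inter> GP c s \<and> C t \<in> O_pq d \<and> D t \<in> P_cover s" for t
    proof -
      have PG: "P t \<in> O_pq d" unfolding P_def using t by (intro O_pq_mult[OF pmd] g hG) auto
      have QP: "Q t \<in> P_cover s" unfolding Q_def using t by (intro P_cover_mult[OF pms] V U) auto
      have FG: "F (\<gamma> t) \<in> GP c s" and cl: "\<Phi> (GP_rel c s `` {\<gamma> t}) = GP_rel c s `` {F (\<gamma> t)}" using lift t by blast+
      have "F (\<gamma> t) \<in> GP_rel c s `` {F (\<gamma> t)}"
      proof -
        obtain g1 U1 where F1: "F (\<gamma> t) = (g1, U1)" by (cases "F (\<gamma> t)")
        have "(g1, U1) = (g1 ** kmat (mat 1), mat 1 ** matrix_inv (iota (mat 1)) ** U1)"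
          unfolding kmat_one iota_one matrix_inv_unique[OF matrix_mul_lid matrix_mul_lid] by simp
        then show ?thesis unfolding F1 GP_class[OF FG[unfolded F1]] using O_pq_one norm_one by blast
      qed
      then have "F (\<gamma> t) \<in> GP_rel c s `` {L (\<gamma> t)}" using cl cls t by blast
      moreover have "L (\<gamma> t) = (P t, Q t)" by (simp add: L_def \<gamma>_def P_def Q_def)
      ultimately obtain B z where B: "B \<in> O_pq s" "norm z = 1" and F: "F (\<gamma> t) = (P t ** kmat B, mat z ** matrix_inv (iota B) ** Q t)"
        using GP_class[of "P t" "Q t" c s] PG QP GPi by auto
      have ft: "f t = P t ** kmat B" and ut: "u t = mat z ** iota (sharp s B) ** Q t"
        unfolding f_def u_def F kmat_inverse[OF pms B(1)] by simp_all
      have "sharp d (P t) ** f t = kmat B" unfolding ft using O_pq_inverse(1)[OF pmd PG] by (simp add: matrix_mul_assoc)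
      then have AB: "A t = B" unfolding A_def by (simp add: gA_def vec_eq_iff)
      have "u t ** usharp s (Q t) ** iota (A t) = mat z ** iota (sharp s B) ** (Q t ** usharp s (Q t)) ** iota B"
        unfolding ut AB by (simp add: matrix_mul_assoc)
      also have "\<dots> = mat z ** (iota (sharp s B) ** iota B)" using P_cover_inverse(2)[OF pms QP] by (simp add: matrix_mul_assoc)
      also have "\<dots> = mat z" using kmat_inverse[OF pms B(1)] by simp
      finally have "Z t = z" unfolding Z_def by (simp add: mat_nth)
      then show ?thesis unfolding R_def using AB B ft ut by simp
    qed
    have evR: "\<forall>\<^sub>F t in at 0. R t" using ev R by (auto elim: eventually_mono)
    have R0: "R 0" using R ev0 by blast
    have "F differentiable (at (\<gamma> 0))" 
    proof -
      have "Ck_on (Suc 0) W F" using sm unfolding smooth_on_def by blast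
      then show ?thesis using ev0 by (simp)
    qed
    then have dF: "((\<lambda>t. F (\<gamma> t)) has_vector_derivative frechet_derivative F (at y) v) (at 0)"
      using curve_chain[OF _ d\<gamma>] \<gamma>0 by simp
    define f' u' where "f' = fst (frechet_derivative F (at y) v)" and "u' = snd (frechet_derivative F (at y) v)"
    have df: "(f has_vector_derivative f') (at 0)" and du: "(u has_vector_derivative u') (at 0)"
      unfolding f_def u_def f'_def u'_def
      using bounded_linear.has_vector_derivative[OF bounded_linear_fst dF] bounded_linear.has_vector_derivative[OF bounded_linear_snd dF] by auto
    have dP: "(P has_vector_derivative g ** X ** h) (at 0)"
      unfolding P_def using mult_vector_derivative[OF d\<gamma>1(1) has_vector_derivative_const[of h]] by simp
    have dQ: "(Q has_vector_derivative V ** (U ** Y)) (at 0)"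
      unfolding Q_def using mult_vector_derivative[OF has_vector_derivative_const[of V] d\<gamma>1(2)] by simp
    obtain A' where dA: "(A has_vector_derivative A') (at 0)"
      unfolding A_def using bounded_linear.has_vector_derivative[OF blk_linear(3) mult_vector_derivative[OF bounded_linear.has_vector_derivative[OF blk_linear(4) dP] df]] by blast
    obtain Z' where dZ: "(Z has_vector_derivative Z') (at 0)"
      unfolding Z_def using bounded_linear.has_vector_derivative[OF blk_linear(7)
         mult_vector_derivative[OF mult_vector_derivative[OF du bounded_linear.has_vector_derivative[OF blk_linear(5) dQ]] kmat_vector_derivative(2)[OF dA]]] by blast
    define B z where "B = A 0" and "z = Z 0"
    have B: "B \<in> O_pq s" and z: "norm z = 1" and f0: "f 0 = g ** h ** kmat B" and u0: "u 0 = mat z ** iota (sharp s B) ** (V ** U)"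
      using R0 unfolding R_def B_def z_def P_def Q_def by (simp_all add: C(1) D(1))
    have f': "f' = g ** h ** kblk A' + g ** X ** h ** kmat B"
    proof (rule vector_derivative_eventually_eq[OF df])
      show "((\<lambda>t. P t ** kmat (A t)) has_vector_derivative g ** h ** kblk A' + g ** X ** h ** kmat B) (at 0)"
        using mult_vector_derivative[OF dP kmat_vector_derivative(1)[OF dA]] by (simp add: P_def C(1) B_def)
      show "\<forall>\<^sub>F t in at 0. f t = P t ** kmat (A t)" using evR by (auto simp: R_def elim: eventually_mono)
      show "f 0 = P 0 ** kmat (A 0)" using R0 by (simp add: R_def)
    qed
    have dsA: "((\<lambda>t. sharp s (A t)) has_vector_derivative sharp s A') (at 0)"
      by (rule bounded_linear.has_vector_derivative[OF blk_linear(4) dA])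
    have u': "u' = mat z ** iota (sharp s B) ** (V ** (U ** Y)) + (mat z ** iota' (sharp s A') + mat Z' ** iota (sharp s B)) ** (V ** U)"
    proof (rule vector_derivative_eventually_eq[OF du])
      show "((\<lambda>t. mat (Z t) ** iota (sharp s (A t)) ** Q t) has_vector_derivative
         mat z ** iota (sharp s B) ** (V ** (U ** Y)) + (mat z ** iota' (sharp s A') + mat Z' ** iota (sharp s B)) ** (V ** U)) (at 0)"
        using mult_vector_derivative[OF mult_vector_derivative[OF bounded_linear.has_vector_derivative[OF blk_linear(6) dZ] kmat_vector_derivative(2)[OF dsA]] dQ]
        by (simp add: Q_def D(1) B_def z_def)
      show "\<forall>\<^sub>F t in at 0. u t = mat (Z t) ** iota (sharp s (A t)) ** Q t" using evR by (auto simp: R_def elim: eventually_mono)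
      show "u 0 = mat (Z 0) ** iota (sharp s (A 0)) ** Q 0" using R0 by (simp add: R_def)
    qed
    have BA: "sharp s B ** A' + sharp s A' ** B = 0"
    proof (rule vector_derivative_eventually_eq)
      show "((\<lambda>t. sharp s (A t) ** A t) has_vector_derivative sharp s B ** A' + sharp s A' ** B) (at 0)"
        using mult_vector_derivative[OF dsA dA] by (simp add: B_def)
      show "((\<lambda>t. mat 1 :: real^'n^'n) has_vector_derivative 0) (at 0)" by simp
      show "\<forall>\<^sub>F t in at 0. sharp s (A t) ** A t = mat 1"
        using evR by (auto simp: R_def O_pq_inverse(1)[OF pms] elim!: eventually_mono)
      show "sharp s (A 0) ** A 0 = mat 1" using R0 by (simp add: R_def O_pq_inverse(1)[OF pms])
    qed
    note Bi = O_pq_inverse[OF pms B] and ki = kmat_inverse[OF pms B]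
    define S where "S = sharp s B ** A'"
    have S: "S \<in> so_pq s"
      unfolding so_pq_sharp[OF pms] S_def sharp_mult[OF pms] sharp_sharp[OF pms] using BA by (simp add: add_eq_0_iff)
    have BS: "B ** S ** sharp s B = A' ** sharp s B"
      unfolding S_def by (simp add: matrix_mul_assoc Bi(2))
    have BS': "B ** sharp s A' = - (A' ** sharp s B)"
    proof -
      have "sharp s A' = - S ** sharp s B"
      proof -
        have "sharp s A' ** B = - S" using BA unfolding S_def by (simp add: add_eq_0_iff2)
        then have "sharp s A' ** (B ** sharp s B) = - S ** sharp s B" by (metis matrix_mul_assoc)
        then show ?thesis by (simp add: Bi(2))
      qed
      then have "B ** sharp s A' = - (B ** S ** sharp s B)" by (simp add: matrix_distribs matrix_mul_assoc)
      then show ?thesis unfolding BS .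
    qed
    have f0G: "f 0 \<in> O_pq d" unfolding f0 d_def
      using g hG kmat_G[OF sig c B] pmd unfolding d_def by (intro O_pq_mult) auto
    have sk: "sharp d (kmat B) = kmat (sharp s B)"
      unfolding d_def kmat_transpose using c by (auto simp: kmat_def)
    define X' where "X' = sharp d h ** X ** h"
    have X'g: "X' \<in> g_alg c s"
    proof -
      have hs: "sharp d h \<in> O_pq d" by (rule O_pq_inverse(4)[OF pmd hG])
      have "sharp d h ** X ** sharp d (sharp d h) \<in> so_pq d" by (rule so_pq_conj[OF pmd hs Xs])
      then have "sharp d h ** X ** h \<in> so_pq d" unfolding sharp_sharp[OF pmd] .
      then show ?thesis unfolding X'_def g_alg_iff[OF sig c] d_def .
    qed
    have gi: "sharp d g ** g = mat 1" "sharp d h ** h = mat 1" using O_pq_inverse(1)[OF pmd g] O_pq_inverse(1)[OF pmd hG] by auto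
    have gc: "M ** sharp d g ** g = M" "M ** sharp d h ** h = M" for M
      using gi by (simp_all flip: matrix_mul_assoc)
    have inv_f: "matrix_inv (f 0) ** f' = kmat (sharp s B) ** X' ** kmat B + kblk S"
    proof -
      have "matrix_inv (f 0) = kmat (sharp s B) ** sharp d h ** sharp d g"
        unfolding O_pq_inverse(3)[OF pmd f0G] unfolding f0 sharp_mult[OF pmd] sk by (simp add: matrix_mul_assoc)
      then show ?thesis unfolding f' X'_def S_def
        by (simp add: matrix_distribs matrix_mul_assoc gc kblk_mult add.commute)
    qed
    have al': "\<alpha>' (kmat (sharp s B) ** X' ** kmat B + kblk S) = iota (sharp s B) ** \<alpha>' X' ** iota B + iota' S"
    proof -
      note e = ext'[unfolded CR_extension_def]
      note add = e[THEN conjunct2, THEN conjunct1, rule_format]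
      note equi = e[THEN conjunct2, THEN conjunct2, THEN conjunct2, THEN conjunct1, rule_format]
      note onk = e[THEN conjunct2, THEN conjunct2, THEN conjunct2, THEN conjunct2, THEN conjunct1, rule_format]
      have mi: "matrix_inv (kmat (sharp s B)) = kmat B" "matrix_inv (iota (sharp s B)) = iota B"
        using kmat_inverse[OF pms Bi(4)] by (simp_all add: sharp_sharp[OF pms])
      have k1: "kmat (sharp s B) ** X' ** kmat B \<in> g_alg c s"
        using gconj_coords(1)[OF X'g sig c Bi(4)] by (simp add: mi)
      have k2: "kblk S \<in> g_alg c s" unfolding kblk_gmat[of _ c s] g_alg_def using S by blast
      show ?thesis
        unfolding add[OF k1 k2] unfolding kblk_gmat[of S c s] unfolding onk[OF S] using equi[OF Bi(4) X'g] by (simp add: mi)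
    qed
    have u0P: "u 0 \<in> P_cover s" unfolding u0
      by (intro P_cover_mult[OF pms] mat_P_cover[OF pms z] iota_P_cover(2)[OF pms Bi(4)] V U)
    have us: "usharp s (u 0) = usharp s U ** usharp s V ** iota B ** mat (cnj z)"
      unfolding u0 usharp_mult[OF pms] iota_P_cover(1)[OF pms Bi(4)] sharp_sharp[OF pms] usharp_mat[OF pms] by (simp add: matrix_mul_assoc)
    have zz: "mat (cnj z) ** mat z = (mat 1 :: 'n lmatrix)"
      using z complex_norm_square[of z] by (simp add: mat_mult_mat mult.commute)
    have rel': "\<alpha>' X' ** V = V ** \<alpha> X" unfolding X'_def d_def by (rule rel[OF X])
    have Vi: "M ** usharp s V ** V = M" for M using P_cover_inverse(1)[OF pms V] by (simp flip: matrix_mul_assoc)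
    have Ui: "M ** usharp s U ** U = M" for M using P_cover_inverse(1)[OF pms U] by (simp flip: matrix_mul_assoc)
    have "matrix_inv (u 0) ** \<alpha>' (matrix_inv (f 0) ** f') ** u 0 + matrix_inv (u 0) ** u'
       = matrix_inv U ** \<alpha> X ** U + Y + mat (cnj z * Z')"
    proof -
      define us0 where "us0 = usharp s U ** usharp s V"
      have conj: "matrix_inv (u 0) ** M ** u 0 = us0 ** (iota B ** M ** iota (sharp s B)) ** (V ** U)" for M
      proof -
        have "matrix_inv (u 0) ** M ** u 0 = us0 ** iota B ** (mat (cnj z) ** (M ** mat z)) ** iota (sharp s B) ** (V ** U)"
          unfolding P_cover_inverse(3)[OF pms u0P] unfolding us unfolding u0 us0_def by (simp add: matrix_mul_assoc)
        also have "mat (cnj z) ** (M ** mat z) = M"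
          using zz by (simp add: mat_commute[of z, symmetric] matrix_mul_assoc)
        finally show ?thesis by (simp add: matrix_mul_assoc)
      qed
      have t1: "iota B ** (iota (sharp s B) ** \<alpha>' X' ** iota B + iota' S) ** iota (sharp s B) = \<alpha>' X' + iota' (A' ** sharp s B)"
      proof -
        have ii: "iota B ** iota (sharp s B) = mat 1" "\<And>M. M ** iota B ** iota (sharp s B) = M"
          using ki by (simp_all flip: matrix_mul_assoc)
        show ?thesis by (simp add: matrix_distribs matrix_mul_assoc ii kblk_mult BS)
      qed
      have p1: "matrix_inv (u 0) ** \<alpha>' (matrix_inv (f 0) ** f') ** u 0 = usharp s U ** \<alpha> X ** U + us0 ** iota' (A' ** sharp s B) ** (V ** U)"
      proof -
        have "us0 ** \<alpha>' X' ** (V ** U) = usharp s U ** usharp s V ** (\<alpha>' X' ** V) ** U" by (simp add: us0_def matrix_mul_assoc)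
        also have "\<dots> = usharp s U ** \<alpha> X ** U" unfolding rel' by (simp add: matrix_mul_assoc Vi)
        finally show ?thesis unfolding inv_f al' conj t1 by (simp add: matrix_distribs)
      qed
      have q: "matrix_inv (u 0) ** (mat w ** M ** N) = mat (cnj z * w) ** us0 ** (iota B ** M) ** N" for w M N
      proof -
        have "matrix_inv (u 0) ** (mat w ** M ** N) = us0 ** iota B ** (mat (cnj z) ** mat w) ** M ** N"
          unfolding P_cover_inverse(3)[OF pms u0P] unfolding us us0_def by (simp add: matrix_mul_assoc)
        also have "\<dots> = mat (cnj z * w) ** us0 ** (iota B ** M) ** N"
          unfolding mat_mult_mat using mat_commute[of "cnj z * w" "us0 ** iota B"] by (simp add: matrix_mul_assoc)
        finally show ?thesis .
      qed
      have zz': "mat (cnj z * z) = (mat 1 :: 'n lmatrix)" using zz by (simp add: mat_mult_mat)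
      have one: "us0 ** (V ** U) = mat 1"
        unfolding us0_def using P_cover_inverse(1)[OF pms U] by (simp add: matrix_mul_assoc Vi)
      have p2: "matrix_inv (u 0) ** u' = Y - us0 ** iota' (A' ** sharp s B) ** (V ** U) + mat (cnj z * Z')"
      proof -
        have "matrix_inv (u 0) ** u' = us0 ** (V ** (U ** Y)) + (us0 ** (iota' (B ** sharp s A')) ** (V ** U) + mat (cnj z * Z') ** us0 ** (V ** U))"
          unfolding u' matrix_distribs q zz' kblk_mult using ki by simp
        also have "us0 ** (V ** (U ** Y)) = Y" using one by (metis matrix_mul_assoc matrix_mul_lid)
        also have "mat (cnj z * Z') ** us0 ** (V ** U) = mat (cnj z * Z')" using one by (simp flip: matrix_mul_assoc)
        also have "iota' (B ** sharp s A') = - iota' (A' ** sharp s B)"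
          unfolding BS' by (simp add: iota'_def vec_eq_iff all_lidx)
        finally show ?thesis by (simp add: matrix_distribs)
      qed
      show ?thesis unfolding p1 p2 P_cover_inverse(3)[OF pms U] by simp
    qed
    then have "trace_free (matrix_inv (u 0) ** \<alpha>' (matrix_inv (f 0) ** f') ** u 0 + matrix_inv (u 0) ** u') = trace_free (matrix_inv U ** \<alpha> X ** U + Y)"
      by (simp add: trace_free_add_mat)
    moreover have "F y = (f 0, u 0)" by (simp add: f_def u_def \<gamma>0)
    moreover have "frechet_derivative F (at y) v = (f', u')" by (simp add: f'_def u'_def)
    moreover have "matrix_inv g ** (g ** X) = X" "matrix_inv U ** (U ** Y) = Y"
      using O_pq_inverse[OF pmd g] P_cover_inverse[OF pms U] by (simp_all add: matrix_mul_assoc)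
    ultimately show "cartan_form \<alpha>' (F y) (frechet_derivative F (at y) v) = cartan_form \<alpha> y v"
      unfolding cartan_form_def yg vv by simp
  qed
  then show ?thesis unfolding equivalent_extensions_def using bm by blast
qed


definition hm :: "real \<Rightarrow> real \<Rightarrow> real \<Rightarrow> real \<Rightarrow> 'n::finite gmatrix" where
  "hm c p q \<delta> = gblocks p q 0 (- \<delta> * c * q) (\<delta> * p) 0 0 0 (mat 1)"

definition tw :: "real \<Rightarrow> real \<Rightarrow> real \<Rightarrow> real \<Rightarrow> complex^'n \<Rightarrow> complex^'n" where
  "tw c p q \<delta> X = (\<chi> k. Complex (p * Re (X $ k) - \<delta> * c * q * Im (X $ k)) (q * Re (X $ k) + \<delta> * p * Im (X $ k)))"

lemma tw_nth [simp]: "tw c p q \<delta> X $ k = Complex (p * Re (X $ k) - \<delta> * c * q * Im (X $ k)) (q * Re (X $ k) + \<delta> * p * Im (X $ k))"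
  by (simp add: tw_def)

lemma hm_G:
  assumes sig: "signature s p0 q0" and c: "c = 1 \<or> c = -1" and \<delta>: "\<delta> = 1 \<or> \<delta> = -1" and pq: "p * p + c * (q * q) = 1"
  shows "hm c p q \<delta> \<in> O_pq (gform c s :: 'n::finite gidx \<Rightarrow> real)"
proof -
  have ss: "s i * s i = 1" for i by (rule s_square[OF sig])
  have "sharp (gform c s) (hm c p q \<delta>) ** hm c p q \<delta> = (mat 1 :: 'n gmatrix)"
    unfolding vec_eq_iff all_gidx matrix_mult_nth sum_gidx sharp_nth
    using c \<delta> pq ss by (auto simp: hm_def mat_nth algebra_simps if_distrib[of "\<lambda>x. _ * x"] cong: if_cong)
  then show ?thesis unfolding O_pq_sharp[OF gform_pm[OF sig c]] .
qed

lemma hm_commute: "hm c p q \<delta> ** kmat A = kmat A ** hm c p q \<delta>"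
  unfolding vec_eq_iff all_gidx matrix_mult_nth sum_gidx
  by (simp add: hm_def mat_nth if_distrib[of "\<lambda>x. x * _"] if_distrib[of "\<lambda>x. _ * x"] cong: if_cong)

lemma hm_conj:
  assumes sig: "signature s p0 q0" and c: "c = 1 \<or> c = -1" and \<delta>: "\<delta> = 1 \<or> \<delta> = -1" and pq: "p * p + c * (q * q) = 1"
    and X: "X \<in> g_alg c s"
  defines "X' \<equiv> sharp (gform c s) (hm c p q \<delta>) ** X ** hm c p q \<delta>"
  shows "X' \<in> g_alg c s" "ga X' = \<delta> * ga X" "gX X' = tw c p q \<delta> (gX X)" "gA X' = gA (X :: 'n::finite gmatrix)"
proof -
  have hG: "hm c p q \<delta> \<in> O_pq (gform c s :: 'n gidx \<Rightarrow> real)" by (rule hm_G[OF sig c \<delta> pq])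
  have pm: "pm_one (gform c s :: 'n gidx \<Rightarrow> real)" by (rule gform_pm[OF sig c])
  have "sharp (gform c s) (hm c p q \<delta>) ** X ** sharp (gform c s) (sharp (gform c s) (hm c p q \<delta>)) \<in> so_pq (gform c s)"
    by (rule so_pq_conj[OF pm O_pq_inverse(4)[OF pm hG]]) (use X g_alg_iff[OF sig c] in blast)
  then show "X' \<in> g_alg c s" unfolding X'_def sharp_sharp[OF pm] g_alg_iff[OF sig c] .
  have ss: "s i * (s i * x) = x" for i x using s_square[OF sig, of i] by (metis mult.assoc mult_1)
  have hc: "hm c p q \<delta> $ Inl u $ Inl u' = p" "hm c p q \<delta> $ Inl u $ Inr (Inl u') = q" "hm c p q \<delta> $ Inl u $ Inr (Inr k) = 0"
    "hm c p q \<delta> $ Inr (Inl u) $ Inl u' = - \<delta> * c * q" "hm c p q \<delta> $ Inr (Inl u) $ Inr (Inl u') = \<delta> * p" "hm c p q \<delta> $ Inr (Inl u) $ Inr (Inr k) = 0"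
    "hm c p q \<delta> $ Inr (Inr l) $ Inl u' = 0" "hm c p q \<delta> $ Inr (Inr l) $ Inr (Inl u') = 0" "hm c p q \<delta> $ Inr (Inr l) $ Inr (Inr k) = (if l = k then 1 else 0)"
    for u u' :: unit and k l :: 'n
    by (simp_all add: hm_def mat_nth)
  note ex = matrix_mult_nth sum_gidx sharp_nth hc g_alg_nth[OF X] gform_simps
  show "ga X' = \<delta> * ga X"
  proof -
    have "ga X' = ga X * \<delta> * (p * p + c * (q * q)) * (if \<delta> * \<delta> = 1 then 1 else 1)"
      unfolding X'_def ga_def[of "_ ** _"] ex using c \<delta> by (auto simp: algebra_simps)
    then show ?thesis unfolding pq by simp
  qed
  show "gX X' = tw c p q \<delta> (gX X)"
    unfolding X'_def gX_def[of "_ ** _"] vec_eq_iff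
    by (simp add: ex ss complex_eq_iff if_distrib[of "\<lambda>x. x * _"] if_distrib[of "\<lambda>x. _ * x"] algebra_simps cong: if_cong)
  show "gA X' = gA X"
    unfolding X'_def gA_def[of "_ ** _"] vec_eq_iff
    using ss by (simp add: ex if_distrib[of "\<lambda>x. x * _"] if_distrib[of "\<lambda>x. _ * x"] algebra_simps cong: if_cong)
qed

definition vm :: "complex \<Rightarrow> real \<Rightarrow> 'n::finite lmatrix" where
  "vm l r = lblocks l 0 (\<i> * of_real r * l) 0 (mat 1) 0 0 0 (1 / cnj l)"

lemma vm_nth [simp]: 
  "vm l r $ Inl u $ Inl u' = l" "vm l r $ Inl u $ Inr (Inl k) = 0" "vm l r $ Inl u $ Inr (Inr u') = \<i> * of_real r * l"
  "vm l r $ Inr (Inl i) $ Inl u' = 0" "vm l r $ Inr (Inl i) $ Inr (Inl k) = (if i = k then 1 else 0)" "vm l r $ Inr (Inl i) $ Inr (Inr u') = 0"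
  "vm l r $ Inr (Inr u) $ Inl u' = 0" "vm l r $ Inr (Inr u) $ Inr (Inl k) = 0" "vm l r $ Inr (Inr u) $ Inr (Inr u') = 1 / cnj l"
  by (simp_all add: vm_def mat_nth)

lemma vm_P_cover: assumes "l \<noteq> 0" shows "vm l r \<in> P_cover s"
proof -
  have "adjoint_mat (vm l r) ** herm s ** vm l r = herm s"
    using assms unfolding vec_eq_iff all_lidx matrix_mult_nth sum_lidx adjoint_mat_def
    by (simp add: if_distrib[of "\<lambda>x. x * _"] if_distrib[of "\<lambda>x. _ * x"] if_distrib[of cnj] cong: if_cong)
  then show ?thesis by (simp add: P_cover_def all_lidx)
qed

lemma vm_commute: "vm l r ** iota A = iota A ** vm l r"
  unfolding vec_eq_iff all_lidx matrix_mult_nth sum_lidx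
  by (simp add: if_distrib[of "\<lambda>x. x * _"] if_distrib[of "\<lambda>x. _ * x"] cong: if_cong)

lemma vm_relation:
  assumes M: "M \<in> u_alg s" and M': "M' \<in> u_alg s" and l: "l \<noteq> 0"
    and z: "zc M' = zc M - of_real (r * xic M)" and x: "xc M' = (1 / l) *s xc M" and A: "Ac M' = Ac M"
    and y: "yc M' = cnj l *s (yc M - (\<i> * of_real r) *s xc M)" and xi: "(cmod l)\<^sup>2 * xic M' = xic M"
    and eta: "etac M' = (cmod l)\<^sup>2 * (etac M - r * (2 * Re (zc M) - r * xic M))"
  shows "M' ** vm l r = vm l r ** M"
proof -
  have xi': "l * cnj l * of_real (xic M') = of_real (xic M)"
    unfolding xi[symmetric] of_real_mult complex_norm_square ..
  have eta': "complex_of_real (etac M') = l * cnj l * of_real (etac M - r * (2 * Re (zc M) - r * xic M))"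
    unfolding eta of_real_mult complex_norm_square ..
  have eta2: "complex_of_real (etac M') = l * cnj l * (of_real (etac M) - of_real r * (zc M + cnj (zc M) - of_real r * of_real (xic M)))"
    unfolding eta' by (simp add: complex_eq_iff)
  have xz: "of_real (xic M') * l = of_real (xic M) / cnj l"
  proof -
    have "of_real (xic M') * l = (l * cnj l * of_real (xic M')) / cnj l" using l by simp
    then show ?thesis unfolding xi' .
  qed
  then have xz1: "l * of_real (xic M') = of_real (xic M) / cnj l" by (simp add: mult.commute)
  have xz2: "l * (w * of_real (xic M')) = w * of_real (xic M) / cnj l" for w
    using arg_cong[OF xz1, of "\<lambda>x. w * x"] by (simp add: mult_ac)
  have "lel s (zc M') (xc M') (Ac M') (yc M') (xic M') (etac M') ** vm l r = vm l r ** lel s (zc M) (xc M) (Ac M) (yc M) (xic M) (etac M)"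
    unfolding vec_eq_iff all_lidx matrix_mult_nth sum_lidx lel_def z x A y eta2 using l
    by (simp add: if_distrib[of "\<lambda>x. x * _"] if_distrib[of "\<lambda>x. _ * x"] algebra_simps add_divide_distrib diff_divide_distrib
       sum_subtractf sum_negf sum_divide_distrib[symmetric] xz1 xz2 cong: if_cong)
  then show ?thesis unfolding lel_collapse[OF M] lel_collapse[OF M'] .
qed


context ext_data begin

lemma ncond_y:
  assumes ncond
  shows "d1 *s X - (d2 * \<i>) *s cnj_vec X = (\<i> / (2 * of_real \<beta>)) *s (\<gamma> *s xx X + xx (Rc c X))"
proof -
  have "la1 = 0" by (rule ncond_simps(2)[OF assms])
  then have "2 * \<i> * of_real \<beta> * \<mu> = - (\<gamma> + \<i> * of_real \<sigma>)" unfolding la1_def by algebra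
  then have "(- \<i> / (2 * of_real \<beta>)) * (2 * \<i> * of_real \<beta> * \<mu>) = (- \<i> / (2 * of_real \<beta>)) * (- (\<gamma> + \<i> * of_real \<sigma>))"
    by (simp only:)
  moreover have "(- \<i> / (2 * of_real \<beta>)) * (- w) = (\<i> / (2 * of_real \<beta>)) * w" for w by simp
  moreover have "(- \<i> / (2 * of_real \<beta>)) * (2 * \<i> * of_real \<beta> * \<mu>) = \<mu>" using \<beta>0 by (simp add: field_simps)
  ultimately have mu: "\<mu> = (\<i> / (2 * of_real \<beta>)) * (\<gamma> + \<i> * of_real \<sigma>)" by metis
  have nu: "\<nu> = (\<i> / (2 * of_real \<beta>)) * k" using assms unfolding ncond_def by simp
  show ?thesis unfolding y_eq J_eq
    by (simp add: vec_eq_iff mu nu ring_distribs mult.assoc)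
qed

lemma ncond_e1:
  assumes ncond
  shows "e1 = ((Re c1)\<^sup>2 + (Im c1)\<^sup>2 - \<sigma>\<^sup>2 + c) / (2 * \<beta>)" "Im c1 = - n * \<sigma> / (2 * (n + 1))"
proof -
  have nc: "Im c1 = - n * \<sigma> / (2 * (n + 1))" "Im \<mu> = Re c1 / (2 * \<beta>)" "Re \<mu> = - n * \<sigma> / (4 * \<beta> * (n + 1))"
    using assms unfolding ncond_def by blast+
  show "Im c1 = - n * \<sigma> / (2 * (n + 1))" by (rule nc)
  have n1: "n + 1 \<noteq> 0" using n0 by linarith
  have "- n * \<sigma> / (4 * \<beta> * w) = (- n * \<sigma> / (2 * w)) / (2 * \<beta>)" for w by simp
  then have Re: "Re \<mu> = Im c1 / (2 * \<beta>)" unfolding nc(1,3) .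
  have "\<epsilon> = 0" by (rule ncond_simps(8)[OF assms])
  then have e: "e1 / \<beta> = 2 * ((cmod \<mu>)\<^sup>2 - (cmod \<nu>)\<^sup>2)" unfolding \<epsilon>_def by simp
  have nu: "(cmod \<nu>)\<^sup>2 = (\<sigma>\<^sup>2 - c) / (4 * \<beta>\<^sup>2)"
    unfolding ncond_simps(10)[OF assms] power_divide k_def kk_norm[OF b c] \<sigma>_def by (simp add: power_mult_distrib)
  have "e1 = \<beta> * (2 * ((Im c1)\<^sup>2 / (4 * \<beta>\<^sup>2) + (Re c1)\<^sup>2 / (4 * \<beta>\<^sup>2) - (\<sigma>\<^sup>2 - c) / (4 * \<beta>\<^sup>2)))"
    using e \<beta>0 unfolding nu unfolding cmod_power2 Re nc(2) by (simp add: power_divide power_mult_distrib divide_eq_eq mult.commute)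
  also have "\<dots> = ((Re c1)\<^sup>2 + (Im c1)\<^sup>2 - \<sigma>\<^sup>2 + c) / (2 * \<beta>)"
    using \<beta>0 by (simp add: power2_eq_square field_simps)
  finally show "e1 = ((Re c1)\<^sup>2 + (Im c1)\<^sup>2 - \<sigma>\<^sup>2 + c) / (2 * \<beta>)" .
qed

end

lemma Rc_tw:
  assumes "c = 1 \<or> c = -1" "\<delta> = 1 \<or> \<delta> = -1"
  shows "Rc c (tw c p q \<delta> X) = \<delta> *\<^sub>R tw c p q \<delta> (Rc c X)"
  using assms by (auto simp: vec_eq_iff complex_eq_iff algebra_simps)

lemma equivalence_of_normal:
  fixes s :: "'n::finite \<Rightarrow> real"
  assumes E: "ext_data c s p0 q0 b1 b2" and E': "ext_data c s p0 q0 b1' b2'"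
    and nc: "ext_data.ncond TYPE('n) c b1 b2 c1 d1 d2 e1" and nc': "ext_data.ncond TYPE('n) c b1' b2' c1' d1' d2' e1'"
    and ag: "\<forall>X\<in>g_alg c s. \<alpha> X = extf s b1 b2 c1 d1 d2 e1 X" and ag': "\<forall>X\<in>g_alg c s. \<alpha>' X = extf s b1' b2' c1' d1' d2' e1' X"
    and \<delta>: "\<delta> = 1 \<or> \<delta> = -1" and pq: "p * p + c * (q * q) = 1" and l: "l \<noteq> 0"
    and hx: "\<And>w. b1' * Complex (p * Re w - \<delta> * c * q * Im w) (q * Re w + \<delta> * p * Im w)
         - b2' * \<i> * cnj (Complex (p * Re w - \<delta> * c * q * Im w) (q * Re w + \<delta> * p * Im w)) = (b1 * w - b2 * \<i> * cnj w) / l"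
    and hb: "(cmod l)\<^sup>2 * bb b1' b2' = \<delta> * bb b1 b2" and hs: "sg c b1' b2' = \<delta> * sg c b1 b2"
  shows "equivalent_extensions c s \<alpha> \<alpha>'"
proof -
  interpret E: ext_data c s p0 q0 b1 b2 c1 d1 d2 e1 by (rule E)
  interpret E': ext_data c s p0 q0 b1' b2' c1' d1' d2' e1' by (rule E')
  note sig = E.sig and c = E.c
  note y = E.ncond_y[OF nc] and y' = E'.ncond_y[OF nc'] and e = E.ncond_e1[OF nc] and e' = E'.ncond_e1[OF nc']
  define r where "r = (Re c1 - \<delta> * Re c1') / (2 * E.\<beta>)"
  have b0: "E.\<beta> \<noteq> 0" "E'.\<beta> \<noteq> 0" by (rule E.\<beta>0 E'.\<beta>0)+
  have dd: "\<delta> * \<delta> = 1" using \<delta> by auto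
  have hs': "E'.\<sigma> = \<delta> * E.\<sigma>" using hs by (simp add: E.\<sigma>_def E'.\<sigma>_def)
  have hb': "(cmod l)\<^sup>2 * E'.\<beta> = \<delta> * E.\<beta>" using hb by (simp add: E.\<beta>_def E'.\<beta>_def)
  have l2: "(cmod l)\<^sup>2 > 0" using l by simp
  have ib: "1 / E'.\<beta> = \<delta> * (cmod l)\<^sup>2 / E.\<beta>"
  proof -
    have "E.\<beta> = \<delta> * ((cmod l)\<^sup>2 * E'.\<beta>)" unfolding hb' using dd by (simp flip: mult.assoc)
    then have "E.\<beta> * 1 = \<delta> * (cmod l)\<^sup>2 * E'.\<beta>" by simp
    then show ?thesis using b0 by (simp add: divide_eq_eq eq_divide_eq)
  qed
  have Im: "\<delta> * Im c1' = Im c1" unfolding e(2) e'(2) hs' using dd by (simp add: mult_ac) 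
  have Re: "\<delta> * Re c1' = Re c1 - 2 * r * E.\<beta>"
  proof -
    have "2 * (x / (2 * E.\<beta>)) * E.\<beta> = x" for x using b0 by simp
    then have "2 * r * E.\<beta> = Re c1 - \<delta> * Re c1'" unfolding r_def .
    then show ?thesis by linarith
  qed
  have xt: "E'.xx (tw c p q \<delta> X) = (1 / l) *s E.xx X" for X
    using hx by (simp add: vec_eq_iff)
  have "\<alpha>' (sharp (gform c s) (hm c p q \<delta>) ** X ** hm c p q \<delta>) ** vm l r = vm l r ** \<alpha> X" if X: "X \<in> g_alg c s" for X
  proof -
    note hc = hm_conj[OF sig c \<delta> pq X]
    have MM: "\<alpha> X = E.\<alpha>0 X" "\<alpha>' (sharp (gform c s) (hm c p q \<delta>) ** X ** hm c p q \<delta>) = E'.\<alpha>0 (sharp (gform c s) (hm c p q \<delta>) ** X ** hm c p q \<delta>)"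
      using ag ag' X hc(1) by blast+
    show ?thesis unfolding MM
    proof (rule vm_relation[OF extf_u_alg[OF X] extf_u_alg[OF hc(1)] l], unfold extf_coords hc)
      show "c1' * of_real (\<delta> * ga X) = c1 * of_real (ga X) - of_real (r * (2 * bb b1 b2 * ga X))"
        using arg_cong[OF Re, of "\<lambda>x. x * ga X"] arg_cong[OF Im, of "\<lambda>x. x * ga X"]
        by (simp add: complex_eq_iff E.\<beta>_def algebra_simps)
      show "E'.xx (tw c p q \<delta> (gX X)) = (1 / l) *s E.xx (gX X)" by (rule xt)
      show "cplx (gA X) - mat (of_real (2 * Im c1' / of_nat CARD('n) * (\<delta> * ga X)) * \<i>) = cplx (gA X) - mat (of_real (2 * Im c1 / of_nat CARD('n) * ga X) * \<i>)"
        unfolding Im[symmetric] by (simp add: mult_ac)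
      show "(cmod l)\<^sup>2 * (2 * bb b1' b2' * (\<delta> * ga X)) = 2 * bb b1 b2 * ga X"
        using hb dd by (metis (no_types, opaque_lifting) mult.assoc mult.left_commute mult_1)
      show "e1' * (\<delta> * ga X) = (cmod l)\<^sup>2 * (e1 * ga X - r * (2 * Re (c1 * of_real (ga X)) - r * (2 * bb b1 b2 * ga X)))"
      proof -
        have sq: "(Re c1')\<^sup>2 = (Re c1 - 2 * r * E.\<beta>)\<^sup>2" "(Im c1')\<^sup>2 = (Im c1)\<^sup>2" "E'.\<sigma>\<^sup>2 = E.\<sigma>\<^sup>2"
          unfolding Re[symmetric] Im[symmetric] hs' using dd by (simp_all add: power_mult_distrib power2_eq_square)
        define K where "K = (Im c1)\<^sup>2 - E.\<sigma>\<^sup>2 + c"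
        have "e1' = ((Re c1 - 2 * r * E.\<beta>)\<^sup>2 + K) / (2 * E'.\<beta>)"
          unfolding e'(1) sq K_def by (rule arg_cong[where f = "\<lambda>x. x / (2 * E'.\<beta>)"]) simp
        then have "e1' * \<delta> = ((Re c1 - 2 * r * E.\<beta>)\<^sup>2 + K) * (\<delta> * (1 / E'.\<beta>)) / 2" by simp
        also have "\<delta> * (1 / E'.\<beta>) = (cmod l)\<^sup>2 / E.\<beta>" unfolding ib using dd by (simp flip: mult.assoc)
        also have "((Re c1 - 2 * r * E.\<beta>)\<^sup>2 + K) * ((cmod l)\<^sup>2 / E.\<beta>) / 2 = (cmod l)\<^sup>2 * (((Re c1)\<^sup>2 + K) / (2 * E.\<beta>) - r * (2 * Re c1 - r * (2 * E.\<beta>)))"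
          using b0 by (simp add: power2_eq_square field_simps)
        also have "((Re c1)\<^sup>2 + K) / (2 * E.\<beta>) = e1" unfolding e(1) K_def by (simp add: algebra_simps)
        finally have "e1' * (\<delta> * ga X) = (cmod l)\<^sup>2 * (e1 - r * (2 * Re c1 - r * (2 * E.\<beta>))) * ga X"
          by (simp flip: mult.assoc)
        then show ?thesis by (simp add: E.\<beta>_def algebra_simps)
      qed
      show "d1' *s tw c p q \<delta> (gX X) - (d2' * \<i>) *s cnj_vec (tw c p q \<delta> (gX X)) =
         cnj l *s (d1 *s gX X - (d2 * \<i>) *s cnj_vec (gX X) - (\<i> * of_real r) *s E.xx (gX X))"
      proof -
        have g: "of_real \<delta> * E'.\<gamma> = E.\<gamma> - 2 * of_real r * of_real E.\<beta>"
          using Re arg_cong[OF Im, of "\<lambda>x. x * 2 / real CARD('n)"] Im unfolding E.\<gamma>_def E'.\<gamma>_def E.n_def E'.n_def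
          by (simp add: complex_eq_iff algebra_simps)
        have lc: "of_real ((cmod l)\<^sup>2) / l = cnj l" unfolding complex_norm_square using l by simp
        have fac: "\<i> / (2 * of_real E'.\<beta>) = of_real \<delta> * of_real ((cmod l)\<^sup>2) * (\<i> / (2 * of_real E.\<beta>))"
        proof -
          have "\<i> / (2 * of_real E'.\<beta>) = \<i> / 2 * of_real (1 / E'.\<beta>)" by simp
          then show ?thesis unfolding ib by simp
        qed
        have "d1' *s tw c p q \<delta> (gX X) - (d2' * \<i>) *s cnj_vec (tw c p q \<delta> (gX X))
           = (\<i> / (2 * of_real E'.\<beta>)) *s (E'.\<gamma> *s ((1 / l) *s E.xx (gX X)) + \<delta> *\<^sub>R ((1 / l) *s E.xx (Rc c (gX X))))"
          unfolding y' xt Rc_tw[OF c \<delta>] xof_add(3) ..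
        also have "\<dots> = (of_real ((cmod l)\<^sup>2) / l) *s ((\<i> / (2 * of_real E.\<beta>)) *s ((of_real \<delta> * E'.\<gamma>) *s E.xx (gX X) + (of_real (\<delta> * \<delta>)) *s E.xx (Rc c (gX X))))"
          unfolding fac by (simp add: vec_eq_iff scaleR_conv_of_real[where 'a=complex] ring_distribs mult_ac)
        also have "\<dots> = cnj l *s ((\<i> / (2 * of_real E.\<beta>)) *s (E.\<gamma> *s E.xx (gX X) + E.xx (Rc c (gX X))) - (\<i> * of_real r) *s E.xx (gX X))"
          unfolding lc g dd using b0 by (simp add: vec_eq_iff field_simps)
        finally show ?thesis unfolding y .
      qed
    qed
  qed
  then show ?thesis
    by (intro equivalence_by_conjugation[OF sig c E'.extf_CR_extension[OF ag'] hm_G[OF sig c \<delta> pq] hm_commute vm_P_cover[OF l] vm_commute])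
qed

lemma normal_coefficients_exist:
  fixes s :: "'n::finite \<Rightarrow> real"
  assumes E: "ext_data c s p0 q0 b1 b2"
  shows "\<exists>c1 d1 d2 e1. ext_data.ncond TYPE('n) c b1 b2 c1 d1 d2 e1"
proof -
  interpret B: ext_data c s p0 q0 b1 b2 0 0 0 0 by (rule E)
  define c1 where "c1 = \<i> * of_real (- B.n * B.\<sigma> / (2 * (B.n + 1)))"
  define m v where "m = complex_of_real (- B.n * B.\<sigma> / (4 * B.\<beta> * (B.n + 1)))" and "v = \<i> * B.k / (2 * of_real B.\<beta>)"
  define d1 d2 where "d1 = m * b1 + \<i> * v * cnj b2" and "d2 = m * b2 + \<i> * v * cnj b1"
  interpret D: ext_data c s p0 q0 b1 b2 c1 d1 d2 0 by (rule E)
  define e1 where "e1 = - (D.\<epsilon> + 2 * Im D.m1 / D.\<beta>) * D.\<beta> / 3"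
  interpret F: ext_data c s p0 q0 b1 b2 c1 d1 d2 e1 by (rule E)
  have b: "b1 * cnj b1 - b2 * cnj b2 = of_real B.\<beta>" by (simp add: B.\<beta>_def bb_cnj)
  have mu: "F.\<mu> = m"
  proof -
    have "d1 * cnj b1 - d2 * cnj b2 = m * (b1 * cnj b1 - b2 * cnj b2)" unfolding d1_def d2_def by (simp add: algebra_simps)
    then show ?thesis unfolding F.\<mu>_def b using B.\<beta>0 by simp
  qed
  have nu: "F.\<nu> = v"
  proof -
    have "\<i> * (d1 * b2 - d2 * b1) = v * (b1 * cnj b1 - b2 * cnj b2)" unfolding d1_def d2_def by (simp add: algebra_simps)
    then show ?thesis unfolding F.\<nu>_def b using B.\<beta>0 by simp
  qed
  have "F.\<epsilon> + 2 * Im F.m1 / F.\<beta> = D.\<epsilon> + 2 * Im D.m1 / D.\<beta> + 3 * (e1 / D.\<beta>)"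
    unfolding F.\<epsilon>_def D.\<epsilon>_def F.m1_def D.m1_def divide_inverse
    by (simp add: algebra_simps del: inverse_eq_divide)
  also have "\<dots> = 0"
  proof -
    have "w + 3 * (- w * D.\<beta> / 3 / D.\<beta>) = 0" for w using D.\<beta>0 by simp
    then show ?thesis unfolding e1_def .
  qed
  finally have "F.\<epsilon> + 2 * Im F.m1 / F.\<beta> = 0" .
  then have "F.ncond" unfolding F.ncond_def mu nu by (simp add: c1_def m_def v_def)
  then show ?thesis by blast
qed


lemma normal_data:
  fixes s :: "'n::finite \<Rightarrow> real"
  assumes sig: "signature s p q" and c: "c = 1 \<or> c = -1" and r: "regular_normal_extension c s \<alpha>" and h: "has_coefficients c s \<alpha> b1 b2"
  shows "ext_data c s p q b1 b2 \<and> (\<exists>c1 d1 d2 e1. ext_data.ncond TYPE('n) c b1 b2 c1 d1 d2 e1 \<and> (\<forall>X\<in>g_alg c s. \<alpha> X = extf s b1 b2 c1 d1 d2 e1 X))"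
proof -
  obtain c1 d1 d2 e1 where b: "bb b1 b2 \<noteq> 0" and ag: "\<forall>X\<in>g_alg c s. \<alpha> X = extf s b1 b2 c1 d1 d2 e1 X"
    using h unfolding has_coefficients_iff by blast
  interpret E: ext_data c s p q b1 b2 c1 d1 d2 e1 by unfold_locales (rule sig c b)+
  have "E.ncond" using E.rne_iff[OF ag] r by blast
  then show ?thesis using ag E.ext_data_axioms by blast
qed

lemma normal_has_coefficients:
  assumes sig: "signature s p q" and c: "c = 1 \<or> c = -1" and r: "regular_normal_extension c s \<alpha>"
  shows "\<exists>b1 b2. has_coefficients c s \<alpha> b1 b2"
  using CR_extension_form[OF sig c] r unfolding regular_normal_extension_def has_coefficients_iff by blast

lemma normal_exists:
  fixes s :: "'n::finite \<Rightarrow> real"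
  assumes sig: "signature s p q" and c: "c = 1 \<or> c = -1" and b: "bb b1 b2 \<noteq> 0"
  shows "\<exists>\<alpha>. regular_normal_extension c s \<alpha> \<and> has_coefficients c s \<alpha> b1 b2"
proof -
  have E: "ext_data c s p q b1 b2" by unfold_locales (rule sig c b)+
  obtain c1 d1 d2 e1 where nc: "ext_data.ncond TYPE('n) c b1 b2 c1 d1 d2 e1" using normal_coefficients_exist[OF E] by blast
  interpret E: ext_data c s p q b1 b2 c1 d1 d2 e1 by (rule E)
  have "regular_normal_extension c s (extf s b1 b2 c1 d1 d2 e1)" using E.rne_iff nc by blast
  moreover have "has_coefficients c s (extf s b1 b2 c1 d1 d2 e1) b1 b2" unfolding has_coefficients_iff using b by blast
  ultimately show ?thesis by blast
qed

lemma t_param_reflect: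
  assumes "c = 1 \<or> c = -1"
  shows "t_param c (- \<i> * b2) (\<i> * b1) = - t_param c b1 b2" "bb (- \<i> * b2) (\<i> * b1) = - bb b1 b2"
proof -
  have m: "cmod (- \<i> * b2) = cmod b2" "cmod (\<i> * b1) = cmod b1" by (simp_all add: norm_mult)
  have fl: "x / (a - b) = - (x / (b - a))" for x a b :: real by (metis minus_diff_eq minus_divide_right)
  show "bb (- \<i> * b2) (\<i> * b1) = - bb b1 b2" unfolding bb_def m by simp
  show "t_param c (- \<i> * b2) (\<i> * b1) = - t_param c b1 b2"
    unfolding t_param_def m using fl[of "(cmod b2)\<^sup>2 + (cmod b1)\<^sup>2" "(cmod b2)\<^sup>2" "(cmod b1)\<^sup>2"]
      fl[of "Im b2 * Re b1 - Re b2 * Im b1" "(cmod b2)\<^sup>2" "(cmod b1)\<^sup>2"]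
    by (auto simp: algebra_simps)
qed

lemma reflected_extension:
  fixes s :: "'n::finite \<Rightarrow> real"
  assumes sig: "signature s p q" and c: "c = 1 \<or> c = -1" and r: "regular_normal_extension c s \<alpha>" and h: "has_coefficients c s \<alpha> b1 b2"
  shows "\<exists>\<alpha>'. regular_normal_extension c s \<alpha>' \<and> equivalent_extensions c s \<alpha> \<alpha>' \<and> has_coefficients c s \<alpha>' (- \<i> * b2) (\<i> * b1)"
proof -
  have E: "ext_data c s p q b1 b2" using normal_data[OF sig c r h] by blast
  obtain c1 d1 d2 e1 where nc: "ext_data.ncond TYPE('n) c b1 b2 c1 d1 d2 e1" and ag: "\<forall>X\<in>g_alg c s. \<alpha> X = extf s b1 b2 c1 d1 d2 e1 X"
    using normal_data[OF sig c r h] by blast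
  have b: "bb b1 b2 \<noteq> 0" using E by (simp add: ext_data_def)
  note tr = t_param_reflect[OF c, where ?b1.0 = b1 and ?b2.0 = b2]
  have b': "bb (- \<i> * b2) (\<i> * b1) \<noteq> 0" unfolding tr using b by simp
  obtain \<alpha>' where a': "regular_normal_extension c s \<alpha>'" "has_coefficients c s \<alpha>' (- \<i> * b2) (\<i> * b1)"
    using normal_exists[OF sig c b'] by blast
  obtain c1' d1' d2' e1' where nc': "ext_data.ncond TYPE('n) c (- \<i> * b2) (\<i> * b1) c1' d1' d2' e1'"
     and ag': "\<forall>X\<in>g_alg c s. \<alpha>' X = extf s (- \<i> * b2) (\<i> * b1) c1' d1' d2' e1' X" and E': "ext_data c s p q (- \<i> * b2) (\<i> * b1)"
    using normal_data[OF sig c a'] by blast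
  have "equivalent_extensions c s \<alpha> \<alpha>'"
  proof (rule equivalence_of_normal[OF E E' nc nc' ag ag', where \<delta> = "-1" and p = 1 and q = 0 and l = 1])
    show "- \<i> * b2 * Complex (1 * Re w - - 1 * c * 0 * Im w) (0 * Re w + - 1 * 1 * Im w) -
         \<i> * b1 * \<i> * cnj (Complex (1 * Re w - - 1 * c * 0 * Im w) (0 * Re w + - 1 * 1 * Im w)) = (b1 * w - b2 * \<i> * cnj w) / 1" for w
    proof -
      have "Complex (Re w) (- Im w) = cnj w" by (simp add: complex_eq_iff)
      then show ?thesis by (simp add: algebra_simps)
    qed
    show "(cmod 1)\<^sup>2 * bb (- \<i> * b2) (\<i> * b1) = - 1 * bb b1 b2" unfolding tr(2) by simp
    show "sg c (- \<i> * b2) (\<i> * b1) = - 1 * sg c b1 b2" unfolding sg_def tr(1) by simp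
  qed simp_all
  then show ?thesis using a' by blast
qed

lemma equal_parameter_equivalent_pos:
  fixes s :: "'n::finite \<Rightarrow> real"
  assumes sig: "signature s p0 q0" 
    and r: "regular_normal_extension 1 s \<alpha>" and h: "has_coefficients 1 s \<alpha> b1 b2" and t1: "t_param 1 b1 b2 \<ge> 1"
    and r': "regular_normal_extension 1 s \<alpha>'" and h': "has_coefficients 1 s \<alpha>' b1' b2'" 
    and t: "t_param 1 b1 b2 = t_param 1 b1' b2'"
  shows "equivalent_extensions 1 s \<alpha> \<alpha>'"
proof -
  have c: "(1::real) = 1 \<or> (1::real) = -1" by simp
  obtain c1 d1 d2 e1 where nc: "ext_data.ncond TYPE('n) 1 b1 b2 c1 d1 d2 e1" and ag: "\<forall>X\<in>g_alg 1 s. \<alpha> X = extf s b1 b2 c1 d1 d2 e1 X"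
    and E: "ext_data 1 s p0 q0 b1 b2" using normal_data[OF sig c r h] by blast
  obtain c1' d1' d2' e1' where nc': "ext_data.ncond TYPE('n) 1 b1' b2' c1' d1' d2' e1'" and ag': "\<forall>X\<in>g_alg 1 s. \<alpha>' X = extf s b1' b2' c1' d1' d2' e1' X"
    and E': "ext_data 1 s p0 q0 b1' b2'" using normal_data[OF sig c r' h'] by blast
  have b: "bb b1 b2 \<noteq> 0" "bb b1' b2' \<noteq> 0" using E E' by (simp_all add: ext_data_def)
  have pos: "bb x y > 0" if "t_param 1 x y \<ge> 1" for x y
  proof (rule ccontr)
    assume "\<not> bb x y > 0"
    then have "((cmod x)\<^sup>2 + (cmod y)\<^sup>2) / bb x y \<le> 0" by (simp add: divide_nonneg_nonpos)
    then show False using that by (simp add: t_param_def bb_def)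
  qed
  define T where "T = t_param 1 b1 b2"
  have tb: "(cmod x)\<^sup>2 + (cmod y)\<^sup>2 = t_param 1 x y * bb x y" if "bb x y \<noteq> 0" for x y
    using that by (simp add: t_param_def bb_def)
  have P: "bb b1 b2 > 0" "bb b1' b2' > 0" using pos[OF t1] pos[of b1' b2'] t t1 by simp_all
  have half: "(cmod x)\<^sup>2 = (w + 1) / 2 * bb x y" "(cmod y)\<^sup>2 = (w - 1) / 2 * bb x y" if "(cmod x)\<^sup>2 + (cmod y)\<^sup>2 = w * bb x y" for x y w
  proof -
    have "(w + 1) / 2 * bb x y = (w * bb x y + bb x y) / 2" "(w - 1) / 2 * bb x y = (w * bb x y - bb x y) / 2"
      by (simp_all add: algebra_simps)
    then show "(cmod x)\<^sup>2 = (w + 1) / 2 * bb x y" "(cmod y)\<^sup>2 = (w - 1) / 2 * bb x y"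
      unfolding that[symmetric] by (simp_all add: bb_def)
  qed
  have n1: "(cmod b1)\<^sup>2 = (T + 1) / 2 * bb b1 b2" "(cmod b2)\<^sup>2 = (T - 1) / 2 * bb b1 b2"
    using half[OF tb[OF b(1)]] unfolding T_def[symmetric] by simp_all
  have n2: "(cmod b1')\<^sup>2 = (T + 1) / 2 * bb b1' b2'" "(cmod b2')\<^sup>2 = (T - 1) / 2 * bb b1' b2'"
    using half[OF tb[OF b(2)]] unfolding t[symmetric] T_def[symmetric] by simp_all
  have T1: "T \<ge> 1" using t1 by (simp add: T_def)
  have b1nz: "b1 \<noteq> 0" "b1' \<noteq> 0" using n1(1) n2(1) P T1 by auto
  define R where "R = bb b1 b2 / bb b1' b2'"
  have R: "R > 0" "bb b1 b2 = R * bb b1' b2'" using P by (simp_all add: R_def)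
  have nb: "(cmod b1)\<^sup>2 = R * (cmod b1')\<^sup>2" "(cmod b2)\<^sup>2 = R * (cmod b2')\<^sup>2"
    unfolding n1 n2 R(2) by simp_all
  have "\<exists>l u. l \<noteq> 0 \<and> cmod u = 1 \<and> b1 = l * (b1' * u) \<and> b2 = l * (b2' * cnj u)"
  proof (cases "b2' = 0")
    case True
    then have "b2 = 0" using nb(2) by simp
    then show ?thesis using True b1nz by (intro exI[of _ "b1 / b1'"] exI[of _ 1]) simp
  next
    case False
    then have b2nz: "b2 \<noteq> 0" using nb(2) R(1) by auto
    define z where "z = (b1 / b1') * (b2' / b2)"
    define u where "u = csqrt z"
    have u2: "u\<^sup>2 = z" by (simp add: u_def)
    have "(cmod z)\<^sup>2 = 1"
      unfolding z_def using nb b1nz b2nz False R(1) by (simp add: norm_mult norm_divide power_mult_distrib power_divide)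
    then have "(cmod u)\<^sup>2 * (cmod u)\<^sup>2 = 1" unfolding u2[symmetric] by (simp add: norm_power norm_mult power2_eq_square)
    then have cu: "cmod u = 1" by (metis abs_norm_cancel abs_square_eq_1 power2_eq_square norm_ge_zero real_sqrt_abs real_sqrt_one power_one abs_of_nonneg zero_le_square)
    then have u0: "u \<noteq> 0" and uc: "u * cnj u = 1" using complex_norm_square[of u] by auto
    define l where "l = (b1 / b1') * cnj u"
    have "l * (b1' * u) = b1" unfolding l_def using b1nz uc by (simp add: mult_ac)
    moreover have "l * (b2' * cnj u) = b2"
    proof -
      have "z * (cnj u * cnj u) = (u * cnj u) * (u * cnj u)" unfolding u2[symmetric] by (simp add: power2_eq_square mult_ac)
      then have z1: "z * (cnj u * cnj u) = 1" unfolding uc by simp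
      have "l * (b2' * cnj u) = b2 * (z * (cnj u * cnj u))" unfolding l_def z_def using b2nz by simp
      then show ?thesis unfolding z1 by simp
    qed
    moreover have "l \<noteq> 0" unfolding l_def using b1nz u0 by simp
    ultimately show ?thesis using cu by metis
  qed
  then obtain l u where l: "l \<noteq> 0" and u: "cmod u = 1" and lb: "b1 = l * (b1' * u)" "b2 = l * (b2' * cnj u)" by blast
  have uu: "Re u * Re u + 1 * (Im u * Im u) = 1" using u by (simp add: cmod_def power2_eq_square)
  show ?thesis
  proof (rule equivalence_of_normal[OF E E' nc nc' ag ag' _ uu l, where \<delta> = 1])
    fix w
    have "Complex (Re u * Re w - 1 * 1 * Im u * Im w) (Im u * Re w + 1 * Re u * Im w) = u * w"
      by (simp add: complex_eq_iff)
    then show "b1' * Complex (Re u * Re w - 1 * 1 * Im u * Im w) (Im u * Re w + 1 * Re u * Im w) -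
         b2' * \<i> * cnj (Complex (Re u * Re w - 1 * 1 * Im u * Im w) (Im u * Re w + 1 * Re u * Im w)) = (b1 * w - b2 * \<i> * cnj w) / l"
      unfolding lb using l by (simp add: field_simps)
  next
    show "(cmod l)\<^sup>2 * bb b1' b2' = 1 * bb b1 b2"
      unfolding lb bb_def using u by (simp add: norm_mult power_mult_distrib algebra_simps)
  qed (simp_all add: sg_def t)
qed

lemma equal_parameter_equivalent_neg:
  fixes s :: "'n::finite \<Rightarrow> real"
  assumes sig: "signature s p0 q0" 
    and r: "regular_normal_extension (-1) s \<alpha>" and h: "has_coefficients (-1) s \<alpha> b1 b2"
    and r': "regular_normal_extension (-1) s \<alpha>'" and h': "has_coefficients (-1) s \<alpha>' b1' b2'" 
    and sgn: "bb b1 b2 > 0 \<longleftrightarrow> bb b1' b2' > 0"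
    and t: "t_param (-1) b1 b2 = t_param (-1) b1' b2'"
  shows "equivalent_extensions (-1) s \<alpha> \<alpha>'"
proof -
  have c: "(-1::real) = 1 \<or> (-1::real) = -1" by simp
  obtain c1 d1 d2 e1 where nc: "ext_data.ncond TYPE('n) (-1) b1 b2 c1 d1 d2 e1" and ag: "\<forall>X\<in>g_alg (-1) s. \<alpha> X = extf s b1 b2 c1 d1 d2 e1 X"
    and E: "ext_data (-1) s p0 q0 b1 b2" using normal_data[OF sig c r h] by blast
  obtain c1' d1' d2' e1' where nc': "ext_data.ncond TYPE('n) (-1) b1' b2' c1' d1' d2' e1'" and ag': "\<forall>X\<in>g_alg (-1) s. \<alpha>' X = extf s b1' b2' c1' d1' d2' e1' X"
    and E': "ext_data (-1) s p0 q0 b1' b2'" using normal_data[OF sig c r' h'] by blast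
  have b: "bb b1 b2 \<noteq> 0" "bb b1' b2' \<noteq> 0" using E E' by (simp_all add: ext_data_def)
  define T where "T = t_param (-1) b1 b2"
  have prod: "cnj (x + y) * (x - y) = of_real (bb x y) * (1 - \<i> * of_real (t_param (-1) x y))" if "bb x y \<noteq> 0" for x y
  proof -
    have "of_real (bb x y) * of_real (t_param (-1) x y) = complex_of_real (2 * (Re x * Im y - Re y * Im x))"
      unfolding of_real_mult[symmetric] using that by (simp add: t_param_def bb_def)
    note e = this
    have "of_real (bb x y) * (1 - \<i> * of_real (t_param (-1) x y)) = of_real (bb x y) - \<i> * (of_real (bb x y) * of_real (t_param (-1) x y))"
      by (simp add: algebra_simps)
    note this[unfolded e]
    then show ?thesis unfolding bb_cnj by (simp add: complex_eq_iff algebra_simps)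
  qed
  define \<tau> where "\<tau> = 1 - \<i> * of_real T"
  have \<tau>0: "\<tau> \<noteq> 0" unfolding \<tau>_def by (simp add: complex_eq_iff)
  define u v u' v' where "u = b1 + b2" and "v = b1 - b2" and "u' = b1' + b2'" and "v' = b1' - b2'"
  have uv: "cnj u * v = of_real (bb b1 b2) * \<tau>" "cnj u' * v' = of_real (bb b1' b2') * \<tau>"
    using prod[OF b(1)] prod[OF b(2)] unfolding \<tau>_def T_def u_def v_def u'_def v'_def t by simp_all
  have nz: "u \<noteq> 0" "v \<noteq> 0" "u' \<noteq> 0" "v' \<noteq> 0" using uv b \<tau>0 by auto
  define R where "R = bb b1 b2 / bb b1' b2'"
  have R: "R > 0" "bb b1 b2 = R * bb b1' b2'" using b sgn by (auto simp: R_def zero_less_divide_iff)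
  define f2 where "f2 = R * (cmod u')\<^sup>2 / (cmod u)\<^sup>2"
  have f20: "f2 > 0" unfolding f2_def using R nz by simp
  define f where "f = sqrt f2"
  have f: "f > 0" "f * f = f2" using f20 by (simp_all add: f_def)
  define l where "l = (v / v') / of_real f"
  have l0: "l \<noteq> 0" unfolding l_def using nz f by simp
  have vl: "v = l * of_real f * v'" unfolding l_def using nz f by simp
  have ul: "u = l * of_real (1 / f) * u'"
  proof -
    have "cnj u * v = of_real R * (cnj u' * v')" unfolding uv R(2) by simp
    then have "cnj u * v * u * u' = of_real R * (u' * cnj u') * v' * u" by (simp add: mult_ac)
    then have "(u * cnj u) * (v * u') = of_real (R * (cmod u')\<^sup>2) * (v' * u)"
      by (simp only: complex_norm_square of_real_mult mult_ac)
    then have "of_real ((cmod u)\<^sup>2) * (v * u') = of_real (R * (cmod u')\<^sup>2) * (v' * u)"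
      by (simp only: complex_norm_square)
    moreover have "b / a * y = x" if "a * x = b * y" "a \<noteq> 0" for a b x y :: complex
      using that by (simp add: field_simps)
    moreover have "complex_of_real ((cmod u)\<^sup>2) \<noteq> 0" using nz by simp
    ultimately have "v * u' = of_real (R * (cmod u')\<^sup>2) / of_real ((cmod u)\<^sup>2) * (v' * u)" by metis
    then have "v * u' = of_real f2 * (v' * u)" unfolding f2_def by simp
    then have "v * u' = of_real (f * f) * (v' * u)" unfolding f .
    then show ?thesis unfolding l_def using nz f(1) by (simp add: field_simps)
  qed
  define p q where "p = (f + 1 / f) / 2" and "q = (f - 1 / f) / 2"
  have pmq: "p - q = 1 / f" "p + q = f" by (simp_all add: p_def q_def field_simps)
  have pq: "p * p + (-1) * (q * q) = 1"
  proof -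
    have "p * p + (-1) * (q * q) = (p + q) * (p - q)" by (simp add: algebra_simps)
    then show ?thesis unfolding pmq using f by simp
  qed
  have lb: "b1 = l * (of_real p * b1' - of_real q * b2')" "b2 = l * (of_real p * b2' - of_real q * b1')"
  proof -
    have "complex_of_real f = of_real p + of_real q" "complex_of_real (1 / f) = of_real p - of_real q"
      using pmq by (simp_all only: of_real_add[symmetric] of_real_diff[symmetric])
    then have s: "b1 + b2 = l * (of_real p - of_real q) * (b1' + b2')" "b1 - b2 = l * (of_real p + of_real q) * (b1' - b2')"
      using ul vl unfolding u_def v_def u'_def v'_def by simp_all
    have "2 * b1 = (b1 + b2) + (b1 - b2)" "2 * b2 = (b1 + b2) - (b1 - b2)" by simp_all
    then have "2 * b1 = 2 * (l * (of_real p * b1' - of_real q * b2'))" "2 * b2 = 2 * (l * (of_real p * b2' - of_real q * b1'))"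
      unfolding s by (simp_all add: algebra_simps)
    then show "b1 = l * (of_real p * b1' - of_real q * b2')" "b2 = l * (of_real p * b2' - of_real q * b1')" by simp_all
  qed
  show ?thesis
  proof (rule equivalence_of_normal[OF E E' nc nc' ag ag' _ pq l0, where \<delta> = 1])
    fix w
    have "Complex (p * Re w - 1 * - 1 * q * Im w) (q * Re w + 1 * p * Im w) = of_real p * w + \<i> * of_real q * cnj w"
      by (simp add: complex_eq_iff)
    then show "b1' * Complex (p * Re w - 1 * - 1 * q * Im w) (q * Re w + 1 * p * Im w) -
         b2' * \<i> * cnj (Complex (p * Re w - 1 * - 1 * q * Im w) (q * Re w + 1 * p * Im w)) = (b1 * w - b2 * \<i> * cnj w) / l"
      unfolding lb using l0 by (simp add: field_simps)
  next
    have "complex_of_real (bb b1 b2) = of_real ((cmod l)\<^sup>2 * (p * p + (-1) * (q * q)) * bb b1' b2')"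
      unfolding of_real_mult complex_norm_square bb_cnj
      by (subst (1 2) lb(1), subst (1 2) lb(2)) (simp add: algebra_simps)
    then show "(cmod l)\<^sup>2 * bb b1' b2' = 1 * bb b1 b2" unfolding pq of_real_eq_iff by simp
  qed (simp_all add: sg_def t)
qed


lemma smooth_on_derivatives:
  assumes "smooth_on W F" "y \<in> W"
  shows "F differentiable (at y)" "smooth_on W (\<lambda>y. frechet_derivative F (at y) v)"
proof -
  have "Ck_on (Suc k) W F" for k using assms(1) unfolding smooth_on_def by blast
  then show "F differentiable (at y)" "smooth_on W (\<lambda>y. frechet_derivative F (at y) v)"
    using assms(2) by (auto simp: smooth_on_def)
qed

lemma line_derivative:
  fixes f :: "'a::euclidean_space \<Rightarrow> 'b::euclidean_space"
  assumes "f differentiable (at (x + r *\<^sub>R v))"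
  shows "((\<lambda>r. f (x + r *\<^sub>R v) \<bullet> b) has_real_derivative frechet_derivative f (at (x + r *\<^sub>R v)) v \<bullet> b) (at r)"
proof -
  have D: "(f has_derivative frechet_derivative f (at (x + r *\<^sub>R v))) (at (x + r *\<^sub>R v))" using assms frechet_derivative_works by blast
  have "((\<lambda>r. x + r *\<^sub>R v) has_derivative (\<lambda>h. h *\<^sub>R v)) (at r)" by (auto intro!: derivative_eq_intros)
  from has_derivative_compose[OF this D]
  have "((\<lambda>r. f (x + r *\<^sub>R v) \<bullet> b) has_derivative (\<lambda>h. frechet_derivative f (at (x + r *\<^sub>R v)) (h *\<^sub>R v) \<bullet> b)) (at r)"
    by (rule has_derivative_inner_left)
  moreover have "frechet_derivative f (at (x + r *\<^sub>R v)) (h *\<^sub>R v) \<bullet> b = (frechet_derivative f (at (x + r *\<^sub>R v)) v \<bullet> b) * h" for h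
    using linear_scale[OF has_derivative_linear[OF D]] by simp
  ultimately show ?thesis by (simp add: has_field_derivative_def)
qed

lemma second_difference_quotient:
  fixes F :: "'a::euclidean_space \<Rightarrow> 'b::euclidean_space"
  assumes "open W" "smooth_on W F" "x \<in> W"
  shows "((\<lambda>h. ((F (x + h *\<^sub>R v + h *\<^sub>R w) - F (x + h *\<^sub>R v) - F (x + h *\<^sub>R w) + F x) \<bullet> b) / h\<^sup>2) \<longlongrightarrow>
     frechet_derivative (\<lambda>y. frechet_derivative F (at y) v) (at x) w \<bullet> b) (at_right 0)"
proof -
  define A where "A y = frechet_derivative F (at y) v" for y
  define Q where "Q y = frechet_derivative A (at y) w \<bullet> b" for y
  have dF: "F differentiable (at y)" if "y \<in> W" for y using smooth_on_derivatives[OF assms(2) that] by blast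
  have sA: "smooth_on W A" unfolding A_def using smooth_on_derivatives(2)[OF assms(2,3)] .
  have dA: "A differentiable (at y)" if "y \<in> W" for y using smooth_on_derivatives[OF sA that] by blast
  have "smooth_on W (\<lambda>y. frechet_derivative A (at y) w)" using smooth_on_derivatives(2)[OF sA assms(3)] .
  then have "Ck_on 0 W (\<lambda>y. frechet_derivative A (at y) w)" unfolding smooth_on_def by blast
  then have "continuous_on W Q" unfolding Q_def by (auto intro!: continuous_intros)
  then have cQ: "isCont Q x" using assms(1,3) continuous_on_eq_continuous_at by blast
  obtain R where R: "R > 0" "ball x R \<subseteq> W" using assms(1,3) open_contains_ball by blast
  show ?thesis
    unfolding A_def[symmetric] Q_def[symmetric]
  proof (rule tendstoI)
    fix e :: real assume e: "e > 0"
    obtain R' where R': "R' > 0" "\<And>y. dist y x < R' \<Longrightarrow> dist (Q y) (Q x) < e"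
      using cQ e unfolding continuous_at_eps_delta by blast
    define S where "S = min R R'"
    define h0 where "h0 = S / (norm v + norm w + 1)"
    have S: "S > 0" using R R' by (simp add: S_def)
    have np: "norm v + norm w + 1 > 0" by (simp add: add_nonneg_pos)
    have h0: "h0 > 0" unfolding h0_def using S np by simp
    have near: "dist (x + r *\<^sub>R v + u *\<^sub>R w) x < S" if "0 \<le> r" "r \<le> h" "0 \<le> u" "u \<le> h" "h < h0" for r u h
    proof -
      have "dist (x + r *\<^sub>R v + u *\<^sub>R w) x = norm (r *\<^sub>R v + u *\<^sub>R w)" by (simp add: dist_norm add.assoc)
      also have "\<dots> \<le> r * norm v + u * norm w" using norm_triangle_ineq[of "r *\<^sub>R v" "u *\<^sub>R w"] that by simp
      also have "\<dots> \<le> h * norm v + h * norm w" using that by (intro add_mono mult_right_mono) auto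
      also have "\<dots> \<le> h * (norm v + norm w + 1)" using that by (simp add: algebra_simps)
      also have "\<dots> < S" using that np unfolding h0_def by (simp add: pos_less_divide_eq)
      finally show ?thesis .
    qed
    have inW: "x + r *\<^sub>R v + u *\<^sub>R w \<in> W" if "0 \<le> r" "r \<le> h" "0 \<le> u" "u \<le> h" "h < h0" for r u h
      using near[OF that] R(2) by (auto simp: S_def dist_commute)
    show "\<forall>\<^sub>F h in at_right 0. dist ((F (x + h *\<^sub>R v + h *\<^sub>R w) - F (x + h *\<^sub>R v) - F (x + h *\<^sub>R w) + F x) \<bullet> b / h\<^sup>2) (Q x) < e"
    proof (rule eventually_at_rightI[OF _ h0])
      fix h assume "h \<in> {0<..<h0}"
      then have h: "0 < h" "h < h0" by auto
      define G where "G r = F (x + h *\<^sub>R w + r *\<^sub>R v) \<bullet> b - F (x + r *\<^sub>R v) \<bullet> b" for r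
      have "\<exists>r. 0 < r \<and> r < h \<and> G h - G 0 = (h - 0) * (A (x + h *\<^sub>R w + r *\<^sub>R v) \<bullet> b - A (x + r *\<^sub>R v) \<bullet> b)"
      proof (rule MVT2[OF h(1)])
        fix r assume r: "0 \<le> r" "r \<le> h"
        have 1: "x + h *\<^sub>R w + r *\<^sub>R v \<in> W" using inW[OF r _ order_refl h(2)] h by (simp add: add_ac)
        have 2: "x + r *\<^sub>R v \<in> W" using inW[OF r order_refl _ h(2)] h by simp
        show "(G has_real_derivative A (x + h *\<^sub>R w + r *\<^sub>R v) \<bullet> b - A (x + r *\<^sub>R v) \<bullet> b) (at r)"
          unfolding G_def A_def by (intro DERIV_diff line_derivative dF 1 2)
      qed
      then obtain r where r: "0 < r" "r < h" "G h - G 0 = h * (A (x + h *\<^sub>R w + r *\<^sub>R v) \<bullet> b - A (x + r *\<^sub>R v) \<bullet> b)" by auto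
      have "\<exists>u. 0 < u \<and> u < h \<and> A (x + r *\<^sub>R v + h *\<^sub>R w) \<bullet> b - A (x + r *\<^sub>R v + 0 *\<^sub>R w) \<bullet> b = (h - 0) * Q (x + r *\<^sub>R v + u *\<^sub>R w)"
      proof (rule MVT2[OF h(1)])
        fix u assume u: "0 \<le> u" "u \<le> h"
        show "((\<lambda>u. A (x + r *\<^sub>R v + u *\<^sub>R w) \<bullet> b) has_real_derivative Q (x + r *\<^sub>R v + u *\<^sub>R w)) (at u)"
          unfolding Q_def using inW[of r h u] r u h by (intro line_derivative dA) auto
      qed
      then obtain u where u: "0 < u" "u < h" "A (x + r *\<^sub>R v + h *\<^sub>R w) \<bullet> b - A (x + r *\<^sub>R v) \<bullet> b = h * Q (x + r *\<^sub>R v + u *\<^sub>R w)" by auto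
      have "(F (x + h *\<^sub>R v + h *\<^sub>R w) - F (x + h *\<^sub>R v) - F (x + h *\<^sub>R w) + F x) \<bullet> b = G h - G 0"
        unfolding G_def by (simp add: inner_simps add_ac)
      also have "\<dots> = h * (A (x + r *\<^sub>R v + h *\<^sub>R w) \<bullet> b - A (x + r *\<^sub>R v) \<bullet> b)" unfolding r(3) by (simp add: add_ac)
      also have "\<dots> = h\<^sup>2 * Q (x + r *\<^sub>R v + u *\<^sub>R w)" unfolding u(3) by (simp add: power2_eq_square)
      finally have "(F (x + h *\<^sub>R v + h *\<^sub>R w) - F (x + h *\<^sub>R v) - F (x + h *\<^sub>R w) + F x) \<bullet> b / h\<^sup>2 = Q (x + r *\<^sub>R v + u *\<^sub>R w)"
        using h by simp
      moreover have "dist (x + r *\<^sub>R v + u *\<^sub>R w) x < R'" using near[of r h u] r u h by (simp add: S_def)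
      ultimately show "dist ((F (x + h *\<^sub>R v + h *\<^sub>R w) - F (x + h *\<^sub>R v) - F (x + h *\<^sub>R w) + F x) \<bullet> b / h\<^sup>2) (Q x) < e"
        using R'(2) by simp
    qed
  qed
qed

lemma second_derivative_symmetric:
  fixes F :: "'a::euclidean_space \<Rightarrow> 'b::euclidean_space"
  assumes "open W" "smooth_on W F" "x \<in> W"
  shows "frechet_derivative (\<lambda>y. frechet_derivative F (at y) v) (at x) w =
    frechet_derivative (\<lambda>y. frechet_derivative F (at y) w) (at x) v"
proof (rule euclidean_eqI)
  fix b :: 'b
  have e: "F (x + h *\<^sub>R v + h *\<^sub>R w) - F (x + h *\<^sub>R v) - F (x + h *\<^sub>R w) + F x =
     F (x + h *\<^sub>R w + h *\<^sub>R v) - F (x + h *\<^sub>R w) - F (x + h *\<^sub>R v) + F x" for h by (simp add: algebra_simps)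
  show "frechet_derivative (\<lambda>y. frechet_derivative F (at y) v) (at x) w \<bullet> b =
    frechet_derivative (\<lambda>y. frechet_derivative F (at y) w) (at x) v \<bullet> b"
    by (rule tendsto_unique[OF _ second_difference_quotient[OF assms, of v w b] second_difference_quotient[OF assms, of w v b, folded e]]) simp
qed

lemma derivative_along_curve:
  fixes F :: "'a::euclidean_space \<Rightarrow> 'b::euclidean_space"
  assumes "open W" "smooth_on W F" "\<gamma> 0 \<in> W"
    "(\<gamma> has_vector_derivative v) (at (0::real))" "(w has_vector_derivative w') (at 0)"
  shows "((\<lambda>t. frechet_derivative F (at (\<gamma> t)) (w t)) has_vector_derivative
     frechet_derivative F (at (\<gamma> 0)) w' + frechet_derivative (\<lambda>y. frechet_derivative F (at y) (w 0)) (at (\<gamma> 0)) v) (at 0)"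
proof -
  define A where "A b y = frechet_derivative F (at y) b" for b y
  have lin: "linear (\<lambda>b. A b y)" if "y \<in> W" for y
    unfolding A_def using smooth_on_derivatives(1)[OF assms(2) that] linear_frechet_derivative by blast
  have dA: "A b differentiable (at (\<gamma> 0))" for b
    unfolding A_def by (rule smooth_on_derivatives(1)[OF smooth_on_derivatives(2)[OF assms(2,3)] assms(3)])
  have expand: "A u y = (\<Sum>b\<in>Basis. (u \<bullet> b) *\<^sub>R A b y)" if "y \<in> W" for u y
    by (subst (1) euclidean_representation[of u, symmetric])
      (simp only: linear_sum[OF lin[OF that]] linear_scale[OF lin[OF that]])
  have ev: "\<forall>\<^sub>F t in at 0. \<gamma> t \<in> W"
  proof -
    have "isCont \<gamma> 0" using assms(4) has_vector_derivative_continuous by blast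
    then show ?thesis unfolding isCont_def using topological_tendstoD assms(1,3) by blast
  qed
  have dw: "((\<lambda>t. w t \<bullet> b) has_vector_derivative w' \<bullet> b) (at 0)" for b
    using bounded_linear.has_vector_derivative[OF bounded_linear_inner_left assms(5)] .
  have dAb: "((\<lambda>t. A b (\<gamma> t)) has_vector_derivative frechet_derivative (A b) (at (\<gamma> 0)) v) (at 0)" for b
    by (rule curve_chain[OF dA assms(4)])
  have d1: "((\<lambda>t. \<Sum>b\<in>Basis. (w t \<bullet> b) *\<^sub>R A b (\<gamma> t)) has_vector_derivative
     (\<Sum>b\<in>Basis. (w 0 \<bullet> b) *\<^sub>R frechet_derivative (A b) (at (\<gamma> 0)) v + (w' \<bullet> b) *\<^sub>R A b (\<gamma> 0))) (at 0)"
    by (intro has_vector_derivative_sum bounded_bilinear.has_vector_derivative[OF bounded_bilinear_scaleR dw dAb])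
  then have d2: "((\<lambda>t. A (w t) (\<gamma> t)) has_vector_derivative
     (\<Sum>b\<in>Basis. (w 0 \<bullet> b) *\<^sub>R frechet_derivative (A b) (at (\<gamma> 0)) v + (w' \<bullet> b) *\<^sub>R A b (\<gamma> 0))) (at 0)"
    unfolding has_vector_derivative_def
  proof (rule has_derivative_transform_eventually)
    show "\<forall>\<^sub>F t in at 0. (\<Sum>b\<in>Basis. (w t \<bullet> b) *\<^sub>R A b (\<gamma> t)) = A (w t) (\<gamma> t)"
      using ev by eventually_elim (simp add: expand)
  qed (simp_all add: expand assms(3))
  have d3: "((\<lambda>t. A (w 0) (\<gamma> t)) has_vector_derivative (\<Sum>b\<in>Basis. (w 0 \<bullet> b) *\<^sub>R frechet_derivative (A b) (at (\<gamma> 0)) v)) (at 0)"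
    unfolding has_vector_derivative_def
  proof (rule has_derivative_transform_eventually)
    show "((\<lambda>t. \<Sum>b\<in>Basis. (w 0 \<bullet> b) *\<^sub>R A b (\<gamma> t)) has_derivative (\<lambda>x. x *\<^sub>R (\<Sum>b\<in>Basis. (w 0 \<bullet> b) *\<^sub>R frechet_derivative (A b) (at (\<gamma> 0)) v))) (at 0)"
      unfolding has_vector_derivative_def[symmetric]
      by (intro has_vector_derivative_sum bounded_linear.has_vector_derivative[OF bounded_linear_scaleR_right dAb])
    show "\<forall>\<^sub>F t in at 0. (\<Sum>b\<in>Basis. (w 0 \<bullet> b) *\<^sub>R A b (\<gamma> t)) = A (w 0) (\<gamma> t)"
      using ev by eventually_elim (simp add: expand)
  qed (simp_all add: expand assms(3))
  have "(\<Sum>b\<in>Basis. (w 0 \<bullet> b) *\<^sub>R frechet_derivative (A b) (at (\<gamma> 0)) v) = frechet_derivative (A (w 0)) (at (\<gamma> 0)) v"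
    by (rule vector_derivative_unique_at[OF d3 dAb])
  then show ?thesis
    using d2 expand[OF assms(3), of w'] unfolding A_def[symmetric] sum.distrib by (simp add: add.commute)
qed


lemma curvature_transport_algebra:
  fixes U :: "'a::comm_ring_1^'m^'m"
  assumes X: "bX ** U + VX = U ** aX + mat zX ** U" and Y: "bY ** U + VY = U ** aY + mat zY ** U"
    and Z: "bZ ** U + VZ = U ** aZ + mat zZ ** U"
    and XY: "P ** U + bY ** VX + S = VX ** aY + mat z1 ** U + mat zY ** VX"
    and YX: "Q ** U + bX ** VY + T = VY ** aX + mat z2 ** U + mat zX ** VY"
    and PQ: "P - Q = bZ - br" and ST: "S - T = VZ"
  shows "(bracket bX bY - br) ** U = U ** (bracket aX aY - aZ) + mat (z1 - z2 - zZ) ** U"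
proof -
  have V: "VX = U ** aX + mat zX ** U - bX ** U" "VY = U ** aY + mat zY ** U - bY ** U" "VZ = U ** aZ + mat zZ ** U - bZ ** U"
    using X Y Z by (simp_all add: algebra_simps)
  have m: "b ** (mat z ** U) = mat z ** (b ** U)" for b :: "'a^'m^'m" and z
    unfolding matrix_mul_assoc mat_commute[of z b] ..
  have zz: "mat zX ** (mat zY ** U) = mat zY ** (mat zX ** U)" by (rule m)
  have P: "P = Q + bZ - br" and S: "S = T + VZ" using PQ ST by (simp_all add: algebra_simps)
  have md: "mat (z1 - z2 - zZ) = mat z1 - mat z2 - mat zZ" by (simp add: vec_eq_iff mat_nth)
  have e: "(P ** U + bY ** VX + S) - (Q ** U + bX ** VY + T) = (VX ** aY + mat z1 ** U + mat zY ** VX) - (VY ** aX + mat z2 ** U + mat zX ** VY)"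
    unfolding XY YX ..
  show ?thesis
    using e unfolding P S bracket_def md unfolding V matrix_distribs matrix_mul_assoc[symmetric] m[of bX] m[of bY] zz
    by (simp add: algebra_simps)
qed

lemma equivalence_transport:
  fixes s :: "'n::finite \<Rightarrow> real"
  assumes sig: "signature s p q" and c: "c = 1 \<or> c = -1" and eq: "equivalent_extensions c s \<alpha> \<alpha>'"
    and \<alpha>: "\<And>X. X \<in> g_alg c s \<Longrightarrow> \<alpha> X \<in> l_alg s"
    and ag: "\<And>X. X \<in> g_alg c s \<Longrightarrow> \<alpha>' X = a X" and lin: "linear a" and al: "\<And>X. X \<in> g_alg c s \<Longrightarrow> a X \<in> l_alg s"
  shows "\<exists>N U V B. open N \<and> mat 1 \<in> N \<and> (\<forall>g\<in>N \<inter> O_pq (gform c s). U g \<in> P_cover s \<and>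
     (\<forall>X\<in>g_alg c s. B g X \<in> g_alg c s \<and> (\<exists>z. a (B g X) ** U g + V g X = U g ** \<alpha> X + mat z ** U g) \<and>
       (\<forall>C. C 0 = mat 1 \<longrightarrow> (C has_vector_derivative X) (at (0::real)) \<longrightarrow> ((\<lambda>t. U (g ** C t)) has_vector_derivative V g X) (at 0)) \<and>
       (\<forall>Y\<in>g_alg c s. curvature a (B g X) (B g Y) ** U g = U g ** curvature \<alpha> X Y)))"
proof -
  define d where "d = gform c s"
  note pms = signature_pm[OF sig]
  have pmd: "pm_one d" unfolding d_def by (rule gform_pm[OF sig c])
  have GPi: "(g, U) \<in> GP c s \<longleftrightarrow> g \<in> O_pq d \<and> U \<in> P_cover s" for g U
    by (simp add: GP_def G_grp_eq d_def)
  have gi: "X \<in> g_alg c s \<longleftrightarrow> sharp d X = - X" for X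
    unfolding g_alg_iff[OF sig c] d_def[symmetric] by (rule so_pq_sharp[OF pmd])
  have gbr: "bracket X Y \<in> g_alg c s" if "X \<in> g_alg c s" "Y \<in> g_alg c s" for X Y
    using that unfolding gi bracket_def sharp_linear sharp_mult[OF pmd] by (simp add: matrix_distribs)
  obtain \<Phi> where \<Phi>: "bundle_morphism c s \<Phi>" "pulls_back c s \<Phi> \<alpha>' \<alpha>" using eq unfolding equivalent_extensions_def by blast
  have "(mat 1, mat 1) \<in> GP c s" using O_pq_one P_cover_one[OF pms] by (auto simp: GPi)
  then obtain W F where WF: "(mat 1, mat 1) \<in> W" "smooth_lift c s \<Phi> W F" using \<Phi>(1) unfolding bundle_morphism_def by blast
  have oW: "open W" and sm: "smooth_on W F" and FGP: "\<And>y. y \<in> W \<inter> GP c s \<Longrightarrow> F y \<in> GP c s"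
    using WF(2) unfolding smooth_lift_def by blast+
  define N where "N = {g. (g, mat 1) \<in> W}"
  define f where "f g = fst (F (g, mat 1))" for g
  define U where "U g = snd (F (g, mat 1))" for g
  define D where "D g X = frechet_derivative F (at (g, mat 1)) (g ** X, 0)" for g X
  define V where "V g X = snd (D g X)" for g X
  define B where "B g X = sharp d (f g) ** fst (D g X)" for g X
  have oN: "open N"
  proof -
    have "open ((\<lambda>g. (g, mat 1)) -` W)" by (intro open_vimage[OF oW] continuous_intros)
    then show ?thesis by (simp add: N_def vimage_def)
  qed
  have N1: "mat 1 \<in> N" using WF(1) by (simp add: N_def)
  have dF: "F differentiable (at (g, mat 1))" if "g \<in> N" for g
    using smooth_on_derivatives(1)[OF sm] that by (simp add: N_def)
  have fG: "f g \<in> O_pq d" and UP: "U g \<in> P_cover s" if "g \<in> N" "g \<in> O_pq d" for g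
  proof -
    have "(g, mat 1) \<in> W \<inter> GP c s" using that P_cover_one[OF pms] by (simp add: N_def GPi)
    then have "(f g, U g) \<in> GP c s" using FGP unfolding f_def U_def by simp
    then show "f g \<in> O_pq d" "U g \<in> P_cover s" by (simp_all add: GPi)
  qed
  have curve: "((\<lambda>t. (g ** C t, mat 1 :: 'n lmatrix)) has_vector_derivative (g ** X, 0)) (at (0::real))"
    if "(C has_vector_derivative X) (at 0)" for g X :: "'n gmatrix" and C
    using mult_vector_derivative[OF has_vector_derivative_const[of g] that]
    by (auto intro!: has_vector_derivative_Pair)
  have chain: "((\<lambda>t. F (g ** C t, mat 1)) has_vector_derivative D g X) (at (0::real))"
    if "g \<in> N" "C 0 = mat 1" "(C has_vector_derivative X) (at 0)" for g C X
    using curve_chain[OF _ curve[OF that(3)], of F g] dF[OF that(1)] that(2) unfolding D_def by simp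
  have chf: "((\<lambda>t. f (g ** C t)) has_vector_derivative fst (D g X)) (at (0::real))"
    and chU: "((\<lambda>t. U (g ** C t)) has_vector_derivative V g X) (at (0::real))"
    if "g \<in> N" "C 0 = mat 1" "(C has_vector_derivative X) (at 0)" for g C X
    unfolding f_def U_def V_def
    using bounded_linear.has_vector_derivative[OF bounded_linear_fst chain[OF that]]
      bounded_linear.has_vector_derivative[OF bounded_linear_snd chain[OF that]] by auto
  have evN: "\<forall>\<^sub>F t in at 0. g ** C t \<in> N \<and> g ** C t \<in> O_pq d"
    if g: "g \<in> N" "g \<in> O_pq d" and C: "C 0 = mat 1" "(C has_vector_derivative X) (at (0::real))" "\<forall>\<^sub>F t in at 0. C t \<in> O_pq d" for g C X
  proof -
    have "((\<lambda>t. g ** C t) has_vector_derivative g ** X) (at 0)"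
      using mult_vector_derivative[OF has_vector_derivative_const[of g] C(2)] by simp
    then have "isCont (\<lambda>t. g ** C t) 0" using has_vector_derivative_continuous by blast
    then have "((\<lambda>t. g ** C t) \<longlongrightarrow> g) (at 0)" unfolding isCont_def C(1) by simp
    then have "\<forall>\<^sub>F t in at 0. g ** C t \<in> N" using topological_tendstoD oN g(1) by blast
    then show ?thesis using C(3) by eventually_elim (simp add: O_pq_mult[OF pmd g(2)])
  qed
  have cv: "\<exists>C. C 0 = mat 1 \<and> (C has_vector_derivative X) (at (0::real)) \<and> (\<forall>\<^sub>F t in at 0. C t \<in> O_pq d)" if "X \<in> g_alg c s" for X
    using O_pq_curve[OF pmd] that unfolding g_alg_iff[OF sig c] d_def[symmetric] by blast
  have fS: "sharp d (fst (D g X)) = - B g X ** sharp d (f g)" and Bg: "B g X \<in> g_alg c s"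
    if g: "g \<in> N" "g \<in> O_pq d" and X: "X \<in> g_alg c s" for g X
  proof -
    obtain C where C: "C 0 = mat 1" "(C has_vector_derivative X) (at (0::real))" "\<forall>\<^sub>F t in at 0. C t \<in> O_pq d" using cv[OF X] by blast
    have df: "((\<lambda>t. f (g ** C t)) has_vector_derivative fst (D g X)) (at 0)" by (rule chf[OF g(1) C(1,2)])
    have 0: "sharp d (f g) ** fst (D g X) + sharp d (fst (D g X)) ** f g = 0"
    proof (rule vector_derivative_eventually_eq)
      show "((\<lambda>t. sharp d (f (g ** C t)) ** f (g ** C t)) has_vector_derivative sharp d (f g) ** fst (D g X) + sharp d (fst (D g X)) ** f g) (at 0)"
        using mult_vector_derivative[OF bounded_linear.has_vector_derivative[OF blk_linear(4) df] df] by (simp add: C(1))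
      show "((\<lambda>t. mat 1 :: 'n gmatrix) has_vector_derivative 0) (at 0)" by simp
      show "\<forall>\<^sub>F t in at 0. sharp d (f (g ** C t)) ** f (g ** C t) = mat 1"
        using evN[OF g C] by eventually_elim (simp add: O_pq_inverse(1)[OF pmd fG])
      show "sharp d (f (g ** C 0)) ** f (g ** C 0) = mat 1" by (simp add: C(1) O_pq_inverse(1)[OF pmd fG[OF g]])
    qed
    then have 1: "sharp d (fst (D g X)) ** f g = - B g X" unfolding B_def by (simp add: add_eq_0_iff)
    have "sharp d (fst (D g X)) ** (f g ** sharp d (f g)) = - B g X ** sharp d (f g)" using 1 by (simp add: matrix_mul_assoc)
    then show "sharp d (fst (D g X)) = - B g X ** sharp d (f g)" by (simp add: O_pq_inverse(2)[OF pmd fG[OF g]])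
    show "B g X \<in> g_alg c s" unfolding gi using 1 unfolding B_def sharp_mult[OF pmd] sharp_sharp[OF pmd] by simp
  qed
  define z where "z g X = ((a (B g X) ** U g + V g X - U g ** \<alpha> X) ** usharp s (U g)) $ Inl () $ Inl ()" for g X
  have rel: "a (B g X) ** U g + V g X = U g ** \<alpha> X + mat (z g X) ** U g"
    if g: "g \<in> N" "g \<in> O_pq d" and X: "X \<in> g_alg c s" for g X
  proof -
    have y: "(g, mat 1) \<in> W \<inter> GP c s" using g P_cover_one[OF pms] by (simp add: N_def GPi)
    have "0 \<in> p_cover s" by (simp add: p_cover_def u_alg_iff)
    then have tg: "(g ** X, 0) \<in> tangent c s (g, mat 1)" unfolding tangent_def using X by force
    have mi: "matrix_inv (mat 1 :: 'n lmatrix) = mat 1" by (rule matrix_inv_unique) simp_all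
    have gX: "matrix_inv g ** (g ** X) = X" using O_pq_inverse(1,3)[OF pmd g(2)] by (simp add: matrix_mul_assoc)
    have tr: "trace (\<alpha> X) = 0" using \<alpha>[OF X] by (simp add: l_alg_def)
    have "cartan_form \<alpha>' (F (g, mat 1)) (D g X) = cartan_form \<alpha> (g, mat 1) (g ** X, 0)"
      using \<Phi>(2) WF(2) y tg unfolding pulls_back_def D_def by blast
    moreover have "cartan_form \<alpha> (g, mat 1) (g ** X, 0) = \<alpha> X"
      unfolding cartan_form_def mi gX prod.case by (simp add: gX mi trace_free_def tr vec_eq_iff mat_nth)
    moreover have "cartan_form \<alpha>' (F (g, mat 1)) (D g X) = trace_free (usharp s (U g) ** a (B g X) ** U g + usharp s (U g) ** V g X)"
    proof -
      have "cartan_form \<alpha>' (f g, U g) (fst (D g X), V g X) = trace_free (usharp s (U g) ** a (B g X) ** U g + usharp s (U g) ** V g X)"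
        unfolding cartan_form_def prod.case O_pq_inverse(3)[OF pmd fG[OF g]] P_cover_inverse(3)[OF pms UP[OF g]]
        using ag[OF Bg[OF g X]] by (simp add: B_def)
      then show ?thesis by (simp add: f_def U_def V_def)
    qed
    ultimately have "trace_free (usharp s (U g) ** a (B g X) ** U g + usharp s (U g) ** V g X) = \<alpha> X" by simp
    then obtain w where "usharp s (U g) ** a (B g X) ** U g + usharp s (U g) ** V g X = \<alpha> X + mat w"
      unfolding trace_free_def by (metis diff_eq_eq)
    then have "U g ** (usharp s (U g) ** a (B g X) ** U g + usharp s (U g) ** V g X) = U g ** \<alpha> X + mat w ** U g"
      by (simp add: matrix_distribs mat_commute[of w "U g"])
    then have e: "a (B g X) ** U g + V g X = U g ** \<alpha> X + mat w ** U g"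
      by (simp add: matrix_distribs matrix_mul_assoc P_cover_inverse(2)[OF pms UP[OF g]])
    then have "(a (B g X) ** U g + V g X - U g ** \<alpha> X) ** usharp s (U g) = mat w ** (U g ** usharp s (U g))"
      by (simp add: matrix_mul_assoc)
    then have "z g X = w" unfolding z_def by (simp add: P_cover_inverse(2)[OF pms UP[OF g]] mat_nth)
    then show ?thesis using e by simp
  qed
  define H where "H g X Y = frechet_derivative F (at (g, mat 1)) (g ** X ** Y, 0) +
     frechet_derivative (\<lambda>y. frechet_derivative F (at y) (g ** Y, 0)) (at (g, mat 1)) (g ** X, 0)" for g X Y
  have H: "H g X Y - H g Y X = D g (bracket X Y)" if g: "g \<in> N" for g X Y
  proof -
    have l: "linear (frechet_derivative F (at (g, mat 1)))" using dF[OF g] linear_frechet_derivative by blast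
    have y: "(g, mat 1) \<in> W" using g by (simp add: N_def)
    show ?thesis
      unfolding H_def D_def second_derivative_symmetric[OF oW sm y, of "(g ** Y, 0)" "(g ** X, 0)"] bracket_def
      by (simp add: linear_diff[OF l, symmetric] matrix_distribs matrix_mul_assoc)
  qed
  have second: "\<exists>w. a (sharp d (f g) ** fst (H g X Y) - B g X ** B g Y) ** U g + a (B g Y) ** V g X + snd (H g X Y) =
      V g X ** \<alpha> Y + mat w ** U g + mat (z g Y) ** V g X"
    if g: "g \<in> N" "g \<in> O_pq d" and X: "X \<in> g_alg c s" and Y: "Y \<in> g_alg c s" for g X Y
  proof -
    obtain C where C: "C 0 = mat 1" "(C has_vector_derivative X) (at (0::real))" "\<forall>\<^sub>F t in at 0. C t \<in> O_pq d" using cv[OF X] by blast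
    have dw: "((\<lambda>t. (g ** C t ** Y, 0 :: 'n lmatrix)) has_vector_derivative (g ** X ** Y, 0)) (at 0)"
      using mult_vector_derivative[OF mult_vector_derivative[OF has_vector_derivative_const[of g] C(2)] has_vector_derivative_const[of Y]]
      by (auto intro!: has_vector_derivative_Pair)
    have "((\<lambda>t. D (g ** C t) Y) has_vector_derivative H g X Y) (at 0)"
      using derivative_along_curve[OF oW sm _ curve[OF C(2)] dw] g(1) unfolding D_def H_def N_def C(1) matrix_mul_rid by simp
    then have d1: "((\<lambda>t. fst (D (g ** C t) Y)) has_vector_derivative fst (H g X Y)) (at 0)"
      and d2: "((\<lambda>t. V (g ** C t) Y) has_vector_derivative snd (H g X Y)) (at 0)"
      unfolding V_def by (auto intro: bounded_linear.has_vector_derivative[OF bounded_linear_fst] bounded_linear.has_vector_derivative[OF bounded_linear_snd])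
    note df = chf[OF g(1) C(1,2)] and dU = chU[OF g(1) C(1,2)]
    define b' where "b' = sharp d (f g) ** fst (H g X Y) - B g X ** B g Y"
    have dB: "((\<lambda>t. B (g ** C t) Y) has_vector_derivative b') (at 0)"
    proof -
      have "((\<lambda>t. B (g ** C t) Y) has_vector_derivative sharp d (f g) ** fst (H g X Y) + sharp d (fst (D g X)) ** fst (D g Y)) (at 0)"
        unfolding B_def using mult_vector_derivative[OF bounded_linear.has_vector_derivative[OF blk_linear(4) df] d1] by (simp add: C(1))
      moreover have "sharp d (fst (D g X)) ** fst (D g Y) = - (B g X ** B g Y)"
        unfolding fS[OF g X] by (simp add: B_def matrix_distribs matrix_mul_assoc)
      ultimately show ?thesis unfolding b'_def by simp
    qed
    have daB: "((\<lambda>t. a (B (g ** C t) Y)) has_vector_derivative a b') (at 0)"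
      by (rule bounded_linear.has_vector_derivative[OF bounded_linear_ev[OF lin] dB])
    define L where "L = a (B g Y) ** V g X + a b' ** U g + snd (H g X Y)"
    have dL: "((\<lambda>t. a (B (g ** C t) Y) ** U (g ** C t) + V (g ** C t) Y) has_vector_derivative L) (at 0)"
      unfolding L_def using has_vector_derivative_add[OF mult_vector_derivative[OF daB dU] d2] by (simp add: C(1))
    have dR: "((\<lambda>t. U (g ** C t) ** \<alpha> Y) has_vector_derivative V g X ** \<alpha> Y) (at 0)"
      using mult_vector_derivative[OF dU has_vector_derivative_const[of "\<alpha> Y"]] by simp
    obtain w where w: "((\<lambda>t. z (g ** C t) Y) has_vector_derivative w) (at 0)"
      unfolding z_def
      using bounded_linear.has_vector_derivative[OF blk_linear(7) mult_vector_derivative[OF has_vector_derivative_diff[OF dL dR] bounded_linear.has_vector_derivative[OF blk_linear(5) dU]]]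
      by blast
    have "L = V g X ** \<alpha> Y + (mat (z g Y) ** V g X + mat w ** U g)"
    proof (rule vector_derivative_eventually_eq[OF dL])
      show "((\<lambda>t. U (g ** C t) ** \<alpha> Y + mat (z (g ** C t) Y) ** U (g ** C t)) has_vector_derivative
          V g X ** \<alpha> Y + (mat (z g Y) ** V g X + mat w ** U g)) (at 0)"
        using has_vector_derivative_add[OF dR mult_vector_derivative[OF bounded_linear.has_vector_derivative[OF blk_linear(6) w] dU]] by (simp add: C(1))
      show "\<forall>\<^sub>F t in at 0. a (B (g ** C t) Y) ** U (g ** C t) + V (g ** C t) Y = U (g ** C t) ** \<alpha> Y + mat (z (g ** C t) Y) ** U (g ** C t)"
        using evN[OF g C] by eventually_elim (blast intro: rel Y)
      show "a (B (g ** C 0) Y) ** U (g ** C 0) + V (g ** C 0) Y = U (g ** C 0) ** \<alpha> Y + mat (z (g ** C 0) Y) ** U (g ** C 0)"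
        unfolding C(1) matrix_mul_rid by (rule rel[OF g Y])
    qed
    then show ?thesis unfolding L_def b'_def by (intro exI[of _ w]) (simp add: add_ac)
  qed
  have curv: "curvature a (B g X) (B g Y) ** U g = U g ** curvature \<alpha> X Y"
    if g: "g \<in> N" "g \<in> O_pq d" and X: "X \<in> g_alg c s" and Y: "Y \<in> g_alg c s" for g X Y
  proof -
    note Z = gbr[OF X Y]
    obtain w1 where w1: "a (sharp d (f g) ** fst (H g X Y) - B g X ** B g Y) ** U g + a (B g Y) ** V g X + snd (H g X Y) =
      V g X ** \<alpha> Y + mat w1 ** U g + mat (z g Y) ** V g X" using second[OF g X Y] by blast
    obtain w2 where w2: "a (sharp d (f g) ** fst (H g Y X) - B g Y ** B g X) ** U g + a (B g X) ** V g Y + snd (H g Y X) =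
      V g Y ** \<alpha> X + mat w2 ** U g + mat (z g X) ** V g Y" using second[OF g Y X] by blast
    have S: "snd (H g X Y) - snd (H g Y X) = V g (bracket X Y)" unfolding V_def H[OF g(1), symmetric] by simp
    have BZ: "B g (bracket X Y) = sharp d (f g) ** fst (H g X Y - H g Y X)"
      unfolding B_def H[OF g(1)] ..
    have "(sharp d (f g) ** fst (H g X Y) - B g X ** B g Y) - (sharp d (f g) ** fst (H g Y X) - B g Y ** B g X)
       = B g (bracket X Y) - bracket (B g X) (B g Y)"
      unfolding BZ unfolding bracket_def by (simp add: matrix_distribs)
    then have P: "a (sharp d (f g) ** fst (H g X Y) - B g X ** B g Y) - a (sharp d (f g) ** fst (H g Y X) - B g Y ** B g X)
       = a (B g (bracket X Y)) - a (bracket (B g X) (B g Y))"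
      by (simp only: linear_diff[OF lin, symmetric])
    define w where "w = w1 - w2 - z g (bracket X Y)"
    have e: "curvature a (B g X) (B g Y) ** U g = U g ** curvature \<alpha> X Y + mat w ** U g"
      unfolding curvature_def w_def
      by (rule curvature_transport_algebra[OF rel[OF g X] rel[OF g Y] rel[OF g Z] w1 w2 P S])
    have UU: "U g ** usharp s (U g) = mat 1" "usharp s (U g) ** U g = mat 1" using P_cover_inverse[OF pms UP[OF g]] by blast+
    have "usharp s (U g) ** (curvature a (B g X) (B g Y) ** U g) = curvature \<alpha> X Y + mat w"
      unfolding e by (simp add: matrix_distribs matrix_mul_assoc UU mat_commute[of w "U g"])
    moreover have "trace (usharp s (U g) ** (curvature a (B g X) (B g Y) ** U g)) = trace (curvature a (B g X) (B g Y))"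
      using trace_mult_commute[of "usharp s (U g)" "curvature a (B g X) (B g Y) ** U g"] by (simp add: matrix_mul_assoc[symmetric] UU)
    moreover have "trace (curvature a (B g X) (B g Y)) = 0" "trace (curvature \<alpha> X Y) = 0"
      using l_alg_bracket[OF al al, OF Bg[OF g X] Bg[OF g Y]] al[OF gbr[OF Bg[OF g X] Bg[OF g Y]]]
        l_alg_bracket[OF \<alpha> \<alpha>, OF X Y] \<alpha>[OF Z] unfolding curvature_def l_alg_def by simp_all
    ultimately have "trace (mat w :: 'n lmatrix) = 0" by (metis add_0 trace_linear(1))
    moreover have "2 + complex_of_nat CARD('n) \<noteq> 0" by (simp add: complex_eq_iff add_eq_0_iff_both_eq_0)
    ultimately have "w = 0" by (simp add: trace_def mat_nth)
    then show ?thesis using e by (simp add: mat_0)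
  qed
  show ?thesis
    unfolding d_def[symmetric]
    using oN N1 UP Bg rel chU curv
    by (intro exI[of _ N] exI[of _ U] exI[of _ V] exI[of _ B]) blast
qed


lemma P_cover_zero:
  assumes "U \<in> P_cover s"
  shows "U $ Inr (Inl i) $ Inl () = 0" "U $ Inr (Inr ()) $ Inl () = 0" "U $ Inr (Inr ()) $ Inr (Inl i) = 0"
  using assms unfolding P_cover_def by auto

lemma P_cover_blocks:
  fixes s :: "'n::finite \<Rightarrow> real"
  assumes sig: "signature s p q" and U: "U \<in> P_cover s"
  defines "Bi \<equiv> (\<chi> i j. of_real (s i) * cnj (U $ Inr (Inl j) $ Inr (Inl i)) * of_real (s j)) :: complex^'n^'n"
  shows "cnj (zc U) * U $ Inr (Inr ()) $ Inr (Inr ()) = 1"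
    "Bi ** Ac U = mat 1" "Ac U ** Bi = mat 1"
    "(\<Sum>k\<in>UNIV. cnj (U $ Inr (Inl k) $ Inr (Inl j)) * of_real (s k) * yc U $ k) = - cnj (U $ Inl () $ Inr (Inl j)) * U $ Inr (Inr ()) $ Inr (Inr ())"
    "yc U = 0 \<Longrightarrow> Re (cnj (U $ Inl () $ Inr (Inr ())) * U $ Inr (Inr ()) $ Inr (Inr ())) = 0"
    "(\<And>j. U $ Inl () $ Inr (Inl j) = 0) \<Longrightarrow> yc U = 0"
proof -
  have H: "(adjoint_mat U ** herm s ** U) $ i $ j = herm s $ i $ j" for i j using U unfolding P_cover_def by simp
  note z = P_cover_zero[OF U]
  note ent = matrix_mult_nth sum_lidx adjoint_mat_def z lcoords if_distrib[of "\<lambda>x. _ * x"]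
  have H': "(adjoint_mat U ** herm s ** U) $ i $ j = cnj (U $ Inr (Inr ()) $ i) * U $ Inl () $ j
     + (\<Sum>k\<in>UNIV. cnj (U $ Inr (Inl k) $ i) * of_real (s k) * U $ Inr (Inl k) $ j) + cnj (U $ Inl () $ i) * U $ Inr (Inr ()) $ j" for i j
    by (simp add: ent cong: if_cong)
  note E = H'[unfolded H]
  show "cnj (zc U) * U $ Inr (Inr ()) $ Inr (Inr ()) = 1" using E[of "Inl ()" "Inr (Inr ())"] by (simp add: z lcoords)
  show 1: "Bi ** Ac U = mat 1"
  proof -
    have "(Bi ** Ac U) $ i $ j = (if i = j then 1 else 0)" for i j
    proof -
      have "(\<Sum>k\<in>UNIV. cnj (U $ Inr (Inl k) $ Inr (Inl i)) * of_real (s k) * U $ Inr (Inl k) $ Inr (Inl j)) = (if i = j then of_real (s i) else 0)"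
        using E[of "Inr (Inl i)" "Inr (Inl j)"] by (simp add: z)
      then have "of_real (s i) * (\<Sum>k\<in>UNIV. cnj (U $ Inr (Inl k) $ Inr (Inl i)) * of_real (s k) * U $ Inr (Inl k) $ Inr (Inl j)) = (if i = j then of_real (s i * s i) else 0)"
        by simp
      then show ?thesis unfolding s_square[OF sig] by (simp add: Bi_def matrix_mult_nth lcoords sum_distrib_left mult_ac)
    qed
    then show ?thesis by (simp add: vec_eq_iff mat_nth)
  qed
  then show 2: "Ac U ** Bi = mat 1" using matrix_left_right_inverse by blast
  show 3: "(\<Sum>k\<in>UNIV. cnj (U $ Inr (Inl k) $ Inr (Inl j)) * of_real (s k) * yc U $ k) = - cnj (U $ Inl () $ Inr (Inl j)) * U $ Inr (Inr ()) $ Inr (Inr ())" for j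
    using E[of "Inr (Inl j)" "Inr (Inr ())"] by (simp add: z lcoords add_eq_0_iff2)
  show "Re (cnj (U $ Inl () $ Inr (Inr ())) * U $ Inr (Inr ()) $ Inr (Inr ())) = 0" if "yc U = 0"
  proof -
    have "U $ Inr (Inl k) $ Inr (Inr ()) = 0" for k using that by (simp add: lcoords vec_eq_iff)
    then have "cnj (U $ Inr (Inr ()) $ Inr (Inr ())) * U $ Inl () $ Inr (Inr ()) + cnj (U $ Inl () $ Inr (Inr ())) * U $ Inr (Inr ()) $ Inr (Inr ()) = 0"
      using E[of "Inr (Inr ())" "Inr (Inr ())"] by simp
    then show ?thesis by (simp add: complex_eq_iff)
  qed
  show "yc U = 0" if r: "\<And>j. U $ Inl () $ Inr (Inl j) = 0"
  proof -
    have "Bi *v yc U = 0"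
      using 3 r by (simp add: vec_eq_iff Bi_def matrix_vector_nth sum_distrib_left[symmetric] mult.assoc)
    then have "(Ac U ** Bi) *v yc U = 0" by (simp add: matrix_vector_mul_assoc[symmetric])
    then show ?thesis unfolding 2 by simp
  qed
qed

lemma matrix_right_cancel_zero:
  fixes A :: "'a::comm_ring_1^'m^'m"
  assumes "A ** B = 0" "B ** C = mat 1"
  shows "A = 0"
proof -
  have "A ** (B ** C) = 0 ** C" unfolding matrix_mul_assoc assms(1) ..
  then show ?thesis unfolding assms(2) by (simp add: vec_eq_iff matrix_mult_nth)
qed

context ext_data begin

text \<open>stub\<close>

lemma curvature_normal:
  assumes nc: ncond and M: "M \<in> g_alg c s" and N: "N \<in> g_alg c s"
  defines "K \<equiv> curvature \<alpha>0 M N"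
  shows "K $ Inl () $ Inl () = 0" "K $ Inl () $ Inr (Inr ()) = 0" "K $ Inr (Inl i) $ Inl () = 0" 
    "K $ Inr (Inr ()) $ j = 0" "K $ Inl () $ Inr (Inl i) = - cnj (yc K $ i) * of_real (s i)" "K $ Inr (Inl i) $ Inr (Inr ()) = yc K $ i"
    "K $ Inr (Inl i) $ Inr (Inl i') = Ac K $ i $ i'"
    "yc K = m2 *s cnj_vec (ga N *\<^sub>R xx (gX M) - ga M *\<^sub>R xx (gX N))"
    "xx (gX M) = 0 \<Longrightarrow> Ac K = 0"
proof -
  note kc = curvature_coords[OF M N, folded K_def, unfolded ncond_simps(1-8)[OF nc]]
  have "K \<in> u_alg s" using kc(1) by (simp add: l_alg_def)
  note u = this[unfolded u_alg_iff]
  have xc: "xc K = 0" using kc(4) by (simp add: vec_eq_iff)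
  show "K $ Inl () $ Inl () = 0" "K $ Inr (Inl i) $ Inl () = 0" using kc(3) xc by (simp_all add: lcoords vec_eq_iff)
  show "K $ Inl () $ Inr (Inr ()) = 0" using u kc(7) by simp
  show "K $ Inl () $ Inr (Inl i) = - cnj (yc K $ i) * of_real (s i)" using u by blast
  show "K $ Inr (Inl i) $ Inr (Inr ()) = yc K $ i" "K $ Inr (Inl i) $ Inr (Inl i') = Ac K $ i $ i'" by (simp_all add: lcoords)
  show "K $ Inr (Inr ()) $ j = 0"
  proof -
    have "\<forall>j. K $ Inr (Inr ()) $ j = 0" using u kc(2) kc(3) by (simp add: all_lidx xc)
    then show ?thesis by blast
  qed
  show "yc K = m2 *s cnj_vec (ga N *\<^sub>R xx (gX M) - ga M *\<^sub>R xx (gX N))" unfolding kc(6) by (simp add: vec_eq_iff)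
  show "Ac K = 0" if "xx (gX M) = 0" using kc(5) unfolding that by (simp add: vec_eq_iff kA_nth)
qed

end

locale two_ext = E: ext_data c s p q b1 b2 c1 d1 d2 e1 + E': ext_data c s p q b1' b2' c1' d1' d2' e1'
  for c :: real and s :: "'n::finite \<Rightarrow> real" and p q b1 b2 c1 d1 d2 e1 b1' b2' c1' d1' d2' e1' +
  assumes nc: "E.ncond" and nc': "E'.ncond"
begin

lemma curvature_blocks:
  assumes U: "U \<in> P_cover s" and M: "M \<in> g_alg c s" and N: "N \<in> g_alg c s" and M': "M' \<in> g_alg c s" and N': "N' \<in> g_alg c s"
    and rel: "curvature E'.\<alpha>0 M' N' ** U = U ** curvature E.\<alpha>0 M N" and 0: "E.xx (gX M) = 0"
  defines "y \<equiv> yc (curvature E.\<alpha>0 M N)" and "y' \<equiv> yc (curvature E'.\<alpha>0 M' N')"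
  shows "y' = cnj (zc U) *s (Ac U *v y)"
    "(\<Sum>j\<in>UNIV. U $ Inl () $ Inr (Inl j) * y $ j) = zc U * U $ Inr (Inr ()) $ Inr (Inr ()) * cnj (\<Sum>j\<in>UNIV. U $ Inl () $ Inr (Inl j) * y $ j)"
proof -
  define K K' where "K = curvature E.\<alpha>0 M N" and "K' = curvature E'.\<alpha>0 M' N'"
  note k = E.curvature_normal[OF nc M N, folded K_def] and k' = E'.curvature_normal[OF nc' M' N', folded K'_def]
  note z = P_cover_zero[OF U] and ub = P_cover_blocks[OF E.sig U]
  have AK: "Ac K = 0" by (rule k(9)[OF 0])
  have ent: "(K' ** U) $ i $ j = (U ** K) $ i $ j" for i j using rel by (simp add: K_def K'_def)
  have "Ac K' ** Ac U = 0"
    using ent[of "Inr (Inl _)" "Inr (Inl _)"] 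
    by (simp add: vec_eq_iff matrix_mult_nth sum_lidx z k k' AK) (simp add: lcoords)
  then have AK': "Ac K' = 0" using ub(3) by (rule matrix_right_cancel_zero)
  have y: "y = yc K" "y' = yc K'" by (simp_all add: y_def y'_def K_def K'_def)
  have e: "y' $ i * U $ Inr (Inr ()) $ Inr (Inr ()) = (Ac U *v y) $ i" for i
    using ent[of "Inr (Inl i)" "Inr (Inr ())"] by (simp add: matrix_mult_nth matrix_vector_nth sum_lidx z k k' AK' y) (simp add: lcoords)
  have y': "y' $ i = cnj (zc U) * (Ac U *v y) $ i" for i
    unfolding e[symmetric] using ub(1) by (simp add: mult_ac)
  then show "y' = cnj (zc U) *s (Ac U *v y)" by (simp add: vec_eq_iff)
  have "(\<Sum>j\<in>UNIV. U $ Inl () $ Inr (Inl j) * y $ j) = - (\<Sum>k\<in>UNIV. cnj (y' $ k) * of_real (s k) * yc U $ k)"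
    using ent[of "Inl ()" "Inr (Inr ())"] by (simp add: matrix_mult_nth sum_lidx z k k' y sum_negf) (simp add: lcoords)
  also have "\<dots> = - zc U * (\<Sum>k\<in>UNIV. \<Sum>j\<in>UNIV. cnj (y $ j) * (cnj (U $ Inr (Inl k) $ Inr (Inl j)) * of_real (s k) * yc U $ k))"
    unfolding y' by (simp add: matrix_vector_nth lcoords sum_distrib_left sum_distrib_right sum_negf mult_ac)
  also have "\<dots> = - zc U * (\<Sum>j\<in>UNIV. cnj (y $ j) * (\<Sum>k\<in>UNIV. cnj (U $ Inr (Inl k) $ Inr (Inl j)) * of_real (s k) * yc U $ k))"
    unfolding sum_distrib_left[of "cnj _"] by (subst sum.swap) simp
  also have "\<dots> = zc U * U $ Inr (Inr ()) $ Inr (Inr ()) * cnj (\<Sum>j\<in>UNIV. U $ Inl () $ Inr (Inl j) * y $ j)"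
    unfolding ub(4) by (simp add: sum_distrib_left sum_negf mult_ac)
  finally show "(\<Sum>j\<in>UNIV. U $ Inl () $ Inr (Inl j) * y $ j) = zc U * U $ Inr (Inr ()) $ Inr (Inr ()) * cnj (\<Sum>j\<in>UNIV. U $ Inl () $ Inr (Inl j) * y $ j)" .
qed

lemma block_diagonal:
  assumes U: "U \<in> P_cover s" and B: "\<And>X. X \<in> g_alg c s \<Longrightarrow> B X \<in> g_alg c s"
    and rel: "\<And>X Y. X \<in> g_alg c s \<Longrightarrow> Y \<in> g_alg c s \<Longrightarrow> curvature E'.\<alpha>0 (B X) (B Y) ** U = U ** curvature E.\<alpha>0 X Y"
    and m2: "E.m2 \<noteq> 0"
  shows "U $ Inl () $ Inr (Inl j) = 0" "yc U = 0"
proof -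
  define r where "r y = (\<Sum>j\<in>UNIV. U $ Inl () $ Inr (Inl j) * y $ j)" for y
  define w where "w = zc U * U $ Inr (Inr ()) $ Inr (Inr ())"
  have r: "r y = w * cnj (r y)" for y
  proof -
    define x where "x = - cnj_vec ((1 / E.m2) *s y)"
    have y: "yc (curvature E.\<alpha>0 (E.pre 0 (2 * E.\<beta>)) (E.pre x 0)) = y"
      unfolding E.curvature_normal(8)[OF nc E.pre_g_alg E.pre_g_alg] E.pre_coords
      using E.\<beta>0 m2 by (simp add: x_def vec_eq_iff)
    show ?thesis
      using curvature_blocks(2)[OF U E.pre_g_alg[of 0 "2 * E.\<beta>"] E.pre_g_alg[of x 0] B[OF E.pre_g_alg] B[OF E.pre_g_alg] rel[OF E.pre_g_alg E.pre_g_alg] E.pre_coords(2)]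
      unfolding r_def w_def y .
  qed
  have ri: "r (\<i> *s y) = \<i> * r y" for y by (simp add: r_def sum_distrib_left mult_ac)
  have r0: "r y = 0" for y
  proof -
    have "\<i> * r y = - \<i> * (w * cnj (r y))" using r[of "\<i> *s y"] unfolding ri by simp
    then have "\<i> * r y = - \<i> * r y" using r[of y] by simp
    then show ?thesis by simp
  qed
  show j: "U $ Inl () $ Inr (Inl j) = 0" for j
    using r0[of "axis j 1"] by (simp add: r_def axis_def if_distrib[of "\<lambda>x. _ * x"] cong: if_cong)
  show "yc U = 0" by (rule P_cover_blocks(6)[OF E.sig U j])
qed

lemma first_order:
  assumes U: "U \<in> P_cover s" and V: "\<And>i. V $ Inr (Inl i) $ Inl () = 0" "V $ Inr (Inr ()) $ Inl () = 0"
    and X: "X \<in> g_alg c s" and X': "X' \<in> g_alg c s" and rel: "E'.\<alpha>0 X' ** U + V = U ** E.\<alpha>0 X + mat z ** U"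
  shows "E'.\<beta> * ga X' * (cmod (zc U))\<^sup>2 = E.\<beta> * ga X"
    "ga X = 0 \<Longrightarrow> zc U *s E'.xx (gX X') = Ac U *v E.xx (gX X)"
    "ga X = 0 \<Longrightarrow> yc U = 0 \<Longrightarrow> (\<And>i. V $ Inr (Inl i) $ Inr (Inr ()) = 0) \<Longrightarrow>
       Ac U *v rl E.\<mu> E.\<nu> (E.xx (gX X)) = U $ Inl () $ Inr (Inr ()) *s E'.xx (gX X') + U $ Inr (Inr ()) $ Inr (Inr ()) *s rl E'.\<mu> E'.\<nu> (E'.xx (gX X'))"
proof -
  define a a' where "a = E.\<alpha>0 X" and "a' = E'.\<alpha>0 X'"
  define x x' where "x = E.xx (gX X)" and "x' = E'.xx (gX X')"
  have "a \<in> u_alg s" "a' \<in> u_alg s" using extf_u_alg X X' by (auto simp: a_def a'_def)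
  note u = this[unfolded u_alg_iff]
  have 20: "a $ Inr (Inr ()) $ Inl () = \<i> * of_real (2 * E.\<beta> * ga X)" "a' $ Inr (Inr ()) $ Inl () = \<i> * of_real (2 * E'.\<beta> * ga X')"
    using u by (simp_all add: a_def a'_def extf_coords E.\<beta>_def E'.\<beta>_def)
  have 10: "a $ Inr (Inl i) $ Inl () = x $ i" "a' $ Inr (Inl i) $ Inl () = x' $ i" for i
    using arg_cong[OF extf_coords(2)[of s b1 b2 c1 d1 d2 e1 X], of "\<lambda>v. v $ i"] arg_cong[OF extf_coords(2)[of s b1' b2' c1' d1' d2' e1' X'], of "\<lambda>v. v $ i"]
    by (simp_all add: a_def a'_def x_def x'_def xc_def)
  have 12: "a $ Inr (Inl i) $ Inr (Inr ()) = rl E.\<mu> E.\<nu> x $ i" "a' $ Inr (Inl i) $ Inr (Inr ()) = rl E'.\<mu> E'.\<nu> x' $ i" for i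
    using arg_cong[OF extf_coords(4)[of s b1 b2 c1 d1 d2 e1 X], of "\<lambda>v. v $ i"] arg_cong[OF extf_coords(4)[of s b1' b2' c1' d1' d2' e1' X'], of "\<lambda>v. v $ i"]
    unfolding E.y_eq E'.y_eq by (simp_all add: a_def a'_def x_def x'_def yc_def)
  note z = P_cover_zero[OF U]
  have mz: "(mat z ** U) $ i $ j = z * U $ i $ j" for i j
    by (simp add: matrix_mult_nth mat_nth if_distrib[of "\<lambda>x. x * _"] cong: if_cong)
  have ent: "(a' ** U) $ i $ j + V $ i $ j = (U ** a) $ i $ j + z * U $ i $ j" for i j
    using arg_cong[OF rel, of "\<lambda>M. M $ i $ j"] by (simp add: a_def a'_def mz)
  have u22: "cnj (zc U) * U $ Inr (Inr ()) $ Inr (Inr ()) = 1" by (rule P_cover_blocks(1)[OF E.sig U])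
  have "of_real (E'.\<beta> * ga X') * zc U = U $ Inr (Inr ()) $ Inr (Inr ()) * of_real (E.\<beta> * ga X)"
    using ent[of "Inr (Inr ())" "Inl ()"] by (simp add: matrix_mult_nth sum_lidx z V 20) (simp add: lcoords mult_ac)
  then have "of_real (E'.\<beta> * ga X') * zc U * cnj (zc U) = (cnj (zc U) * U $ Inr (Inr ()) $ Inr (Inr ())) * of_real (E.\<beta> * ga X)" by simp
  then have "complex_of_real (E'.\<beta> * ga X' * (cmod (zc U))\<^sup>2) = of_real (E.\<beta> * ga X)"
    unfolding u22 of_real_mult[of _ "(cmod (zc U))\<^sup>2"] complex_norm_square by (simp only: mult.assoc mult_1)
  then show "E'.\<beta> * ga X' * (cmod (zc U))\<^sup>2 = E.\<beta> * ga X" unfolding of_real_eq_iff .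
  assume g0: "ga X = 0"
  show "zc U *s x' = Ac U *v x"
    using ent[of "Inr (Inl _)" "Inl ()"] 
    by (simp add: vec_eq_iff matrix_mult_nth matrix_vector_nth sum_lidx z V 10 20 g0) (simp add: lcoords mult.commute)
  assume w: "yc U = 0" and V2: "\<And>i. V $ Inr (Inl i) $ Inr (Inr ()) = 0"
  have w': "U $ Inr (Inl k) $ Inr (Inr ()) = 0" for k using w by (simp add: lcoords vec_eq_iff)
  show "Ac U *v rl E.\<mu> E.\<nu> x = U $ Inl () $ Inr (Inr ()) *s x' + U $ Inr (Inr ()) $ Inr (Inr ()) *s rl E'.\<mu> E'.\<nu> x'"
    using ent[of "Inr (Inl _)" "Inr (Inr ())"] 
    by (simp add: vec_eq_iff matrix_mult_nth matrix_vector_nth sum_lidx z V2 w' 10 12 del: rl_nth) (simp add: lcoords mult.commute)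
qed

lemma column_nonzero: assumes U: "U \<in> P_cover s"
  shows "\<exists>i. Ac U $ i $ j \<noteq> 0"
proof (rule ccontr)
  assume "\<not> ?thesis"
  then have 0: "(Bi ** Ac U) $ j $ j = 0" for Bi by (simp add: matrix_mult_nth)
  from arg_cong[OF P_cover_blocks(2)[OF E.sig U], of "\<lambda>M. M $ j $ j"] show False unfolding 0 by (simp add: mat_nth)
qed

lemma mult_axis: "(A *v axis j z) $ i = A $ i $ j * z" for A :: "complex^'n^'n"
  by (simp add: matrix_vector_nth axis_def if_distrib[of "\<lambda>x. _ * x"] cong: if_cong)

lemma flat_transport:
  assumes U: "U \<in> P_cover s" and B: "\<And>X. X \<in> g_alg c s \<Longrightarrow> B X \<in> g_alg c s"
    and V: "\<And>X i. X \<in> g_alg c s \<Longrightarrow> V X $ Inr (Inl i) $ Inl () = 0" "\<And>X. X \<in> g_alg c s \<Longrightarrow> V X $ Inr (Inr ()) $ Inl () = 0"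
    and first: "\<And>X. X \<in> g_alg c s \<Longrightarrow> \<exists>z. E'.\<alpha>0 (B X) ** U + V X = U ** E.\<alpha>0 X + mat z ** U"
    and rel: "\<And>X Y. X \<in> g_alg c s \<Longrightarrow> Y \<in> g_alg c s \<Longrightarrow> curvature E'.\<alpha>0 (B X) (B Y) ** U = U ** curvature E.\<alpha>0 X Y"
    and m2: "E.m2 = 0"
  shows "E'.m2 = 0"
proof -
  fix j :: 'n
  define M N where "M = E.pre 0 (2 * E.\<beta>)" and "N = E.pre (axis j 1) 0"
  have M: "M \<in> g_alg c s" "ga M = 1" "E.xx (gX M) = 0" and N: "N \<in> g_alg c s" "ga N = 0" "E.xx (gX N) = axis j 1"
    unfolding M_def N_def using E.\<beta>0 by (simp_all add: E.pre_g_alg E.pre_coords)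
  obtain zM zN where zM: "E'.\<alpha>0 (B M) ** U + V M = U ** E.\<alpha>0 M + mat zM ** U" and zN: "E'.\<alpha>0 (B N) ** U + V N = U ** E.\<alpha>0 N + mat zN ** U"
    using first M(1) N(1) by blast
  have l0: "zc U \<noteq> 0" using P_cover_blocks(1)[OF E.sig U] by auto
  have gM: "ga (B M) \<noteq> 0" using first_order(1)[OF U V M(1) B[OF M(1)] zM] M E.\<beta>0 by auto
  have gN: "ga (B N) = 0" using first_order(1)[OF U V N(1) B[OF N(1)] zN] N E'.\<beta>0 l0 by simp
  have "zc U *s E'.xx (gX (B N)) = Ac U *v axis j 1" using first_order(2)[OF U V N(1) B[OF N(1)] zN] N by simp
  from arg_cong[OF this, of "\<lambda>x. x $ i" for i] have e: "zc U * E'.xx (gX (B N)) $ i = Ac U $ i $ j" for i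
    unfolding mult_axis by (simp del: xof_nth)
  obtain i where i: "E'.xx (gX (B N)) $ i \<noteq> 0" using column_nonzero[OF U, of j] unfolding e[symmetric] by auto
  have "yc (curvature E.\<alpha>0 M N) = 0" unfolding E.curvature_normal(8)[OF nc M(1) N(1)] m2 by (simp add: vec_eq_iff)
  then have "yc (curvature E'.\<alpha>0 (B M) (B N)) = 0"
    using curvature_blocks(1)[OF U M(1) N(1) B[OF M(1)] B[OF N(1)] rel[OF M(1) N(1)] M(3)] by (simp add: vec_eq_iff matrix_vector_nth)
  then have "E'.m2 * cnj (ga (B M) *\<^sub>R E'.xx (gX (B N)) $ i) = 0"
    unfolding E'.curvature_normal(8)[OF nc' B[OF M(1)] B[OF N(1)]] gN by (auto simp: vec_eq_iff simp del: xof_nth)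
  then show ?thesis using gM i by (auto simp del: xof_nth)
qed

lemma invariants:
  assumes U: "U \<in> P_cover s" and B: "\<And>X. X \<in> g_alg c s \<Longrightarrow> B X \<in> g_alg c s"
    and V: "\<And>X i. X \<in> g_alg c s \<Longrightarrow> V X $ Inr (Inl i) $ Inl () = 0" "\<And>X. X \<in> g_alg c s \<Longrightarrow> V X $ Inr (Inr ()) $ Inl () = 0"
      "\<And>X i. X \<in> g_alg c s \<Longrightarrow> V X $ Inr (Inl i) $ Inr (Inr ()) = 0"
    and first: "\<And>X. X \<in> g_alg c s \<Longrightarrow> \<exists>z. E'.\<alpha>0 (B X) ** U + V X = U ** E.\<alpha>0 X + mat z ** U"
    and w: "yc U = 0"
  shows "\<exists>r>0. Re E.\<mu> = r * Re E'.\<mu> \<and> cmod E.\<nu> = r * cmod E'.\<nu>"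
proof -
  fix j :: 'n
  define l t v where "l = zc U" and "t = U $ Inl () $ Inr (Inr ())" and "v = U $ Inr (Inr ()) $ Inr (Inr ())"
  have lv: "cnj l * v = 1" and tv: "Re (cnj t * v) = 0" using P_cover_blocks(1,5)[OF E.sig U] w by (simp_all add: l_def t_def v_def)
  then have l0: "l \<noteq> 0" by auto
  obtain i where i: "Ac U $ i $ j \<noteq> 0" using column_nonzero[OF U] by blast
  define b where "b = Ac U $ i $ j"
  have main: "b * (E.\<mu> * a + E.\<nu> * cnj a) = t * (b * a / l) + v * (E'.\<mu> * (b * a / l) + E'.\<nu> * cnj (b * a / l))" for a
  proof -
    define N where "N = E.pre (axis j a) 0"
    have N: "N \<in> g_alg c s" "ga N = 0" "E.xx (gX N) = axis j a"
      unfolding N_def by (simp_all add: E.pre_g_alg E.pre_coords)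
    obtain z where z: "E'.\<alpha>0 (B N) ** U + V N = U ** E.\<alpha>0 N + mat z ** U" using first N(1) by blast
    note VN = V(1)[OF N(1)] V(2)[OF N(1)]
    note fo = first_order(2,3)[OF U VN N(1) B[OF N(1)] z, unfolded N(3)]
    have x: "l * E'.xx (gX (B N)) $ i = b * a"
      using arg_cong[OF fo(1)[OF N(2)], of "\<lambda>x. x $ i"] unfolding mult_axis l_def b_def by (simp del: xof_nth)
    then have x: "E'.xx (gX (B N)) $ i = b * a / l" using l0 by (simp add: field_simps del: xof_nth)
    have ra: "rl E.\<mu> E.\<nu> (axis j a) = axis j (E.\<mu> * a + E.\<nu> * cnj a)" by (simp add: vec_eq_iff axis_def)
    show ?thesis
      using arg_cong[OF fo(2)[OF N(2) w V(3)[OF N(1)]], of "\<lambda>x. x $ i"] unfolding ra mult_axis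
      by (simp add: x b_def t_def v_def del: xof_nth)
  qed
  have e: "b * E.\<mu> = t * (b / l) + v * E'.\<mu> * (b / l)" "b * E.\<nu> = v * E'.\<nu> * cnj (b / l)"
  proof -
    define P Q where "P = t * (b / l) + v * E'.\<mu> * (b / l)" and "Q = v * E'.\<nu> * cnj (b / l)"
    have "b * E.\<mu> + b * E.\<nu> = P + Q" using main[of 1] unfolding P_def Q_def by (simp add: ring_distribs mult.assoc)
    moreover have "\<i> * (b * E.\<mu> - b * E.\<nu>) = \<i> * (P - Q)"
    proof -
      have "b * \<i> / l = \<i> * (b / l)" "cnj (\<i> * (b / l)) = - \<i> * cnj (b / l)" by simp_all
      then show ?thesis using main[of \<i>] unfolding P_def Q_def by (simp only: complex_cnj_i) (simp add: algebra_simps)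
    qed
    ultimately have "b * E.\<mu> + b * E.\<nu> = P + Q" "b * E.\<mu> - b * E.\<nu> = P - Q" by simp_all
    moreover have "x = p \<and> y = q" if "x + y = p + q" "x - y = p - q" for x y p q :: complex
      using that by (auto simp: complex_eq_iff)
    ultimately show "b * E.\<mu> = t * (b / l) + v * E'.\<mu> * (b / l)" "b * E.\<nu> = v * E'.\<nu> * cnj (b / l)"
      unfolding P_def[symmetric] Q_def[symmetric] by blast+
  qed
  have b0: "b \<noteq> 0" using i by (simp add: b_def)
  have vl: "v = 1 / cnj l" using lv l0 by (simp add: field_simps)
  define r where "r = 1 / (cmod l)\<^sup>2"
  have r0: "r > 0" using l0 by (simp add: r_def)
  have rc: "v / l = of_real r" unfolding r_def vl of_real_divide complex_norm_square by (simp add: mult.commute)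
  have "E.\<mu> = t / l + (v / l) * E'.\<mu>"
  proof -
    have "b * E.\<mu> = b * (t / l + (v / l) * E'.\<mu>)" unfolding e(1) by (simp add: algebra_simps add_divide_distrib)
    then show ?thesis using b0 by simp
  qed
  moreover have "Re (t / l) = 0"
  proof -
    have e: "t / l = cnj (cnj t * v)" unfolding vl by simp
    show ?thesis unfolding e using tv by simp
  qed
  ultimately have 1: "Re E.\<mu> = r * Re E'.\<mu>" unfolding rc by simp
  have "cmod b * cmod E.\<nu> = cmod b * (r * cmod E'.\<nu>)"
    unfolding norm_mult[symmetric] e(2) unfolding vl r_def by (simp add: norm_mult norm_divide power2_eq_square)
  then have "cmod E.\<nu> = r * cmod E'.\<nu>" using b0 by simp
  then show ?thesis using r0 1 by blast
qed

end


lemma (in ext_data) m2_zero_iff: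
  assumes ncond shows "m2 = 0 \<longleftrightarrow> \<sigma> = 0 \<or> \<sigma>\<^sup>2 = c"
proof -
  have "k = 0 \<longleftrightarrow> (cmod k)\<^sup>2 = 0" by simp
  also have "\<dots> \<longleftrightarrow> \<sigma>\<^sup>2 = c" unfolding k_def kk_norm[OF b c] \<sigma>_def by simp
  finally have k: "k = 0 \<longleftrightarrow> \<sigma>\<^sup>2 = c" .
  have "\<sigma> * (n + 2) / (2 * \<beta> * (n + 1)) = 0 \<longleftrightarrow> \<sigma> = 0" using \<beta>0 n0 by auto
  then show ?thesis unfolding ncond_simps(9)[OF assms] mult_eq_0_iff of_real_eq_0_iff k by simp
qed

lemma (in two_ext) sigma_eq:
  assumes r: "r > 0" "Re E.\<mu> = r * Re E'.\<mu>" "cmod E.\<nu> = r * cmod E'.\<nu>" and sgn: "E.\<beta> > 0 \<longleftrightarrow> E'.\<beta> > 0"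
  shows "E.\<sigma> = E'.\<sigma>"
proof -
  have n1: "E.n > 0" "E.n + 1 > 0" using E.n0 by linarith+
  have "Re E.\<mu> = - E.n * E.\<sigma> / (4 * E.\<beta> * (E.n + 1))" "Re E'.\<mu> = - E.n * E'.\<sigma> / (4 * E'.\<beta> * (E.n + 1))"
    using nc nc' unfolding E.ncond_def E'.ncond_def E.n_def E'.n_def by blast+
  then have Re: "Re E.\<mu> = - (E.n / (4 * (E.n + 1))) * (E.\<sigma> / E.\<beta>)" "Re E'.\<mu> = - (E.n / (4 * (E.n + 1))) * (E'.\<sigma> / E'.\<beta>)"
    by (simp_all add: mult_ac)
  have "- (E.n / (4 * (E.n + 1))) * (E.\<sigma> / E.\<beta>) = - (E.n / (4 * (E.n + 1))) * (r * (E'.\<sigma> / E'.\<beta>))"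
    using r(2) unfolding Re by (simp add: mult_ac)
  moreover have "E.n / (4 * (E.n + 1)) \<noteq> 0" using n1 by simp
  moreover have "x = y" if "- a * x = - a * y" "a \<noteq> 0" for a x y :: real using that by simp
  ultimately have s: "E.\<sigma> / E.\<beta> = r * (E'.\<sigma> / E'.\<beta>)" by blast
  have "cmod E.k / \<bar>E.\<beta>\<bar> = r * (cmod E'.k / \<bar>E'.\<beta>\<bar>)"
  proof -
    have "2 * (x / (2 * y)) = x / y" for x y :: real by simp
    then show ?thesis
      using arg_cong[OF r(3)[unfolded E.ncond_simps(10)[OF nc] E'.ncond_simps(10)[OF nc']], of "\<lambda>x. 2 * x"]
      by (simp only: mult.left_commute[of 2 r])
  qed
  then have "(cmod E.k / \<bar>E.\<beta>\<bar>)\<^sup>2 = (r * (cmod E'.k / \<bar>E'.\<beta>\<bar>))\<^sup>2" by simp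
  then have k: "(E.\<sigma>\<^sup>2 - c) / E.\<beta>\<^sup>2 = r\<^sup>2 * ((E'.\<sigma>\<^sup>2 - c) / E'.\<beta>\<^sup>2)"
    unfolding power_divide power_mult_distrib power2_abs E.k_def E'.k_def kk_norm[OF E.b E.c] kk_norm[OF E'.b E.c] E.\<sigma>_def E'.\<sigma>_def .
  have s2: "E.\<sigma>\<^sup>2 / E.\<beta>\<^sup>2 = r\<^sup>2 * (E'.\<sigma>\<^sup>2 / E'.\<beta>\<^sup>2)"
    using arg_cong[OF s, of "\<lambda>x. x\<^sup>2"] by (simp only: power_divide power_mult_distrib)
  have "c * (1 / E.\<beta>\<^sup>2) = c * (r\<^sup>2 / E'.\<beta>\<^sup>2)"
    using k s2 unfolding diff_divide_distrib right_diff_distrib by simp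
  then have "(1 / E.\<beta>)\<^sup>2 = (r / E'.\<beta>)\<^sup>2" using E.c by (auto simp: power_divide)
  moreover have "1 / E.\<beta> > 0 \<longleftrightarrow> r / E'.\<beta> > 0" using sgn r(1) by (simp add: zero_less_divide_iff)
  moreover have same_sign: "a = b" if "a\<^sup>2 = b\<^sup>2" "a > 0 \<longleftrightarrow> b > 0" "a \<noteq> 0" for a b :: real
    using that by (auto simp: power2_eq_iff)
  ultimately have "1 / E.\<beta> = r / E'.\<beta>"
    using same_sign[of "1 / E.\<beta>" "r / E'.\<beta>"] E.\<beta>0 by simp
  moreover have "E.\<sigma> * (1 / E.\<beta>) = E'.\<sigma> * (r / E'.\<beta>)" using s by simp
  ultimately have "E.\<sigma> * (1 / E.\<beta>) = E'.\<sigma> * (1 / E.\<beta>)" by (simp only:)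
  then show ?thesis using E.\<beta>0 by simp
qed

lemma equivalent_parameter_eq:
  fixes s :: "'n::finite \<Rightarrow> real"
  assumes sig: "signature s p q" and c: "c = 1 \<or> c = -1" and eq: "equivalent_extensions c s \<alpha> \<alpha>'"
    and r: "regular_normal_extension c s \<alpha>" "regular_normal_extension c s \<alpha>'"
    and h: "has_coefficients c s \<alpha> b1 b2" "has_coefficients c s \<alpha>' b1' b2'"
    and sgn: "bb b1 b2 > 0 \<longleftrightarrow> bb b1' b2' > 0" and t: "c = 1 \<Longrightarrow> t_param c b1 b2 \<ge> 1 \<and> t_param c b1' b2' \<ge> 1"
  shows "t_param c b1 b2 = t_param c b1' b2'"
proof -
  obtain c1 d1 d2 e1 where E: "ext_data c s p q b1 b2" "ext_data.ncond TYPE('n) c b1 b2 c1 d1 d2 e1" and ag: "\<forall>X\<in>g_alg c s. \<alpha> X = extf s b1 b2 c1 d1 d2 e1 X"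
    using normal_data[OF sig c r(1) h(1)] by blast
  obtain c1' d1' d2' e1' where E': "ext_data c s p q b1' b2'" "ext_data.ncond TYPE('n) c b1' b2' c1' d1' d2' e1'" and ag': "\<forall>X\<in>g_alg c s. \<alpha>' X = extf s b1' b2' c1' d1' d2' e1' X"
    using normal_data[OF sig c r(2) h(2)] by blast
  interpret two_ext c s p q b1 b2 c1 d1 d2 e1 b1' b2' c1' d1' d2' e1'
    by (intro two_ext.intro two_ext_axioms.intro E E')
  have lin: "linear E'.\<alpha>0" by (rule linearI) (simp_all add: extf_add extf_scaleR)
  have al: "\<alpha> X \<in> l_alg s" "\<alpha>' X = E'.\<alpha>0 X" "E'.\<alpha>0 X \<in> l_alg s" if "X \<in> g_alg c s" for X
    using ag ag' that extf_l_alg[OF sig that] by auto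
  note pmd = gform_pm[OF sig c]
  obtain N U V B where N: "open N" "mat 1 \<in> N" and all: "\<forall>g\<in>N \<inter> O_pq (gform c s). U g \<in> P_cover s \<and>
     (\<forall>X\<in>g_alg c s. B g X \<in> g_alg c s \<and> (\<exists>z. E'.\<alpha>0 (B g X) ** U g + V g X = U g ** \<alpha> X + mat z ** U g) \<and>
       (\<forall>C. C 0 = mat 1 \<longrightarrow> (C has_vector_derivative X) (at (0::real)) \<longrightarrow> ((\<lambda>t. U (g ** C t)) has_vector_derivative V g X) (at 0)) \<and>
       (\<forall>Y\<in>g_alg c s. curvature E'.\<alpha>0 (B g X) (B g Y) ** U g = U g ** curvature \<alpha> X Y))"
    using equivalence_transport[OF sig c eq al(1,2) lin al(3)] by blast
  have UP: "U g \<in> P_cover s" if "g \<in> N \<inter> O_pq (gform c s)" for g using all that by blast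
  have Bg: "B g X \<in> g_alg c s" if "g \<in> N \<inter> O_pq (gform c s)" "X \<in> g_alg c s" for g X using all that by blast
  have rel: "curvature E'.\<alpha>0 (B g X) (B g Y) ** U g = U g ** curvature E.\<alpha>0 X Y" 
    if "g \<in> N \<inter> O_pq (gform c s)" "X \<in> g_alg c s" "Y \<in> g_alg c s" for g X Y
    using all that E.curvature_agree[OF ag that(2,3)] by metis
  have one: "mat 1 \<in> N \<inter> O_pq (gform c s)" using N(2) O_pq_one by blast
  have first: "\<exists>z. E'.\<alpha>0 (B (mat 1) X) ** U (mat 1) + V (mat 1) X = U (mat 1) ** E.\<alpha>0 X + mat z ** U (mat 1)" if "X \<in> g_alg c s" for X
    using all one that ag by metis
  have V0: "V (mat 1) X $ i $ j = 0" if X: "X \<in> g_alg c s" and z: "\<And>g. g \<in> N \<inter> O_pq (gform c s) \<Longrightarrow> U g $ i $ j = 0" for X i j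
  proof -
    have "X \<in> so_pq (gform c s)" using X unfolding g_alg_iff[OF sig c] .
    then obtain C where C: "C 0 = mat 1" "(C has_vector_derivative X) (at (0::real))" "\<forall>\<^sub>F t in at 0. C t \<in> O_pq (gform c s)"
      using O_pq_curve[OF pmd] by blast
    have "((\<lambda>t. U (mat 1 ** C t)) has_vector_derivative V (mat 1) X) (at 0)" using all one X C(1,2) by blast
    then have d: "((\<lambda>t. U (C t) $ i $ j) has_vector_derivative V (mat 1) X $ i $ j) (at 0)"
      using bounded_linear.has_vector_derivative[OF blk_linear(7)] by simp
    have "isCont C 0" using C(2) has_vector_derivative_continuous by blast
    then have "(C \<longlongrightarrow> mat 1) (at 0)" unfolding isCont_def C(1) .
    then have "\<forall>\<^sub>F t in at 0. C t \<in> N" using topological_tendstoD N by blast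
    then have ev: "\<forall>\<^sub>F t in at 0. U (C t) $ i $ j = 0" using C(3) by eventually_elim (simp add: z)
    show ?thesis
      by (rule vector_derivative_eventually_eq[OF d has_vector_derivative_const ev]) (simp add: C(1) z[OF one])
  qed
  have Vl: "V (mat 1) X $ Inr (Inl i) $ Inl () = 0" "V (mat 1) X $ Inr (Inr ()) $ Inl () = 0" if "X \<in> g_alg c s" for X i
    using that UP P_cover_zero by (intro V0; blast)+
  have ts: "t_param c b1 b2 = - c * E.\<sigma>" "t_param c b1' b2' = - c * E'.\<sigma>"
    using c by (auto simp: E.\<sigma>_def E'.\<sigma>_def sg_def)
  show ?thesis
  proof (cases "E.m2 = 0")
    case True
    then have "E'.m2 = 0" using flat_transport[OF UP[OF one] Bg[OF one] Vl first rel[OF one]] by blast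
    then have z: "E.\<sigma> = 0 \<or> E.\<sigma>\<^sup>2 = c" "E'.\<sigma> = 0 \<or> E'.\<sigma>\<^sup>2 = c"
      using True E.m2_zero_iff[OF nc] E'.m2_zero_iff[OF nc'] by blast+
    show ?thesis
    proof (cases "c = 1")
      case True
      then have "E.\<sigma> \<le> -1" "E'.\<sigma> \<le> -1" using t ts by auto
      then have "E.\<sigma> = -1" "E'.\<sigma> = -1" using z True by (auto simp: power2_eq_1_iff)
      then show ?thesis unfolding ts by simp
    next
      case False
      then have "c = -1" using c by blast
      moreover have "x\<^sup>2 \<noteq> -1" for x :: real using zero_le_power2[of x] by linarith
      ultimately have "E.\<sigma> = 0" "E'.\<sigma> = 0" using z by auto
      then show ?thesis unfolding ts by simp
    qed
  next
    case False
    have bd: "U g $ Inl () $ Inr (Inl j) = 0" "yc (U g) = 0" if g: "g \<in> N \<inter> O_pq (gform c s)" for g j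
      using block_diagonal[OF UP[OF g] Bg[OF g] rel[OF g] False] by blast+
    have "V (mat 1) X $ Inr (Inl i) $ Inr (Inr ()) = 0" if "X \<in> g_alg c s" for X i
      by (rule V0[OF that]) (use bd(2) in \<open>simp add: lcoords vec_eq_iff\<close>)
    then obtain r where "r > 0" "Re E.\<mu> = r * Re E'.\<mu>" "cmod E.\<nu> = r * cmod E'.\<nu>"
      using invariants[OF UP[OF one] Bg[OF one] Vl _ first bd(2)[OF one]] by blast
    then have "E.\<sigma> = E'.\<sigma>" using sigma_eq sgn by (simp add: E.\<beta>_def E'.\<beta>_def)
    then show ?thesis unfolding ts by simp
  qed
qed

lemma bb_pos_of_t_param: assumes "t_param 1 b1 b2 \<ge> 1" shows "bb b1 b2 > 0"
proof -
  have "((cmod b1)\<^sup>2 + (cmod b2)\<^sup>2) / bb b1 b2 > 0" using assms by (simp add: t_param_def bb_def)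
  then show ?thesis by (simp add: zero_less_divide_iff add_nonneg_nonneg not_less[symmetric])
     (smt (verit) zero_le_power2)
qed

lemma t_param_outside: assumes "bb b1 b2 \<noteq> 0" shows "t_param 1 b1 b2 \<ge> 1 \<or> t_param 1 b1 b2 \<le> -1"
proof -
  have "1\<^sup>2 \<le> (t_param 1 b1 b2)\<^sup>2"
    using kk_norm[OF assms, of 1] zero_le_power2[of "cmod (kk 1 b1 b2)"] by (simp add: sg_def)
  then have "\<bar>1\<bar> \<le> \<bar>t_param 1 b1 b2\<bar>" using abs_le_square_iff by blast
  then show ?thesis by linarith
qed

theorem theorem6p6:
  fixes s :: "'n::finite \<Rightarrow> real" and p q :: nat
  assumes "signature s p q"
  shows
    "((\<forall>\<alpha>. regular_normal_extension 1 s \<alpha> \<longrightarrow>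
        (\<exists>\<alpha>' b1 b2. regular_normal_extension 1 s \<alpha>' \<and> equivalent_extensions 1 s \<alpha> \<alpha>' \<and>
           has_coefficients 1 s \<alpha>' b1 b2 \<and> t_param 1 b1 b2 \<ge> 1)) \<and>
     (\<forall>t\<ge>1. \<exists>\<alpha> b1 b2. regular_normal_extension 1 s \<alpha> \<and>
        has_coefficients 1 s \<alpha> b1 b2 \<and> t_param 1 b1 b2 = t) \<and>
     (\<forall>\<alpha> \<alpha>' b1 b2 b1' b2'.
        regular_normal_extension 1 s \<alpha> \<and> has_coefficients 1 s \<alpha> b1 b2 \<and> t_param 1 b1 b2 \<ge> 1 \<and>
        regular_normal_extension 1 s \<alpha>' \<and> has_coefficients 1 s \<alpha>' b1' b2' \<and> t_param 1 b1' b2' \<ge> 1 \<longrightarrow>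
        (equivalent_extensions 1 s \<alpha> \<alpha>' \<longleftrightarrow> t_param 1 b1 b2 = t_param 1 b1' b2')))
     \<and>
     ((\<forall>\<alpha>. regular_normal_extension (-1) s \<alpha> \<longrightarrow>
        (\<exists>\<alpha>' b1 b2. regular_normal_extension (-1) s \<alpha>' \<and> equivalent_extensions (-1) s \<alpha> \<alpha>' \<and>
           has_coefficients (-1) s \<alpha>' b1 b2 \<and> t_param (-1) b1 b2 > -1)) \<and>
     (\<forall>t>-1. \<exists>\<alpha> b1 b2. regular_normal_extension (-1) s \<alpha> \<and>
        has_coefficients (-1) s \<alpha> b1 b2 \<and> t_param (-1) b1 b2 = t) \<and>
     (\<forall>\<alpha> \<alpha>' b1 b2 b1' b2'.
        regular_normal_extension (-1) s \<alpha> \<and> has_coefficients (-1) s \<alpha> b1 b2 \<and> t_param (-1) b1 b2 > -1 \<and>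
        regular_normal_extension (-1) s \<alpha>' \<and> has_coefficients (-1) s \<alpha>' b1' b2' \<and> t_param (-1) b1' b2' > -1 \<and>
        (cmod b1 > cmod b2 \<longleftrightarrow> cmod b1' > cmod b2') \<longrightarrow>
        (equivalent_extensions (-1) s \<alpha> \<alpha>' \<longleftrightarrow> t_param (-1) b1 b2 = t_param (-1) b1' b2')))"
proof (intro conjI allI impI)
  have c: "(1::real) = 1 \<or> (1::real) = -1" "(-1::real) = 1 \<or> (-1::real) = -1" by simp_all
  note sig = assms
  have bb_sgn: "bb b1 b2 > 0 \<longleftrightarrow> cmod b1 > cmod b2" for b1 b2
    unfolding bb_def by (simp add: abs_le_square_iff[symmetric] not_le[symmetric])
  show "\<exists>\<alpha>' b1 b2. regular_normal_extension 1 s \<alpha>' \<and> equivalent_extensions 1 s \<alpha> \<alpha>' \<and>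
           has_coefficients 1 s \<alpha>' b1 b2 \<and> t_param 1 b1 b2 \<ge> 1" if r: "regular_normal_extension 1 s \<alpha>" for \<alpha>
  proof -
    obtain b1 b2 where h: "has_coefficients 1 s \<alpha> b1 b2" using normal_has_coefficients[OF sig c(1) r] by blast
    show ?thesis
    proof (cases "t_param 1 b1 b2 \<ge> 1")
      case True
      then show ?thesis using equal_parameter_equivalent_pos[OF sig r h True r h refl] r h by blast
    next
      case False
      then have "t_param 1 b1 b2 \<le> -1" using t_param_outside h has_coefficients_iff by blast
      then have "t_param 1 (- \<i> * b2) (\<i> * b1) \<ge> 1" unfolding t_param_reflect(1)[OF c(1)] by simp
      then show ?thesis using reflected_extension[OF sig c(1) r h] by blast
    qed
  qed
  show "\<exists>\<alpha>' b1 b2. regular_normal_extension (-1) s \<alpha>' \<and> equivalent_extensions (-1) s \<alpha> \<alpha>' \<and>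
           has_coefficients (-1) s \<alpha>' b1 b2 \<and> t_param (-1) b1 b2 > -1" if r: "regular_normal_extension (-1) s \<alpha>" for \<alpha>
  proof -
    obtain b1 b2 where h: "has_coefficients (-1) s \<alpha> b1 b2" using normal_has_coefficients[OF sig c(2) r] by blast
    show ?thesis
    proof (cases "t_param (-1) b1 b2 > -1")
      case True
      then show ?thesis using equal_parameter_equivalent_neg[OF sig r h r h refl refl] r h by blast
    next
      case False
      then have "t_param (-1) (- \<i> * b2) (\<i> * b1) > -1" unfolding t_param_reflect(1)[OF c(2)] by simp
      then show ?thesis using reflected_extension[OF sig c(2) r h] by blast
    qed
  qed
  show "\<exists>\<alpha> b1 b2. regular_normal_extension 1 s \<alpha> \<and> has_coefficients 1 s \<alpha> b1 b2 \<and> t_param 1 b1 b2 = t" if t: "1 \<le> t" for t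
  proof -
    define b1 b2 where "b1 = complex_of_real (sqrt ((t + 1) / 2))" and "b2 = complex_of_real (sqrt ((t - 1) / 2))"
    have n: "(cmod b1)\<^sup>2 = (t + 1) / 2" "(cmod b2)\<^sup>2 = (t - 1) / 2" using t by (simp_all add: b1_def b2_def)
    have "bb b1 b2 \<noteq> 0" unfolding bb_def n by (simp add: field_simps)
    moreover have "t_param 1 b1 b2 = t" unfolding t_param_def n by (simp add: field_simps)
    ultimately show ?thesis using normal_exists[OF sig c(1)] by blast
  qed
  show "\<exists>\<alpha> b1 b2. regular_normal_extension (-1) s \<alpha> \<and> has_coefficients (-1) s \<alpha> b1 b2 \<and> t_param (-1) b1 b2 = t" for t
  proof -
    define b1 b2 where "b1 = Complex 1 (- t / 2)" and "b2 = Complex 0 (t / 2)"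
    have n: "(cmod b1)\<^sup>2 - (cmod b2)\<^sup>2 = 1" by (simp add: b1_def b2_def cmod_power2)
    have "bb b1 b2 \<noteq> 0" unfolding bb_def n by simp
    moreover have "t_param (-1) b1 b2 = t" unfolding t_param_def n by (simp add: b1_def b2_def)
    ultimately show ?thesis using normal_exists[OF sig c(2)] by blast
  qed
  show "equivalent_extensions 1 s \<alpha> \<alpha>' \<longleftrightarrow> t_param 1 b1 b2 = t_param 1 b1' b2'"
    if "regular_normal_extension 1 s \<alpha> \<and> has_coefficients 1 s \<alpha> b1 b2 \<and> t_param 1 b1 b2 \<ge> 1 \<and>
        regular_normal_extension 1 s \<alpha>' \<and> has_coefficients 1 s \<alpha>' b1' b2' \<and> t_param 1 b1' b2' \<ge> 1"
    for \<alpha> \<alpha>' b1 b2 b1' b2'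
  proof -
    have a: "regular_normal_extension 1 s \<alpha>" "has_coefficients 1 s \<alpha> b1 b2" "t_param 1 b1 b2 \<ge> 1"
        "regular_normal_extension 1 s \<alpha>'" "has_coefficients 1 s \<alpha>' b1' b2'" "t_param 1 b1' b2' \<ge> 1" using that by blast+
    have "bb b1 b2 > 0 \<longleftrightarrow> bb b1' b2' > 0" using bb_pos_of_t_param a(3,6) by blast
    then show ?thesis
      using equivalent_parameter_eq[OF sig c(1) _ a(1,4,2,5)] equal_parameter_equivalent_pos[OF sig a(1-5)] a(3,6) by blast
  qed
  show "equivalent_extensions (-1) s \<alpha> \<alpha>' \<longleftrightarrow> t_param (-1) b1 b2 = t_param (-1) b1' b2'"
    if "regular_normal_extension (-1) s \<alpha> \<and> has_coefficients (-1) s \<alpha> b1 b2 \<and> t_param (-1) b1 b2 > -1 \<and>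
        regular_normal_extension (-1) s \<alpha>' \<and> has_coefficients (-1) s \<alpha>' b1' b2' \<and> t_param (-1) b1' b2' > -1 \<and>
        (cmod b1 > cmod b2 \<longleftrightarrow> cmod b1' > cmod b2')"
    for \<alpha> \<alpha>' b1 b2 b1' b2'
  proof -
    have a: "regular_normal_extension (-1) s \<alpha>" "has_coefficients (-1) s \<alpha> b1 b2"
        "regular_normal_extension (-1) s \<alpha>'" "has_coefficients (-1) s \<alpha>' b1' b2'" 
      and sgn: "bb b1 b2 > 0 \<longleftrightarrow> bb b1' b2' > 0" unfolding bb_sgn using that by blast+
    have "(-1::real) \<noteq> 1" by simp
    then show ?thesis
      using equivalent_parameter_eq[OF sig c(2) _ a(1,3,2,4) sgn] equal_parameter_equivalent_neg[OF sig a sgn] by blast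
  qed
qed

end
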